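(* Let $\varepsilon_0>0$, $C<\infty$, let $\{\varepsilon_n\}$ be a sequence of positive numbers with $\sup_n|\varepsilon_n|\le\varepsilon_0$, and let $\{w_n\}\subset\mathcal{A}$ satisfy $\mathcal{E}_{\varepsilon_n}(w_n)\le C$ for all $n$. Then $\{w_n\}$ is precompact in $L^p(\mathbb{T}^2)$ for any $p\in[1,\tfrac{10}{3})$.
   Context: $\mathbb{T}^2=[0,1)^2$ is the flat torus with Lebesgue measure; functions are real valued and 1-periodic in each variable. Fourier coefficients $\widehat f(k)$ are indexed by $k=(k_1,k_2)\in(2\pi\mathbb{Z})^2$. A periodic distribution $f$ on $\mathbb{T}^2$ has vanishing mean in $x_1$ if $\widehat f(k)=0$ for all $k\in(2\pi\mathbb{Z})^2$ with $k_1=0$ (for integrable functions: $\int_0^1 f(x_1,x_2)\,dx_1=0$ for a.e. $x_2$). For such $f$, $|\partial_1|^{-1}f$ is defined by $\widehat{|\partial_1|^{-1}f}(k)=|k_1|^{-1}\widehat f(k)$ for $k_1\ne0$ (and $0$ for $k_1=0$). For $w\in L^2(\mathbb{T}^2)$ with vanishing mean in $x_1$, put $\eta_w=\partial_2 w-\partial_1\tfrac12w^2$ (a distribution with vanishing mean in $x_1$), and for $\varepsilon>0$ $$\mathcal{E}(w)=\left(\int_{\mathbb{T}^2}(|\partial_1|^{-1}\eta_w)^2dx\right)^{1/2}\left(\int_{\mathbb{T}^2}(\partial_1 w)^2dx\right)^{1/2},\qquad \mathcal{E}_\varepsilon(w)=\frac12\int_{\mathbb{T}^2}\frac1\varepsilon(|\partial_1|^{-1}\eta_w)^2+\varepsilon(\partial_1w)^2\,dx,$$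 where an integral is $+\infty$ if the corresponding distribution is not in $L^2(\mathbb{T}^2)$, and $\mathcal{E}(w)=+\infty$ if one of the two integrals is $+\infty$. The set $\mathcal{A}$ consists of all $w\in L^2(\mathbb{T}^2)$ with vanishing mean in $x_1$ and $\mathcal{E}(w)<\infty$. Precompact means that every subsequence has a further subsequence converging strongly in the indicated norm. *)

theory Defs
  imports "HOL-Analysis.Analysis"
begin

text \<open>
  Functions on the flat torus are 1-periodic functions on \<^typ>\<open>real \<times> real\<close>, integrated over
  the fundamental cell.  Elements of \<open>L\<^sup>p\<close> are represented by Borel functions;
  every class modulo null sets has a periodic Borel representative.
\<close>

definition cell :: "(real \<times> real) set"
  where "cell = {0..<1} \<times> {0..<1}"

definition periodic :: "(real \<times> real \<Rightarrow> 'b) \<Rightarrow> bool"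
  where "periodic f \<longleftrightarrow> (\<forall>x1 x2. f (x1 + 1, x2) = f (x1, x2) \<and> f (x1, x2 + 1) = f (x1, x2))"

definition in_Lp :: "real \<Rightarrow> (real \<times> real \<Rightarrow> real) \<Rightarrow> bool"
  where "in_Lp p f \<longleftrightarrow> f \<in> borel_measurable lborel \<and> periodic f \<and>
           set_integrable lborel cell (\<lambda>x. \<bar>f x\<bar> powr p)"

definition Lp_norm :: "real \<Rightarrow> (real \<times> real \<Rightarrow> real) \<Rightarrow> real"
  where "Lp_norm p f = (LINT x:cell|lborel. \<bar>f x\<bar> powr p) powr (1 / p)"

text \<open>Membership in \<open>L\<^sup>p\<close> of all the terms is part of being precompact in \<open>L\<^sup>p\<close>.\<close>

definition precompact_Lp :: "real \<Rightarrow> (nat \<Rightarrow> real \<times> real \<Rightarrow> real) \<Rightarrow> bool"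
  where "precompact_Lp p w \<longleftrightarrow> (\<forall>n. in_Lp p (w n)) \<and>
           (\<forall>r :: nat \<Rightarrow> nat. strict_mono r \<longrightarrow>
             (\<exists>(s :: nat \<Rightarrow> nat) v. strict_mono s \<and> in_Lp p v \<and>
               (\<lambda>n. Lp_norm p (\<lambda>x. w (r (s n)) x - v x)) \<longlonglongrightarrow> 0))"

definition d1 :: "(real \<times> real \<Rightarrow> complex) \<Rightarrow> real \<times> real \<Rightarrow> complex"
  where "d1 \<phi> x = vector_derivative (\<lambda>t. \<phi> (t, snd x)) (at (fst x))"

definition d2 :: "(real \<times> real \<Rightarrow> complex) \<Rightarrow> real \<times> real \<Rightarrow> complex"
  where "d2 \<phi> x = vector_derivative (\<lambda>t. \<phi> (fst x, t)) (at (snd x))"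

primrec Ck :: "nat \<Rightarrow> (real \<times> real \<Rightarrow> complex) \<Rightarrow> bool"
  where
    "Ck 0 \<phi> \<longleftrightarrow> continuous_on UNIV \<phi>"
  | "Ck (Suc n) \<phi> \<longleftrightarrow> continuous_on UNIV \<phi> \<and>
       (\<forall>x1 x2. (\<lambda>t. \<phi> (t, x2)) differentiable (at x1) \<and> (\<lambda>t. \<phi> (x1, t)) differentiable (at x2)) \<and>
       Ck n (d1 \<phi>) \<and> Ck n (d2 \<phi>)"

text \<open>
  The test functions are the complex-valued smooth periodic functions; the pairing is bilinear
  (no complex conjugation).  A distribution is given by its values on test functions, so two
  functionals are compared on test functions only.
\<close>

definition test_functions :: "(real \<times> real \<Rightarrow> complex) set"
  where "test_functions = {\<phi>. periodic \<phi> \<and> (\<forall>n. Ck n \<phi>)}"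

type_synonym functional = "(real \<times> real \<Rightarrow> complex) \<Rightarrow> complex"

definition distr_eq :: "functional \<Rightarrow> functional \<Rightarrow> bool"
  where "distr_eq S T \<longleftrightarrow> (\<forall>\<phi>\<in>test_functions. S \<phi> = T \<phi>)"

definition distr_of :: "(real \<times> real \<Rightarrow> real) \<Rightarrow> functional"
  where "distr_of f \<phi> = (LINT x:cell|lborel. complex_of_real (f x) * \<phi> x)"

definition D1 :: "functional \<Rightarrow> functional"
  where "D1 T \<phi> = - T (d1 \<phi>)"

definition D2 :: "functional \<Rightarrow> functional"
  where "D2 T \<phi> = - T (d2 \<phi>)"

definition freqs :: "(real \<times> real) set"
  where "freqs = {(2 * pi * of_int m, 2 * pi * of_int n) | m n :: int. True}"

definition fourier :: "functional \<Rightarrow> real \<times> real \<Rightarrow> complex"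
  where "fourier T k = T (\<lambda>x. cis (- (k \<bullet> x)))"

definition vanishing_mean_x1 :: "functional \<Rightarrow> bool"
  where "vanishing_mean_x1 T \<longleftrightarrow> (\<forall>k\<in>freqs. fst k = 0 \<longrightarrow> fourier T k = 0)"

text \<open>\<open>S = |\<partial>\<^sub>1|\<^sup>-\<^sup>1 T\<close>; a periodic distribution is determined by its Fourier coefficients.\<close>

definition is_abs_D1_inv :: "functional \<Rightarrow> functional \<Rightarrow> bool"
  where "is_abs_D1_inv T S \<longleftrightarrow> (\<forall>k\<in>freqs.
           fourier S k = (if fst k = 0 then 0 else fourier T k / complex_of_real \<bar>fst k\<bar>))"

definition eta :: "(real \<times> real \<Rightarrow> real) \<Rightarrow> functional"
  where "eta w \<phi> = D2 (distr_of w) \<phi> - D1 (distr_of (\<lambda>x. 1 / 2 * (w x)\<^sup>2)) \<phi>"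

text \<open>
  In the next two definitions the infimum ranges over the \<open>L\<^sup>2\<close> functions representing the
  distribution in question.  They agree almost everywhere, so there is at most one
  value; if the distribution is not in \<open>L\<^sup>2\<close>, the infimum is over the empty set, i.e. \<open>\<infinity>\<close>.
\<close>

definition int_abs_D1_inv_eta_sq :: "(real \<times> real \<Rightarrow> real) \<Rightarrow> ennreal"
  where "int_abs_D1_inv_eta_sq w =
           (INF g \<in> {g. in_Lp 2 g \<and> is_abs_D1_inv (eta w) (distr_of g)}.
              \<integral>\<^sup>+x\<in>cell. ennreal ((g x)\<^sup>2) \<partial>lborel)"

definition int_D1_sq :: "(real \<times> real \<Rightarrow> real) \<Rightarrow> ennreal"
  where "int_D1_sq w =
           (INF g \<in> {g. in_Lp 2 g \<and> distr_eq (D1 (distr_of w)) (distr_of g)}.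
              \<integral>\<^sup>+x\<in>cell. ennreal ((g x)\<^sup>2) \<partial>lborel)"

text \<open>The case distinction is needed since \<open>0 * \<infinity> = 0\<close> in \<^typ>\<open>ennreal\<close>.\<close>

definition energy :: "(real \<times> real \<Rightarrow> real) \<Rightarrow> ennreal"
  where "energy w =
           (if int_abs_D1_inv_eta_sq w = \<infinity> \<or> int_D1_sq w = \<infinity> then \<infinity>
            else ennreal (sqrt (enn2real (int_abs_D1_inv_eta_sq w)) * sqrt (enn2real (int_D1_sq w))))"

definition energy_eps :: "real \<Rightarrow> (real \<times> real \<Rightarrow> real) \<Rightarrow> ennreal"
  where "energy_eps \<epsilon> w =
           ennreal (1 / 2) * (ennreal (1 / \<epsilon>) * int_abs_D1_inv_eta_sq w + ennreal \<epsilon> * int_D1_sq w)"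

definition admissible :: "(real \<times> real \<Rightarrow> real) set"
  where "admissible = {w. in_Lp 2 w \<and> vanishing_mean_x1 (distr_of w) \<and> energy w < \<infinity>}"

end

theory Submission
  imports Defs "HOL-Probability.Probability_Measure" "HOL-Complex_Analysis.Great_Picard"
begin

text \<open>
  Write \<open>b = \<partial>\<^sub>1 w\<close> and \<open>|\<partial>\<^sub>1| g = \<eta>\<^sub>w\<close>, so that \<open>\<partial>\<^sub>2 w = w b + |\<partial>\<^sub>1| g\<close>.  Against a bounded \<open>\<psi>\<close> with
  \<open>\<parallel>\<partial>\<^sub>1 \<psi>\<parallel> \<le> L\<close> in \<open>L\<^sup>2\<close> the last term contributes at most \<open>L \<parallel>g\<parallel>\<close>.  The energies control \<open>\<parallel>b\<parallel> \<parallel>g\<parallel>\<close> and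
  \<open>\<parallel>g\<parallel>\<close>, but not \<open>\<parallel>b\<parallel>\<close>, so \<open>b\<close> may enter the estimates only through the product.

  Let \<open>D = w(\<cdot> + h e\<^sub>1) - w\<close> and let \<open>S\<close> be a truncated positive part.  For \<open>\<psi> = S(D)(\<cdot> - h e\<^sub>1) - S(D)\<close>
  the left side is \<open>\<integral> S(D) \<partial>\<^sub>2 D = 0\<close>, and \<open>\<integral> \<psi> w b\<close> is the \<open>h\<close>-derivative of a truncated
  \<open>\<integral> D\<^sub>+\<^sup>3 / 6\<close>; hence \<open>\<integral> |D|\<^sup>3 \<le> 48 |h| \<parallel>b\<parallel> \<parallel>g\<parallel>\<close>.  For \<open>\<psi> = \<rho>(x\<^sub>2) S(w)\<close> the term \<open>\<integral> \<psi> w b\<close>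
  vanishes, which bounds \<open>\<integral> |w| dx\<^sub>1\<close> on almost every line by a constant \<open>M\<close>.  Comparing \<open>w\<close> with its
  average over a segment of length \<open>h = 2 M / \<lambda>\<close> parallel to \<open>e\<^sub>1\<close> then gives \<open>|{|w| > \<lambda>}| \<le> C / \<lambda>\<^sup>4\<close>
  and a bound in \<open>L\<^bsup>7/2\<^esup>\<close>, where \<open>7/2 > 10/3\<close>.

  Compactness in \<open>L\<^sup>1\<close> follows from equicontinuity of translations.  For translations along \<open>e\<^sub>2\<close>
  one takes for \<open>\<psi>\<close> the average of \<open>sgn (w(\<cdot> + t e\<^sub>2) - w)\<close> over segments of length \<open>h\<close>
  parallel to \<open>e\<^sub>1\<close>, which is Lipschitz in \<open>x\<^sub>1\<close>.  Interpolation with \<open>L\<^bsup>7/2\<^esup>\<close> gives \<open>L\<^sup>p\<close>.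
\<close>

subsection \<open>The torus as a probability space\<close>

text \<open>The obstacle is the lack of regularity in x2. The function \<open>w\<close> has an L2
  derivative only in x1, and \<open>w b\<close> is merely integrable. Hence test functions have to
  be bounded, which forces the truncations, and no chain rule holds for the derivative in x2. Two
  devices replace it. The equation is used integrated over a segment of length t parallel to e2: up
  to the factor t, the Fourier coefficients of w(x + t e2) - w(x) - t (average of w b) are those of
  an averaged \<open>|\<partial>\<^sub>1| g\<close>, and pairing them with a test function needs
  only square sums. Derivatives in x2 of functions of w become the convexity inequality S(p) (q - p)
  \<le> \<Phi>(q) - \<Phi>(p) for a primitive \<Phi> of S; read for t > 0 and for t < 0, it yields a
  two-sided estimate as t tends to 0. The exponent 7/2 is one choice between 10/3 and 4: a bound C /
  \<lambda>^4 for the measure of the level sets gives every exponent below 4.\<close>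

definition torus :: "(real \<times> real) measure"
  where "torus = density lborel (indicator cell)"

text \<open>The space of \<open>torus\<close> is the whole plane and its mass sits on
  \<open>cell\<close>. Hence the translation by y does not preserve \<open>torus\<close>, but its
  composition with \<open>wrap\<close> does, and periodic functions do not distinguish the
  two.\<close>

definition wrap :: "real \<times> real \<Rightarrow> real \<times> real"
  where "wrap x = (frac (fst x), frac (snd x))"

lemma cell_borel [measurable]: "cell \<in> sets borel"
proof -
  have "{0..<1::real} \<times> {0..<1::real} \<in> sets (borel \<Otimes>\<^sub>M borel)"
    by (intro pair_measureI) auto
  then show ?thesis unfolding cell_def by (simp only: borel_prod)
qed

lemma sets_torus [simp, measurable_cong]: "sets torus = sets borel"
  and space_torus [simp]: "space torus = UNIV"
  by (simp_all add: torus_def)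

lemma indicator_cell_ennreal: "indicator cell (x, y) = (indicator {0..<1} x * indicator {0..<1} y :: ennreal)"
  by (auto simp: cell_def indicator_def)

lemma nn_integral_torus:
  "f \<in> borel_measurable borel \<Longrightarrow> (\<integral>\<^sup>+x. f x \<partial>torus) = (\<integral>\<^sup>+x\<in>cell. f x \<partial>lborel)"
  unfolding torus_def by (subst nn_integral_density) (auto simp: mult.commute)

lemma nn_integral_torus_iterated:
  assumes [measurable]: "f \<in> borel_measurable borel"
  shows "(\<integral>\<^sup>+x. f x \<partial>torus) =
    (\<integral>\<^sup>+a\<in>{0..<1}. (\<integral>\<^sup>+b\<in>{0..<1}. f (a, b) \<partial>lborel) \<partial>lborel)"
proof -
  have [measurable]: "f \<in> borel_measurable (borel \<Otimes>\<^sub>M borel)"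
    by (simp add: borel_prod)
  have "(\<integral>\<^sup>+x. f x \<partial>torus) = (\<integral>\<^sup>+x. f x * indicator cell x \<partial>(lborel \<Otimes>\<^sub>M lborel))"
    by (simp add: nn_integral_torus lborel_prod)
  also have "\<dots> = (\<integral>\<^sup>+a. \<integral>\<^sup>+b. f (a, b) * indicator cell (a, b) \<partial>lborel \<partial>lborel)"
    by (rule lborel.nn_integral_fst[symmetric]) (simp add: borel_prod lborel_prod)
  also have "\<dots> = (\<integral>\<^sup>+a. (\<integral>\<^sup>+b. f (a, b) * indicator {0..<1} b \<partial>lborel) * indicator {0..<1} a \<partial>lborel)"
    by (subst nn_integral_multc[symmetric], measurable)
       (auto intro!: nn_integral_cong simp: indicator_cell_ennreal ac_simps)
  finally show ?thesis .
qed

lemma prob_space_torus: "prob_space torus"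
proof
  have "emeasure torus UNIV = (\<integral>\<^sup>+x. 1 \<partial>torus)"
    by simp
  also have "\<dots> = 1"
    by (subst nn_integral_torus_iterated) auto
  finally show "emeasure torus (space torus) = 1" by simp
qed

interpretation torus: prob_space torus
  by (rule prob_space_torus)

lemma integrable_torus:
  fixes f :: "real \<times> real \<Rightarrow> 'a::{banach, second_countable_topology}"
  assumes "f \<in> borel_measurable borel"
  shows "integrable torus f \<longleftrightarrow> set_integrable lborel cell f"
proof -
  have *: "torus = density lborel (\<lambda>x. ennreal (indicator cell x))"
    unfolding torus_def by (intro density_cong) (auto simp: indicator_def)
  show ?thesis
    unfolding * set_integrable_def using assms by (subst integrable_density) auto
qed

lemma integral_torus:
  fixes f :: "real \<times> real \<Rightarrow> 'a::{banach, second_countable_topology}"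
  assumes "f \<in> borel_measurable borel"
  shows "(LINT x:cell|lborel. f x) = integral\<^sup>L torus f"
proof -
  have *: "torus = density lborel (\<lambda>x. ennreal (indicator cell x))"
    unfolding torus_def by (intro density_cong) (auto simp: indicator_def)
  show ?thesis
    unfolding * set_lebesgue_integral_def using assms by (subst integral_density) auto
qed

lemma periodic_shift_int:
  fixes f :: "real \<Rightarrow> 'a"
  assumes "\<And>x. f (x + 1) = f x"
  shows "f (x + of_int n) = f x"
proof (induction n arbitrary: x rule: int_induct[where k = 0])
  case (step1 i) then show ?case using assms[of "x + of_int i"] by (simp add: add.assoc)
next
  case (step2 i)
  have "f (x + of_int (i - 1) + 1) = f (x + of_int (i - 1))" by (rule assms)
  then show ?case using step2(2)[of x] by simp
qed simp

text \<open>The window [r, 1 + r) is cut at 1, and the piece beyond 1 is moved back by one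
  period.\<close>

lemma nn_integral_shift_periodic_01:
  fixes f :: "real \<Rightarrow> ennreal"
  assumes [measurable]: "f \<in> borel_measurable borel" and per: "\<And>x. f (x + 1) = f x" and r: "0 \<le> r" "r < 1"
  shows "(\<integral>\<^sup>+x\<in>{0..<1}. f (x + r) \<partial>lborel) = (\<integral>\<^sup>+x\<in>{0..<1}. f x \<partial>lborel)"
proof -
  have shift: "(\<integral>\<^sup>+x. g (x + c) \<partial>lborel) = (\<integral>\<^sup>+x. g x \<partial>lborel)"
    if "g \<in> borel_measurable borel" for g :: "real \<Rightarrow> ennreal" and c
    using nn_integral_real_affine[OF that, of 1 c] by (simp add: add.commute)
  have "(\<integral>\<^sup>+x\<in>{0..<1}. f (x + r) \<partial>lborel) = (\<integral>\<^sup>+x. f (x + r) * indicator {r..<1+r} (x + r) \<partial>lborel)"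
    by (intro nn_integral_cong) (auto simp: indicator_def)
  also have "\<dots> = (\<integral>\<^sup>+x. f x * indicator {r..<1+r} x \<partial>lborel)"
    by (rule shift[where g = "\<lambda>x. f x * indicator {r..<1+r} x"]) measurable
  also have "\<dots> = (\<integral>\<^sup>+x. f x * indicator {r..<1} x + f x * indicator {1..<1+r} x \<partial>lborel)"
    using r by (intro nn_integral_cong) (auto simp: indicator_def)
  also have "\<dots> = (\<integral>\<^sup>+x. f x * indicator {r..<1} x \<partial>lborel) + (\<integral>\<^sup>+x. f x * indicator {1..<1+r} x \<partial>lborel)"
    by (rule nn_integral_add) measurable
  also have "(\<integral>\<^sup>+x. f x * indicator {1..<1+r} x \<partial>lborel) =
      (\<integral>\<^sup>+x. f (x + 1) * indicator {1..<1+r} (x + 1) \<partial>lborel)"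
    by (rule shift[where g = "\<lambda>x. f x * indicator {1..<1+r} x", symmetric]) measurable
  also have "\<dots> = (\<integral>\<^sup>+x. f x * indicator {0..<r} x \<partial>lborel)"
    by (intro nn_integral_cong) (auto simp: indicator_def per)
  also have "(\<integral>\<^sup>+x. f x * indicator {r..<1} x \<partial>lborel) + (\<integral>\<^sup>+x. f x * indicator {0..<r} x \<partial>lborel)
     = (\<integral>\<^sup>+x. f x * indicator {r..<1} x + f x * indicator {0..<r} x \<partial>lborel)"
    by (rule nn_integral_add[symmetric]) measurable
  also have "\<dots> = (\<integral>\<^sup>+x\<in>{0..<1}. f x \<partial>lborel)"
    using r by (intro nn_integral_cong) (auto simp: indicator_def)
  finally show ?thesis .
qed

lemma nn_integral_shift_periodic:
  fixes f :: "real \<Rightarrow> ennreal"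
  assumes f: "f \<in> borel_measurable borel" and per: "\<And>x. f (x + 1) = f x"
  shows "(\<integral>\<^sup>+x\<in>{0..<1}. f (x + r) \<partial>lborel) = (\<integral>\<^sup>+x\<in>{0..<1}. f x \<partial>lborel)"
proof -
  have "f (x + r) = f (x + frac r)" for x
    using periodic_shift_int[of f "x + frac r" "\<lfloor>r\<rfloor>", OF per] by (simp add: frac_def)
  then show ?thesis
    using nn_integral_shift_periodic_01[OF f per, of "frac r"] by (simp add: frac_lt_1)
qed

lemma periodic_1: "periodic f \<Longrightarrow> f (a + 1, b) = f (a, b)"
  and periodic_2: "periodic f \<Longrightarrow> f (a, b + 1) = f (a, b)"
  by (auto simp: periodic_def)

lemma nn_integral_torus_shift:
  fixes f :: "real \<times> real \<Rightarrow> ennreal"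
  assumes [measurable]: "f \<in> borel_measurable borel" and per: "periodic f"
  shows "(\<integral>\<^sup>+x. f (x + y) \<partial>torus) = (\<integral>\<^sup>+x. f x \<partial>torus)"
proof -
  have [measurable]: "f \<in> borel_measurable (borel \<Otimes>\<^sub>M borel)"
    by (simp add: borel_prod)
  obtain c d where y: "y = (c, d)" by fastforce
  have [measurable]: "(\<lambda>b. f (a, b)) \<in> borel_measurable borel" for a
    by measurable
  have "(\<integral>\<^sup>+x. f (x + y) \<partial>torus) =
     (\<integral>\<^sup>+a\<in>{0..<1}. (\<integral>\<^sup>+b\<in>{0..<1}. f (a + c, b + d) \<partial>lborel) \<partial>lborel)"
    by (subst nn_integral_torus_iterated) (auto simp: y)
  also have "\<dots> = (\<integral>\<^sup>+a\<in>{0..<1}. (\<integral>\<^sup>+b\<in>{0..<1}. f (a + c, b) \<partial>lborel) \<partial>lborel)"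
    by (subst nn_integral_shift_periodic) (auto simp: periodic_2[OF per])
  also have "\<dots> = (\<integral>\<^sup>+a\<in>{0..<1}. (\<integral>\<^sup>+b\<in>{0..<1}. f (a, b) \<partial>lborel) \<partial>lborel)"
    by (rule nn_integral_shift_periodic[where f = "\<lambda>a. \<integral>\<^sup>+b\<in>{0..<1}. f (a, b) \<partial>lborel"])
       (measurable, simp add: periodic_1[OF per])
  also have "\<dots> = (\<integral>\<^sup>+x. f x \<partial>torus)"
    by (subst nn_integral_torus_iterated) auto
  finally show ?thesis .
qed

lemma wrap_measurable [measurable]: "wrap \<in> borel_measurable borel"
proof -
  have [measurable]: "fst \<in> borel_measurable (borel :: (real \<times> real) measure)"
    "snd \<in> borel_measurable (borel :: (real \<times> real) measure)"
    by (intro borel_measurable_continuous_onI continuous_intros)+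
  show ?thesis
    unfolding wrap_def frac_def by (intro borel_measurable_Pair) measurable
qed

lemma wrap_periodic: "periodic (\<lambda>x. f (wrap x))"
  by (simp add: periodic_def wrap_def frac_1_eq)

lemma periodic_wrap: "periodic f \<Longrightarrow> f (wrap x) = f x"
proof -
  assume per: "periodic f"
  have "f (frac a, frac b) = f (a, b)" for a b
  proof -
    have "f (frac a + of_int \<lfloor>a\<rfloor>, frac b + of_int \<lfloor>b\<rfloor>) = f (frac a, frac b + of_int \<lfloor>b\<rfloor>)"
      using periodic_shift_int[of "\<lambda>a. f (a, frac b + of_int \<lfloor>b\<rfloor>)"] periodic_1[OF per] by simp
    also have "\<dots> = f (frac a, frac b)"
      using periodic_shift_int[of "\<lambda>b. f (frac a, b)"] periodic_2[OF per] by simp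
    finally show ?thesis by (simp add: frac_def)
  qed
  then show ?thesis by (simp add: wrap_def)
qed

lemma wrap_eq: "x \<in> cell \<Longrightarrow> wrap x = x"
  by (auto simp: cell_def wrap_def frac_eq)

lemma AE_torus_cell: "AE x in torus. x \<in> cell"
  unfolding torus_def by (subst AE_density) (auto simp: indicator_def)

text \<open>Stated for the measure, the invariance passes at once to Bochner integrals with values
  in any Banach space and to integrability.\<close>

lemma distr_torus_shift: "distr torus torus (\<lambda>x. wrap (x + y)) = torus"
proof (rule measure_eqI)
  fix A assume "A \<in> sets (distr torus torus (\<lambda>x. wrap (x + y)))"
  then have A [measurable]: "A \<in> sets borel" by simp
  have "emeasure (distr torus torus (\<lambda>x. wrap (x + y))) A
      = (\<integral>\<^sup>+x. indicator A x \<partial>distr torus torus (\<lambda>x. wrap (x + y)))"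
    by simp
  also have "\<dots> = (\<integral>\<^sup>+x. indicator A (wrap (x + y)) \<partial>torus)"
    by (rule nn_integral_distr) measurable
  also have "\<dots> = (\<integral>\<^sup>+x. indicator A (wrap x) \<partial>torus)"
    by (rule nn_integral_torus_shift[where f = "\<lambda>x. indicator A (wrap x)"])
       (measurable, rule wrap_periodic)
  also have "\<dots> = (\<integral>\<^sup>+x. indicator A x \<partial>torus)"
    using AE_torus_cell by (intro nn_integral_cong_AE) (auto simp: wrap_eq)
  also have "\<dots> = emeasure torus A" by simp
  finally show "emeasure (distr torus torus (\<lambda>x. wrap (x + y))) A = emeasure torus A" .
qed simp

lemma integral_torus_shift:
  fixes f :: "real \<times> real \<Rightarrow> 'a::{banach, second_countable_topology}"
  assumes [measurable]: "f \<in> borel_measurable borel" and per: "periodic f"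
  shows "(\<integral>x. f (x + y) \<partial>torus) = (\<integral>x. f x \<partial>torus)"
proof -
  have "(\<integral>x. f x \<partial>torus) = (\<integral>x. f x \<partial>distr torus torus (\<lambda>x. wrap (x + y)))"
    by (simp add: distr_torus_shift)
  also have "\<dots> = (\<integral>x. f (wrap (x + y)) \<partial>torus)"
    by (rule integral_distr) measurable
  finally show ?thesis by (simp add: periodic_wrap[OF per])
qed

lemma integrable_torus_shift:
  fixes f :: "real \<times> real \<Rightarrow> 'a::{banach, second_countable_topology}"
  assumes [measurable]: "f \<in> borel_measurable borel" and per: "periodic f"
  shows "integrable torus (\<lambda>x. f (x + y)) \<longleftrightarrow> integrable torus f"
proof -
  have "integrable torus f \<longleftrightarrow> integrable (distr torus torus (\<lambda>x. wrap (x + y))) f"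
    by (simp add: distr_torus_shift)
  also have "\<dots> \<longleftrightarrow> integrable torus (\<lambda>x. f (wrap (x + y)))"
    by (rule integrable_distr_eq) measurable
  finally show ?thesis by (simp add: periodic_wrap[OF per])
qed

lemma periodic_shift: "periodic f \<Longrightarrow> periodic (\<lambda>x. f (x + y))"
proof (cases y)
  case (Pair c d)
  assume per: "periodic f"
  show ?thesis
    unfolding periodic_def Pair
    using periodic_1[OF per, of "_ + c" "_ + d"] periodic_2[OF per, of "_ + c" "_ + d"]
    by (simp add: add.assoc add.commute[of 1] add.left_commute)
qed

lemma periodic_comp: "periodic f \<Longrightarrow> periodic (\<lambda>x. h (f x))"
  by (auto simp: periodic_def)

lemma periodic_const: "periodic (\<lambda>x. c)"
  by (auto simp: periodic_def)

subsection \<open>Periodic functions in L1 and L2\<close>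

text \<open>Quantifiers over points of the plane stay unsplit, so that terms such as
  \<open>f (x + y)\<close> are not broken into coordinates.\<close>

declare split_paired_All [simp del]

lemma periodic_add: "periodic f \<Longrightarrow> periodic g \<Longrightarrow> periodic (\<lambda>x. f x + g x)"
  and periodic_diff: "periodic f \<Longrightarrow> periodic g \<Longrightarrow> periodic (\<lambda>x. f x - g x)"
  and periodic_mult: "periodic f \<Longrightarrow> periodic g \<Longrightarrow> periodic (\<lambda>x. f x * g x)"
  and periodic_cmult: "periodic f \<Longrightarrow> periodic (\<lambda>x. c * f x)"
  and periodic_abs: "periodic f \<Longrightarrow> periodic (\<lambda>x. \<bar>f x\<bar>)"
  and periodic_power: "periodic f \<Longrightarrow> periodic (\<lambda>x. f x ^ n)"
  for f g :: "real \<times> real \<Rightarrow> real"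
  by (simp_all add: periodic_def)

lemmas periodic_intros = periodic_add periodic_diff periodic_mult periodic_abs periodic_power periodic_const

definition L1p :: "(real \<times> real \<Rightarrow> real) \<Rightarrow> bool"
  where "L1p f \<longleftrightarrow> f \<in> borel_measurable borel \<and> periodic f \<and> integrable torus f"

definition L2p :: "(real \<times> real \<Rightarrow> real) \<Rightarrow> bool"
  where "L2p f \<longleftrightarrow> f \<in> borel_measurable borel \<and> periodic f \<and> integrable torus (\<lambda>x. (f x)\<^sup>2)"

text \<open>The bound holds at every point and not only almost everywhere, so that it survives
  translation and averaging without an argument about null sets.\<close>

definition Linf :: "real \<Rightarrow> (real \<times> real \<Rightarrow> real) \<Rightarrow> bool"
  where "Linf B f \<longleftrightarrow> f \<in> borel_measurable borel \<and> periodic f \<and> (\<forall>x. \<bar>f x\<bar> \<le> B)"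

lemma L1p_measurable [measurable_dest]: "L1p f \<Longrightarrow> f \<in> borel_measurable borel"
  by (simp add: L1p_def)

lemma L1pD [dest]: "L1p f \<Longrightarrow> f \<in> borel_measurable borel" "L1p f \<Longrightarrow> periodic f" "L1p f \<Longrightarrow> integrable torus f"
  by (auto simp: L1p_def)

lemma L2p_measurable [measurable_dest]: "L2p f \<Longrightarrow> f \<in> borel_measurable borel"
  by (simp add: L2p_def)

lemma L2pD [dest]: "L2p f \<Longrightarrow> f \<in> borel_measurable borel" "L2p f \<Longrightarrow> periodic f" "L2p f \<Longrightarrow> integrable torus (\<lambda>x. (f x)\<^sup>2)"
  by (auto simp: L2p_def)

lemma Linf_measurable [measurable_dest]: "Linf B f \<Longrightarrow> f \<in> borel_measurable borel"
  by (simp add: Linf_def)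

lemma LinfD [dest]: "Linf B f \<Longrightarrow> f \<in> borel_measurable borel" "Linf B f \<Longrightarrow> periodic f" "Linf B f \<Longrightarrow> \<bar>f x\<bar> \<le> B"
  unfolding Linf_def by blast+

lemma integrable_torus_bound:
  fixes f :: "real \<times> real \<Rightarrow> 'b::{banach, second_countable_topology}"
  assumes "integrable torus g" "f \<in> borel_measurable borel" "\<And>x. norm (f x) \<le> g x"
  shows "integrable torus f"
  using assms(2) by (intro Bochner_Integration.integrable_bound[OF assms(1)])
    (auto intro!: AE_I2 order_trans[OF assms(3)])

lemma integrable_torus_const_bound:
  fixes f :: "real \<times> real \<Rightarrow> 'b::{banach, second_countable_topology}"
  assumes "f \<in> borel_measurable borel" "\<And>x. norm (f x) \<le> B"
  shows "integrable torus f"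
  by (rule integrable_torus_bound[of "\<lambda>_. B"]) (use assms in auto)

lemma L1p_add: "L1p f \<Longrightarrow> L1p g \<Longrightarrow> L1p (\<lambda>x. f x + g x)"
  and L1p_diff: "L1p f \<Longrightarrow> L1p g \<Longrightarrow> L1p (\<lambda>x. f x - g x)"
  and L1p_cmult: "L1p f \<Longrightarrow> L1p (\<lambda>x. c * f x)"
  and L1p_abs: "L1p f \<Longrightarrow> L1p (\<lambda>x. \<bar>f x\<bar>)"
  by (auto simp: L1p_def intro: periodic_intros periodic_cmult)

lemma L1p_shift: "L1p f \<Longrightarrow> L1p (\<lambda>x. f (x + y))"
  by (auto simp: L1p_def integrable_torus_shift periodic_shift)

lemma L2p_shift: "L2p f \<Longrightarrow> L2p (\<lambda>x. f (x + y))"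
  using integrable_torus_shift[of "\<lambda>x. (f x)\<^sup>2" y] periodic_comp[of f "\<lambda>t. t\<^sup>2"]
  by (auto simp: L2p_def periodic_shift)

lemma Linf_shift: "Linf B f \<Longrightarrow> Linf B (\<lambda>x. f (x + y))"
  by (auto simp: Linf_def periodic_shift)

lemma Linf_square: "Linf B f \<Longrightarrow> (f x)\<^sup>2 \<le> B\<^sup>2"
  using power_mono[of "\<bar>f x\<bar>" B 2] by (auto dest: LinfD(3))

lemma Linf_L1p: "Linf B f \<Longrightarrow> L1p f"
  using LinfD(3) by (auto simp: L1p_def intro!: integrable_torus_const_bound[of f B])

lemma Linf_L2p: "Linf B f \<Longrightarrow> L2p f"
  using Linf_square by (auto simp: L2p_def intro!: integrable_torus_const_bound[of _ "B\<^sup>2"])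

lemma L1p_mult_Linf:
  assumes u: "Linf B u" and f: "L1p f" shows "L1p (\<lambda>x. u x * f x)"
  unfolding L1p_def
proof (intro conjI)
  show "integrable torus (\<lambda>x. u x * f x)"
    by (rule integrable_torus_bound[of "\<lambda>x. B * \<bar>f x\<bar>"])
       (use u f in \<open>auto simp: abs_mult intro!: mult_right_mono\<close>)
qed (use u f in \<open>auto intro: periodic_intros\<close>)

lemma L2p_mult_Linf:
  assumes u: "Linf B u" and f: "L2p f" shows "L2p (\<lambda>x. u x * f x)"
  unfolding L2p_def
proof (intro conjI)
  show "integrable torus (\<lambda>x. (u x * f x)\<^sup>2)"
    by (rule integrable_torus_bound[of "\<lambda>x. B\<^sup>2 * (f x)\<^sup>2"])
       (use u f Linf_square[OF u] in \<open>auto simp: power_mult_distrib intro!: mult_right_mono\<close>)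
qed (use u f in \<open>auto intro: periodic_intros\<close>)

lemma abs_mult_le_squares: "\<bar>a * b\<bar> \<le> a\<^sup>2 + b\<^sup>2" for a b :: real
proof -
  have "2 * (a * b) \<le> a\<^sup>2 + b\<^sup>2" "- 2 * (a * b) \<le> a\<^sup>2 + b\<^sup>2" "0 \<le> a\<^sup>2 + b\<^sup>2"
    using sum_squares_bound[of a b] sum_squares_bound[of "-a" b] by auto
  then show ?thesis by (intro abs_leI) linarith+
qed

lemma L2p_L1p_mult:
  assumes f: "L2p f" and g: "L2p g" shows "L1p (\<lambda>x. f x * g x)"
  unfolding L1p_def
proof (intro conjI)
  show "integrable torus (\<lambda>x. f x * g x)"
  proof (rule integrable_torus_bound)
    show "integrable torus (\<lambda>x. (f x)\<^sup>2 + (g x)\<^sup>2)" using f g by (auto simp: L2p_def)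
    show "(\<lambda>x. f x * g x) \<in> borel_measurable borel" using f g by measurable
    show "norm (f x * g x) \<le> (f x)\<^sup>2 + (g x)\<^sup>2" for x
      unfolding real_norm_def by (rule abs_mult_le_squares)
  qed
  show "(\<lambda>x. f x * g x) \<in> borel_measurable borel" using f g by measurable
  show "periodic (\<lambda>x. f x * g x)" using f g by (intro periodic_mult) auto
qed

lemma L2p_L1p: assumes "L2p f" shows "L1p f"
proof -
  have "L2p (\<lambda>x. 1)" by (rule Linf_L2p[of 1]) (auto simp: Linf_def periodic_const)
  from L2p_L1p_mult[OF assms this] show ?thesis by simp
qed

lemma L2p_L1p_square: "L2p f \<Longrightarrow> L1p (\<lambda>x. (f x)\<^sup>2)"
  using L2p_L1p_mult[of f f] by (simp add: power2_eq_square)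

lemma L2p_add: assumes "L2p f" "L2p g" shows "L2p (\<lambda>x. f x + g x)"
  using assms L2p_L1p_mult[OF assms] unfolding L2p_def L1p_def
  by (auto simp: power2_sum mult.assoc intro: periodic_intros)

lemma L2p_cmult: "L2p f \<Longrightarrow> L2p (\<lambda>x. c * f x)"
  by (auto simp: L2p_def power_mult_distrib intro: periodic_cmult)

lemma L2p_diff: assumes "L2p f" "L2p g" shows "L2p (\<lambda>x. f x - g x)"
  using L2p_add[OF assms(1) L2p_cmult[OF assms(2), of "-1"]] by simp

lemma L2p_divide: "L2p f \<Longrightarrow> L2p (\<lambda>x. f x / c)"
  using L2p_cmult[of f "1/c"] by simp

lemma L1p_divide: "L1p f \<Longrightarrow> L1p (\<lambda>x. f x / c)"
  using L1p_cmult[of f "1/c"] by simp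

lemma L2p_bound:
  assumes "L2p g" "f \<in> borel_measurable borel" "periodic f" "\<And>x. \<bar>f x\<bar> \<le> \<bar>g x\<bar>"
  shows "L2p f"
proof -
  have "integrable torus (\<lambda>x. (f x)\<^sup>2)"
    by (rule integrable_torus_bound[of "\<lambda>x. (g x)\<^sup>2"]) (use assms in \<open>auto simp: abs_le_square_iff[symmetric]\<close>)
  then show ?thesis using assms by (auto simp: L2p_def)
qed

lemma integral_cong_shift:
  fixes f :: "real \<times> real \<Rightarrow> 'b::{banach, second_countable_topology}"
  assumes "f \<in> borel_measurable borel" "periodic f" and "\<And>x. g x = f (x + y)"
  shows "integral\<^sup>L torus g = integral\<^sup>L torus f"
  using integral_torus_shift[OF assms(1,2), of y] unfolding assms(3)[abs_def] .

text \<open>The integral of (B f - C g)^2 is nonnegative, which gives B (A B - C^2) \<ge> 0. The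
  case B = 0 needs its own argument, as g then vanishes almost everywhere.\<close>

lemma Cauchy_Schwarz_torus_sq:
  assumes f: "L2p f" and g: "L2p g"
  shows "(\<integral>x. f x * g x \<partial>torus)\<^sup>2 \<le> (\<integral>x. (f x)\<^sup>2 \<partial>torus) * (\<integral>x. (g x)\<^sup>2 \<partial>torus)"
proof -
  define A B C where "A = (\<integral>x. (f x)\<^sup>2 \<partial>torus)" and "B = (\<integral>x. (g x)\<^sup>2 \<partial>torus)"
    and "C = (\<integral>x. f x * g x \<partial>torus)"
  have i: "integrable torus (\<lambda>x. (f x)\<^sup>2)" "integrable torus (\<lambda>x. (g x)\<^sup>2)" "integrable torus (\<lambda>x. f x * g x)"
    using f g L2p_L1p_mult[OF f g] by auto
  have "0 \<le> (\<integral>x. (B * f x - C * g x)\<^sup>2 \<partial>torus)" by simp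
  also have "\<dots> = (\<integral>x. B\<^sup>2 * (f x)\<^sup>2 - 2 * B * C * (f x * g x) + C\<^sup>2 * (g x)\<^sup>2 \<partial>torus)"
    by (intro Bochner_Integration.integral_cong) (auto simp: power2_eq_square algebra_simps)
  also have "\<dots> = B\<^sup>2 * A - 2 * B * C * C + C\<^sup>2 * B"
    using i by (simp add: A_def B_def C_def)
  finally have *: "0 \<le> B * (A * B - C\<^sup>2)" by (simp add: power2_eq_square algebra_simps)
  have "0 \<le> B" by (simp add: B_def)
  show ?thesis
  proof (cases "B = 0")
    case True
    then have "AE x in torus. (g x)\<^sup>2 = 0"
      unfolding B_def using integral_nonneg_eq_0_iff_AE[OF i(2)] by simp
    then have "AE x in torus. f x * g x = 0" by eventually_elim simp
    moreover have "(\<lambda>x. f x * g x) \<in> borel_measurable torus" using i(3) by auto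
    ultimately have "C = (\<integral>x. 0 \<partial>torus)" unfolding C_def by (intro integral_cong_AE) auto
    with True show ?thesis by (simp add: A_def B_def C_def)
  next
    case False
    with * \<open>0 \<le> B\<close> have "0 \<le> A * B - C\<^sup>2" by (simp add: zero_le_mult_iff)
    then show ?thesis by (simp add: A_def B_def C_def)
  qed
qed

lemma Cauchy_Schwarz_torus:
  assumes f: "L2p f" and g: "L2p g"
  shows "\<bar>\<integral>x. f x * g x \<partial>torus\<bar> \<le> sqrt (\<integral>x. (f x)\<^sup>2 \<partial>torus) * sqrt (\<integral>x. (g x)\<^sup>2 \<partial>torus)"
  using real_sqrt_le_mono[OF Cauchy_Schwarz_torus_sq[OF assms]] by (simp add: real_sqrt_mult)

subsection \<open>Averages of translates\<close>

definition bprob :: "(real \<times> real) measure \<Rightarrow> bool"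
  where "bprob \<nu> \<longleftrightarrow> prob_space \<nu> \<and> sets \<nu> = sets borel"

text \<open>Convolution with the reflection of \<nu>. A general probability measure covers both
  uses: the uniform measure on a segment and the summability kernel.\<close>

definition tavg :: "(real \<times> real) measure \<Rightarrow> (real \<times> real \<Rightarrow> real) \<Rightarrow> real \<times> real \<Rightarrow> real"
  where "tavg \<nu> f x = (\<integral>y. f (x + y) \<partial>\<nu>)"

lemma bprob_sets: "bprob \<nu> \<Longrightarrow> sets \<nu> = sets borel"
  by (simp add: bprob_def)

lemma bprob_space: "bprob \<nu> \<Longrightarrow> space \<nu> = UNIV"
  using sets_eq_imp_space_eq[OF bprob_sets] by simp

lemma bprob_pair: "bprob \<nu> \<Longrightarrow> pair_sigma_finite torus \<nu>"
  unfolding bprob_def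
  by (simp add: pair_sigma_finite_def prob_space_imp_sigma_finite prob_space_torus)

text \<open>The variance is nonnegative. With values in \<open>ennreal\<close> the inequality also
  covers functions whose square is not integrable, where the right side is infinite.\<close>

lemma prob_nn_Jensen_square:
  assumes "prob_space M" "f \<in> borel_measurable M"
  shows "ennreal ((\<integral>x. f x \<partial>M)\<^sup>2) \<le> (\<integral>\<^sup>+x. ennreal ((f x :: real)\<^sup>2) \<partial>M)"
proof -
  interpret prob_space M by fact
  show ?thesis
  proof (cases "(\<integral>\<^sup>+x. ennreal ((f x)\<^sup>2) \<partial>M) = \<infinity>")
    case False
    then have i2: "integrable M (\<lambda>x. (f x)\<^sup>2)"
      using assms(2) by (intro integrableI_bounded) (simp_all add: less_top[symmetric])
    have i: "integrable M f" by (rule square_integrable_imp_integrable[OF assms(2) i2])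
    have "0 \<le> (\<integral>x. (f x - expectation f)\<^sup>2 \<partial>M)" by simp
    also have "\<dots> = (\<integral>x. (f x)\<^sup>2 - 2 * expectation f * f x + (expectation f)\<^sup>2 \<partial>M)"
      by (intro Bochner_Integration.integral_cong) (auto simp: power2_eq_square algebra_simps)
    also have "\<dots> = (\<integral>x. (f x)\<^sup>2 \<partial>M) - (expectation f)\<^sup>2"
      using i i2 by (simp add: prob_space power2_eq_square)
    finally show ?thesis
      using i2 by (subst nn_integral_eq_integral) (auto intro: ennreal_leI)
  qed simp
qed

lemma prob_nn_Jensen_cube:
  assumes "prob_space M" "f \<in> borel_measurable M"
  shows "ennreal (\<bar>\<integral>x. f x \<partial>M\<bar> ^ 3) \<le> (\<integral>\<^sup>+x. ennreal (\<bar>f x :: real\<bar> ^ 3) \<partial>M)"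
proof -
  interpret prob_space M by fact
  show ?thesis
  proof (cases "(\<integral>\<^sup>+x. ennreal (\<bar>f x\<bar> ^ 3) \<partial>M) = \<infinity>")
    case False
    then have i3: "integrable M (\<lambda>x. \<bar>f x\<bar> ^ 3)"
      using assms(2) by (intro integrableI_bounded) (simp_all add: less_top[symmetric])
    have le: "t \<le> 1 + t ^ 3" if "0 \<le> t" for t :: real
    proof (cases "t \<le> 1")
      case False then have "t ^ 1 \<le> t ^ 3" by (intro power_increasing) auto then show ?thesis by simp
    next
      case True
      with that zero_le_power[OF that, of 3] show ?thesis by linarith
    qed
    have i: "integrable M f"
      by (rule Bochner_Integration.integrable_bound[of _ "\<lambda>x. 1 + \<bar>f x\<bar> ^ 3"]) (use assms i3 le in auto)
    define m where "m = (\<integral>x. \<bar>f x\<bar> \<partial>M)"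
    have m0: "0 \<le> m" by (simp add: m_def)
    \<comment> \<open>On t \<ge> 0 the graph of t^3 lies above its tangent at the mean m of |f|;
      integrating the tangent gives m^3.\<close>
    have tangent: "3 * m\<^sup>2 * t - 2 * m ^ 3 \<le> t ^ 3" if "0 \<le> t" for t
    proof -
      have "t ^ 3 - 3 * m\<^sup>2 * t + 2 * m ^ 3 = (t - m)\<^sup>2 * (t + 2 * m)"
        by (simp add: power2_eq_square power3_eq_cube algebra_simps)
      also have "\<dots> \<ge> 0" using that m0 by simp
      finally show ?thesis by simp
    qed
    have "m ^ 3 = (\<integral>x. 3 * m\<^sup>2 * \<bar>f x\<bar> - 2 * m ^ 3 \<partial>M)"
      using i by (simp add: prob_space m_def[symmetric] power2_eq_square power3_eq_cube)
    also have "\<dots> \<le> (\<integral>x. \<bar>f x\<bar> ^ 3 \<partial>M)"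
      using i i3 tangent by (intro integral_mono) auto
    finally have "m ^ 3 \<le> (\<integral>x. \<bar>f x\<bar> ^ 3 \<partial>M)" .
    moreover have "\<bar>\<integral>x. f x \<partial>M\<bar> ^ 3 \<le> m ^ 3"
      unfolding m_def by (intro power_mono integral_abs_bound) auto
    ultimately show ?thesis
      using i3 by (subst nn_integral_eq_integral) (auto intro: ennreal_leI)
  qed simp
qed

text \<open>If f is not integrable, the integral on the left is 0 by convention.\<close>

lemma ennreal_abs_integral_le:
  fixes f :: "'a \<Rightarrow> real"
  shows "ennreal \<bar>\<integral>x. f x \<partial>M\<bar> \<le> (\<integral>\<^sup>+x. ennreal \<bar>f x\<bar> \<partial>M)"
  using integral_norm_bound_ennreal[of M f] not_integrable_integral_eq[of M f]
  by (cases "integrable M f") auto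

context
  fixes \<nu> :: "(real \<times> real) measure"
  assumes \<nu>: "bprob \<nu>"
begin

interpretation pair_sigma_finite torus \<nu> by (rule bprob_pair[OF \<nu>])
interpretation nu: prob_space \<nu> using \<nu> by (simp add: bprob_def)

lemma sets_nu [measurable_cong, simp]: "sets \<nu> = sets borel"
  by (rule bprob_sets[OF \<nu>])

lemma tavg_measurable [measurable (raw)]:
  assumes [measurable]: "f \<in> borel_measurable borel"
  shows "tavg \<nu> f \<in> borel_measurable borel"
proof -
  have "(\<lambda>x. \<integral>y. f (x + y) \<partial>\<nu>) \<in> borel_measurable borel"
    by (rule M2.borel_measurable_lebesgue_integral) measurable
  then show ?thesis by (simp add: tavg_def[abs_def])
qed

lemma tavg_periodic: "periodic f \<Longrightarrow> periodic (tavg \<nu> f)"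
proof -
  assume per: "periodic f"
  have "f ((a + 1, b) + y) = f ((a, b) + y)" "f ((a, b + 1) + y) = f ((a, b) + y)" for a b y
    using periodic_shift[OF per, of y] by (auto simp: periodic_def)
  then show ?thesis by (simp add: periodic_def tavg_def)
qed

lemma nn_integral_tavg_swap:
  assumes [measurable]: "(\<lambda>(x, y). F x y) \<in> borel_measurable (borel \<Otimes>\<^sub>M borel)"
  shows "(\<integral>\<^sup>+x. \<integral>\<^sup>+y. F x y \<partial>\<nu> \<partial>torus) = (\<integral>\<^sup>+y. \<integral>\<^sup>+x. F x y \<partial>torus \<partial>\<nu>)"
proof -
  have "(\<lambda>(x, y). F x y) \<in> borel_measurable (torus \<Otimes>\<^sub>M \<nu>)" by measurable
  from Fubini'[OF this] show ?thesis by simp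
qed

lemma nn_integral_tavg:
  assumes [measurable]: "f \<in> borel_measurable borel" and per: "periodic f"
  shows "(\<integral>\<^sup>+x. \<integral>\<^sup>+y. f (x + y) \<partial>\<nu> \<partial>torus) = (\<integral>\<^sup>+x. f x \<partial>torus)"
  by (subst nn_integral_tavg_swap) (simp_all add: nn_integral_torus_shift per nu.emeasure_space_1)

lemma integrable_tavg_pair:
  assumes f: "L1p f"
  shows "integrable (torus \<Otimes>\<^sub>M \<nu>) (\<lambda>(x, y). f (x + y))"
proof (rule integrableI_bounded)
  have [measurable]: "f \<in> borel_measurable borel" and per: "periodic f" using f by auto
  show "(\<lambda>(x, y). f (x + y)) \<in> borel_measurable (torus \<Otimes>\<^sub>M \<nu>)" by measurable
  have "(\<integral>\<^sup>+z. ennreal (norm (case z of (x, y) \<Rightarrow> f (x + y))) \<partial>(torus \<Otimes>\<^sub>M \<nu>)) =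
     (\<integral>\<^sup>+x. \<integral>\<^sup>+y. ennreal \<bar>f (x + y)\<bar> \<partial>\<nu> \<partial>torus)"
    by (subst M2.nn_integral_fst[symmetric]) simp_all
  also have "\<dots> = (\<integral>\<^sup>+x. ennreal \<bar>f x\<bar> \<partial>torus)"
    by (rule nn_integral_tavg[where f = "\<lambda>x. ennreal \<bar>f x\<bar>"]) (measurable, rule periodic_comp[OF per])
  also have "\<dots> < \<infinity>" using L1pD(3)[OF f] by (simp add: integrable_iff_bounded)
  finally show "(\<integral>\<^sup>+z. ennreal (norm (case z of (x, y) \<Rightarrow> f (x + y))) \<partial>(torus \<Otimes>\<^sub>M \<nu>)) < \<infinity>" .
qed

lemma integrable_tavg_pair_mult:
  fixes u :: "real \<times> real \<Rightarrow> 'b::{real_normed_algebra_1, banach, second_countable_topology}"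
  assumes f: "L1p f" and [measurable]: "u \<in> borel_measurable borel" and u: "\<And>x. norm (u x) \<le> B"
  shows "integrable (torus \<Otimes>\<^sub>M \<nu>) (\<lambda>(x, y). of_real (f (x + y)) * u x)"
proof (rule Bochner_Integration.integrable_bound)
  have [measurable]: "f \<in> borel_measurable borel" using f by auto
  show "integrable (torus \<Otimes>\<^sub>M \<nu>) (\<lambda>z. B * \<bar>case z of (x, y) \<Rightarrow> f (x + y)\<bar>)"
    using integrable_tavg_pair[OF f] by (intro integrable_mult_right integrable_abs)
  show "(\<lambda>(x, y). of_real (f (x + y)) * u x) \<in> borel_measurable (torus \<Otimes>\<^sub>M \<nu>)" by measurable
  show "AE z in torus \<Otimes>\<^sub>M \<nu>. norm (case z of (x, y) \<Rightarrow> of_real (f (x + y)) * u x)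
     \<le> norm (B * \<bar>case z of (x, y) \<Rightarrow> f (x + y)\<bar>)"
  proof (rule AE_I2, clarify)
    fix a b c d :: real
    have "norm (of_real (f ((a, b) + (c, d))) * u (a, b)) \<le> \<bar>f ((a, b) + (c, d))\<bar> * norm (u (a, b))"
      by (rule order_trans[OF norm_mult_ineq]) simp
    also have "\<dots> \<le> \<bar>f ((a, b) + (c, d))\<bar> * B" by (intro mult_left_mono u) auto
    also have "\<dots> \<le> norm (B * \<bar>f ((a, b) + (c, d))\<bar>)" by (simp add: abs_mult mult.commute mult_left_mono mult_right_mono)
    finally show "norm (of_real (f ((a, b) + (c, d))) * u (a, b)) \<le> norm (B * \<bar>f ((a, b) + (c, d))\<bar>)" .
  qed
qed

lemma AE_integrable_tavg:
  assumes f: "L1p f"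
  shows "AE x in torus. integrable \<nu> (\<lambda>y. f (x + y))"
  using AE_integrable_fst'[OF integrable_tavg_pair[OF f]] by simp

lemma tavg_L1p: assumes f: "L1p f" shows "L1p (tavg \<nu> f)"
  using integrable_fst'[OF integrable_tavg_pair[OF f]] f
    tavg_measurable[of f] tavg_periodic[of f]
  by (auto simp: L1p_def tavg_def[abs_def])

lemma integral_mult_tavg:
  fixes u :: "real \<times> real \<Rightarrow> 'b::{real_normed_algebra_1, banach, second_countable_topology}"
  assumes f: "L1p f" and u: "u \<in> borel_measurable borel" "\<And>x. norm (u x) \<le> B"
  shows "(\<integral>x. of_real (tavg \<nu> f x) * u x \<partial>torus) = (\<integral>y. (\<integral>x. of_real (f (x + y)) * u x \<partial>torus) \<partial>\<nu>)"
proof -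
  have "(\<integral>x. of_real (tavg \<nu> f x) * u x \<partial>torus) = (\<integral>x. (\<integral>y. of_real (f (x + y)) * u x \<partial>\<nu>) \<partial>torus)"
  proof (rule integral_cong_AE)
    show "(\<lambda>x. of_real (tavg \<nu> f x) * u x) \<in> borel_measurable torus"
      using tavg_measurable[of f] f u by auto
    show "(\<lambda>x. \<integral>y. of_real (f (x + y)) * u x \<partial>\<nu>) \<in> borel_measurable torus"
      using integrable_fst'[OF integrable_tavg_pair_mult[OF f u]] by (auto dest: borel_measurable_integrable)
    show "AE x in torus. of_real (tavg \<nu> f x) * u x = (\<integral>y. of_real (f (x + y)) * u x \<partial>\<nu>)"
      using AE_integrable_tavg[OF f]
    proof eventually_elim
      case (elim x)
      then show ?case
        by (simp add: tavg_def)
    qed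
  qed
  also have "\<dots> = (\<integral>y. (\<integral>x. of_real (f (x + y)) * u x \<partial>torus) \<partial>\<nu>)"
    by (rule Fubini_integral[symmetric]) (rule integrable_tavg_pair_mult[OF f u])
  finally show ?thesis .
qed

text \<open>Jensen's inequality at each point and translation invariance make averaging a
  contraction in L2.\<close>

lemma tavg_L2p: assumes f: "L2p f"
  shows "L2p (tavg \<nu> f)" and "(\<integral>x. (tavg \<nu> f x)\<^sup>2 \<partial>torus) \<le> (\<integral>x. (f x)\<^sup>2 \<partial>torus)"
proof -
  have [measurable]: "f \<in> borel_measurable borel" and per: "periodic f" using f by auto
  have "(\<integral>\<^sup>+x. ennreal ((tavg \<nu> f x)\<^sup>2) \<partial>torus) \<le> (\<integral>\<^sup>+x. \<integral>\<^sup>+y. ennreal ((f (x + y))\<^sup>2) \<partial>\<nu> \<partial>torus)"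
    unfolding tavg_def by (intro nn_integral_mono prob_nn_Jensen_square nu.prob_space_axioms) measurable
  also have "\<dots> = (\<integral>\<^sup>+x. ennreal ((f x)\<^sup>2) \<partial>torus)"
    by (rule nn_integral_tavg[where f = "\<lambda>x. ennreal ((f x)\<^sup>2)"]) (measurable, rule periodic_comp[OF per])
  also have "\<dots> = ennreal (\<integral>x. (f x)\<^sup>2 \<partial>torus)"
    using f by (intro nn_integral_eq_integral) auto
  finally have *: "(\<integral>\<^sup>+x. ennreal ((tavg \<nu> f x)\<^sup>2) \<partial>torus) \<le> ennreal (\<integral>x. (f x)\<^sup>2 \<partial>torus)" .
  have i: "integrable torus (\<lambda>x. (tavg \<nu> f x)\<^sup>2)"
  proof (rule integrableI_bounded)
    show "(\<integral>\<^sup>+x. ennreal (norm ((tavg \<nu> f x)\<^sup>2)) \<partial>torus) < \<infinity>"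
      using * by (simp add: order_le_less_trans ennreal_less_top)
  qed measurable
  then show "L2p (tavg \<nu> f)" using tavg_periodic[OF per] by (simp add: L2p_def tavg_measurable)
  show "(\<integral>x. (tavg \<nu> f x)\<^sup>2 \<partial>torus) \<le> (\<integral>x. (f x)\<^sup>2 \<partial>torus)"
    using * by (subst (asm) nn_integral_eq_integral[OF i]) auto
qed

lemma prob_integral_diff:
  assumes "integrable \<nu> g" shows "(\<integral>y. g y \<partial>\<nu>) - c = (\<integral>y. g y - c \<partial>\<nu> :: real)"
  using assms by (simp add: nu.prob_space)

lemma Linf_tavg: "Linf B f \<Longrightarrow> Linf B (tavg \<nu> f)"
proof -
  assume f: "Linf B f"
  then have [measurable]: "f \<in> borel_measurable borel" by auto
  have "\<bar>tavg \<nu> f x\<bar> \<le> B" for x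
  proof -
    have "\<bar>tavg \<nu> f x\<bar> \<le> (\<integral>y. \<bar>f (x + y)\<bar> \<partial>\<nu>)"
      unfolding tavg_def by (rule integral_abs_bound)
    also have "\<dots> \<le> (\<integral>y. B \<partial>\<nu>)"
      using f by (intro integral_mono nu.integrable_const_bound[where B = B]) (auto simp: Linf_def)
    finally show ?thesis by (simp add: nu.prob_space)
  qed
  then show ?thesis using f by (auto simp: Linf_def tavg_measurable tavg_periodic)
qed

text \<open>The function e stands for the absolute value, its square or its cube, and the second
  hypothesis is its Jensen inequality. The constant \<open>f x\<close> can be pulled into the
  average only where the averaged function is integrable, hence the passage to almost every
  x.\<close>

lemma nn_integral_tavg_defect_le:
  assumes f: "L1p f" and e: "\<And>M (g :: real \<times> real \<Rightarrow> real). prob_space M \<Longrightarrow> g \<in> borel_measurable M \<Longrightarrow>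
      ennreal (e (\<integral>y. g y \<partial>M)) \<le> (\<integral>\<^sup>+y. ennreal (e (g y)) \<partial>M)"
    and [measurable]: "e \<in> borel_measurable borel"
  shows "(\<integral>\<^sup>+x. ennreal (e (tavg \<nu> f x - f x)) \<partial>torus)
     \<le> (\<integral>\<^sup>+y. (\<integral>\<^sup>+x. ennreal (e (f (x + y) - f x)) \<partial>torus) \<partial>\<nu>)"
proof -
  have [measurable]: "f \<in> borel_measurable borel" and per: "periodic f" using f by auto
  have "(\<integral>\<^sup>+x. ennreal (e (tavg \<nu> f x - f x)) \<partial>torus)
     \<le> (\<integral>\<^sup>+x. \<integral>\<^sup>+y. ennreal (e (f (x + y) - f x)) \<partial>\<nu> \<partial>torus)"
  proof (rule nn_integral_mono_AE)
    show "AE x in torus. ennreal (e (tavg \<nu> f x - f x)) \<le> (\<integral>\<^sup>+y. ennreal (e (f (x + y) - f x)) \<partial>\<nu>)"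
      using AE_integrable_tavg[OF f]
    proof eventually_elim
      case (elim x)
      show ?case
        unfolding tavg_def prob_integral_diff[OF elim]
        by (rule e) (use nu.prob_space_axioms in auto)
    qed
  qed
  also have "\<dots> = (\<integral>\<^sup>+y. \<integral>\<^sup>+x. ennreal (e (f (x + y) - f x)) \<partial>torus \<partial>\<nu>)"
    by (rule nn_integral_tavg_swap) measurable
  finally show ?thesis .
qed

end

declare sets_nu [measurable_cong del, simp del]

subsection \<open>Continuity of translations\<close>

definition modL1 :: "(real \<times> real \<Rightarrow> real) \<Rightarrow> real \<times> real \<Rightarrow> real"
  where "modL1 f y = (\<integral>x. \<bar>f (x + y) - f x\<bar> \<partial>torus)"

definition modL2 :: "(real \<times> real \<Rightarrow> real) \<Rightarrow> real \<times> real \<Rightarrow> real"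
  where "modL2 f y = (\<integral>x. (f (x + y) - f x)\<^sup>2 \<partial>torus)"

lemma fst_borel [measurable]: "fst \<in> borel_measurable (borel :: (real \<times> real) measure)"
  and snd_borel [measurable]: "snd \<in> borel_measurable (borel :: (real \<times> real) measure)"
  by (intro borel_measurable_continuous_onI continuous_intros)+

text \<open>The map \<open>wrap\<close> jumps where a coordinate is an integer; inside the cell this
  happens on two null segments.\<close>

lemma AE_torus_interior: "AE x in torus. 0 < fst x \<and> fst x < 1 \<and> 0 < snd x \<and> snd x < 1"
proof -
  have "emeasure (lborel \<Otimes>\<^sub>M lborel) ({0::real} \<times> (UNIV :: real set)) = 0"
    by (subst lborel.emeasure_pair_measure_Times) auto
  then have 1: "AE x in lborel. x \<notin> {0::real} \<times> (UNIV :: real set)"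
    by (intro AE_not_in null_setsI) (auto intro!: borel_closed closed_Times simp: lborel_prod)
  have "emeasure (lborel \<Otimes>\<^sub>M lborel) ((UNIV :: real set) \<times> {0::real}) = 0"
    by (subst lborel.emeasure_pair_measure_Times) auto
  then have 2: "AE x in lborel. x \<notin> (UNIV :: real set) \<times> {0::real}"
    by (intro AE_not_in null_setsI) (auto intro!: borel_closed closed_Times simp: lborel_prod)
  have "AE x in torus. x \<notin> {0::real} \<times> (UNIV :: real set) \<and> x \<notin> (UNIV :: real set) \<times> {0::real}"
    unfolding torus_def using 1 2 by (subst AE_density) auto
  with AE_torus_cell show ?thesis
    by eventually_elim (auto simp: cell_def less_le mem_Times_iff)
qed

lemma integrable_wrap_shift:
  fixes f :: "real \<times> real \<Rightarrow> real"
  assumes f: "integrable torus f"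
  shows "integrable torus (\<lambda>x. f (wrap (x + y)))"
    and "(\<integral>x. f (wrap (x + y)) \<partial>torus) = (\<integral>x. f x \<partial>torus)"
proof -
  have [measurable]: "f \<in> borel_measurable borel"
    using borel_measurable_integrable[OF f] measurable_cong_sets[OF sets_torus refl] by blast
  have [measurable]: "(\<lambda>x. wrap (x + y)) \<in> torus \<rightarrow>\<^sub>M torus" by measurable
  show "integrable torus (\<lambda>x. f (wrap (x + y)))"
    using f integrable_distr_eq[of "\<lambda>x. wrap (x + y)" torus torus f] by (simp add: distr_torus_shift)
  show "(\<integral>x. f (wrap (x + y)) \<partial>torus) = (\<integral>x. f x \<partial>torus)"
    using integral_distr[of "\<lambda>x. wrap (x + y)" torus torus f] by (simp add: distr_torus_shift)
qed

lemma wrap_tendsto: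
  assumes X: "X \<longlonglongrightarrow> (0 :: real \<times> real)" and x: "0 < fst x" "fst x < 1" "0 < snd x" "snd x < 1"
  shows "(\<lambda>n. wrap (x + X n)) \<longlonglongrightarrow> x"
proof -
  have lim: "(\<lambda>n. x + X n) \<longlonglongrightarrow> x" using tendsto_add[OF tendsto_const X] by simp
  have "open ({0<..<1::real} \<times> {0<..<1::real})" by (intro open_Times) auto
  then have "\<forall>\<^sub>F n in sequentially. x + X n \<in> {0<..<1} \<times> {0<..<1}"
    by (rule topological_tendstoD[OF lim]) (use x in \<open>auto simp: mem_Times_iff\<close>)
  then have "\<forall>\<^sub>F n in sequentially. x + X n = wrap (x + X n)"
    by eventually_elim (auto simp: wrap_eq cell_def mem_Times_iff)
  with lim show ?thesis by (rule Lim_transform_eventually)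
qed

text \<open>For values 0 and 1 one has |p - q| = p + q - 2 p q, and translation invariance turns the
  integral into twice that of I - I I(x + y). For this only points of U matter, and they stay in U
  under small translations; nothing has to be known about the boundary of U.\<close>

lemma wrap_modulus_open:
  assumes U: "open U" and X: "X \<longlonglongrightarrow> 0"
  shows "(\<lambda>n. \<integral>x. \<bar>indicator U (wrap (x + X n)) - indicator U (wrap x)\<bar> \<partial>torus) \<longlonglongrightarrow> (0::real)"
proof -
  define I where "I = (indicator U :: real \<times> real \<Rightarrow> real)"
  have [measurable]: "U \<in> sets borel" using U by (rule borel_open)
  have [measurable]: "I \<in> borel_measurable borel" unfolding I_def by measurable
  have I01: "I x = 0 \<or> I x = 1" for x by (auto simp: I_def indicator_def)
  have int: "integrable torus I" by (rule integrable_torus_const_bound[of _ 1]) (auto simp: I_def indicator_def)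
  note i = integrable_wrap_shift[OF int]
  have ii: "integrable torus (\<lambda>x. I (wrap x) * I (wrap (x + y)))" for y
    by (rule integrable_torus_const_bound[of _ 1]) (auto simp: I_def indicator_def)
  have eq: "(\<integral>x. \<bar>I (wrap (x + y)) - I (wrap x)\<bar> \<partial>torus)
      = 2 * (\<integral>x. I (wrap x) - I (wrap x) * I (wrap (x + y)) \<partial>torus)" for y
  proof -
    have "(\<integral>x. \<bar>I (wrap (x + y)) - I (wrap x)\<bar> \<partial>torus) =
        (\<integral>x. I (wrap (x + y)) + I (wrap x) - 2 * (I (wrap x) * I (wrap (x + y))) \<partial>torus)"
    proof (intro Bochner_Integration.integral_cong refl)
      fix x show "\<bar>I (wrap (x + y)) - I (wrap x)\<bar> = I (wrap (x + y)) + I (wrap x) - 2 * (I (wrap x) * I (wrap (x + y)))"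
        using I01[of "wrap x"] I01[of "wrap (x + y)"] by auto
    qed
    also have "\<dots> = 2 * (\<integral>x. I (wrap x) - I (wrap x) * I (wrap (x + y)) \<partial>torus)"
      using i[of y] i[of 0] ii[of y] by simp
    finally show ?thesis .
  qed
  have "(\<lambda>n. \<integral>x. I (wrap x) - I (wrap x) * I (wrap (x + X n)) \<partial>torus) \<longlonglongrightarrow> (\<integral>x. 0 \<partial>torus)"
  proof (rule integral_dominated_convergence[where w = "\<lambda>_. 1"])
    show "AE x in torus. (\<lambda>n. I (wrap x) - I (wrap x) * I (wrap (x + X n))) \<longlonglongrightarrow> 0"
      using AE_torus_interior
    proof eventually_elim
      case (elim x)
      then have w: "wrap x = x" by (intro wrap_eq) (auto simp: cell_def mem_Times_iff)
      show ?case
      proof (cases "x \<in> U")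
        case True
        have "\<forall>\<^sub>F n in sequentially. wrap (x + X n) \<in> U"
          by (rule topological_tendstoD[OF wrap_tendsto[OF X] U True]) (use elim in auto)
        then have "\<forall>\<^sub>F n in sequentially. I (wrap x) - I (wrap x) * I (wrap (x + X n)) = 0"
          by eventually_elim (simp add: I_def)
        then show ?thesis by (rule tendsto_eventually)
      qed (simp add: I_def w)
    qed
    show "AE x in torus. norm (I (wrap x) - I (wrap x) * I (wrap (x + X n))) \<le> 1" for n
      by (auto simp: I_def indicator_def)
  qed (auto simp: I_def)
  from tendsto_mult[OF tendsto_const[of 2] this] show ?thesis
    unfolding I_def[symmetric] eq by simp
qed

text \<open>Approximation by simple functions in the form of \<open>integrable_induct\<close>. The
  functions met in the induction are not periodic, so \<open>wrap\<close> stands in for periodicity.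
  Indicators of Borel sets are reduced to those of open sets by outer regularity.\<close>

lemma wrap_modulus_integrable:
  assumes f: "integrable torus (f :: real \<times> real \<Rightarrow> real)" and X: "X \<longlonglongrightarrow> 0"
  shows "(\<lambda>n. \<integral>x. \<bar>f (wrap (x + X n)) - f (wrap x)\<bar> \<partial>torus) \<longlonglongrightarrow> 0"
  using f
proof (induction rule: integrable_induct)
  case (base A c)
  then have [measurable]: "A \<in> sets borel" by simp
  have approx: "\<exists>U. open U \<and> A \<subseteq> U \<and> measure torus (U - A) \<le> e" if "0 < e" for e :: real
  proof -
    have inf: "emeasure torus A = (INF U \<in> {U. A \<subseteq> U \<and> open U}. emeasure torus U)"
      by (rule outer_regular) auto
    have "emeasure torus A < emeasure torus A + ennreal e"
      using that by (auto simp: torus.emeasure_eq_measure ennreal_plus[symmetric] simp del: ennreal_plus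
          intro!: ennreal_lessI add_nonneg_pos)
    then obtain U where U: "A \<subseteq> U" "open U" "emeasure torus U < emeasure torus A + ennreal e"
      by (subst (asm) (1) inf) (auto simp: INF_less_iff)
    have "measure torus U \<le> measure torus A + e"
      using U(3) that by (simp add: torus.emeasure_eq_measure ennreal_plus[symmetric] ennreal_less_iff del: ennreal_plus)
    then have "measure torus (U - A) \<le> e"
      using U by (subst torus.finite_measure_Diff) auto
    with U show ?thesis by auto
  qed
  have "(\<lambda>n. \<integral>x. \<bar>indicator A (wrap (x + X n)) - indicator A (wrap x)\<bar> \<partial>torus) \<longlonglongrightarrow> (0::real)"
  proof (rule LIMSEQ_I)
    fix e :: real assume "0 < e"
    then obtain U where U: "open U" "A \<subseteq> U" "measure torus (U - A) \<le> e / 4"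
      using approx[of "e/4"] by auto
    have [measurable]: "U \<in> sets borel" using U by simp
    obtain n0 where n0: "\<And>n. n \<ge> n0 \<Longrightarrow>
        \<bar>\<integral>x. \<bar>indicator U (wrap (x + X n)) - indicator U (wrap x)\<bar> \<partial>torus\<bar> < e / 2"
      using LIMSEQ_D[OF wrap_modulus_open[OF U(1) X], of "e/2"] \<open>0 < e\<close> by auto
    define R where "R = (indicator (U - A) :: real \<times> real \<Rightarrow> real)"
    have intR: "integrable torus R"
      unfolding R_def by (rule integrable_torus_const_bound[of _ 1]) (auto simp: indicator_def)
    have intU: "integrable torus (\<lambda>x. \<bar>indicator U (wrap (x + X n)) - indicator U (wrap x)\<bar> :: real)" for n
      by (rule integrable_torus_const_bound[of _ 1]) (auto simp: indicator_def)
    have "(\<integral>x. \<bar>indicator A (wrap (x + X n)) - indicator A (wrap x)\<bar> \<partial>torus) < e" if "n \<ge> n0" for n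
    proof -
      have "(\<integral>x. \<bar>indicator A (wrap (x + X n)) - indicator A (wrap x)\<bar> \<partial>torus) \<le>
        (\<integral>x. \<bar>indicator U (wrap (x + X n)) - indicator U (wrap x)\<bar> + (R (wrap (x + X n)) + R (wrap (x + 0))) \<partial>torus)"
      proof (rule integral_mono)
        show "integrable torus (\<lambda>x. \<bar>indicator A (wrap (x + X n)) - indicator A (wrap x)\<bar> :: real)"
          by (rule integrable_torus_const_bound[of _ 1]) (auto simp: indicator_def)
        show "\<bar>indicator A (wrap (x + X n)) - indicator A (wrap x)\<bar> \<le>
          \<bar>indicator U (wrap (x + X n)) - indicator U (wrap x)\<bar> + (R (wrap (x + X n)) + R (wrap (x + 0)))" for x
          using U(2) by (auto simp: R_def indicator_def)
      qed (intro Bochner_Integration.integrable_add intU integrable_wrap_shift intR)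
      also have "\<dots> = (\<integral>x. \<bar>indicator U (wrap (x + X n)) - indicator U (wrap x)\<bar> \<partial>torus) + 2 * measure torus (U - A)"
        using integrable_wrap_shift[OF intR, of "X n"] integrable_wrap_shift[OF intR, of 0] intU[of n]
        by (simp add: R_def)
      also have "\<dots> < e" using n0[OF that] U(3) by linarith
      finally show ?thesis .
    qed
    then show "\<exists>no. \<forall>n\<ge>no. norm ((\<integral>x. \<bar>indicator A (wrap (x + X n)) - indicator A (wrap x)\<bar> \<partial>torus) - 0 :: real) < e"
      by (auto simp: abs_of_nonneg intro!: exI[of _ n0])
  qed
  moreover have "\<bar>a * c - b * c\<bar> = \<bar>c\<bar> * \<bar>a - b\<bar>" for a b :: real
    by (simp add: abs_mult mult.commute flip: left_diff_distrib)
  ultimately show ?case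
    using tendsto_mult[OF tendsto_const[of "\<bar>c\<bar>"]] by fastforce
next
  case (add f g)
  have i: "integrable torus (\<lambda>x. \<bar>h (wrap (x + X n)) - h (wrap x)\<bar>)" if "integrable torus h" for h :: "real \<times> real \<Rightarrow> real" and n
    using integrable_wrap_shift(1)[OF that, of "X n"] integrable_wrap_shift(1)[OF that, of 0] by auto
  have le: "(\<integral>x. \<bar>(f (wrap (x + X n)) + g (wrap (x + X n))) - (f (wrap x) + g (wrap x))\<bar> \<partial>torus)
    \<le> (\<integral>x. \<bar>f (wrap (x + X n)) - f (wrap x)\<bar> \<partial>torus) + (\<integral>x. \<bar>g (wrap (x + X n)) - g (wrap x)\<bar> \<partial>torus)" for n
    unfolding Bochner_Integration.integral_add[OF i[OF add(1)] i[OF add(2)], symmetric]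
    using i[OF Bochner_Integration.integrable_add[OF add(1,2)], of n] i[OF add(1), of n] i[OF add(2), of n]
    by (intro integral_mono Bochner_Integration.integrable_add) auto
  show ?case
  proof (rule tendsto_sandwich[OF always_eventually always_eventually])
    show "\<forall>n. (0::real) \<le> (\<integral>x. \<bar>(f (wrap (x + X n)) + g (wrap (x + X n))) - (f (wrap x) + g (wrap x))\<bar> \<partial>torus)" by simp
    show "(\<lambda>n. (\<integral>x. \<bar>f (wrap (x + X n)) - f (wrap x)\<bar> \<partial>torus) + (\<integral>x. \<bar>g (wrap (x + X n)) - g (wrap x)\<bar> \<partial>torus)) \<longlonglongrightarrow> 0"
      using tendsto_add[OF add(3,4)] by simp
  qed (use le in auto)
next
  case (lim f s)
  have i: "integrable torus (\<lambda>x. \<bar>h (wrap (x + X n)) - h (wrap x)\<bar>)" if "integrable torus h" for h :: "real \<times> real \<Rightarrow> real" and n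
    using integrable_wrap_shift(1)[OF that, of "X n"] integrable_wrap_shift(1)[OF that, of 0] by auto
  \<comment> \<open>The induction rule supplies approximants with |s i x| \<le> 2 |f x|, hence the
    dominating function 3 |f x|.\<close>
  have conv: "(\<lambda>i. \<integral>x. \<bar>f x - s i x\<bar> \<partial>torus) \<longlonglongrightarrow> (\<integral>x. 0 \<partial>torus)"
  proof (rule integral_dominated_convergence[where w = "\<lambda>x. 3 * \<bar>f x\<bar>"])
    show "integrable torus (\<lambda>x. 3 * \<bar>f x\<bar>)" using lim by auto
    show "AE x in torus. (\<lambda>i. \<bar>f x - s i x\<bar>) \<longlonglongrightarrow> 0"
    proof (rule AE_I2)
      fix x assume "x \<in> space torus"
      from tendsto_diff[OF tendsto_const lim(2)[OF this], of "f x"]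
      show "(\<lambda>i. \<bar>f x - s i x\<bar>) \<longlonglongrightarrow> 0" by (intro tendsto_rabs_zero) simp
    qed
    show "AE x in torus. norm \<bar>f x - s i x\<bar> \<le> 3 * \<bar>f x\<bar>" for i
    proof (rule AE_I2)
      fix x assume "x \<in> space torus"
      from lim(3)[OF this, of i] show "norm \<bar>f x - s i x\<bar> \<le> 3 * \<bar>f x\<bar>" by auto
    qed
  qed (use lim in auto)
  show ?case
  proof (rule LIMSEQ_I)
    fix e :: real assume "0 < e"
    obtain i0 where i0: "(\<integral>x. \<bar>f x - s i0 x\<bar> \<partial>torus) < e / 4"
      using LIMSEQ_D[OF conv, of "e/4"] \<open>0 < e\<close> by auto
    obtain n0 where n0: "\<And>n. n \<ge> n0 \<Longrightarrow> \<bar>\<integral>x. \<bar>s i0 (wrap (x + X n)) - s i0 (wrap x)\<bar> \<partial>torus\<bar> < e / 2"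
      using LIMSEQ_D[OF lim(5)[of i0], of "e/2"] \<open>0 < e\<close> by auto
    define R where "R x = \<bar>f x - s i0 x\<bar>" for x
    have intR: "integrable torus R" using lim unfolding R_def by auto
    note iR = integrable_wrap_shift[OF intR]
    have "(\<integral>x. \<bar>f (wrap (x + X n)) - f (wrap x)\<bar> \<partial>torus) < e" if "n \<ge> n0" for n
    proof -
      have "(\<integral>x. \<bar>f (wrap (x + X n)) - f (wrap x)\<bar> \<partial>torus) \<le>
        (\<integral>x. \<bar>s i0 (wrap (x + X n)) - s i0 (wrap x)\<bar> + (R (wrap (x + X n)) + R (wrap (x + 0))) \<partial>torus)"
        by (intro integral_mono Bochner_Integration.integrable_add i lim iR) (auto simp: R_def)
      also have "\<dots> = (\<integral>x. \<bar>s i0 (wrap (x + X n)) - s i0 (wrap x)\<bar> \<partial>torus) + 2 * (\<integral>x. R x \<partial>torus)"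
        using iR[of "X n"] iR[of 0] i[OF lim(1), of i0 n] by simp
      also have "\<dots> < e" using n0[OF that] i0 by (auto simp: R_def)
      finally show ?thesis .
    qed
    then show "\<exists>no. \<forall>n\<ge>no. norm ((\<integral>x. \<bar>f (wrap (x + X n)) - f (wrap x)\<bar> \<partial>torus) - 0) < e"
      by (auto intro!: exI[of _ n0])
  qed
qed

lemma modL1_tendsto:
  assumes f: "L1p f"
  shows "(modL1 f \<longlongrightarrow> 0) (at 0)"
  unfolding tendsto_at_iff_sequentially
proof (intro allI impI)
  fix X :: "nat \<Rightarrow> real \<times> real" assume X: "X \<longlonglongrightarrow> 0"
  show "(modL1 f \<circ> X) \<longlonglongrightarrow> 0"
    using wrap_modulus_integrable[OF L1pD(3)[OF f] X] periodic_wrap[OF L1pD(2)[OF f]]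
    by (simp add: modL1_def comp_def)
qed

lemma modL1_zero [simp]: "modL1 f 0 = 0" and modL2_zero [simp]: "modL2 f 0 = 0"
  by (simp_all add: modL1_def modL2_def)

lemma modL1_small:
  assumes f: "L1p f" and e: "0 < e"
  obtains d where "0 < d" "\<And>y. norm y < d \<Longrightarrow> modL1 f y < e"
proof -
  have "\<forall>\<^sub>F y in at 0. modL1 f y < e" by (rule order_tendstoD(2)[OF modL1_tendsto[OF f] e])
  then obtain d where d: "0 < d" "\<And>y. y \<noteq> 0 \<Longrightarrow> dist y 0 < d \<Longrightarrow> modL1 f y < e"
    unfolding eventually_at by auto
  show ?thesis by (rule that[OF d(1)]) (use d e in \<open>metis dist_0_norm dist_commute modL1_zero\<close>)
qed

text \<open>
  Applied to \<open>f |f|\<close>, this reduces continuity of translations in \<open>L\<^sup>2\<close> to that in \<open>L\<^sup>1\<close>.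
\<close>

lemma square_diff_le_signed: "(a - b)\<^sup>2 \<le> 2 * \<bar>a * \<bar>a\<bar> - b * \<bar>b\<bar>\<bar>" for a b :: real
proof -
  have *: "(a - b)\<^sup>2 \<le> 2 * \<bar>a * \<bar>a\<bar> - b * \<bar>b\<bar>\<bar>" if "\<bar>b\<bar> \<le> \<bar>a\<bar>" "0 \<le> a" for a b :: real
  proof (cases "0 \<le> b")
    case True
    with that have "(a - b) * (a - b) \<le> (a - b) * (a + b)" by (intro mult_left_mono) auto
    moreover have "0 \<le> (a - b) * (a + b)" using that True by (intro mult_nonneg_nonneg) auto
    ultimately show ?thesis using that True by (simp add: power2_eq_square algebra_simps)
  next
    case False
    have "0 \<le> (a + b)\<^sup>2" by simp
    moreover have "0 \<le> a * a + b * b" by simp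
    ultimately show ?thesis using that False by (simp add: power2_eq_square algebra_simps)
  qed
  have **: "(a - b)\<^sup>2 \<le> 2 * \<bar>a * \<bar>a\<bar> - b * \<bar>b\<bar>\<bar>" if "\<bar>b\<bar> \<le> \<bar>a\<bar>" for a b :: real
    using *[of b a] *[of "-b" "-a"] that by (cases "0 \<le> a") (auto simp: power2_eq_square algebra_simps abs_minus_commute)
  show ?thesis
    using **[of b a] **[of a b] by (cases "\<bar>b\<bar> \<le> \<bar>a\<bar>") (auto simp: power2_commute abs_minus_commute)
qed

lemma modL2_le_modL1_signed_square:
  assumes f: "L2p f"
  shows "L1p (\<lambda>x. f x * \<bar>f x\<bar>)" "modL2 f y \<le> 2 * modL1 (\<lambda>x. f x * \<bar>f x\<bar>) y"
proof -
  have [measurable]: "f \<in> borel_measurable borel" using f by auto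
  have "integrable torus (\<lambda>x. f x * \<bar>f x\<bar>)"
    by (rule integrable_torus_bound[of "\<lambda>x. (f x)\<^sup>2"]) (use f in \<open>auto simp: abs_mult power2_eq_square\<close>)
  then show *: "L1p (\<lambda>x. f x * \<bar>f x\<bar>)"
    using f by (auto simp: L1p_def intro!: periodic_mult periodic_abs)
  have i: "integrable torus (\<lambda>x. (f (x + y) - f x)\<^sup>2)" using L2p_diff[OF L2p_shift[OF f, of y] f] by auto
  have i': "integrable torus (\<lambda>x. \<bar>f (x + y) * \<bar>f (x + y)\<bar> - f x * \<bar>f x\<bar>\<bar>)"
    using L1p_abs[OF L1p_diff[OF L1p_shift[OF *, of y] *]] by auto
  show "modL2 f y \<le> 2 * modL1 (\<lambda>x. f x * \<bar>f x\<bar>) y"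
    unfolding modL2_def modL1_def Bochner_Integration.integral_mult_right_zero[symmetric]
    by (rule integral_mono) (use i i' square_diff_le_signed in auto)
qed

lemma modL2_small:
  assumes f: "L2p f" and e: "0 < e"
  obtains d where "0 < d" "\<And>y. norm y < d \<Longrightarrow> modL2 f y < e"
proof -
  obtain d where d: "0 < d" "\<And>y. norm y < d \<Longrightarrow> modL1 (\<lambda>x. f x * \<bar>f x\<bar>) y < e / 2"
    using modL1_small[OF modL2_le_modL1_signed_square(1)[OF f], of "e/2"] e by auto
  show ?thesis
  proof (rule that[OF d(1)])
    fix y :: "real \<times> real" assume "norm y < d"
    from d(2)[OF this] modL2_le_modL1_signed_square(2)[OF f, of y] show "modL2 f y < e" by linarith
  qed
qed

lemma modL1_nonneg [simp]: "0 \<le> modL1 f y" and modL2_nonneg [simp]: "0 \<le> modL2 f y"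
  by (simp_all add: modL1_def modL2_def)

lemma nn_integral_modL1: "L1p f \<Longrightarrow> (\<integral>\<^sup>+x. ennreal \<bar>f (x + y) - f x\<bar> \<partial>torus) = ennreal (modL1 f y)"
  unfolding modL1_def
  by (intro nn_integral_eq_integral L1pD(3) L1p_abs L1p_diff L1p_shift) auto

lemma nn_integral_modL2: "L2p f \<Longrightarrow> (\<integral>\<^sup>+x. ennreal ((f (x + y) - f x)\<^sup>2) \<partial>torus) = ennreal (modL2 f y)"
  unfolding modL2_def
  by (intro nn_integral_eq_integral L2pD(3) L2p_diff L2p_shift) auto

lemma tavg_minus_L1:
  assumes \<nu>: "bprob \<nu>" and f: "L1p f"
  shows "ennreal (\<integral>x. \<bar>tavg \<nu> f x - f x\<bar> \<partial>torus) \<le> (\<integral>\<^sup>+y. ennreal (modL1 f y) \<partial>\<nu>)"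
proof -
  have "ennreal (\<integral>x. \<bar>tavg \<nu> f x - f x\<bar> \<partial>torus) = (\<integral>\<^sup>+x. ennreal \<bar>tavg \<nu> f x - f x\<bar> \<partial>torus)"
    using L1p_abs[OF L1p_diff[OF tavg_L1p[OF \<nu> f] f]] by (intro nn_integral_eq_integral[symmetric]) auto
  also have "\<dots> \<le> (\<integral>\<^sup>+y. (\<integral>\<^sup>+x. ennreal \<bar>f (x + y) - f x\<bar> \<partial>torus) \<partial>\<nu>)"
    by (rule nn_integral_tavg_defect_le[OF \<nu> f]) (auto intro: ennreal_abs_integral_le)
  finally show ?thesis by (simp add: nn_integral_modL1[OF f])
qed

lemma tavg_minus_L2:
  assumes \<nu>: "bprob \<nu>" and f: "L2p f"
  shows "ennreal (\<integral>x. (tavg \<nu> f x - f x)\<^sup>2 \<partial>torus) \<le> (\<integral>\<^sup>+y. ennreal (modL2 f y) \<partial>\<nu>)"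
proof -
  have "ennreal (\<integral>x. (tavg \<nu> f x - f x)\<^sup>2 \<partial>torus) = (\<integral>\<^sup>+x. ennreal ((tavg \<nu> f x - f x)\<^sup>2) \<partial>torus)"
    using L2p_diff[OF tavg_L2p(1)[OF \<nu> f] f] by (intro nn_integral_eq_integral[symmetric]) auto
  also have "\<dots> \<le> (\<integral>\<^sup>+y. (\<integral>\<^sup>+x. ennreal ((f (x + y) - f x)\<^sup>2) \<partial>torus) \<partial>\<nu>)"
    by (rule nn_integral_tavg_defect_le[OF \<nu> L2p_L1p[OF f]]) (auto intro: prob_nn_Jensen_square)
  finally show ?thesis by (simp add: nn_integral_modL2[OF f])
qed

subsection \<open>Averages along segments\<close>

definition unit01 :: "real measure"
  where "unit01 = density lborel (indicator {0..1})"

text \<open>The uniform probability measure on the segment from 0 to v. For v = 0 it is the unit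
  mass at the origin, so formulas of the form "t times an average" need no exception at t =
  0.\<close>

definition seg :: "real \<times> real \<Rightarrow> (real \<times> real) measure"
  where "seg v = distr unit01 borel (\<lambda>t. t *\<^sub>R v)"

lemma sets_unit01 [simp, measurable_cong]: "sets unit01 = sets borel"
  and space_unit01 [simp]: "space unit01 = UNIV"
  by (simp_all add: unit01_def)

lemma prob_space_unit01: "prob_space unit01"
proof
  show "emeasure unit01 (space unit01) = 1"
    unfolding unit01_def by (subst emeasure_density) auto
qed

lemma AE_unit01: "AE t in unit01. t \<in> {0..1}"
  unfolding unit01_def by (subst AE_density) (auto simp: indicator_def)

lemma seg_map_measurable [measurable]: "(\<lambda>t. t *\<^sub>R (v :: real \<times> real)) \<in> borel_measurable unit01"
proof -
  have "(\<lambda>t. t *\<^sub>R v) \<in> borel_measurable borel"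
    by (intro borel_measurable_continuous_onI continuous_intros)
  then show ?thesis by measurable
qed

lemma bprob_seg: "bprob (seg v)"
  unfolding bprob_def seg_def
  by (auto intro: prob_space.prob_space_distr[OF prob_space_unit01])

lemma AE_seg: "AE z in seg v. norm z \<le> norm v"
proof -
  have "AE t in unit01. norm (t *\<^sub>R v) \<le> norm v"
    using AE_unit01 by eventually_elim (auto intro: mult_left_le_one_le)
  then show ?thesis unfolding seg_def by (subst AE_distr_iff) auto
qed

lemma nn_integral_prob_le:
  assumes "prob_space M" "AE z in M. f z \<le> ennreal e"
  shows "(\<integral>\<^sup>+z. f z \<partial>M) \<le> ennreal e"
proof -
  interpret prob_space M by fact
  have "(\<integral>\<^sup>+z. f z \<partial>M) \<le> (\<integral>\<^sup>+z. ennreal e \<partial>M)" by (rule nn_integral_mono_AE) fact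
  then show ?thesis by (simp add: emeasure_space_1)
qed

lemma tavg_seg_L1:
  assumes f: "L1p f" and e: "0 \<le> e" and le: "\<And>z. norm z \<le> norm v \<Longrightarrow> modL1 f z \<le> e"
  shows "(\<integral>x. \<bar>tavg (seg v) f x - f x\<bar> \<partial>torus) \<le> e"
proof -
  have "ennreal (\<integral>x. \<bar>tavg (seg v) f x - f x\<bar> \<partial>torus) \<le> (\<integral>\<^sup>+y. ennreal (modL1 f y) \<partial>seg v)"
    by (rule tavg_minus_L1[OF bprob_seg f])
  also have "\<dots> \<le> ennreal e"
    using AE_seg[of v] bprob_seg[of v]
    by (intro nn_integral_prob_le) (auto simp: bprob_def elim!: eventually_mono intro!: ennreal_leI le)
  finally show ?thesis using e by simp
qed

lemma tavg_seg_L2: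
  assumes f: "L2p f" and e: "0 \<le> e" and le: "\<And>z. norm z \<le> norm v \<Longrightarrow> modL2 f z \<le> e"
  shows "(\<integral>x. (tavg (seg v) f x - f x)\<^sup>2 \<partial>torus) \<le> e"
proof -
  have "ennreal (\<integral>x. (tavg (seg v) f x - f x)\<^sup>2 \<partial>torus) \<le> (\<integral>\<^sup>+y. ennreal (modL2 f y) \<partial>seg v)"
    by (rule tavg_minus_L2[OF bprob_seg f])
  also have "\<dots> \<le> ennreal e"
    using AE_seg[of v] bprob_seg[of v]
    by (intro nn_integral_prob_le) (auto simp: bprob_def elim!: eventually_mono intro!: ennreal_leI le)
  finally show ?thesis using e by simp
qed

lemma tendsto_zero_at_0I:
  fixes F :: "real \<Rightarrow> real"
  assumes nonneg: "\<And>t. 0 \<le> F t" and small: "\<And>e. 0 < e \<Longrightarrow> \<exists>d>0. \<forall>t. \<bar>t\<bar> < d \<longrightarrow> F t \<le> e"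
  shows "(F \<longlongrightarrow> 0) (at 0)"
proof (rule tendstoI)
  fix e :: real assume "0 < e"
  then obtain d where "d > 0" "\<forall>t. \<bar>t\<bar> < d \<longrightarrow> F t \<le> e / 2" using small[of "e/2"] by auto
  with \<open>0 < e\<close> nonneg show "\<forall>\<^sub>F x in at 0. dist (F x) 0 < e"
    unfolding eventually_at by (intro exI[of _ d]) (auto simp: dist_real_def intro: le_less_trans[of _ "e/2"])
qed

lemma tavg_seg_L1_tendsto:
  assumes f: "L1p f"
  shows "((\<lambda>t. \<integral>x. \<bar>tavg (seg (t *\<^sub>R v)) f x - f x\<bar> \<partial>torus) \<longlongrightarrow> 0) (at 0)"
proof (rule tendsto_zero_at_0I)
  fix e :: real assume e: "0 < e"
  obtain d where d: "0 < d" "\<And>y. norm y < d \<Longrightarrow> modL1 f y < e" using modL1_small[OF f e] by blast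
  have "(\<integral>x. \<bar>tavg (seg (t *\<^sub>R v)) f x - f x\<bar> \<partial>torus) \<le> e" if t: "\<bar>t\<bar> < d / (norm v + 1)" for t
  proof (rule tavg_seg_L1[OF f])
    have "\<bar>t\<bar> * (norm v + 1) < d" using t by (simp add: pos_less_divide_eq add_nonneg_pos)
    then have "norm (t *\<^sub>R v) < d" by (simp add: algebra_simps)
    then show "modL1 f z \<le> e" if "norm z \<le> norm (t *\<^sub>R v)" for z
      using d(2)[of z] that by simp
  qed (use e in auto)
  with d(1) show "\<exists>d>0. \<forall>t. \<bar>t\<bar> < d \<longrightarrow> (\<integral>x. \<bar>tavg (seg (t *\<^sub>R v)) f x - f x\<bar> \<partial>torus) \<le> e"
    by (intro exI[of _ "d / (norm v + 1)"]) (auto intro!: divide_pos_pos add_nonneg_pos)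
qed simp

lemma tavg_seg_L2_tendsto:
  assumes f: "L2p f"
  shows "((\<lambda>t. \<integral>x. (tavg (seg (t *\<^sub>R v)) f x - f x)\<^sup>2 \<partial>torus) \<longlongrightarrow> 0) (at 0)"
proof (rule tendsto_zero_at_0I)
  fix e :: real assume e: "0 < e"
  obtain d where d: "0 < d" "\<And>y. norm y < d \<Longrightarrow> modL2 f y < e" using modL2_small[OF f e] by blast
  have "(\<integral>x. (tavg (seg (t *\<^sub>R v)) f x - f x)\<^sup>2 \<partial>torus) \<le> e" if t: "\<bar>t\<bar> < d / (norm v + 1)" for t
  proof (rule tavg_seg_L2[OF f])
    have "\<bar>t\<bar> * (norm v + 1) < d" using t by (simp add: pos_less_divide_eq add_nonneg_pos)
    then have "norm (t *\<^sub>R v) < d" by (simp add: algebra_simps)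
    then show "modL2 f z \<le> e" if "norm z \<le> norm (t *\<^sub>R v)" for z
      using d(2)[of z] that by simp
  qed (use e in auto)
  with d(1) show "\<exists>d>0. \<forall>t. \<bar>t\<bar> < d \<longrightarrow> (\<integral>x. (tavg (seg (t *\<^sub>R v)) f x - f x)\<^sup>2 \<partial>torus) \<le> e"
    by (intro exI[of _ "d / (norm v + 1)"]) (auto intro!: divide_pos_pos add_nonneg_pos)
qed simp

subsection \<open>Fourier coefficients\<close>

definition fc :: "(real \<times> real \<Rightarrow> real) \<Rightarrow> real \<times> real \<Rightarrow> complex"
  where "fc f k = (\<integral>x. complex_of_real (f x) * cis (- (k \<bullet> x)) \<partial>torus)"

lemma cis_inner_measurable [measurable]: "(\<lambda>x. cis (- (k \<bullet> x))) \<in> borel_measurable borel"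
  "(\<lambda>x. cis (k \<bullet> x)) \<in> borel_measurable borel"
  for k :: "real \<times> real"
  by (intro borel_measurable_continuous_onI continuous_intros)+

lemma fourier_distr_of:
  assumes [measurable]: "f \<in> borel_measurable borel"
  shows "fourier (distr_of f) k = fc f k"
  unfolding fourier_def distr_of_def fc_def by (rule integral_torus) measurable

lemma cis_freq_1: "cis (2 * pi * of_int m) = 1" "cis (- (2 * pi * of_int m)) = 1"
  using cis_multiple_2pi[of "of_int m"] cis_multiple_2pi[of "- of_int m"] by auto

lemma periodic_cis:
  assumes "k \<in> freqs"
  shows "periodic (\<lambda>x. cis (- (k \<bullet> x)))" "periodic (\<lambda>x. cis (k \<bullet> x))"
proof -
  obtain m n :: int where k: "k = (2 * pi * of_int m, 2 * pi * of_int n)"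
    using assms by (auto simp: freqs_def)
  have "cis (- (k \<bullet> (a + 1, b))) = cis (- (k \<bullet> (a, b))) * cis (- (2 * pi * of_int m))"
    "cis (- (k \<bullet> (a, b + 1))) = cis (- (k \<bullet> (a, b))) * cis (- (2 * pi * of_int n))" for a b
    by (simp_all add: k cis_mult algebra_simps)
  then show "periodic (\<lambda>x. cis (- (k \<bullet> x)))" by (simp add: periodic_def cis_freq_1)
  have "cis (k \<bullet> (a + 1, b)) = cis (k \<bullet> (a, b)) * cis (2 * pi * of_int m)"
    "cis (k \<bullet> (a, b + 1)) = cis (k \<bullet> (a, b)) * cis (2 * pi * of_int n)" for a b
    by (simp_all add: k cis_mult algebra_simps)
  then show "periodic (\<lambda>x. cis (k \<bullet> x))" by (simp add: periodic_def cis_freq_1)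
qed

lemma integrable_fc: "L1p f \<Longrightarrow> integrable torus (\<lambda>x. complex_of_real (f x) * cis (- (k \<bullet> x)))"
  by (rule integrable_torus_bound[of "\<lambda>x. \<bar>f x\<bar>"]) (auto simp: norm_mult dest: L1p_measurable)

lemma fc_diff: "L1p f \<Longrightarrow> L1p g \<Longrightarrow> fc (\<lambda>x. f x - g x) k = fc f k - fc g k"
  using integrable_fc[of f k] integrable_fc[of g k] by (simp add: fc_def left_diff_distrib)

lemma fc_cmult: "fc (\<lambda>x. c * f x) k = complex_of_real c * fc f k"
  by (simp add: fc_def mult.assoc)

lemma norm_fc_le: "L1p f \<Longrightarrow> norm (fc f k) \<le> (\<integral>x. \<bar>f x\<bar> \<partial>torus)"
  unfolding fc_def by (rule order_trans[OF integral_norm_bound]) (simp add: norm_mult)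

lemma fc_shift:
  assumes f: "L1p f" and k: "k \<in> freqs"
  shows "fc (\<lambda>x. f (x + y)) k = cis (k \<bullet> y) * fc f k"
proof -
  have "fc (\<lambda>x. f (x + y)) k =
      (\<integral>x. cis (k \<bullet> y) * (complex_of_real (f (x + y)) * cis (- (k \<bullet> (x + y)))) \<partial>torus)"
    unfolding fc_def by (intro Bochner_Integration.integral_cong) (auto simp: cis_mult inner_add_right)
  also have "\<dots> = cis (k \<bullet> y) * (\<integral>x. complex_of_real (f (x + y)) * cis (- (k \<bullet> (x + y))) \<partial>torus)"
    by simp
  also have "(\<integral>x. complex_of_real (f (x + y)) * cis (- (k \<bullet> (x + y))) \<partial>torus) = fc f k"
    unfolding fc_def
  proof (rule integral_torus_shift[where f = "\<lambda>x. complex_of_real (f x) * cis (- (k \<bullet> x))"])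
    show "periodic (\<lambda>x. complex_of_real (f x) * cis (- (k \<bullet> x)))"
      using periodic_cis(1)[OF k] L1pD(2)[OF f] by (simp add: periodic_def)
  qed (use f in measurable)
  finally show ?thesis .
qed

lemma fc_tavg:
  assumes \<nu>: "bprob \<nu>" and f: "L1p f" and k: "k \<in> freqs"
  shows "fc (tavg \<nu> f) k = (\<integral>y. cis (k \<bullet> y) \<partial>\<nu>) * fc f k"
proof -
  have "fc (tavg \<nu> f) k = (\<integral>y. fc (\<lambda>x. f (x + y)) k \<partial>\<nu>)"
    unfolding fc_def by (rule integral_mult_tavg[OF \<nu> f, where B = 1, unfolded of_real_eq_id id_apply]) auto
  also have "\<dots> = (\<integral>y. cis (k \<bullet> y) \<partial>\<nu>) * fc f k" by (simp add: fc_shift[OF f k])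
  finally show ?thesis .
qed

text \<open>The Fourier multiplier of the average over a segment, equal to (e^(is) - 1) / (is) for
  nonzero s.\<close>

definition segA :: "real \<Rightarrow> complex"
  where "segA s = (\<integral>t. cis (t * s) \<partial>unit01)"

lemma integral_seg_cis: "(\<integral>y. cis (k \<bullet> y) \<partial>seg v) = segA (k \<bullet> v)"
  unfolding seg_def segA_def by (subst integral_distr) auto

lemma norm_segA: "norm (segA s) \<le> 1"
proof -
  have "norm (segA s) \<le> (\<integral>t. norm (cis (t * s)) \<partial>unit01)"
    unfolding segA_def by (rule integral_norm_bound)
  then show ?thesis using prob_space.prob_space[OF prob_space_unit01] by simp
qed

text \<open>The fundamental theorem of calculus for e^(ist). This product form, valid also at s = 0,
  says that averaging a derivative over a segment amounts to taking a difference;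
  \<open>D_eq\<close> and \<open>weak_equation\<close> rest on it.\<close>

lemma segA_mult: "\<i> * complex_of_real s * segA s = cis s - 1"
proof -
  have [measurable]: "(\<lambda>t. cis (t * s)) \<in> borel_measurable borel"
    by (intro borel_measurable_continuous_onI continuous_intros)
  have u: "unit01 = density lborel (\<lambda>t. ennreal (indicator {0..1} t))"
    unfolding unit01_def by (intro density_cong) (auto simp: indicator_def)
  have "\<i> * complex_of_real s * segA s = (\<integral>t. \<i> * complex_of_real s * cis (t * s) \<partial>unit01)"
    unfolding segA_def by simp
  also have "\<dots> = (\<integral>t. indicator {0..1} t *\<^sub>R (\<i> * complex_of_real s * cis (t * s)) \<partial>lborel)"
    unfolding u by (subst integral_density) auto
  also have "\<dots> = cis (1 * s) - cis (0 * s)"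
  proof (rule integral_FTC_Icc)
    show "((\<lambda>t. cis (t * s)) has_vector_derivative \<i> * complex_of_real s * cis (t * s)) (at t within {0..1})" for t
      unfolding has_vector_derivative_def
      by (rule has_derivative_eq_rhs[OF has_derivative_cis[OF has_derivative_mult_left[OF has_derivative_ident]]])
         (auto simp: scaleR_conv_of_real)
    show "continuous_on {0..1} (\<lambda>t. \<i> * complex_of_real s * cis (t * s))"
      by (intro continuous_intros)
  qed simp
  finally show ?thesis by simp
qed

lemma fc_tavg_seg:
  assumes "L1p f" "k \<in> freqs"
  shows "fc (tavg (seg v) f) k = segA (k \<bullet> v) * fc f k"
  by (simp add: fc_tavg[OF bprob_seg assms] integral_seg_cis)

subsection \<open>A summability kernel\<close>

text \<open>
  The powers of \<open>cos\<^sup>2 cos\<^sup>2\<close> form an approximate identity of nonnegative trigonometric polynomials with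
  nonnegative coefficients.  The latter makes \<open>\<integral> f (K\<^sub>N * f)\<close> a positive quadratic form in the Fourier
  coefficients of \<open>f\<close>, which serves as Bessel's inequality.
\<close>

definition Kpow :: "nat \<Rightarrow> real \<times> real \<Rightarrow> real"
  where "Kpow N x = cos (pi * fst x) ^ (2 * N) * cos (pi * snd x) ^ (2 * N)"

definition Kmass :: "nat \<Rightarrow> real"
  where "Kmass N = (\<integral>x. Kpow N x \<partial>torus)"

definition ker :: "nat \<Rightarrow> (real \<times> real) measure"
  where "ker N = density torus (\<lambda>x. ennreal (Kpow N x / Kmass N))"

definition kidx :: "nat \<Rightarrow> (nat \<times> nat) set"
  where "kidx N = {..2*N} \<times> {..2*N}"

text \<open>The binomial index j in 0..2N belongs to the frequency j - N, so that the frequency 0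
  has the index N.\<close>

definition kfreq :: "nat \<Rightarrow> nat \<times> nat \<Rightarrow> real \<times> real"
  where "kfreq N i = (2 * pi * (real (fst i) - real N), 2 * pi * (real (snd i) - real N))"

definition kcoef :: "nat \<Rightarrow> nat \<times> nat \<Rightarrow> real"
  where "kcoef N i = (real (2*N choose fst i) / 4 ^ N) * (real (2*N choose snd i) / 4 ^ N) / Kmass N"

lemma kfreq_freqs: "kfreq N i \<in> freqs"
  unfolding freqs_def kfreq_def
  by (rule CollectI, rule exI[of _ "int (fst i) - int N"], rule exI[of _ "int (snd i) - int N"]) simp

lemma finite_kidx [simp]: "finite (kidx N)"
  by (simp add: kidx_def)

lemma cos_power_cis:
  "complex_of_real (cos (pi * s) ^ (2 * N)) =
    (\<Sum>j\<le>2*N. complex_of_real (real (2*N choose j) / 4 ^ N) * cis (- (2 * pi * (real j - real N) * s)))"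
proof -
  have "complex_of_real (cos (pi * s)) = (cis (- (pi * s)) + cis (pi * s)) / 2"
    by (simp add: complex_eq_iff)
  then have "complex_of_real (cos (pi * s) ^ (2 * N)) = ((cis (- (pi * s)) + cis (pi * s)) / 2) ^ (2 * N)"
    by (simp only: of_real_power)
  also have "\<dots> = (cis (- (pi * s)) + cis (pi * s)) ^ (2 * N) / 4 ^ N"
    by (simp add: power_divide power_mult)
  also have "\<dots> = (\<Sum>j\<le>2*N. of_nat (2*N choose j) * cis (- (pi * s)) ^ j * cis (pi * s) ^ (2 * N - j)) / 4 ^ N"
    by (subst binomial_ring) simp
  also have "\<dots> = (\<Sum>j\<le>2*N. complex_of_real (real (2*N choose j) / 4 ^ N) * cis (- (2 * pi * (real j - real N) * s)))"
    unfolding sum_divide_distrib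
  proof (intro sum.cong refl)
    fix j assume "j \<in> {..2*N}"
    then have "cis (- (pi * s)) ^ j * cis (pi * s) ^ (2 * N - j) = cis (- (2 * pi * (real j - real N) * s))"
      unfolding Complex.DeMoivre cis_mult by (intro arg_cong[where f = cis]) (auto simp: of_nat_diff algebra_simps)
    then show "of_nat (2*N choose j) * cis (- (pi * s)) ^ j * cis (pi * s) ^ (2 * N - j) / 4 ^ N
       = complex_of_real (real (2*N choose j) / 4 ^ N) * cis (- (2 * pi * (real j - real N) * s))"
      by (simp add: mult.assoc)
  qed
  finally show ?thesis .
qed

lemma Kpow_cis:
  "complex_of_real (Kpow N x / Kmass N) = (\<Sum>i\<in>kidx N. complex_of_real (kcoef N i) * cis (- (kfreq N i \<bullet> x)))"
proof -
  have "complex_of_real (Kpow N x / Kmass N) =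
     (\<Sum>j\<le>2*N. complex_of_real (real (2*N choose j) / 4 ^ N) * cis (- (2 * pi * (real j - real N) * fst x))) *
     (\<Sum>j\<le>2*N. complex_of_real (real (2*N choose j) / 4 ^ N) * cis (- (2 * pi * (real j - real N) * snd x))) / Kmass N"
    unfolding Kpow_def of_real_divide of_real_mult cos_power_cis ..
  also have "\<dots> = (\<Sum>i\<in>kidx N. complex_of_real (kcoef N i) * cis (- (kfreq N i \<bullet> x)))"
    (is "_ = ?R")
  proof -
    have cis2: "cis (- (kfreq N i \<bullet> x)) = cis (- (2 * pi * (real (fst i) - real N) * fst x)) *
        cis (- (2 * pi * (real (snd i) - real N) * snd x))" for i
      by (simp add: kfreq_def inner_prod_def cis_mult)
    show ?thesis
    unfolding sum_product sum.cartesian_product kidx_def sum_divide_distrib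
    by (intro sum.cong) (auto simp: kcoef_def cis2)
  qed
  finally show ?thesis .
qed

lemma Kpow_measurable [measurable]: "Kpow N \<in> borel_measurable borel"
proof -
  have "(\<lambda>x. cos (pi * fst x) ^ (2 * N) * cos (pi * snd x) ^ (2 * N)) \<in> borel_measurable (borel :: (real \<times> real) measure)"
    by measurable
  then show ?thesis by (simp add: Kpow_def[abs_def])
qed

lemma Kpow_nonneg: "0 \<le> Kpow N x"
  by (simp add: Kpow_def power_mult)

lemma Kpow_le_1: "Kpow N x \<le> 1"
proof -
  have "cos a ^ (2 * N) \<le> 1" for a :: real
    unfolding power_mult by (rule power_le_one) (auto simp: abs_square_le_1)
  then show ?thesis unfolding Kpow_def by (intro mult_le_one) (auto simp: power_mult)
qed

lemma periodic_Kpow: "periodic (Kpow N)"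
  by (simp add: periodic_def Kpow_def distrib_left power_mult)

lemma integrable_Kpow: "integrable torus (Kpow N)"
  by (rule integrable_torus_const_bound[of _ 1]) (auto simp: Kpow_nonneg Kpow_le_1)

lemma measure_torus_corner:
  assumes "0 \<le> a" "a \<le> 1"
  shows "measure torus ({0..<a} \<times> {0..<a}) = a\<^sup>2"
proof -
  have "{0..<a} \<times> {0..<a} \<in> sets (borel \<Otimes>\<^sub>M borel)" by (intro pair_measureI) auto
  then have [measurable]: "{0..<a} \<times> {0..<a} \<in> sets borel" by (simp only: borel_prod)
  have "emeasure torus ({0..<a} \<times> {0..<a}) = (\<integral>\<^sup>+x. indicator ({0..<a} \<times> {0..<a}) x \<partial>torus)" by simp
  also have "\<dots> = (\<integral>\<^sup>+x\<in>cell. indicator ({0..<a} \<times> {0..<a}) x \<partial>lborel)"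
    by (rule nn_integral_torus) measurable
  also have "\<dots> = (\<integral>\<^sup>+x. indicator ({0..<a} \<times> {0..<a}) x \<partial>lborel)"
    using assms by (intro nn_integral_cong) (auto simp: indicator_def cell_def)
  also have "\<dots> = emeasure (lborel \<Otimes>\<^sub>M lborel) ({0..<a} \<times> {0..<a})"
    by (simp add: lborel_prod)
  also have "\<dots> = ennreal a * ennreal a"
    using assms by (subst lborel.emeasure_pair_measure_Times) auto
  finally show ?thesis
    using assms by (simp add: measure_def power2_eq_square ennreal_mult[symmetric])
qed

text \<open>On the square [0, d/2)^2 each factor of the kernel is at least cos(pi d/2)^(2N). The
  half-angle formula rewrites this in terms of cos(pi d), for comparison with the size of the kernel
  at distance d from the origin.\<close>

lemma Kmass_ge:
  assumes d: "0 < d" "d \<le> 1/4"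
  shows "((1 + cos (pi * d)) / 2) ^ (2 * N) * (d / 2)\<^sup>2 \<le> Kmass N"
proof -
  have cosh: "(cos (pi * (d / 2)))\<^sup>2 = (1 + cos (pi * d)) / 2"
    using cos_double_cos[of "pi * (d / 2)"] by simp
  have [measurable]: "{0..<d/2} \<times> {0..<d/2} \<in> sets borel"
  proof -
    have "{0..<d/2} \<times> {0..<d/2} \<in> sets (borel \<Otimes>\<^sub>M borel)" by (intro pair_measureI) auto
    then show ?thesis by (simp only: borel_prod)
  qed
  have "((1 + cos (pi * d)) / 2) ^ (2 * N) * (d / 2)\<^sup>2 =
     (\<integral>x. ((1 + cos (pi * d)) / 2) ^ (2 * N) * indicator ({0..<d/2} \<times> {0..<d/2}) x \<partial>torus)"
    using measure_torus_corner[of "d/2"] d by simp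
  also have "\<dots> \<le> Kmass N"
    unfolding Kmass_def
  proof (rule integral_mono)
    show "integrable torus (Kpow N)" by (rule integrable_Kpow)
    show "integrable torus (\<lambda>x. ((1 + cos (pi * d)) / 2) ^ (2 * N) * indicator ({0..<d/2} \<times> {0..<d/2}) x :: real)"
      by (intro integrable_mult_right integrable_torus_const_bound[of _ 1]) (auto simp: indicator_def)
    fix x :: "real \<times> real"
    show "((1 + cos (pi * d)) / 2) ^ (2 * N) * indicator ({0..<d/2} \<times> {0..<d/2}) x \<le> Kpow N x"
    proof (cases "x \<in> {0..<d/2} \<times> {0..<d/2}")
      case True
      have *: "((1 + cos (pi * d)) / 2) ^ N \<le> cos (pi * s) ^ (2 * N)" if "0 \<le> s" "s < d / 2" for s
      proof -
        have "cos (pi * (d / 2)) \<le> cos (pi * s)"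
          using that d by (intro cos_monotone_0_pi_le) auto
        moreover have "0 \<le> cos (pi * (d / 2))" using d by (intro cos_ge_zero order_trans[of "- (pi / 2)" 0 "pi * (d / 2)"]) auto
        ultimately have "(cos (pi * (d / 2)))\<^sup>2 \<le> (cos (pi * s))\<^sup>2" by (intro power_mono)
        then show ?thesis unfolding power_mult cosh by (intro power_mono) (simp_all add: cosh[symmetric])
      qed
      have nn: "0 \<le> (1 + cos (pi * d)) / 2" by (simp add: cosh[symmetric])
      have "((1 + cos (pi * d)) / 2) ^ (2 * N) = ((1 + cos (pi * d)) / 2) ^ N * ((1 + cos (pi * d)) / 2) ^ N"
        by (simp add: mult_2 power_add)
      also have "\<dots> \<le> Kpow N x"
        unfolding Kpow_def using True nn by (intro mult_mono * ) (auto simp: power_mult)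
      finally show ?thesis using True by simp
    qed (simp add: Kpow_nonneg)
  qed
  finally show ?thesis .
qed

lemma Kmass_pos: "0 < Kmass N"
proof -
  have "0 < ((1 + cos (pi * (1/4))) / 2) ^ (2 * N) * ((1/4) / 2)\<^sup>2"
    by (simp add: cos_45 add_pos_pos)
  with Kmass_ge[of "1/4" N] show ?thesis by simp
qed

lemma kcoef_nonneg: "0 \<le> kcoef N i"
  using Kmass_pos[of N] by (simp add: kcoef_def)

lemma bprob_ker: "bprob (ker N)"
  unfolding bprob_def
proof
  have "(\<integral>\<^sup>+x. ennreal (Kpow N x / Kmass N) \<partial>torus) = ennreal (\<integral>x. Kpow N x / Kmass N \<partial>torus)"
    using integrable_Kpow[of N] Kmass_pos[of N] Kpow_nonneg[of N] by (intro nn_integral_eq_integral) auto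
  also have "\<dots> = 1" using Kmass_pos[of N] by (simp add: Kmass_def[symmetric])
  finally have *: "(\<integral>\<^sup>+x. ennreal (Kpow N x / Kmass N) \<partial>torus) = 1" .
  show "prob_space (ker N)"
    by (rule prob_spaceI) (simp add: ker_def emeasure_density *)
qed (simp add: ker_def)

text \<open>The kernel is a trigonometric polynomial, so the average is one as well, and the
  identity holds at every point.\<close>

lemma tavg_ker_cis:
  assumes f: "L1p f"
  shows "complex_of_real (tavg (ker N) f x) =
    (\<Sum>i\<in>kidx N. complex_of_real (kcoef N i) * fc f (kfreq N i) * cis (kfreq N i \<bullet> x))"
proof -
  define G where "G z = f z * (Kpow N (z - x) / Kmass N)" for z
  have perG: "periodic G"
    unfolding G_def using periodic_shift[OF periodic_Kpow[of N], of "-x"] L1pD(2)[OF f]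
    by (auto simp: periodic_def)
  have "tavg (ker N) f x = (\<integral>y. (Kpow N y / Kmass N) *\<^sub>R f (x + y) \<partial>torus)"
    unfolding tavg_def ker_def using Kmass_pos[of N] Kpow_nonneg[of N] L1p_measurable[OF f]
    by (subst integral_density) auto
  also have "\<dots> = (\<integral>y. G (y + x) \<partial>torus)"
    by (simp add: G_def add.commute mult.commute)
  also have "\<dots> = (\<integral>z. G z \<partial>torus)"
    by (rule integral_torus_shift) (use f perG in \<open>auto simp: G_def[abs_def]\<close>)
  finally have "complex_of_real (tavg (ker N) f x) = (\<integral>z. complex_of_real (G z) \<partial>torus)" by simp
  also have "\<dots> = (\<integral>z. (\<Sum>i\<in>kidx N. complex_of_real (kcoef N i) * cis (kfreq N i \<bullet> x) *
      (complex_of_real (f z) * cis (- (kfreq N i \<bullet> z)))) \<partial>torus)"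
  proof (intro Bochner_Integration.integral_cong refl)
    fix z
    have "cis (- (kfreq N i \<bullet> (z - x))) = cis (kfreq N i \<bullet> x) * cis (- (kfreq N i \<bullet> z))" for i
      by (simp add: cis_mult inner_diff_right)
    then show "complex_of_real (G z) = (\<Sum>i\<in>kidx N. complex_of_real (kcoef N i) * cis (kfreq N i \<bullet> x) *
      (complex_of_real (f z) * cis (- (kfreq N i \<bullet> z))))"
      unfolding G_def of_real_mult Kpow_cis sum_distrib_left by (intro sum.cong) auto
  qed
  also have "\<dots> = (\<Sum>i\<in>kidx N. complex_of_real (kcoef N i) * fc f (kfreq N i) * cis (kfreq N i \<bullet> x))"
    by (subst Bochner_Integration.integral_sum)
       (auto intro!: sum.cong integrable_mult_right integrable_fc f simp: fc_def)
  finally show ?thesis .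
qed

text \<open>Parseval's identity, exact because only finitely many frequencies occur.\<close>

lemma integral_mult_tavg_ker:
  assumes f: "L1p f" and g: "L1p g"
  shows "complex_of_real (\<integral>x. g x * tavg (ker N) f x \<partial>torus) =
    (\<Sum>i\<in>kidx N. complex_of_real (kcoef N i) * fc f (kfreq N i) * cnj (fc g (kfreq N i)))"
proof -
  have cnj: "cnj (fc g k) = (\<integral>x. complex_of_real (g x) * cis (k \<bullet> x) \<partial>torus)" for k
    unfolding fc_def using integrable_fc[OF g, of k]
    by (simp add: Bochner_Integration.integral_cnj[symmetric] cis_cnj)
  have i: "integrable torus (\<lambda>x. complex_of_real (g x) * cis (k \<bullet> x))" for k
    by (rule integrable_torus_bound[of "\<lambda>x. \<bar>g x\<bar>"]) (use g in \<open>auto simp: norm_mult dest: L1p_measurable\<close>)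
  have "complex_of_real (\<integral>x. g x * tavg (ker N) f x \<partial>torus) =
      (\<integral>x. complex_of_real (g x) * complex_of_real (tavg (ker N) f x) \<partial>torus)"
    by (simp flip: integral_complex_of_real)
  also have "\<dots> = (\<integral>x. (\<Sum>i\<in>kidx N. complex_of_real (kcoef N i) * fc f (kfreq N i) *
      (complex_of_real (g x) * cis (kfreq N i \<bullet> x))) \<partial>torus)"
    by (intro Bochner_Integration.integral_cong refl) (simp add: tavg_ker_cis[OF f] sum_distrib_left ac_simps)
  also have "\<dots> = (\<Sum>i\<in>kidx N. complex_of_real (kcoef N i) * fc f (kfreq N i) * cnj (fc g (kfreq N i)))"
    by (subst Bochner_Integration.integral_sum) (auto intro!: sum.cong integrable_mult_right i simp: cnj)
  finally show ?thesis .
qed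

section \<open>Concentration of the kernel at the origin\<close>

definition ktail :: "real \<Rightarrow> nat \<Rightarrow> real"
  where "ktail d N = cos (pi * d) ^ (2 * N) / Kmass N"

text \<open>In the cell, a coordinate is close to 0 modulo 1 if it is near 0 or near 1. Being away
  from the origin thus means that some coordinate lies in [d, 1 - d].\<close>

lemma Kpow_small:
  assumes d: "0 < d" "d \<le> 1/4"
    and x: "(d \<le> fst x \<and> fst x \<le> 1 - d) \<or> (d \<le> snd x \<and> snd x \<le> 1 - d)"
  shows "Kpow N x \<le> cos (pi * d) ^ (2 * N)"
proof -
  have small: "cos (pi * s) ^ (2 * N) \<le> cos (pi * d) ^ (2 * N)" if "d \<le> s" "s \<le> 1 - d" for s
  proof -
    have "cos (pi * s) \<le> cos (pi * d)" using that d by (intro cos_monotone_0_pi_le) auto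
    moreover have "cos (pi * (1 - d)) \<le> cos (pi * s)" using that d by (intro cos_monotone_0_pi_le) auto
    moreover have "cos (pi * (1 - d)) = - cos (pi * d)" by (simp add: right_diff_distrib cos_diff)
    ultimately have "\<bar>cos (pi * s)\<bar> \<le> \<bar>cos (pi * d)\<bar>" by linarith
    then have "(cos (pi * s))\<^sup>2 \<le> (cos (pi * d))\<^sup>2" by (simp add: abs_le_square_iff)
    then show ?thesis unfolding power_mult by (rule power_mono) auto
  qed
  have one: "0 \<le> cos a ^ (2 * N)" "cos a ^ (2 * N) \<le> 1" for a :: real
    unfolding power_mult by (rule zero_le_power, simp, rule power_le_one) (auto simp: abs_square_le_1)
  from x show ?thesis
  proof
    assume "d \<le> fst x \<and> fst x \<le> 1 - d"
    then have "Kpow N x \<le> cos (pi * d) ^ (2 * N) * 1"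
      unfolding Kpow_def by (intro mult_mono small one) auto
    then show ?thesis by simp
  next
    assume "d \<le> snd x \<and> snd x \<le> 1 - d"
    then have "Kpow N x \<le> 1 * cos (pi * d) ^ (2 * N)"
      unfolding Kpow_def by (intro mult_mono small one) auto
    then show ?thesis by simp
  qed
qed

lemma ktail_nonneg: "0 \<le> ktail d N"
  using Kmass_pos[of N] by (simp add: ktail_def power_mult)

lemma ktail_tendsto:
  assumes d: "0 < d" "d \<le> 1/4"
  shows "(\<lambda>N. ktail d N) \<longlonglongrightarrow> 0"
proof -
  define c where "c = cos (pi * d)"
  have "0 < c" unfolding c_def using d
    by (intro cos_gt_zero_pi) (auto intro: less_le_trans[of _ 0])
  have "cos (pi * d) < cos 0" using d by (intro cos_monotone_0_pi) auto
  then have "c < 1" by (simp add: c_def)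
  \<comment> \<open>The ratio of c to the base (1 + c) / 2 in \<open>Kmass_ge\<close>, squared
    because of the exponent 2N. It is below 1 because c < 1.\<close>
  define r where "r = (2 * c / (1 + c))\<^sup>2"
  have "0 \<le> 2 * c / (1 + c)" "2 * c / (1 + c) < 1" using \<open>0 < c\<close> \<open>c < 1\<close> by auto
  then have "0 \<le> r" "r < 1" unfolding r_def using power_strict_mono[of "2 * c / (1 + c)" 1 2] by auto
  then have lim: "(\<lambda>N. r ^ N * (1 / (d / 2)\<^sup>2)) \<longlonglongrightarrow> 0"
    by (intro tendsto_mult_left_zero LIMSEQ_power_zero) auto
  have le: "ktail d N \<le> r ^ N * (1 / (d / 2)\<^sup>2)" for N
  proof -
    have "ktail d N \<le> c ^ (2 * N) / (((1 + c) / 2) ^ (2 * N) * (d / 2)\<^sup>2)"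
      unfolding ktail_def c_def[symmetric]
      using Kmass_ge[OF d, of N] \<open>0 < c\<close> d unfolding c_def[symmetric]
      by (intro divide_left_mono) (auto intro!: mult_pos_pos Kmass_pos)
    also have "\<dots> = r ^ N * (1 / (d / 2)\<^sup>2)"
      using power_mult[of "2::real" 2 N]
      unfolding r_def by (simp add: power_mult[symmetric] power_divide power_mult_distrib)
    finally show ?thesis .
  qed
  show ?thesis
    by (rule tendsto_sandwich[OF always_eventually always_eventually tendsto_const lim])
       (use le ktail_nonneg in auto)
qed

text \<open>Near the origin modulo 1 the function is at most e and the kernel has total mass 1;
  elsewhere the density of the kernel is at most \<open>ktail d N\<close>.\<close>

lemma nn_integral_ker_le:
  assumes d: "0 < d" "d \<le> 1/4"
    and [measurable]: "m \<in> borel_measurable borel" and per: "periodic m"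
    and m: "\<And>x. 0 \<le> m x" "\<And>x. m x \<le> M" and e: "0 \<le> e"
    and near: "\<And>y. \<bar>fst y\<bar> \<le> d \<Longrightarrow> \<bar>snd y\<bar> \<le> d \<Longrightarrow> m y \<le> e"
  shows "(\<integral>\<^sup>+y. ennreal (m y) \<partial>ker N) \<le> ennreal (e + M * ktail d N)"
proof -
  have M: "0 \<le> M" using m order_trans by blast
  have pt: "Kpow N x / Kmass N * m x \<le> e * (Kpow N x / Kmass N) + M * ktail d N" if "x \<in> cell" for x
  proof -
    obtain a b where x: "x = (a, b)" by fastforce
    have ab: "0 \<le> a" "a < 1" "0 \<le> b" "b < 1" using that by (auto simp: x cell_def)
    have K0: "0 \<le> Kpow N x / Kmass N" using Kpow_nonneg[of N x] Kmass_pos[of N] by simp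
    have T0: "0 \<le> M * ktail d N" using M ktail_nonneg by simp
    show ?thesis
    proof (cases "(d \<le> fst x \<and> fst x \<le> 1 - d) \<or> (d \<le> snd x \<and> snd x \<le> 1 - d)")
      case True
      have "Kpow N x / Kmass N \<le> ktail d N"
        unfolding ktail_def using Kpow_small[OF d True, of N] Kmass_pos[of N] by (intro divide_right_mono) auto
      then have "Kpow N x / Kmass N * m x \<le> ktail d N * M"
        using m[of x] ktail_nonneg by (intro mult_mono) auto
      moreover have "0 \<le> e * (Kpow N x / Kmass N)" using e K0 by (rule mult_nonneg_nonneg)
      ultimately show ?thesis unfolding mult.commute[of "ktail d N" M] by linarith
    next
      case False
      \<comment> \<open>Representatives of the two coordinates modulo 1 with absolute value at most
        d.\<close>
      define a' where "a' = (if a < d then a else a - 1)"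
      define b' where "b' = (if b < d then b else b - 1)"
      have "m (a', b') \<le> e" using False ab d by (intro near) (auto simp: a'_def b'_def x)
      moreover have "m (a', b') = m x"
        using periodic_1[OF per, of "a - 1"] periodic_2[OF per, of _ "b - 1"]
        by (auto simp: a'_def b'_def x)
      ultimately have "m x \<le> e" by simp
      then have "Kpow N x / Kmass N * m x \<le> Kpow N x / Kmass N * e" using K0 by (rule mult_left_mono)
      then show ?thesis using T0 by (simp add: mult.commute)
    qed
  qed
  have i: "integrable torus (\<lambda>x. e * (Kpow N x / Kmass N) + M * ktail d N)"
    using integrable_Kpow[of N] by auto
  have "(\<integral>\<^sup>+y. ennreal (m y) \<partial>ker N) = (\<integral>\<^sup>+x. ennreal (Kpow N x / Kmass N * m x) \<partial>torus)"
    unfolding ker_def using m Kpow_nonneg[of N] Kmass_pos[of N]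
    by (subst nn_integral_density) (auto intro!: nn_integral_cong simp: ennreal_mult[symmetric])
  also have "\<dots> \<le> (\<integral>\<^sup>+x. ennreal (e * (Kpow N x / Kmass N) + M * ktail d N) \<partial>torus)"
  proof (rule nn_integral_mono_AE)
    show "AE x in torus. ennreal (Kpow N x / Kmass N * m x) \<le> ennreal (e * (Kpow N x / Kmass N) + M * ktail d N)"
      using AE_torus_cell by eventually_elim (rule ennreal_leI, rule pt)
  qed
  also have "\<dots> = ennreal (\<integral>x. e * (Kpow N x / Kmass N) + M * ktail d N \<partial>torus)"
    using e M Kpow_nonneg[of N] Kmass_pos[of N] ktail_nonneg[of d N]
    by (intro nn_integral_eq_integral[OF i] AE_I2) auto
  also have "(\<integral>x. e * (Kpow N x / Kmass N) + M * ktail d N \<partial>torus) = e + M * ktail d N"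
    using integrable_Kpow[of N] Kmass_pos[of N] torus.prob_space by (simp add: Kmass_def[symmetric])
  finally show ?thesis .
qed

lemma modL1_measurable [measurable (raw)]:
  assumes [measurable]: "f \<in> borel_measurable borel"
  shows "modL1 f \<in> borel_measurable borel"
proof -
  have "(\<lambda>y. \<integral>x. \<bar>f (x + y) - f x\<bar> \<partial>torus) \<in> borel_measurable borel"
    by (rule torus.borel_measurable_lebesgue_integral) measurable
  then show ?thesis by (simp add: modL1_def[abs_def])
qed

lemma periodic_modL1: "periodic f \<Longrightarrow> periodic (modL1 f)"
proof -
  assume per: "periodic f"
  have "f (x + (a + 1, b)) = f (x + (a, b))" "f (x + (a, b + 1)) = f (x + (a, b))" for x a b
    using periodic_1[OF per, of "fst x + a" "snd x + b"] periodic_2[OF per, of "fst x + a" "snd x + b"]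
    by (cases x, simp add: add.assoc)+
  then show ?thesis by (simp add: periodic_def modL1_def)
qed

lemma modL1_le: "L1p f \<Longrightarrow> modL1 f y \<le> 2 * (\<integral>x. \<bar>f x\<bar> \<partial>torus)"
proof -
  assume f: "L1p f"
  note s = L1p_shift[OF f, of y]
  have "modL1 f y \<le> (\<integral>x. \<bar>f (x + y)\<bar> + \<bar>f x\<bar> \<partial>torus)"
    unfolding modL1_def
    using L1pD(3)[OF L1p_abs[OF L1p_diff[OF s f]]] L1pD(3)[OF L1p_add[OF L1p_abs[OF s] L1p_abs[OF f]]]
    by (intro integral_mono) auto
  also have "\<dots> = (\<integral>x. \<bar>f (x + y)\<bar> \<partial>torus) + (\<integral>x. \<bar>f x\<bar> \<partial>torus)"
    using L1pD(3)[OF L1p_abs[OF s]] L1pD(3)[OF L1p_abs[OF f]] by (rule Bochner_Integration.integral_add)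
  also have "(\<integral>x. \<bar>f (x + y)\<bar> \<partial>torus) = (\<integral>x. \<bar>f x\<bar> \<partial>torus)"
    by (rule integral_torus_shift[where f = "\<lambda>x. \<bar>f x\<bar>"]) (use L1p_abs[OF f] in auto)
  finally show ?thesis by simp
qed

lemma tavg_ker_L1:
  assumes f: "L1p f" and M: "(\<integral>x. \<bar>f x\<bar> \<partial>torus) \<le> M" and d: "0 < d" "d \<le> 1/4" and e: "0 \<le> e"
    and near: "\<And>y. \<bar>fst y\<bar> \<le> d \<Longrightarrow> \<bar>snd y\<bar> \<le> d \<Longrightarrow> modL1 f y \<le> e"
  shows "(\<integral>x. \<bar>tavg (ker N) f x - f x\<bar> \<partial>torus) \<le> e + 2 * M * ktail d N"
proof -
  have "0 \<le> (\<integral>x. \<bar>f x\<bar> \<partial>torus)" by simp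
  then have M0: "0 \<le> M" using M by linarith
  have "ennreal (\<integral>x. \<bar>tavg (ker N) f x - f x\<bar> \<partial>torus) \<le> (\<integral>\<^sup>+y. ennreal (modL1 f y) \<partial>ker N)"
    by (rule tavg_minus_L1[OF bprob_ker f])
  also have "\<dots> \<le> ennreal (e + 2 * M * ktail d N)"
  proof (rule nn_integral_ker_le[OF d _ _ _ _ e near])
    show "modL1 f x \<le> 2 * M" for x using modL1_le[OF f, of x] M by linarith
  qed (use f in \<open>auto intro: modL1_measurable periodic_modL1\<close>)
  finally show ?thesis using e M0 ktail_nonneg[of d N] by (subst (asm) ennreal_le_iff) auto
qed

lemma tavg_ker_L1_tendsto:
  assumes f: "L1p f"
  shows "(\<lambda>N. \<integral>x. \<bar>tavg (ker N) f x - f x\<bar> \<partial>torus) \<longlonglongrightarrow> 0"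
proof (rule LIMSEQ_I)
  fix e :: real assume e: "0 < e"
  obtain d where d: "0 < d" "\<And>y. norm y < d \<Longrightarrow> modL1 f y < e / 2" using modL1_small[OF f, of "e/2"] e by auto
  \<comment> \<open>With d / 4 the sum of two coordinates, which bounds the norm, stays below d; 1/4
    is the largest radius allowed in the kernel estimates.\<close>
  define d' where "d' = min (d / 4) (1/4)"
  have d': "0 < d'" "d' \<le> 1/4" "d' \<le> d / 4" using d(1) by (auto simp: d'_def)
  define M where "M = (\<integral>x. \<bar>f x\<bar> \<partial>torus)"
  have "(\<lambda>N. e / 2 + 2 * M * ktail d' N) \<longlonglongrightarrow> e / 2 + 2 * M * 0"
    by (intro tendsto_intros ktail_tendsto d')
  then have "\<forall>\<^sub>F N in sequentially. e / 2 + 2 * M * ktail d' N < e"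
    by (rule order_tendstoD) (use e in auto)
  then obtain N0 where N0: "\<And>N. N \<ge> N0 \<Longrightarrow> e / 2 + 2 * M * ktail d' N < e"
    unfolding eventually_sequentially by blast
  have "(\<integral>x. \<bar>tavg (ker N) f x - f x\<bar> \<partial>torus) \<le> e / 2 + 2 * M * ktail d' N" for N
  proof (rule tavg_ker_L1[OF f _ d'(1,2)])
    fix y :: "real \<times> real" assume y: "\<bar>fst y\<bar> \<le> d'" "\<bar>snd y\<bar> \<le> d'"
    have "norm y \<le> \<bar>fst y\<bar> + \<bar>snd y\<bar>" by (simp add: norm_prod_def sqrt_sum_squares_le_sum_abs)
    then have "norm y < d" using y d' d(1) by linarith
    then show "modL1 f y \<le> e / 2" using d(2) less_imp_le by blast
  qed (use e in \<open>auto simp: M_def\<close>)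
  with N0 show "\<exists>no. \<forall>n\<ge>no. norm ((\<integral>x. \<bar>tavg (ker n) f x - f x\<bar> \<partial>torus) - 0) < e"
    by (intro exI[of _ N0]) (auto intro: le_less_trans)
qed

lemma integral_mult_Linf_diff_le:
  assumes u: "Linf B u" and f: "L1p f" and g: "L1p g"
  shows "\<bar>(\<integral>x. u x * f x \<partial>torus) - (\<integral>x. u x * g x \<partial>torus)\<bar> \<le> B * (\<integral>x. \<bar>f x - g x\<bar> \<partial>torus)"
proof -
  have fg: "L1p (\<lambda>x. f x - g x)" by (rule L1p_diff[OF f g])
  have "(\<integral>x. u x * f x \<partial>torus) - (\<integral>x. u x * g x \<partial>torus) = (\<integral>x. u x * (f x - g x) \<partial>torus)"
    using L1pD(3)[OF L1p_mult_Linf[OF u f]] L1pD(3)[OF L1p_mult_Linf[OF u g]]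
    by (simp add: right_diff_distrib)
  also have "\<bar>\<dots>\<bar> \<le> (\<integral>x. \<bar>u x * (f x - g x)\<bar> \<partial>torus)" by (rule integral_abs_bound)
  also have "\<dots> \<le> (\<integral>x. B * \<bar>f x - g x\<bar> \<partial>torus)"
  proof (rule integral_mono)
    show "integrable torus (\<lambda>x. \<bar>u x * (f x - g x)\<bar>)" using L1p_abs[OF L1p_mult_Linf[OF u fg]] by auto
    show "integrable torus (\<lambda>x. B * \<bar>f x - g x\<bar>)" using L1pD(3)[OF L1p_abs[OF fg]] by simp
    show "\<bar>u x * (f x - g x)\<bar> \<le> B * \<bar>f x - g x\<bar>" for x
      unfolding abs_mult by (intro mult_right_mono LinfD(3)[OF u]) auto
  qed
  finally show ?thesis by simp
qed

lemma tendsto_integral_mult_Linf: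
  assumes u: "Linf B u" and f: "\<And>n. L1p (F n)" "L1p f"
    and lim: "((\<lambda>n. \<integral>x. \<bar>F n x - f x\<bar> \<partial>torus) \<longlongrightarrow> 0) Fl"
  shows "((\<lambda>n. \<integral>x. u x * F n x \<partial>torus) \<longlongrightarrow> (\<integral>x. u x * f x \<partial>torus)) Fl"
proof (rule Lim_null_comparison[of _ _ _ , THEN LIM_zero_cancel])
  show "\<forall>\<^sub>F n in Fl. norm ((\<integral>x. u x * F n x \<partial>torus) - (\<integral>x. u x * f x \<partial>torus))
      \<le> B * (\<integral>x. \<bar>F n x - f x\<bar> \<partial>torus)"
    using integral_mult_Linf_diff_le[OF u f] by (auto intro: always_eventually)
  show "((\<lambda>n. B * (\<integral>x. \<bar>F n x - f x\<bar> \<partial>torus)) \<longlongrightarrow> 0) Fl"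
    using tendsto_mult[OF tendsto_const lim, of B] by simp
qed

text \<open>The pairings of bounded functions with kernel averages of f vanish, and these averages
  converge to f in L1. The choice sgn f as bounded function recovers the L1 norm of f.\<close>

lemma fc_zero_imp_AE_zero:
  assumes f: "L1p f" and 0: "\<And>k. k \<in> freqs \<Longrightarrow> fc f k = 0"
  shows "AE x in torus. f x = 0"
proof -
  have [measurable]: "f \<in> borel_measurable borel" using f by auto
  define u where "u x = sgn (f x)" for x
  have u: "Linf 1 u" unfolding Linf_def u_def using L1pD(2)[OF f] by (auto simp: sgn_real_def periodic_def)
  have "(\<lambda>N. \<integral>x. u x * tavg (ker N) f x \<partial>torus) \<longlonglongrightarrow> (\<integral>x. u x * f x \<partial>torus)"
    by (rule tendsto_integral_mult_Linf[OF u tavg_L1p[OF bprob_ker f] f tavg_ker_L1_tendsto[OF f]])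
  moreover have "(\<integral>x. u x * tavg (ker N) f x \<partial>torus) = 0" for N
  proof -
    have "complex_of_real (\<integral>x. u x * tavg (ker N) f x \<partial>torus) = 0"
      unfolding integral_mult_tavg_ker[OF f Linf_L1p[OF u]] using 0 kfreq_freqs by simp
    then show ?thesis by simp
  qed
  ultimately have "(\<integral>x. u x * f x \<partial>torus) = 0" by (simp add: LIMSEQ_const_iff)
  moreover have "u x * f x = \<bar>f x\<bar>" for x by (simp add: u_def sgn_real_def)
  ultimately have "(\<integral>x. \<bar>f x\<bar> \<partial>torus) = 0" by simp
  then show ?thesis using integral_nonneg_eq_0_iff_AE[OF L1pD(3)[OF L1p_abs[OF f]]] by auto
qed

lemma fc_eq_imp_AE_eq:
  assumes f: "L1p f" and g: "L1p g" and eq: "\<And>k. k \<in> freqs \<Longrightarrow> fc f k = fc g k"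
  shows "AE x in torus. f x = g x"
  using fc_zero_imp_AE_zero[OF L1p_diff[OF f g]] by (simp add: fc_diff[OF f g] eq)

lemma ker_Bessel:
  assumes f: "L2p f"
  shows "(\<Sum>i\<in>kidx N. kcoef N i * (norm (fc f (kfreq N i)))\<^sup>2) \<le> (\<integral>x. (f x)\<^sup>2 \<partial>torus)"
proof -
  note L1 = L2p_L1p[OF f]
  have "complex_of_real (\<integral>x. f x * tavg (ker N) f x \<partial>torus) =
     complex_of_real (\<Sum>i\<in>kidx N. kcoef N i * (norm (fc f (kfreq N i)))\<^sup>2)"
    unfolding integral_mult_tavg_ker[OF L1 L1] of_real_sum
    by (intro sum.cong refl) (simp only: of_real_mult mult.assoc complex_norm_square)
  then have "(\<Sum>i\<in>kidx N. kcoef N i * (norm (fc f (kfreq N i)))\<^sup>2) = (\<integral>x. f x * tavg (ker N) f x \<partial>torus)"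
    by (simp only: of_real_eq_iff)
  also have "\<dots> \<le> sqrt (\<integral>x. (f x)\<^sup>2 \<partial>torus) * sqrt (\<integral>x. (tavg (ker N) f x)\<^sup>2 \<partial>torus)"
    using Cauchy_Schwarz_torus[OF f tavg_L2p(1)[OF bprob_ker f], of N] by linarith
  also have "\<dots> \<le> sqrt (\<integral>x. (f x)\<^sup>2 \<partial>torus) * sqrt (\<integral>x. (f x)\<^sup>2 \<partial>torus)"
    by (intro mult_left_mono real_sqrt_le_mono tavg_L2p(2)[OF bprob_ker f]) auto
  finally show ?thesis by simp
qed

subsection \<open>L2 limits and L2 derivatives in the first variable\<close>

definition L2lim :: "('i \<Rightarrow> real \<times> real \<Rightarrow> real) \<Rightarrow> (real \<times> real \<Rightarrow> real) \<Rightarrow> 'i filter \<Rightarrow> bool"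
  where "L2lim X f F \<longleftrightarrow> (\<forall>i. L2p (X i)) \<and> L2p f \<and> ((\<lambda>i. \<integral>x. (X i x - f x)\<^sup>2 \<partial>torus) \<longlongrightarrow> 0) F"

definition dquot :: "(real \<times> real \<Rightarrow> real) \<Rightarrow> real \<Rightarrow> real \<times> real \<Rightarrow> real"
  where "dquot f d x = (f (x + (d, 0)) - f x) / d"

text \<open>A strong derivative, so that products pass to the limit by the Cauchy-Schwarz
  inequality. At d = 0 the quotient is 0 by convention, which the filter \<open>at 0\<close>
  ignores.\<close>

definition dL2 :: "(real \<times> real \<Rightarrow> real) \<Rightarrow> (real \<times> real \<Rightarrow> real) \<Rightarrow> bool"
  where "dL2 f f' \<longleftrightarrow> L2p f \<and> L2lim (dquot f) f' (at 0)"

lemma L2p_dquot: "L2p f \<Longrightarrow> L2p (dquot f d)"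
  unfolding dquot_def[abs_def] by (intro L2p_divide L2p_diff L2p_shift)

lemma tendsto_zero_le:
  fixes f g :: "'i \<Rightarrow> real"
  assumes "(g \<longlongrightarrow> 0) F" "\<And>i. 0 \<le> f i" "\<And>i. f i \<le> g i"
  shows "(f \<longlongrightarrow> 0) F"
  by (rule tendsto_sandwich[OF always_eventually always_eventually tendsto_const assms(1)])
     (use assms in auto)

lemma integral_square_le_2:
  assumes X: "L2p X" and Y: "L2p Y" and Z: "L2p Z" and le: "\<And>x. \<bar>Z x\<bar> \<le> \<bar>X x\<bar> + \<bar>Y x\<bar>"
  shows "(\<integral>x. (Z x)\<^sup>2 \<partial>torus) \<le> 2 * (\<integral>x. (X x)\<^sup>2 \<partial>torus) + 2 * (\<integral>x. (Y x)\<^sup>2 \<partial>torus)"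
proof -
  have pt: "(Z x)\<^sup>2 \<le> 2 * (X x)\<^sup>2 + 2 * (Y x)\<^sup>2" for x
  proof -
    have "(Z x)\<^sup>2 \<le> (\<bar>X x\<bar> + \<bar>Y x\<bar>)\<^sup>2"
      using power_mono[OF le[of x], of 2] by simp
    also have "\<dots> \<le> 2 * (X x)\<^sup>2 + 2 * (Y x)\<^sup>2"
      using sum_squares_bound[of "\<bar>X x\<bar>" "\<bar>Y x\<bar>"] by (simp add: power2_sum)
    finally show ?thesis .
  qed
  have "(\<integral>x. (Z x)\<^sup>2 \<partial>torus) \<le> (\<integral>x. 2 * (X x)\<^sup>2 + 2 * (Y x)\<^sup>2 \<partial>torus)"
    by (intro integral_mono pt Bochner_Integration.integrable_add integrable_mult_right L2pD(3) X Y Z)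
  also have "\<dots> = 2 * (\<integral>x. (X x)\<^sup>2 \<partial>torus) + 2 * (\<integral>x. (Y x)\<^sup>2 \<partial>torus)"
    using L2pD(3)[OF X] L2pD(3)[OF Y] by simp
  finally show ?thesis .
qed

lemma L2lim_add:
  assumes X: "L2lim X f F" and Y: "L2lim Y g F"
  shows "L2lim (\<lambda>i x. X i x + Y i x) (\<lambda>x. f x + g x) F"
proof -
  have m: "L2p (X i)" "L2p (Y i)" "L2p f" "L2p g" for i using X Y by (auto simp: L2lim_def)
  have "((\<lambda>i. 2 * (\<integral>x. (X i x - f x)\<^sup>2 \<partial>torus) + 2 * (\<integral>x. (Y i x - g x)\<^sup>2 \<partial>torus)) \<longlongrightarrow> 2 * 0 + 2 * 0) F"
    using X Y by (intro tendsto_intros) (auto simp: L2lim_def)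
  then have lim: "((\<lambda>i. 2 * (\<integral>x. (X i x - f x)\<^sup>2 \<partial>torus) + 2 * (\<integral>x. (Y i x - g x)\<^sup>2 \<partial>torus)) \<longlongrightarrow> 0) F" by simp
  have le: "(\<integral>x. (X i x + Y i x - (f x + g x))\<^sup>2 \<partial>torus)
      \<le> 2 * (\<integral>x. (X i x - f x)\<^sup>2 \<partial>torus) + 2 * (\<integral>x. (Y i x - g x)\<^sup>2 \<partial>torus)" for i
  proof (rule integral_square_le_2)
    show "L2p (\<lambda>x. X i x - f x)" by (rule L2p_diff[OF m(1,3)])
    show "L2p (\<lambda>x. Y i x - g x)" by (rule L2p_diff[OF m(2,4)])
    show "L2p (\<lambda>x. X i x + Y i x - (f x + g x))" by (rule L2p_diff[OF L2p_add[OF m(1,2)] L2p_add[OF m(3,4)]])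
    show "\<bar>X i x + Y i x - (f x + g x)\<bar> \<le> \<bar>X i x - f x\<bar> + \<bar>Y i x - g x\<bar>" for x by linarith
  qed
  have "((\<lambda>i. \<integral>x. (X i x + Y i x - (f x + g x))\<^sup>2 \<partial>torus) \<longlongrightarrow> 0) F"
    by (rule tendsto_zero_le[OF lim _ le]) simp
  then show ?thesis by (simp add: L2lim_def L2p_add m)
qed

lemma L2lim_cmult:
  assumes X: "L2lim X f F" shows "L2lim (\<lambda>i x. c * X i x) (\<lambda>x. c * f x) F"
proof -
  have "((\<lambda>i. c\<^sup>2 * (\<integral>x. (X i x - f x)\<^sup>2 \<partial>torus)) \<longlongrightarrow> c\<^sup>2 * 0) F"
    using X by (intro tendsto_intros) (auto simp: L2lim_def)
  then show ?thesis using X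
    by (auto simp: L2lim_def L2p_cmult right_diff_distrib[symmetric] power_mult_distrib)
qed

lemma L2lim_diff:
  assumes X: "L2lim X f F" and Y: "L2lim Y g F"
  shows "L2lim (\<lambda>i x. X i x - Y i x) (\<lambda>x. f x - g x) F"
  using L2lim_add[OF X L2lim_cmult[OF Y, of "-1"]] by simp

lemma L2lim_const: "L2p f \<Longrightarrow> L2lim (\<lambda>i. f) f F"
  by (simp add: L2lim_def)

lemma L2lim_dominated:
  assumes X: "L2lim X f F" and Y: "\<And>i. L2p (Y i)" "L2p g"
    and le: "\<And>i x. \<bar>Y i x - g x\<bar> \<le> K * \<bar>X i x - f x\<bar>"
  shows "L2lim Y g F"
proof -
  have X': "L2lim (\<lambda>i x. K * X i x) (\<lambda>x. K * f x) F" by (rule L2lim_cmult[OF X])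
  have "(\<integral>x. (Y i x - g x)\<^sup>2 \<partial>torus) \<le> (\<integral>x. (K * X i x - K * f x)\<^sup>2 \<partial>torus)" for i
  proof (rule integral_mono)
    show "integrable torus (\<lambda>x. (Y i x - g x)\<^sup>2)" using L2p_diff[OF Y] by auto
    show "integrable torus (\<lambda>x. (K * X i x - K * f x)\<^sup>2)"
      by (rule L2pD(3)[OF L2p_diff]) (use X' in \<open>auto simp: L2lim_def\<close>)
    fix x
    have "\<bar>Y i x - g x\<bar> \<le> \<bar>K * X i x - K * f x\<bar>"
      using order_trans[OF le[of i x] mult_right_mono[OF abs_ge_self[of K] abs_ge_zero]]
      by (simp add: right_diff_distrib[symmetric] abs_mult)
    then show "(Y i x - g x)\<^sup>2 \<le> (K * X i x - K * f x)\<^sup>2" by (simp add: abs_le_square_iff)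
  qed
  moreover have "((\<lambda>i. \<integral>x. (K * X i x - K * f x)\<^sup>2 \<partial>torus) \<longlongrightarrow> 0) F" using X' by (simp add: L2lim_def)
  ultimately have "((\<lambda>i. \<integral>x. (Y i x - g x)\<^sup>2 \<partial>torus) \<longlongrightarrow> 0) F"
    by (rule tendsto_zero_le[rotated 2]) simp
  then show ?thesis using Y by (simp add: L2lim_def)
qed

lemma L2lim_mult_Linf:
  assumes u: "Linf B u" and X: "L2lim X f F"
  shows "L2lim (\<lambda>i x. u x * X i x) (\<lambda>x. u x * f x) F"
proof (rule L2lim_dominated[OF X])
  show "\<bar>u x * X i x - u x * f x\<bar> \<le> B * \<bar>X i x - f x\<bar>" for i x
    unfolding right_diff_distrib[symmetric] abs_mult by (intro mult_right_mono LinfD(3)[OF u]) auto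
qed (use X u in \<open>auto simp: L2lim_def intro: L2p_mult_Linf\<close>)

lemma L2lim_shift:
  assumes X: "L2lim X f F" shows "L2lim (\<lambda>i x. X i (x + y)) (\<lambda>x. f (x + y)) F"
proof -
  have "(\<integral>x. (X i (x + y) - f (x + y))\<^sup>2 \<partial>torus) = (\<integral>x. (X i x - f x)\<^sup>2 \<partial>torus)" for i
  proof (rule integral_torus_shift[where f = "\<lambda>x. (X i x - f x)\<^sup>2"])
    have "L2p (\<lambda>x. X i x - f x)" using X by (auto simp: L2lim_def intro: L2p_diff)
    from L2p_L1p_square[OF this] show "(\<lambda>x. (X i x - f x)\<^sup>2) \<in> borel_measurable borel"
      "periodic (\<lambda>x. (X i x - f x)\<^sup>2)" by auto
  qed
  then show ?thesis using X by (simp add: L2lim_def L2p_shift)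
qed

lemma L2lim_prod:
  assumes X: "L2lim X f F" and Y: "L2lim Y g F"
  shows "((\<lambda>i. \<integral>x. X i x * Y i x \<partial>torus) \<longlongrightarrow> (\<integral>x. f x * g x \<partial>torus)) F"
proof -
  have m: "L2p (X i)" "L2p (Y i)" "L2p f" "L2p g" for i using X Y by (auto simp: L2lim_def)
  define a where "a i = sqrt (\<integral>x. (X i x - f x)\<^sup>2 \<partial>torus)" for i
  define b where "b i = sqrt (\<integral>x. (Y i x - g x)\<^sup>2 \<partial>torus)" for i
  define p where "p = sqrt (\<integral>x. (f x)\<^sup>2 \<partial>torus)"
  define q where "q = sqrt (\<integral>x. (g x)\<^sup>2 \<partial>torus)"
  have a: "(a \<longlongrightarrow> 0) F" and b: "(b \<longlongrightarrow> 0) F"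
    using X Y tendsto_real_sqrt[of _ 0 F] by (auto simp: L2lim_def a_def[abs_def] b_def[abs_def])
  have lim: "((\<lambda>i. a i * b i + a i * q + p * b i) \<longlongrightarrow> 0 * 0 + 0 * q + p * 0) F"
    by (intro tendsto_intros a b)
  have le: "\<bar>(\<integral>x. X i x * Y i x \<partial>torus) - (\<integral>x. f x * g x \<partial>torus)\<bar> \<le> a i * b i + a i * q + p * b i" for i
  proof -
    have d: "L2p (\<lambda>x. X i x - f x)" "L2p (\<lambda>x. Y i x - g x)" using m by (auto intro: L2p_diff)
    have "(\<integral>x. X i x * Y i x \<partial>torus) - (\<integral>x. f x * g x \<partial>torus) =
       (\<integral>x. X i x * Y i x - f x * g x \<partial>torus)"
      using L2p_L1p_mult m by (subst Bochner_Integration.integral_diff) auto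
    also have "\<dots> = (\<integral>x. (X i x - f x) * (Y i x - g x) + (X i x - f x) * g x + f x * (Y i x - g x) \<partial>torus)"
      by (intro Bochner_Integration.integral_cong) (auto simp: algebra_simps)
    also have "\<dots> = (\<integral>x. (X i x - f x) * (Y i x - g x) \<partial>torus) + (\<integral>x. (X i x - f x) * g x \<partial>torus)
        + (\<integral>x. f x * (Y i x - g x) \<partial>torus)"
      using L1pD(3)[OF L2p_L1p_mult[OF d]] L1pD(3)[OF L2p_L1p_mult[OF d(1) m(4)]] L1pD(3)[OF L2p_L1p_mult[OF m(3) d(2)]]
      by simp
    finally show ?thesis
      using Cauchy_Schwarz_torus[OF d] Cauchy_Schwarz_torus[OF d(1) m(4)] Cauchy_Schwarz_torus[OF m(3) d(2)]
      unfolding a_def b_def p_def q_def by linarith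
  qed
  show ?thesis
    by (rule LIM_zero_cancel, rule Lim_null_comparison[where g = "\<lambda>i. a i * b i + a i * q + p * b i"])
       (use le lim in \<open>auto intro!: always_eventually\<close>)
qed

lemma L2lim_translate: assumes f: "L2p f" shows "L2lim (\<lambda>d x. f (x + (d, 0))) f (at 0)"
proof -
  have "(\<lambda>d. modL2 f (d, 0)) \<midarrow>0\<rightarrow> 0"
  proof (rule tendsto_zero_at_0I)
    fix e :: real assume "0 < e"
    then obtain d where "0 < d" "\<And>y. norm y < d \<Longrightarrow> modL2 f y < e" using modL2_small[OF f] by blast
    then show "\<exists>d>0. \<forall>t. \<bar>t\<bar> < d \<longrightarrow> modL2 f (t, 0) \<le> e"
      by (intro exI[of _ d]) (auto simp: norm_prod_def intro!: less_imp_le)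
  qed simp
  then show ?thesis using f by (simp add: L2lim_def L2p_shift modL2_def)
qed

lemma dL2_L2p: "dL2 f f' \<Longrightarrow> L2p f" "dL2 f f' \<Longrightarrow> L2p f'"
  by (auto simp: dL2_def L2lim_def)

lemma dL2_shift: assumes "dL2 f f'" shows "dL2 (\<lambda>x. f (x + y)) (\<lambda>x. f' (x + y))"
proof -
  have "dquot (\<lambda>x. f (x + y)) = (\<lambda>d x. dquot f d (x + y))"
    by (intro ext) (simp add: dquot_def ac_simps)
  then show ?thesis using assms L2lim_shift[of "dquot f" f' "at 0" y]
    by (simp add: dL2_def L2p_shift)
qed

lemma dL2_diff: assumes f: "dL2 f f'" and g: "dL2 g g'" shows "dL2 (\<lambda>x. f x - g x) (\<lambda>x. f' x - g' x)"
proof -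
  have "dquot (\<lambda>x. f x - g x) = (\<lambda>d x. dquot f d x - dquot g d x)"
    by (intro ext) (simp add: dquot_def diff_divide_distrib)
  then show ?thesis using f g L2lim_diff[of "dquot f" f' "at 0" "dquot g" g']
    by (simp add: dL2_def L2p_diff)
qed

lemma dL2_add: assumes f: "dL2 f f'" and g: "dL2 g g'" shows "dL2 (\<lambda>x. f x + g x) (\<lambda>x. f' x + g' x)"
proof -
  have "dquot (\<lambda>x. f x + g x) = (\<lambda>d x. dquot f d x + dquot g d x)"
    by (intro ext) (simp add: dquot_def add_divide_distrib[symmetric])
  then show ?thesis using f g L2lim_add[of "dquot f" f' "at 0" "dquot g" g']
    by (simp add: dL2_def L2p_add)
qed

text \<open>Summation by parts for difference quotients: a translation turns the quotient of g with
  step d into minus the quotient of f with step -d.\<close>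

lemma dL2_parts:
  assumes f: "dL2 f f'" and g: "dL2 g g'"
  shows "(\<integral>x. f x * g' x \<partial>torus) = - (\<integral>x. f' x * g x \<partial>torus)"
proof -
  note m = dL2_L2p[OF f] dL2_L2p[OF g]
  have [measurable]: "f \<in> borel_measurable borel" "g \<in> borel_measurable borel" using m by auto
  have 1: "(\<lambda>d. \<integral>x. f x * dquot g d x \<partial>torus) \<midarrow>0\<rightarrow> (\<integral>x. f x * g' x \<partial>torus)"
    using g m by (intro L2lim_prod L2lim_const) (auto simp: dL2_def)
  have "(\<lambda>d. \<integral>x. dquot f d x * g x \<partial>torus) \<midarrow>0\<rightarrow> (\<integral>x. f' x * g x \<partial>torus)"
    using f m by (intro L2lim_prod L2lim_const) (auto simp: dL2_def)
  moreover have "filterlim (\<lambda>d::real. - d) (at 0) (at 0)"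
    by (auto simp: filterlim_at eventually_at_filter intro!: tendsto_eq_intros)
  ultimately have "((\<lambda>d. \<integral>x. dquot f (- d) x * g x \<partial>torus) \<longlongrightarrow> (\<integral>x. f' x * g x \<partial>torus)) (at 0)"
    by (rule filterlim_compose)
  then have 2: "((\<lambda>d. - (\<integral>x. dquot f (- d) x * g x \<partial>torus)) \<longlongrightarrow> - (\<integral>x. f' x * g x \<partial>torus)) (at 0)"
    by (rule tendsto_minus)
  have "(\<integral>x. f x * dquot g d x \<partial>torus) = - (\<integral>x. dquot f (- d) x * g x \<partial>torus)" for d
  proof -
    have s: "(\<integral>x. f x * g (x + (d, 0)) \<partial>torus) = (\<integral>x. f (x + (- d, 0)) * g x \<partial>torus)"
    proof (rule integral_cong_shift[where y = "(d, 0)"])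
      show "periodic (\<lambda>x. f (x + (- d, 0)) * g x)"
        using m by (intro periodic_mult periodic_shift) auto
      show "f x * g (x + (d, 0)) = f (x + (d, 0) + (- d, 0)) * g (x + (d, 0))" for x
        by (simp add: add.assoc zero_prod_def[symmetric])
    qed measurable
    have i: "integrable torus (\<lambda>x. f x * g (x + (d, 0)))" "integrable torus (\<lambda>x. f x * g x)"
      "integrable torus (\<lambda>x. f (x + (- d, 0)) * g x)"
      using m by (auto intro!: L1pD(3) L2p_L1p_mult L2p_shift)
    have "(\<integral>x. f x * dquot g d x \<partial>torus) = (\<integral>x. (f x * g (x + (d, 0)) - f x * g x) / d \<partial>torus)"
      by (intro Bochner_Integration.integral_cong) (auto simp: dquot_def algebra_simps)
    also have "\<dots> = ((\<integral>x. f (x + (- d, 0)) * g x \<partial>torus) - (\<integral>x. f x * g x \<partial>torus)) / d"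
      using i s by simp
    also have "\<dots> = (\<integral>x. (f (x + (- d, 0)) * g x - f x * g x) / d \<partial>torus)"
      unfolding Bochner_Integration.integral_diff[OF i(3,2), symmetric] by simp
    also have "\<dots> = (\<integral>x. - (dquot f (- d) x * g x) \<partial>torus)"
      by (intro Bochner_Integration.integral_cong) (simp_all add: dquot_def diff_divide_distrib left_diff_distrib)
    finally show ?thesis by simp
  qed
  with 1 have "((\<lambda>d. - (\<integral>x. dquot f (- d) x * g x \<partial>torus)) \<longlongrightarrow> (\<integral>x. f x * g' x \<partial>torus)) (at 0)" by simp
  from tendsto_unique[OF _ this 2] show ?thesis by simp
qed

text \<open>This replaces dominated convergence, since R tends to 0 only in L1 and along an
  arbitrary filter. The weight h is cut at a height n: below it the L1 convergence acts, and above
  it the remainder of h has small integral while R is bounded.\<close>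

lemma tendsto_integral_mult_bounded:
  fixes R :: "'i \<Rightarrow> real \<times> real \<Rightarrow> real"
  assumes h: "integrable torus h" "\<And>x. 0 \<le> h x"
    and R: "\<And>i. R i \<in> borel_measurable borel" "\<And>i x. 0 \<le> R i x" "\<And>i x. R i x \<le> B"
    and lim: "((\<lambda>i. \<integral>x. R i x \<partial>torus) \<longlongrightarrow> 0) F"
  shows "((\<lambda>i. \<integral>x. R i x * h x \<partial>torus) \<longlongrightarrow> 0) F"
proof (rule tendstoI)
  fix e :: real assume e: "0 < e"
  have B0: "0 \<le> B" using R(2,3) order_trans by blast
  have [measurable]: "h \<in> borel_measurable torus" using h by auto
  have "(\<lambda>n. \<integral>x. h x - min (h x) (real n) \<partial>torus) \<longlonglongrightarrow> (\<integral>x. 0 \<partial>torus)"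
  proof (rule integral_dominated_convergence[where w = h])
    show "AE x in torus. (\<lambda>n. h x - min (h x) (real n)) \<longlonglongrightarrow> 0"
    proof (rule AE_I2, rule tendsto_eventually)
      fix x show "\<forall>\<^sub>F n in sequentially. h x - min (h x) (real n) = 0"
        using eventually_ge_at_top[of "nat \<lceil>h x\<rceil>"] by eventually_elim (simp add: min_def ceiling_le_iff nat_le_iff)
    qed
  qed (use h in auto)
  then have "\<forall>\<^sub>F n in sequentially. (\<integral>x. h x - min (h x) (real n) \<partial>torus) < e / (2 * (B + 1))"
    by (rule order_tendstoD) (use e B0 in auto)
  then obtain n where n: "(\<integral>x. h x - min (h x) (real n) \<partial>torus) < e / (2 * (B + 1))"
    using eventually_happens'[OF sequentially_bot] by blast
  have im: "integrable torus (\<lambda>x. h x - min (h x) (real n))"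
    using h by (intro Bochner_Integration.integrable_diff Bochner_Integration.integrable_bound[OF h(1), of "\<lambda>x. min (h x) (real n)"]) auto
  have iR: "integrable torus (R i)" for i
    by (rule integrable_torus_const_bound[of _ B]) (use R in auto)
  have iRh: "integrable torus (\<lambda>x. R i x * h x)" for i
    by (rule Bochner_Integration.integrable_bound[of _ "\<lambda>x. B * h x"])
       (use R h B0 in \<open>auto simp: abs_mult intro!: mult_right_mono\<close>)
  have le: "(\<integral>x. R i x * h x \<partial>torus) \<le> real n * (\<integral>x. R i x \<partial>torus) + B * (\<integral>x. h x - min (h x) (real n) \<partial>torus)" for i
  proof -
    have "(\<integral>x. R i x * h x \<partial>torus) \<le> (\<integral>x. real n * R i x + B * (h x - min (h x) (real n)) \<partial>torus)"
    proof (rule integral_mono[OF iRh])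
      show "integrable torus (\<lambda>x. real n * R i x + B * (h x - min (h x) (real n)))" using im iR by auto
      fix x
      have "R i x * min (h x) (real n) \<le> R i x * real n" by (intro mult_left_mono R) auto
      moreover have "R i x * (h x - min (h x) (real n)) \<le> B * (h x - min (h x) (real n))"
        by (intro mult_right_mono R) auto
      ultimately show "R i x * h x \<le> real n * R i x + B * (h x - min (h x) (real n))"
        by (simp add: algebra_simps)
    qed
    also have "\<dots> = real n * (\<integral>x. R i x \<partial>torus) + B * (\<integral>x. h x - min (h x) (real n) \<partial>torus)"
      using im iR by simp
    finally show ?thesis .
  qed
  have "B * (\<integral>x. h x - min (h x) (real n) \<partial>torus) \<le> B * (e / (2 * (B + 1)))"
    using n B0 by (intro mult_left_mono) auto
  also have "\<dots> \<le> e / 2" using B0 e by (simp add: field_simps)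
  finally have half: "B * (\<integral>x. h x - min (h x) (real n) \<partial>torus) \<le> e / 2" .
  have "((\<lambda>i. real n * (\<integral>x. R i x \<partial>torus)) \<longlongrightarrow> real n * 0) F" by (intro tendsto_intros lim)
  then have "\<forall>\<^sub>F i in F. real n * (\<integral>x. R i x \<partial>torus) < e / 2"
    by (rule order_tendstoD) (use e in auto)
  then show "\<forall>\<^sub>F i in F. dist (\<integral>x. R i x * h x \<partial>torus) 0 < e"
  proof eventually_elim
    case (elim i)
    have "0 \<le> (\<integral>x. R i x * h x \<partial>torus)" using R h by (intro integral_nonneg_AE) auto
    with le[of i] half elim show ?case by (simp add: dist_real_def)
  qed
qed

section \<open>The chain rule for strong L2 derivatives\<close>

lemma MVT_either_order:
  fixes \<Phi> \<phi> :: "real \<Rightarrow> real"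
  assumes D: "\<And>s. (\<Phi> has_real_derivative \<phi> s) (at s)"
  obtains z where "\<Phi> y - \<Phi> x = \<phi> z * (y - x)" "\<bar>z - x\<bar> \<le> \<bar>y - x\<bar>" "min x y \<le> z" "z \<le> max x y"
proof (cases x y rule: linorder_cases)
  case less
  from MVT2[OF less, of \<Phi> \<phi>] D obtain z where "x < z" "z < y" "\<Phi> y - \<Phi> x = (y - x) * \<phi> z" by blast
  then show ?thesis by (intro that[of z]) (auto simp: mult.commute)
next
  case greater
  from MVT2[OF greater, of \<Phi> \<phi>] D obtain z where "y < z" "z < x" "\<Phi> x - \<Phi> y = (x - y) * \<phi> z" by blast
  then show ?thesis by (intro that[of z]) (auto simp: algebra_simps)
qed (auto intro: that[of x])

text \<open>The linear bound in the minimum makes the remainder factor small; the constant bound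
  keeps it bounded where the increment is large.\<close>

lemma C1_remainder:
  fixes \<Phi> \<phi> :: "real \<Rightarrow> real"
  assumes D: "\<And>s. (\<Phi> has_real_derivative \<phi> s) (at s)" and B: "\<And>s. \<bar>\<phi> s\<bar> \<le> B"
    and K: "\<And>s t. \<bar>\<phi> s - \<phi> t\<bar> \<le> K * \<bar>s - t\<bar>" "0 \<le> K"
  shows "\<bar>\<Phi> y - \<Phi> x - \<phi> x * (y - x)\<bar> \<le> min (2 * B) (K * \<bar>y - x\<bar>) * \<bar>y - x\<bar>"
proof -
  obtain z where z: "\<Phi> y - \<Phi> x = \<phi> z * (y - x)" "\<bar>z - x\<bar> \<le> \<bar>y - x\<bar>" using MVT_either_order[OF D] by blast
  have "\<bar>\<phi> z - \<phi> x\<bar> \<le> 2 * B" using B[of z] B[of x] by linarith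
  moreover have "\<bar>\<phi> z - \<phi> x\<bar> \<le> K * \<bar>y - x\<bar>"
    using K(1)[of z x] mult_left_mono[OF z(2) K(2)] by linarith
  ultimately have "\<bar>\<phi> z - \<phi> x\<bar> \<le> min (2 * B) (K * \<bar>y - x\<bar>)" by simp
  then have "\<bar>\<phi> z - \<phi> x\<bar> * \<bar>y - x\<bar> \<le> min (2 * B) (K * \<bar>y - x\<bar>) * \<bar>y - x\<bar>" by (intro mult_right_mono) auto
  then show ?thesis unfolding z(1) left_diff_distrib[symmetric] abs_mult .
qed

lemma C1_Lipschitz:
  fixes \<Phi> \<phi> :: "real \<Rightarrow> real"
  assumes D: "\<And>s. (\<Phi> has_real_derivative \<phi> s) (at s)" and B: "\<And>s. \<bar>\<phi> s\<bar> \<le> B"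
  shows "\<bar>\<Phi> y - \<Phi> x\<bar> \<le> B * \<bar>y - x\<bar>"
proof -
  obtain z where "\<Phi> y - \<Phi> x = \<phi> z * (y - x)" using MVT_either_order[OF D] .
  then show ?thesis using B[of z] by (simp add: abs_mult mult_right_mono)
qed

lemma borel_measurable_C1: "(\<And>s. (\<Phi> has_real_derivative \<phi> s) (at s)) \<Longrightarrow> \<Phi> \<in> borel_measurable borel"
  by (intro borel_measurable_continuous_onI continuous_at_imp_continuous_on ballI DERIV_isCont)

lemma L2p_comp_Lipschitz:
  assumes f: "L2p f" and L: "\<And>x y. \<bar>\<Phi> y - \<Phi> x\<bar> \<le> B * \<bar>y - x\<bar>" and [measurable]: "\<Phi> \<in> borel_measurable borel"
  shows "L2p (\<lambda>x. \<Phi> (f x))"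
proof -
  have c: "L2p (\<lambda>x. c)" for c :: real by (rule Linf_L2p[of "\<bar>c\<bar>"]) (simp add: Linf_def periodic_const)
  have "L2p (\<lambda>x. \<Phi> (f x) - \<Phi> 0)"
  proof (rule L2p_bound)
    show "L2p (\<lambda>x. B * f x)" by (rule L2p_cmult[OF f])
    show "\<bar>\<Phi> (f x) - \<Phi> 0\<bar> \<le> \<bar>B * f x\<bar>" for x
      using order_trans[OF L[of 0 "f x"] mult_right_mono[OF abs_ge_self[of B] abs_ge_zero]] by (simp add: abs_mult)
    show "periodic (\<lambda>x. \<Phi> (f x) - \<Phi> 0)" using L2pD(2)[OF f] by (simp add: periodic_def)
  qed (use f in measurable)
  from L2p_add[OF this c[of "\<Phi> 0"]] show ?thesis by simp
qed

text \<open>The increments of u are not uniformly small, so neither is the remainder factor r. But r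
  is bounded and tends to 0 in L2, which suffices against the fixed integrable weight
  (u')^2.\<close>

lemma dL2_chain:
  assumes u: "dL2 u u'" and D: "\<And>s. (\<Phi> has_real_derivative \<phi> s) (at s)" and B: "\<And>s. \<bar>\<phi> s\<bar> \<le> B"
    and K: "\<And>s t. \<bar>\<phi> s - \<phi> t\<bar> \<le> K * \<bar>s - t\<bar>" "0 \<le> K" and m\<phi> [measurable]: "\<phi> \<in> borel_measurable borel"
  shows "dL2 (\<lambda>x. \<Phi> (u x)) (\<lambda>x. \<phi> (u x) * u' x)"
proof -
  note m = dL2_L2p[OF u]
  have B0: "0 \<le> B" using B[of 0] by linarith
  have [measurable]: "u \<in> borel_measurable borel" "u' \<in> borel_measurable borel" using m by auto
  have mPhi: "L2p (\<lambda>x. \<Phi> (u x))"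
    by (rule L2p_comp_Lipschitz[OF m(1) C1_Lipschitz[OF D B] borel_measurable_C1[OF D]])
  have Lu: "Linf B (\<lambda>x. \<phi> (u x))"
    using L2pD(2)[OF m(1)] B by (auto simp: Linf_def periodic_def)
  have mprod: "L2p (\<lambda>x. \<phi> (u x) * u' x)" by (rule L2p_mult_Linf[OF Lu m(2)])
  define r where "r d x = min (2 * B) (K * \<bar>u (x + (d, 0)) - u x\<bar>)" for d x
  have r0: "0 \<le> r d x" "r d x \<le> 2 * B" for d x using B0 K(2) by (auto simp: r_def)
  have [measurable]: "r d \<in> borel_measurable borel" for d unfolding r_def[abs_def] by measurable
  have perr: "periodic (r d)" for d
    using L2pD(2)[OF m(1)] periodic_shift[OF L2pD(2)[OF m(1)], of "(d, 0)"] by (simp add: periodic_def r_def)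
  have Lr: "Linf (2 * B) (r d)" for d using r0[of d] perr[of d] by (auto simp: Linf_def)
  \<comment> \<open>In the remainder, r times the quotient, the quotient is written as (quotient -
    u') + u'. Its first part costs 2 B, and replacing the quotient by u' in the main term costs
    another B.\<close>
  have pt: "\<bar>dquot (\<lambda>x. \<Phi> (u x)) d x - \<phi> (u x) * u' x\<bar> \<le> 3 * B * \<bar>dquot u d x - u' x\<bar> + \<bar>r d x * u' x\<bar>" if "d \<noteq> 0" for d x
  proof -
    define y where "y = u (x + (d, 0))"
    have "\<bar>\<Phi> y - \<Phi> (u x) - \<phi> (u x) * (y - u x)\<bar> / \<bar>d\<bar> \<le> r d x * \<bar>y - u x\<bar> / \<bar>d\<bar>"
      using C1_remainder[OF D B K, where y = y and x = "u x"] by (intro divide_right_mono) (auto simp: r_def y_def)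
    also have "r d x * \<bar>y - u x\<bar> / \<bar>d\<bar> = r d x * \<bar>dquot u d x\<bar>" by (simp add: dquot_def y_def)
    also have "\<bar>\<Phi> y - \<Phi> (u x) - \<phi> (u x) * (y - u x)\<bar> / \<bar>d\<bar> = \<bar>dquot (\<lambda>x. \<Phi> (u x)) d x - \<phi> (u x) * dquot u d x\<bar>"
      unfolding abs_divide[symmetric] by (simp add: dquot_def y_def diff_divide_distrib right_diff_distrib)
    finally have 1: "\<bar>dquot (\<lambda>x. \<Phi> (u x)) d x - \<phi> (u x) * dquot u d x\<bar> \<le> r d x * \<bar>dquot u d x\<bar>" .
    have "r d x * \<bar>dquot u d x\<bar> \<le> r d x * (\<bar>dquot u d x - u' x\<bar> + \<bar>u' x\<bar>)"
      using r0[of d x] by (intro mult_left_mono) auto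
    also have "\<dots> \<le> 2 * B * \<bar>dquot u d x - u' x\<bar> + \<bar>r d x * u' x\<bar>"
      using r0[of d x] by (simp add: distrib_left abs_mult mult_right_mono)
    finally have 2: "r d x * \<bar>dquot u d x\<bar> \<le> 2 * B * \<bar>dquot u d x - u' x\<bar> + \<bar>r d x * u' x\<bar>" .
    have "\<bar>\<phi> (u x) * dquot u d x - \<phi> (u x) * u' x\<bar> \<le> B * \<bar>dquot u d x - u' x\<bar>"
      unfolding right_diff_distrib[symmetric] abs_mult by (intro mult_right_mono B) auto
    with 1 2 show ?thesis by linarith
  qed
  have "((\<lambda>d. \<integral>x. (r d x)\<^sup>2 \<partial>torus) \<longlongrightarrow> 0) (at 0)"
  proof (rule tendsto_zero_le)
    show "((\<lambda>d. K\<^sup>2 * (\<integral>x. (u (x + (d, 0)) - u x)\<^sup>2 \<partial>torus)) \<longlongrightarrow> 0) (at 0)"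
      using L2lim_translate[OF m(1)] by (auto simp: L2lim_def intro: tendsto_mult_right_zero)
    show "(\<integral>x. (r d x)\<^sup>2 \<partial>torus) \<le> K\<^sup>2 * (\<integral>x. (u (x + (d, 0)) - u x)\<^sup>2 \<partial>torus)" for d
      unfolding integral_mult_right_zero[symmetric]
    proof (rule integral_mono)
      show "integrable torus (\<lambda>x. (r d x)\<^sup>2)" using Linf_L2p[OF Lr] by auto
      show "integrable torus (\<lambda>x. K\<^sup>2 * (u (x + (d, 0)) - u x)\<^sup>2)"
        using L2p_diff[OF L2p_shift[OF m(1), of "(d, 0)"] m(1)] by auto
      show "(r d x)\<^sup>2 \<le> K\<^sup>2 * (u (x + (d, 0)) - u x)\<^sup>2" for x
        unfolding power_mult_distrib[symmetric]
        using power_mono[of "r d x" "K * \<bar>u (x + (d, 0)) - u x\<bar>" 2] r0(1)[of d x]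
        by (simp add: r_def power_mult_distrib)
    qed
  qed simp
  then have "((\<lambda>d. \<integral>x. (r d x)\<^sup>2 * (u' x)\<^sup>2 \<partial>torus) \<longlongrightarrow> 0) (at 0)"
    by (rule tendsto_integral_mult_bounded[where B = "(2 * B)\<^sup>2", rotated -1])
       (use m Linf_square[OF Lr] in auto)
  then have limr: "((\<lambda>d. \<integral>x. (r d x * u' x)\<^sup>2 \<partial>torus) \<longlongrightarrow> 0) (at 0)" by (simp add: power_mult_distrib)
  have "((\<lambda>d. \<integral>x. (dquot (\<lambda>x. \<Phi> (u x)) d x - \<phi> (u x) * u' x)\<^sup>2 \<partial>torus) \<longlongrightarrow> 0) (at 0)"
  proof (rule tendsto_sandwich[OF _ _ tendsto_const])
    show "\<forall>\<^sub>F d in at 0. (0::real) \<le> (\<integral>x. (dquot (\<lambda>x. \<Phi> (u x)) d x - \<phi> (u x) * u' x)\<^sup>2 \<partial>torus)" by simp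
    have "((\<lambda>d. \<integral>x. (dquot u d x - u' x)\<^sup>2 \<partial>torus) \<longlongrightarrow> 0) (at 0)" using u by (simp add: dL2_def L2lim_def)
    then have "((\<lambda>d. 2 * ((3 * B)\<^sup>2 * (\<integral>x. (dquot u d x - u' x)\<^sup>2 \<partial>torus)) + 2 * (\<integral>x. (r d x * u' x)\<^sup>2 \<partial>torus))
        \<longlongrightarrow> 2 * ((3 * B)\<^sup>2 * 0) + 2 * 0) (at 0)"
      using limr by (intro tendsto_intros)
    then show "((\<lambda>d. 2 * (\<integral>x. (3 * B * (dquot u d x - u' x))\<^sup>2 \<partial>torus) + 2 * (\<integral>x. (r d x * u' x)\<^sup>2 \<partial>torus))
        \<longlongrightarrow> 0) (at 0)" by (simp add: power_mult_distrib)
    have "(\<integral>x. (dquot (\<lambda>x. \<Phi> (u x)) d x - \<phi> (u x) * u' x)\<^sup>2 \<partial>torus) \<le>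
        2 * (\<integral>x. (3 * B * (dquot u d x - u' x))\<^sup>2 \<partial>torus) + 2 * (\<integral>x. (r d x * u' x)\<^sup>2 \<partial>torus)" if "d \<noteq> 0" for d
    proof (rule integral_square_le_2)
      show "\<bar>dquot (\<lambda>x. \<Phi> (u x)) d x - \<phi> (u x) * u' x\<bar> \<le> \<bar>3 * B * (dquot u d x - u' x)\<bar> + \<bar>r d x * u' x\<bar>" for x
        using pt[OF that, of x] B0 by (simp add: abs_mult)
    qed (intro L2p_cmult L2p_diff L2p_dquot m mPhi mprod L2p_mult_Linf[OF Lr])+
    then show "\<forall>\<^sub>F d in at 0. (\<integral>x. (dquot (\<lambda>x. \<Phi> (u x)) d x - \<phi> (u x) * u' x)\<^sup>2 \<partial>torus) \<le>
        2 * (\<integral>x. (3 * B * (dquot u d x - u' x))\<^sup>2 \<partial>torus) + 2 * (\<integral>x. (r d x * u' x)\<^sup>2 \<partial>torus)"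
      by (auto simp: eventually_at_filter)
  qed
  then show ?thesis using mPhi mprod by (simp add: dL2_def L2lim_def L2p_dquot)
qed

subsection \<open>Truncations of the positive part\<close>

definition trunc :: "real \<Rightarrow> real \<Rightarrow> real"
  where "trunc N s = max 0 (min s N)"

text \<open>The primitive of \<open>trunc N\<close>: a version of (max 0 s)^2 / 2 that grows
  linearly beyond N.\<close>

definition trunc1 :: "real \<Rightarrow> real \<Rightarrow> real"
  where "trunc1 N s = (max 0 s)\<^sup>2 / 2 - (max 0 (s - N))\<^sup>2 / 2"

text \<open>The primitive of (trunc N s)^2 / 2, not of \<open>trunc1 N\<close>: a version of (max 0
  s)^3 / 6 that grows linearly beyond N.\<close>

definition trunc2 :: "real \<Rightarrow> real \<Rightarrow> real"
  where "trunc2 N s = max 0 s ^ 3 / 6 - max 0 (s - N) ^ 3 / 6 - N / 2 * (max 0 (s - N))\<^sup>2"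

text \<open>At 0 the difference quotient is again a power of the positive part, with exponent at
  least 1, and therefore tends to 0.\<close>

lemma DERIV_pos_part_power:
  "((\<lambda>s::real. max 0 s ^ Suc (Suc n)) has_real_derivative (real (Suc (Suc n)) * max 0 s ^ Suc n)) (at s)"
proof (cases s "0::real" rule: linorder_cases)
  case less
  have "((\<lambda>s::real. 0) has_real_derivative 0) (at s)" by simp
  then have "((\<lambda>s::real. max 0 s ^ Suc (Suc n)) has_real_derivative 0) (at s)"
    by (rule has_field_derivative_transform_within_open[of _ _ _ "{..<0}"]) (use less in auto)
  then show ?thesis using less by simp
next
  case greater
  have "((\<lambda>s::real. s ^ Suc (Suc n)) has_real_derivative (real (Suc (Suc n)) * s ^ Suc n)) (at s)"
    using DERIV_pow[of "Suc (Suc n)" s] by simp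
  then have "((\<lambda>s::real. max 0 s ^ Suc (Suc n)) has_real_derivative (real (Suc (Suc n)) * s ^ Suc n)) (at s)"
    by (rule has_field_derivative_transform_within_open[of _ _ _ "{0<..}"]) (use greater in auto)
  then show ?thesis using greater by simp
next
  case equal
  have "(\<lambda>h::real. max 0 h ^ Suc n) \<midarrow>0\<rightarrow> max 0 0 ^ Suc n"
    by (intro tendsto_intros)
  then have "(\<lambda>h::real. max 0 h ^ Suc n) \<midarrow>0\<rightarrow> 0" by simp
  then have "((\<lambda>h::real. (max 0 (0 + h) ^ Suc (Suc n) - max 0 0 ^ Suc (Suc n)) / h) \<longlongrightarrow> 0) (at 0)"
  proof (rule Lim_transform_eventually)
    show "\<forall>\<^sub>F h in at 0. max 0 h ^ Suc n = (max 0 (0 + h) ^ Suc (Suc n) - max 0 0 ^ Suc (Suc n)) / (h::real)"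
      by (auto simp: eventually_at_filter max_def)
  qed
  then show ?thesis using equal by (simp add: DERIV_def)
qed

lemma DERIV_trunc1: "(trunc1 N has_real_derivative trunc N s) (at s)" if "0 < N"
proof -
  note d = DERIV_pos_part_power[of 0, simplified]
  have "((\<lambda>s. (max 0 s)\<^sup>2 / 2 - (max 0 (s - N))\<^sup>2 / 2) has_real_derivative
      (2 * max 0 s) / 2 - (2 * max 0 (s - N) * 1) / 2) (at s)"
    by (intro DERIV_diff DERIV_cdivide DERIV_chain2[where f = "\<lambda>s. (max 0 s)\<^sup>2" and g = "\<lambda>s. s - N"])
       (use d in \<open>auto simp: numeral_2_eq_2 intro!: derivative_eq_intros\<close>)
  then show ?thesis
    using that by (simp add: trunc1_def[abs_def] trunc_def) (auto simp: max_def min_def split: if_splits)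
qed

lemma DERIV_trunc2: "(trunc2 N has_real_derivative (trunc N s)\<^sup>2 / 2) (at s)" if "0 < N"
proof -
  note d2 = DERIV_pos_part_power[of 0, simplified] and d3 = DERIV_pos_part_power[of 1, simplified]
  have c: "((\<lambda>s. s - N) has_real_derivative 1) (at s)" by (auto intro!: derivative_eq_intros)
  have 3: "((\<lambda>s. max 0 s ^ 3) has_real_derivative 3 * (max 0 s)\<^sup>2) (at s)" for s :: real
    using d3[of s] by (simp add: eval_nat_numeral)
  have 2: "((\<lambda>s. (max 0 s)\<^sup>2) has_real_derivative 2 * max 0 s) (at s)" for s :: real
    using d2[of s] by (simp add: eval_nat_numeral)
  have "((\<lambda>s. max 0 s ^ 3 / 6 - max 0 (s - N) ^ 3 / 6 - N / 2 * (max 0 (s - N))\<^sup>2) has_real_derivative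
      (3 * (max 0 s)\<^sup>2) / 6 - (3 * (max 0 (s - N))\<^sup>2 * 1) / 6 - N / 2 * (2 * max 0 (s - N) * 1)) (at s)"
    by (intro DERIV_diff DERIV_cdivide DERIV_cmult 3 DERIV_chain2[OF 3 c] DERIV_chain2[OF 2 c])
  moreover have "(3 * (max 0 s)\<^sup>2) / 6 - (3 * (max 0 (s - N))\<^sup>2 * 1) / 6 - N / 2 * (2 * max 0 (s - N) * 1) = (trunc N s)\<^sup>2 / 2"
    using that by (auto simp: trunc_def max_def min_def power2_eq_square algebra_simps)
  ultimately show ?thesis unfolding trunc2_def[abs_def] by (simp only:)
qed

lemma trunc_bounds: "0 < N \<Longrightarrow> 0 \<le> trunc N s" "0 < N \<Longrightarrow> trunc N s \<le> N"
  by (auto simp: trunc_def)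

lemma trunc_mono: "s \<le> t \<Longrightarrow> trunc N s \<le> trunc N t"
  by (auto simp: trunc_def)

lemma trunc_Lipschitz: "\<bar>trunc N s - trunc N t\<bar> \<le> \<bar>s - t\<bar>"
  by (auto simp: trunc_def max_def min_def abs_if)

lemma trunc_sq_Lipschitz: "0 < N \<Longrightarrow> \<bar>(trunc N s)\<^sup>2 / 2 - (trunc N t)\<^sup>2 / 2\<bar> \<le> N * \<bar>s - t\<bar>"
proof -
  assume N: "0 < N"
  have "\<bar>(trunc N s)\<^sup>2 / 2 - (trunc N t)\<^sup>2 / 2\<bar> = (trunc N s + trunc N t) / 2 * \<bar>trunc N s - trunc N t\<bar>"
    using trunc_bounds[OF N, of s] trunc_bounds[OF N, of t]
    by (simp add: power2_eq_square square_diff_square_factored diff_divide_distrib[symmetric] abs_mult)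
  also have "\<dots> \<le> N * \<bar>s - t\<bar>"
    using trunc_bounds[OF N, of s] trunc_bounds[OF N, of t] by (intro mult_mono trunc_Lipschitz) auto
  finally show ?thesis .
qed

lemma trunc_measurable [measurable]: "trunc N \<in> borel_measurable borel"
  unfolding trunc_def[abs_def] by measurable

text \<open>The mean value theorem with the nondecreasing derivative \<open>trunc N\<close>.\<close>

lemma trunc1_convex: "0 < N \<Longrightarrow> trunc N x * (y - x) \<le> trunc1 N y - trunc1 N x"
proof -
  assume N: "0 < N"
  obtain z where z: "trunc1 N y - trunc1 N x = trunc N z * (y - x)" "min x y \<le> z" "z \<le> max x y"
    using MVT_either_order[OF DERIV_trunc1[OF N]] by blast
  show ?thesis
  proof (cases "x \<le> y")
    case True
    then show ?thesis unfolding z(1) using z by (intro mult_right_mono trunc_mono) auto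
  next
    case False
    then show ?thesis unfolding z(1) using z by (intro mult_right_mono_neg trunc_mono) auto
  qed
qed

text \<open>The quantity left over after integrating by parts is the derivative of
  \<open>trunc2 N\<close>; hence the choice of \<open>trunc2\<close>.\<close>

lemma trunc_trunc1: "0 < N \<Longrightarrow> trunc N s * s - trunc1 N s = (trunc N s)\<^sup>2 / 2"
  by (auto simp: trunc_def trunc1_def max_def min_def power2_eq_square algebra_simps)

lemma trunc1_ge: "max 0 s - 1 / 2 \<le> trunc1 1 s"
  using zero_le_power2[of "s - 1"]
  by (auto simp: trunc1_def max_def power2_eq_square algebra_simps)

lemma trunc1_bounds: "0 \<le> trunc1 1 s" "trunc1 1 s \<le> \<bar>s\<bar>"
  using mult_left_mono[of s 1 s] by (auto simp: trunc1_def max_def power2_eq_square algebra_simps)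

lemma trunc2_ge: "0 < N \<Longrightarrow> trunc N s ^ 3 \<le> 6 * trunc2 N s"
proof (cases "s \<le> N")
  case False
  assume N: "0 < N"
  have "6 * trunc2 N s = s ^ 3 - (s - N) ^ 3 - 3 * N * (s - N)\<^sup>2"
    using N False by (simp add: trunc2_def algebra_simps)
  also have "\<dots> = 3 * N\<^sup>2 * s - 2 * N ^ 3"
    by (simp add: power2_eq_square power3_eq_cube algebra_simps)
  also have "\<dots> \<ge> 3 * N\<^sup>2 * N - 2 * N ^ 3"
    using False N by (intro diff_right_mono mult_left_mono) auto
  finally show ?thesis using N False by (simp add: trunc_def power2_eq_square power3_eq_cube)
qed (auto simp: trunc_def trunc2_def max_def)

lemma trunc_tendsto: "(\<lambda>n. trunc (real (Suc n)) s) \<longlonglongrightarrow> max 0 s"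
proof (rule tendsto_eventually)
  show "\<forall>\<^sub>F n in sequentially. trunc (real (Suc n)) s = max 0 s"
    using eventually_ge_at_top[of "nat \<lceil>s\<rceil>"]
    by eventually_elim (auto simp: trunc_def nat_le_iff ceiling_le_iff min_def)
qed

subsection \<open>The equation and its regularity\<close>

lemma cis_minus_1_tendsto: "((\<lambda>d. (cis (s * d) - 1) / complex_of_real d) \<longlongrightarrow> \<i> * complex_of_real s) (at 0)"
proof (cases "s = 0")
  case False
  have "((\<lambda>d. \<i> * complex_of_real (s * d)) \<longlongrightarrow> \<i> * complex_of_real (s * 0)) (at 0)" by (intro tendsto_intros)
  then have "filterlim (\<lambda>d. \<i> * complex_of_real (s * d)) (at 0) (at 0)"
    using False by (auto simp: filterlim_at eventually_at_filter)
  from filterlim_compose[OF lim_exp_minus_1 this]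
  have "((\<lambda>d. (exp (\<i> * complex_of_real (s * d)) - 1) / (\<i> * complex_of_real (s * d))) \<longlongrightarrow> 1) (at 0)" .
  from tendsto_mult[OF tendsto_const[of "\<i> * complex_of_real s"] this]
  have "((\<lambda>d. \<i> * complex_of_real s * ((exp (\<i> * complex_of_real (s * d)) - 1) / (\<i> * complex_of_real (s * d)))) \<longlongrightarrow> \<i> * complex_of_real s) (at 0)"
    by simp
  then show ?thesis
    by (rule Lim_transform_eventually) (use False in \<open>auto simp: eventually_at_filter cis_conv_exp\<close>)
qed simp

lemma Re_fc: "L1p f \<Longrightarrow> Re (fc f k) = (\<integral>x. cos (k \<bullet> x) * f x \<partial>torus)"
  and Im_fc: "L1p f \<Longrightarrow> Im (fc f k) = - (\<integral>x. sin (k \<bullet> x) * f x \<partial>torus)"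
  unfolding fc_def
  by (simp_all only: integral_Re[OF integrable_fc, symmetric] integral_Im[OF integrable_fc, symmetric]
      Bochner_Integration.integral_minus[symmetric])
     (simp_all add: mult.commute)

lemma Linf_trig:
  assumes "k \<in> freqs"
  shows "Linf 1 (\<lambda>x. cos (k \<bullet> x))" "Linf 1 (\<lambda>x. sin (k \<bullet> x))"
proof -
  have m: "(\<lambda>x. cos (k \<bullet> x)) \<in> borel_measurable borel" "(\<lambda>x. sin (k \<bullet> x)) \<in> borel_measurable borel"
    by (intro borel_measurable_continuous_onI continuous_intros)+
  have "periodic (\<lambda>x. Re (cis (k \<bullet> x)))" "periodic (\<lambda>x. Im (cis (k \<bullet> x)))"
    by (rule periodic_comp[OF periodic_cis(2)[OF assms]])+
  then show "Linf 1 (\<lambda>x. cos (k \<bullet> x))" "Linf 1 (\<lambda>x. sin (k \<bullet> x))"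
    using m by (auto simp: Linf_def)
qed

text \<open>Bessel's inequality is applied to the difference quotients of f. The sum is finite, so d
  can tend to 0 term by term, without producing a derivative of f.\<close>

lemma ker_Bessel_deriv:
  assumes f: "L2p f" and lip: "\<And>d. (\<integral>x. (f (x + (d, 0)) - f x)\<^sup>2 \<partial>torus) \<le> L\<^sup>2 * d\<^sup>2"
  shows "(\<Sum>i\<in>kidx N. kcoef N i * (\<bar>fst (kfreq N i)\<bar> * norm (fc f (kfreq N i)))\<^sup>2) \<le> L\<^sup>2"
proof (rule tendsto_upperbound)
  let ?q = "\<lambda>d i. (cis (fst (kfreq N i) * d) - 1) / complex_of_real d"
  show "((\<lambda>d. \<Sum>i\<in>kidx N. kcoef N i * (norm (?q d i) * norm (fc f (kfreq N i)))\<^sup>2) \<longlongrightarrow>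
    (\<Sum>i\<in>kidx N. kcoef N i * (\<bar>fst (kfreq N i)\<bar> * norm (fc f (kfreq N i)))\<^sup>2)) (at 0)"
  proof (intro tendsto_intros)
    show "((\<lambda>d. norm (?q d i)) \<longlongrightarrow> \<bar>fst (kfreq N i)\<bar>) (at 0)" for i
      using tendsto_norm[OF cis_minus_1_tendsto[of "fst (kfreq N i)"]] by (simp add: norm_mult)
  qed
  have "(\<Sum>i\<in>kidx N. kcoef N i * (norm (?q d i) * norm (fc f (kfreq N i)))\<^sup>2) \<le> L\<^sup>2" if "d \<noteq> 0" for d
  proof -
    have L2: "L2p (\<lambda>x. f (x + (d, 0)) - f x)" by (rule L2p_diff[OF L2p_shift[OF f] f])
    have fcd: "fc (\<lambda>x. f (x + (d, 0)) - f x) (kfreq N i) = (cis (fst (kfreq N i) * d) - 1) * fc f (kfreq N i)" for i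
      using fc_diff[OF L1p_shift[OF L2p_L1p[OF f], of "(d, 0)"] L2p_L1p[OF f]]
        fc_shift[OF L2p_L1p[OF f] kfreq_freqs, of "(d, 0)"]
      by (simp add: inner_prod_def left_diff_distrib)
    have "d\<^sup>2 * (\<Sum>i\<in>kidx N. kcoef N i * (norm (?q d i) * norm (fc f (kfreq N i)))\<^sup>2) =
        (\<Sum>i\<in>kidx N. kcoef N i * (norm (fc (\<lambda>x. f (x + (d, 0)) - f x) (kfreq N i)))\<^sup>2)"
      unfolding fcd sum_distrib_left using that
      by (intro sum.cong) (auto simp: norm_mult norm_divide power_mult_distrib power_divide)
    also have "\<dots> \<le> L\<^sup>2 * d\<^sup>2" by (rule order_trans[OF ker_Bessel[OF L2] lip])
    finally show ?thesis using that by (simp add: mult.commute)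
  qed
  then show "\<forall>\<^sub>F d in at 0. (\<Sum>i\<in>kidx N. kcoef N i * (norm (?q d i) * norm (fc f (kfreq N i)))\<^sup>2) \<le> L\<^sup>2"
    by (auto simp: eventually_at_filter)
qed simp

lemma integral_square_shift: "L2p f \<Longrightarrow> (\<integral>x. (f (x + y))\<^sup>2 \<partial>torus) = (\<integral>x. (f x)\<^sup>2 \<partial>torus)"
  using L2p_L1p_square[of f] by (intro integral_torus_shift[where f = "\<lambda>x. (f x)\<^sup>2"]) auto

text \<open>In terms of distributions: b is the x1-derivative of w, w has vanishing mean in x1, and
  the x2-derivative of w is \<open>|\<partial>\<^sub>1| g\<close> plus the x1-derivative of w^2 /
  2.\<close>

locale burgers =
  fixes w b g :: "real \<times> real \<Rightarrow> real"
  assumes w: "L2p w" and b: "L2p b" and g: "L2p g"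
    and fc_b: "\<And>k. k \<in> freqs \<Longrightarrow> fc b k = \<i> * complex_of_real (fst k) * fc w k"
    and fc_w_0: "\<And>k. k \<in> freqs \<Longrightarrow> fst k = 0 \<Longrightarrow> fc w k = 0"
    and fc_eta: "\<And>k. k \<in> freqs \<Longrightarrow> \<i> * complex_of_real (snd k) * fc w k =
      complex_of_real \<bar>fst k\<bar> * fc g k + \<i> * complex_of_real (fst k) / 2 * fc (\<lambda>x. (w x)\<^sup>2) k"
begin

definition \<beta> :: real where "\<beta> = sqrt (\<integral>x. (b x)\<^sup>2 \<partial>torus)"
definition \<gamma> :: real where "\<gamma> = sqrt (\<integral>x. (g x)\<^sup>2 \<partial>torus)"
definition v :: "real \<times> real \<Rightarrow> real" where "v x = w x * b x"
definition D :: "real \<Rightarrow> real \<times> real \<Rightarrow> real" where "D h x = w (x + (h, 0)) - w x"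

lemma nonneg: "0 \<le> \<beta>" "0 \<le> \<gamma>"
  by (simp_all add: \<beta>_def \<gamma>_def)

lemma v_L1p: "L1p v"
  unfolding v_def[abs_def] by (rule L2p_L1p_mult[OF w b])

lemma D_L2p: "L2p (D h)"
  unfolding D_def[abs_def] by (rule L2p_diff[OF L2p_shift[OF w] w])

text \<open>The fundamental theorem of calculus along e1, obtained from \<open>segA_mult\<close> by
  comparing Fourier coefficients instead of working on single lines.\<close>

lemma D_eq: "AE x in torus. D h x = h * tavg (seg (h, 0)) b x"
proof (rule fc_eq_imp_AE_eq)
  note w1 = L2p_L1p[OF w] and b1 = L2p_L1p[OF b]
  show "L1p (D h)" by (rule L2p_L1p[OF D_L2p])
  show "L1p (\<lambda>x. h * tavg (seg (h, 0)) b x)" by (rule L1p_cmult[OF tavg_L1p[OF bprob_seg b1]])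
  fix k assume k: "k \<in> freqs"
  have "fc (D h) k = (cis (fst k * h) - 1) * fc w k"
    unfolding D_def[abs_def] fc_diff[OF L1p_shift[OF w1] w1] fc_shift[OF w1 k]
    by (simp add: inner_prod_def left_diff_distrib)
  also have "\<dots> = \<i> * complex_of_real (fst k * h) * segA (fst k * h) * fc w k"
    by (simp only: segA_mult)
  also have "\<dots> = fc (\<lambda>x. h * tavg (seg (h, 0)) b x) k"
    by (simp add: fc_cmult fc_tavg_seg[OF b1 k] fc_b[OF k] inner_prod_def)
  finally show "fc (D h) k = fc (\<lambda>x. h * tavg (seg (h, 0)) b x) k" .
qed

lemma D_Lipschitz: "(\<integral>x. (D h x)\<^sup>2 \<partial>torus) \<le> \<beta>\<^sup>2 * h\<^sup>2"
proof -
  have "(\<integral>x. (D h x)\<^sup>2 \<partial>torus) = (\<integral>x. (h * tavg (seg (h, 0)) b x)\<^sup>2 \<partial>torus)"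
    using D_eq[of h] D_L2p[of h] L2p_cmult[OF tavg_L2p(1)[OF bprob_seg b], of h "(h, 0)"]
    by (intro integral_cong_AE) (auto simp: L2p_def elim!: eventually_mono)
  also have "\<dots> = h\<^sup>2 * (\<integral>x. (tavg (seg (h, 0)) b x)\<^sup>2 \<partial>torus)" by (simp add: power_mult_distrib)
  also have "\<dots> \<le> h\<^sup>2 * (\<integral>x. (b x)\<^sup>2 \<partial>torus)" by (intro mult_left_mono tavg_L2p(2)[OF bprob_seg b]) auto
  finally show ?thesis by (simp add: \<beta>_def mult.commute)
qed

text \<open>By \<open>D_eq\<close> the difference quotients of w are averages of b over shrinking
  segments, which converge to b in L2.\<close>

lemma dL2_w: "dL2 w b"
proof -
  have "(\<integral>x. (tavg (seg (d *\<^sub>R (1, 0))) b x - b x)\<^sup>2 \<partial>torus) = (\<integral>x. (dquot w d x - b x)\<^sup>2 \<partial>torus)" if "d \<noteq> 0" for d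
  proof (rule integral_cong_AE)
    show "AE x in torus. (tavg (seg (d *\<^sub>R (1, 0))) b x - b x)\<^sup>2 = (dquot w d x - b x)\<^sup>2"
      using D_eq[of d] that by (auto elim!: eventually_mono simp: dquot_def D_def)
    show "(\<lambda>x. (tavg (seg (d *\<^sub>R (1, 0))) b x - b x)\<^sup>2) \<in> borel_measurable torus"
      using L2pD(3)[OF L2p_diff[OF tavg_L2p(1)[OF bprob_seg b] b]] by (auto dest: borel_measurable_integrable)
    show "(\<lambda>x. (dquot w d x - b x)\<^sup>2) \<in> borel_measurable torus"
      using L2pD(3)[OF L2p_diff[OF L2p_dquot[OF w] b]] by (auto dest: borel_measurable_integrable)
  qed
  then have ev: "\<forall>\<^sub>F d in at 0. (\<integral>x. (tavg (seg (d *\<^sub>R (1, 0))) b x - b x)\<^sup>2 \<partial>torus) = (\<integral>x. (dquot w d x - b x)\<^sup>2 \<partial>torus)"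
    by (auto simp: eventually_at_filter)
  have "((\<lambda>d. \<integral>x. (dquot w d x - b x)\<^sup>2 \<partial>torus) \<longlongrightarrow> 0) (at 0)"
    by (rule Lim_transform_eventually[OF tavg_seg_L2_tendsto[OF b, of "(1, 0)"] ev])
  then show ?thesis by (simp add: dL2_def L2lim_def w b L2p_dquot)
qed

text \<open>The difference of squares factors into the difference quotient of w and a sum of two
  translates, both convergent in L2.\<close>

lemma square_quotient_tendsto:
  assumes u: "Linf B u"
  shows "((\<lambda>d. \<integral>x. u x * (((w (x + (d, 0)))\<^sup>2 - (w x)\<^sup>2) / d) \<partial>torus) \<longlongrightarrow> 2 * (\<integral>x. u x * v x \<partial>torus)) (at 0)"
proof -
  have "L2lim (\<lambda>d x. u x * (w (x + (d, 0)) + w x)) (\<lambda>x. u x * (w x + w x)) (at 0)"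
    by (intro L2lim_mult_Linf[OF u] L2lim_add L2lim_translate L2lim_const w)
  moreover have "L2lim (dquot w) b (at 0)" using dL2_w by (simp add: dL2_def)
  ultimately have "((\<lambda>d. \<integral>x. dquot w d x * (u x * (w (x + (d, 0)) + w x)) \<partial>torus) \<longlongrightarrow>
      (\<integral>x. b x * (u x * (w x + w x)) \<partial>torus)) (at 0)"
    by (intro L2lim_prod)
  moreover have "dquot w d x * (u x * (w (x + (d, 0)) + w x)) = u x * (((w (x + (d, 0)))\<^sup>2 - (w x)\<^sup>2) / d)" for d x
    by (simp add: dquot_def power2_eq_square square_diff_square_factored ac_simps)
  moreover have "(\<integral>x. b x * (u x * (w x + w x)) \<partial>torus) = 2 * (\<integral>x. u x * v x \<partial>torus)"
    unfolding integral_mult_right_zero[symmetric] by (intro Bochner_Integration.integral_cong) (auto simp: v_def)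
  ultimately show ?thesis by simp
qed

text \<open>The product rule for w^2 / 2, in which \<open>v\<close> is w b: difference quotients of
  w^2 are tested with the cosine and the sine of the frequency.\<close>

lemma fc_v: assumes k: "k \<in> freqs" shows "fc v k = \<i> * complex_of_real (fst k) / 2 * fc (\<lambda>x. (w x)\<^sup>2) k"
proof -
  define q where "q d x = ((w (x + (d, 0)))\<^sup>2 - (w x)\<^sup>2) / d" for d x
  have w2: "L1p (\<lambda>x. (w x)\<^sup>2)" by (rule L2p_L1p_square[OF w])
  have q: "L1p (q d)" for d
    unfolding q_def[abs_def] by (rule L1p_divide[OF L1p_diff[OF L1p_shift[OF w2] w2]])
  have "((\<lambda>d. fc (q d) k) \<longlongrightarrow> 2 * fc v k) (at 0)"
    unfolding tendsto_complex_iff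
    using square_quotient_tendsto[OF Linf_trig(1)[OF k]] tendsto_minus[OF square_quotient_tendsto[OF Linf_trig(2)[OF k]]]
    by (simp add: Re_fc[OF q] Im_fc[OF q] Re_fc[OF v_L1p] Im_fc[OF v_L1p] q_def)
  moreover have "fc (q d) k = (cis (fst k * d) - 1) / complex_of_real d * fc (\<lambda>x. (w x)\<^sup>2) k" for d
  proof -
    have "q d = (\<lambda>x. (1 / d) * ((w (x + (d, 0)))\<^sup>2 - (w x)\<^sup>2))" by (simp add: q_def[abs_def])
    then have "fc (q d) k = complex_of_real (1 / d) * fc (\<lambda>x. (w (x + (d, 0)))\<^sup>2 - (w x)\<^sup>2) k"
      by (simp only: fc_cmult)
    then show ?thesis
      by (simp add: fc_diff[OF L1p_shift[OF w2] w2] fc_shift[OF w2 k] inner_prod_def left_diff_distrib diff_divide_distrib)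
  qed
  moreover have "((\<lambda>d. (cis (fst k * d) - 1) / complex_of_real d * fc (\<lambda>x. (w x)\<^sup>2) k) \<longlongrightarrow>
      \<i> * complex_of_real (fst k) * fc (\<lambda>x. (w x)\<^sup>2) k) (at 0)"
    by (intro tendsto_intros cis_minus_1_tendsto)
  ultimately have "2 * fc v k = \<i> * complex_of_real (fst k) * fc (\<lambda>x. (w x)\<^sup>2) k"
    by (intro tendsto_unique[OF trivial_limit_at]) auto
  then show ?thesis by (simp add: field_simps)
qed

text \<open>The remainder r has the coefficients t \<open>segA\<close> |k1| \<open>fc g k\<close>.
  The factor |k1| is given to \<psi>, whose weighted coefficients have square sum at most L^2, and
  the Cauchy-Schwarz inequality gives L \<gamma>. Kernel averages of r keep all sums finite;
  removing them needs \<psi> bounded, because r is only known to lie in L1.\<close>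

lemma weak_equation:
  assumes \<psi>: "Linf B \<psi>" and L: "0 \<le> L" and lip: "\<And>d. (\<integral>x. (\<psi> (x + (d, 0)) - \<psi> x)\<^sup>2 \<partial>torus) \<le> L\<^sup>2 * d\<^sup>2"
  shows "\<bar>(\<integral>x. \<psi> x * (w (x + (0, t)) - w x) \<partial>torus) - t * (\<integral>x. \<psi> x * tavg (seg (0, t)) v x \<partial>torus)\<bar> \<le> \<bar>t\<bar> * (L * \<gamma>)"
proof -
  note w1 = L2p_L1p[OF w]
  define r where "r x = w (x + (0, t)) - w x - t * tavg (seg (0, t)) v x" for x
  have d1: "L1p (\<lambda>x. w (x + (0, t)) - w x)" by (rule L1p_diff[OF L1p_shift[OF w1] w1])
  have d2: "L1p (tavg (seg (0, t)) v)" by (rule tavg_L1p[OF bprob_seg v_L1p])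
  have r: "L1p r" unfolding r_def[abs_def] by (rule L1p_diff[OF d1 L1p_cmult[OF d2]])
  have fcr: "fc r k = complex_of_real t * segA (snd k * t) * (complex_of_real \<bar>fst k\<bar> * fc g k)" if k: "k \<in> freqs" for k
  proof -
    have "fc r k = (cis (snd k * t) - 1) * fc w k - complex_of_real t * segA (snd k * t) * fc v k"
      unfolding r_def[abs_def] fc_diff[OF d1 L1p_cmult[OF d2]] fc_diff[OF L1p_shift[OF w1] w1] fc_shift[OF w1 k]
        fc_cmult fc_tavg_seg[OF v_L1p k]
      by (simp add: inner_prod_def left_diff_distrib)
    also have "\<dots> = complex_of_real t * segA (snd k * t) * (\<i> * complex_of_real (snd k) * fc w k - fc v k)"
      unfolding segA_mult[symmetric] by (simp add: algebra_simps)
    also have "\<i> * complex_of_real (snd k) * fc w k - fc v k = complex_of_real \<bar>fst k\<bar> * fc g k"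
      unfolding fc_eta[OF k] fc_v[OF k] by simp
    finally show ?thesis .
  qed
  have bound: "\<bar>\<integral>x. \<psi> x * tavg (ker N) r x \<partial>torus\<bar> \<le> \<bar>t\<bar> * (L * \<gamma>)" for N
  proof -
    let ?G = "\<lambda>i. sqrt (kcoef N i) * norm (fc g (kfreq N i))"
    let ?P = "\<lambda>i. sqrt (kcoef N i) * (\<bar>fst (kfreq N i)\<bar> * norm (fc \<psi> (kfreq N i)))"
    have "\<bar>\<integral>x. \<psi> x * tavg (ker N) r x \<partial>torus\<bar> = norm (complex_of_real (\<integral>x. \<psi> x * tavg (ker N) r x \<partial>torus))"
      by simp
    also have "\<dots> \<le> (\<Sum>i\<in>kidx N. norm (complex_of_real (kcoef N i) * fc r (kfreq N i) * cnj (fc \<psi> (kfreq N i))))"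
      unfolding integral_mult_tavg_ker[OF r Linf_L1p[OF \<psi>]] by (rule norm_sum)
    also have "\<dots> \<le> (\<Sum>i\<in>kidx N. \<bar>t\<bar> * (\<bar>?G i\<bar> * \<bar>?P i\<bar>))"
    proof (rule sum_mono)
      fix i
      have "norm (complex_of_real (kcoef N i) * fc r (kfreq N i) * cnj (fc \<psi> (kfreq N i))) =
        \<bar>t\<bar> * (kcoef N i * (\<bar>fst (kfreq N i)\<bar> * norm (fc g (kfreq N i)) * norm (fc \<psi> (kfreq N i)))) * norm (segA (snd (kfreq N i) * t))"
        unfolding fcr[OF kfreq_freqs] using kcoef_nonneg[of N i] by (simp add: norm_mult)
      also have "\<dots> \<le> \<bar>t\<bar> * (kcoef N i * (\<bar>fst (kfreq N i)\<bar> * norm (fc g (kfreq N i)) * norm (fc \<psi> (kfreq N i)))) * 1"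
        using kcoef_nonneg[of N i] by (intro mult_left_mono norm_segA) auto
      also have "\<dots> = \<bar>t\<bar> * (\<bar>?G i\<bar> * \<bar>?P i\<bar>)"
        using kcoef_nonneg[of N i] real_sqrt_mult_self[of "kcoef N i"] by (simp add: abs_mult)
      finally show "norm (complex_of_real (kcoef N i) * fc r (kfreq N i) * cnj (fc \<psi> (kfreq N i))) \<le> \<bar>t\<bar> * (\<bar>?G i\<bar> * \<bar>?P i\<bar>)" .
    qed
    also have "\<dots> = \<bar>t\<bar> * (\<Sum>i\<in>kidx N. \<bar>?G i\<bar> * \<bar>?P i\<bar>)" by (simp add: sum_distrib_left)
    also have "\<dots> \<le> \<bar>t\<bar> * (L2_set ?G (kidx N) * L2_set ?P (kidx N))"
      by (intro mult_left_mono L2_set_mult_ineq) auto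
    also have "L2_set ?G (kidx N) \<le> \<gamma>"
      unfolding L2_set_def \<gamma>_def using kcoef_nonneg ker_Bessel[OF g, of N]
      by (intro real_sqrt_le_mono) (simp add: power_mult_distrib)
    also have "L2_set ?P (kidx N) \<le> L"
      unfolding L2_set_def using kcoef_nonneg ker_Bessel_deriv[OF Linf_L2p[OF \<psi>] lip, of N] L
      by (intro real_le_lsqrt) (simp_all add: power_mult_distrib sum_nonneg)
    finally show ?thesis by (simp add: mult.commute mult_left_mono mult_right_mono nonneg L2_set_nonneg)
  qed
  have "(\<lambda>N. \<bar>\<integral>x. \<psi> x * tavg (ker N) r x \<partial>torus\<bar>) \<longlonglongrightarrow> \<bar>\<integral>x. \<psi> x * r x \<partial>torus\<bar>"
    by (intro tendsto_rabs tendsto_integral_mult_Linf[OF \<psi> tavg_L1p[OF bprob_ker r] r tavg_ker_L1_tendsto[OF r]])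
  then have "\<bar>\<integral>x. \<psi> x * r x \<partial>torus\<bar> \<le> \<bar>t\<bar> * (L * \<gamma>)"
    by (rule LIMSEQ_le_const2) (use bound in auto)
  moreover have "(\<integral>x. \<psi> x * r x \<partial>torus) = (\<integral>x. \<psi> x * (w (x + (0, t)) - w x) - t * (\<psi> x * tavg (seg (0, t)) v x) \<partial>torus)"
    by (intro Bochner_Integration.integral_cong) (auto simp: r_def algebra_simps)
  moreover have "\<dots> = (\<integral>x. \<psi> x * (w (x + (0, t)) - w x) \<partial>torus) - t * (\<integral>x. \<psi> x * tavg (seg (0, t)) v x \<partial>torus)"
    using L1pD(3)[OF L1p_mult_Linf[OF \<psi> d1]] L1pD(3)[OF L1p_mult_Linf[OF \<psi> d2]] by simp
  ultimately show ?thesis by simp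
qed

text \<open>An upper bound H for both signs of t suffices: division by t reverses the inequality for
  t < 0, so the two one-sided limits bound the difference from both sides.\<close>

lemma weak_equation_limit:
  assumes \<psi>: "Linf B \<psi>" and L: "0 \<le> L" and lip: "\<And>d. (\<integral>x. (\<psi> (x + (d, 0)) - \<psi> x)\<^sup>2 \<partial>torus) \<le> L\<^sup>2 * d\<^sup>2"
    and H: "\<And>t. (\<integral>x. \<psi> x * (w (x + (0, t)) - w x) \<partial>torus) \<le> H t"
    and lim: "((\<lambda>t. H t / t) \<longlongrightarrow> H') (at 0)"
  shows "\<bar>(\<integral>x. \<psi> x * v x \<partial>torus) - H'\<bar> \<le> L * \<gamma>"
proof -
  define I where "I t = (\<integral>x. \<psi> x * tavg (seg (0, t)) v x \<partial>torus)" for t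
  have I: "((\<lambda>t. I t - H t / t) \<longlongrightarrow> (\<integral>x. \<psi> x * v x \<partial>torus) - H') (at 0)"
  proof (intro tendsto_diff lim)
    have "((\<lambda>t. \<integral>x. \<psi> x * tavg (seg (t *\<^sub>R (0, 1))) v x \<partial>torus) \<longlongrightarrow> (\<integral>x. \<psi> x * v x \<partial>torus)) (at 0)"
      by (rule tendsto_integral_mult_Linf[OF \<psi> tavg_L1p[OF bprob_seg v_L1p] v_L1p tavg_seg_L1_tendsto[OF v_L1p]])
    then show "(I \<longlongrightarrow> (\<integral>x. \<psi> x * v x \<partial>torus)) (at 0)" by (simp add: I_def[abs_def])
  qed
  have key: "t * I t \<le> H t + \<bar>t\<bar> * (L * \<gamma>)" for t
    using weak_equation[OF \<psi> L lip, of t] H[of t] unfolding I_def by linarith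
  have "(\<integral>x. \<psi> x * v x \<partial>torus) - H' \<le> L * \<gamma>"
  proof (rule tendsto_upperbound)
    show "((\<lambda>t. I t - H t / t) \<longlongrightarrow> (\<integral>x. \<psi> x * v x \<partial>torus) - H') (at_right 0)"
      using I by (simp add: filterlim_at_split)
    show "\<forall>\<^sub>F t in at_right 0. I t - H t / t \<le> L * \<gamma>"
      unfolding eventually_at_filter
    proof (intro always_eventually allI impI)
      fix t :: real assume "t \<in> {0<..}"
      then have t: "0 < t" by simp
      have "(I t - H t / t) * t \<le> L * \<gamma> * t" using key[of t] t by (simp add: algebra_simps)
      then show "I t - H t / t \<le> L * \<gamma>" using t by (rule mult_right_le_imp_le)
    qed
  qed simp
  moreover have "- (L * \<gamma>) \<le> (\<integral>x. \<psi> x * v x \<partial>torus) - H'"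
  proof (rule tendsto_lowerbound)
    show "((\<lambda>t. I t - H t / t) \<longlongrightarrow> (\<integral>x. \<psi> x * v x \<partial>torus) - H') (at_left 0)"
      using I by (simp add: filterlim_at_split)
    show "\<forall>\<^sub>F t in at_left 0. - (L * \<gamma>) \<le> I t - H t / t"
      unfolding eventually_at_filter
    proof (intro always_eventually allI impI)
      fix t :: real assume "t \<in> {..<0}"
      then have t: "t < 0" by simp
      have "- (L * \<gamma>) * (- t) \<le> (I t - H t / t) * (- t)" using key[of t] t by (simp add: algebra_simps)
      then show "- (L * \<gamma>) \<le> I t - H t / t" using t by (intro mult_right_le_imp_le[of "- (L * \<gamma>)" "- t"]) auto
    qed
  qed simp
  ultimately show ?thesis by linarith
qed

end

subsection \<open>The cubic estimate for increments in the first variable\<close>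

lemma L2p_const: "L2p (\<lambda>x. c)"
  by (rule Linf_L2p[of "\<bar>c\<bar>"]) (simp add: Linf_def periodic_const)

lemma dL2_const: "dL2 (\<lambda>x. c) (\<lambda>x. 0)"
proof -
  have "dquot (\<lambda>x. c) = (\<lambda>d x. 0)" by (intro ext) (simp add: dquot_def)
  then show ?thesis by (simp add: dL2_def L2p_const L2lim_const)
qed

lemma Linf_comp:
  assumes f: "f \<in> borel_measurable borel" "periodic f" and [measurable]: "\<Phi> \<in> borel_measurable borel" and B: "\<And>s. \<bar>\<Phi> s\<bar> \<le> B"
  shows "Linf B (\<lambda>x. \<Phi> (f x))"
  using f B by (auto simp: Linf_def periodic_def)

lemma trunc_abs_le: "0 < N \<Longrightarrow> \<bar>trunc N s\<bar> \<le> N" "0 < N \<Longrightarrow> \<bar>(trunc N s)\<^sup>2 / 2\<bar> \<le> N\<^sup>2 / 2"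
  using trunc_bounds[of N s] by (auto intro: power_mono)

lemma dL2_trunc1: "0 < N \<Longrightarrow> dL2 u u' \<Longrightarrow> dL2 (\<lambda>x. trunc1 N (u x)) (\<lambda>x. trunc N (u x) * u' x)"
  by (rule dL2_chain[where B = N and K = 1]) (auto simp: DERIV_trunc1 trunc_abs_le trunc_Lipschitz)

lemma dL2_trunc2: "0 < N \<Longrightarrow> dL2 u u' \<Longrightarrow> dL2 (\<lambda>x. trunc2 N (u x)) (\<lambda>x. (trunc N (u x))\<^sup>2 / 2 * u' x)"
  by (rule dL2_chain[where B = "N\<^sup>2 / 2" and K = N])
     (simp_all add: DERIV_trunc2 trunc_abs_le(2)[simplified] trunc_sq_Lipschitz[simplified])

lemma dL2_mean_zero: "dL2 u u' \<Longrightarrow> (\<integral>x. u' x \<partial>torus) = 0"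
  using dL2_parts[OF dL2_const[of 1]] by simp

context burgers
begin

lemma D_measurable [measurable]: "D h \<in> borel_measurable borel" and D_periodic: "periodic (D h)"
  using D_L2p[of h] by auto

lemma dL2_D: "dL2 (D h) (\<lambda>x. b (x + (h, 0)) - b x)"
  unfolding D_def[abs_def] by (rule dL2_diff[OF dL2_shift[OF dL2_w] dL2_w])

lemma trunc_D_Linf: "0 < N \<Longrightarrow> Linf N (\<lambda>x. trunc N (D h x))"
  by (rule Linf_comp[OF D_measurable D_periodic trunc_measurable trunc_abs_le(1)])

lemma trunc_D_sq_Linf: "0 < N \<Longrightarrow> Linf (N\<^sup>2 / 2) (\<lambda>x. (trunc N (D h x))\<^sup>2 / 2)"
  by (rule Linf_comp[OF D_measurable D_periodic, where \<Phi> = "\<lambda>s. (trunc N s)\<^sup>2 / 2"]) (use trunc_abs_le(2) in auto)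

lemma D_D_commute: "D h (x + (d, 0)) - D h x = D d (x + (h, 0)) - D d x"
  by (simp add: D_def ac_simps)

text \<open>The x1-increment of \<open>D h\<close> by d is the difference of \<open>D d\<close> at
  two points, and each of them is controlled by \<open>D_Lipschitz\<close>.\<close>

lemma trunc_D_Lipschitz:
  assumes N: "0 < N"
  shows "(\<integral>x. (trunc N (D h (x + (d, 0))) - trunc N (D h x))\<^sup>2 \<partial>torus) \<le> 4 * (\<beta>\<^sup>2 * d\<^sup>2)"
proof -
  note S2 = Linf_L2p[OF trunc_D_Linf[OF N, of h]]
  have "(\<integral>x. (trunc N (D h (x + (d, 0))) - trunc N (D h x))\<^sup>2 \<partial>torus) \<le>
      2 * (\<integral>x. (D d (x + (h, 0)))\<^sup>2 \<partial>torus) + 2 * (\<integral>x. (D d x)\<^sup>2 \<partial>torus)"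
  proof (rule integral_square_le_2)
    show "L2p (\<lambda>x. trunc N (D h (x + (d, 0))) - trunc N (D h x))"
      by (rule L2p_diff[OF L2p_shift[OF S2] S2])
    show "\<bar>trunc N (D h (x + (d, 0))) - trunc N (D h x)\<bar> \<le> \<bar>D d (x + (h, 0))\<bar> + \<bar>D d x\<bar>" for x
      using trunc_Lipschitz[of N "D h (x + (d, 0))" "D h x"] D_D_commute[of h x d] by linarith
  qed (rule L2p_shift[OF D_L2p] D_L2p)+
  also have "\<dots> = 4 * (\<integral>x. (D d x)\<^sup>2 \<partial>torus)" by (simp add: integral_square_shift[OF D_L2p])
  also have "\<dots> \<le> 4 * (\<beta>\<^sup>2 * d\<^sup>2)" by (intro mult_left_mono D_Lipschitz) auto
  finally show ?thesis .
qed

text \<open>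
  By convexity \<open>S(D) (D(\<cdot> + t e\<^sub>2) - D)\<close> has a nonpositive integral for both signs of \<open>t\<close>, so that the
  left side of the equation drops out in the limit \<open>t \<rightarrow> 0\<close>.
\<close>

lemma flux_bound_increment:
  assumes N: "0 < N"
  shows "\<bar>\<integral>x. trunc N (D h x) * (v (x + (h, 0)) - v x) \<partial>torus\<bar> \<le> 4 * \<beta> * \<gamma>"
proof -
  define S where "S x = trunc N (D h x)" for x
  have S: "Linf N S" unfolding S_def[abs_def] by (rule trunc_D_Linf[OF N])
  note S2 = Linf_L2p[OF S]
  define \<psi> where "\<psi> x = S (x + (- h, 0)) - S x" for x
  have LS: "Linf N (\<lambda>x. S (x + (- h, 0)))" by (rule Linf_shift[OF S])
  have pm: "\<psi> \<in> borel_measurable borel" "periodic \<psi>"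
    using LS S unfolding \<psi>_def[abs_def] by (auto intro!: periodic_diff)
  have \<psi>: "Linf (2 * N) \<psi>"
    unfolding Linf_def
  proof (intro conjI allI pm)
    fix x show "\<bar>\<psi> x\<bar> \<le> 2 * N"
      using LinfD(3)[OF S, of x] LinfD(3)[OF LS, of x] unfolding \<psi>_def by linarith
  qed
  \<comment> \<open>An increment of S has L2 norm at most 2 \<beta> |d|, and \<psi> is the
    difference of two translates of S.\<close>
  have lip: "(\<integral>x. (\<psi> (x + (d, 0)) - \<psi> x)\<^sup>2 \<partial>torus) \<le> (4 * \<beta>)\<^sup>2 * d\<^sup>2" for d
  proof -
    have dS: "L2p (\<lambda>x. S (x + (d, 0)) - S x)" by (rule L2p_diff[OF L2p_shift[OF S2] S2])
    have "(\<integral>x. (\<psi> (x + (d, 0)) - \<psi> x)\<^sup>2 \<partial>torus) \<le>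
        2 * (\<integral>x. (S (x + (- h, 0) + (d, 0)) - S (x + (- h, 0)))\<^sup>2 \<partial>torus) + 2 * (\<integral>x. (S (x + (d, 0)) - S x)\<^sup>2 \<partial>torus)"
    proof (rule integral_square_le_2)
      show "\<bar>\<psi> (x + (d, 0)) - \<psi> x\<bar> \<le> \<bar>S (x + (- h, 0) + (d, 0)) - S (x + (- h, 0))\<bar> + \<bar>S (x + (d, 0)) - S x\<bar>" for x
        unfolding \<psi>_def by (simp add: ac_simps)
      show "L2p (\<lambda>x. S (x + (- h, 0) + (d, 0)) - S (x + (- h, 0)))" by (rule L2p_shift[OF dS])
      show "L2p (\<lambda>x. \<psi> (x + (d, 0)) - \<psi> x)"
        by (rule L2p_diff[OF L2p_shift]) (use Linf_L2p[OF \<psi>] in auto)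
    qed (rule dS)
    also have "\<dots> = 4 * (\<integral>x. (S (x + (d, 0)) - S x)\<^sup>2 \<partial>torus)"
      by (simp add: integral_square_shift[OF dS])
    also have "\<dots> \<le> 4 * (4 * (\<beta>\<^sup>2 * d\<^sup>2))"
      unfolding S_def by (intro mult_left_mono trunc_D_Lipschitz[OF N]) auto
    finally show ?thesis by (simp add: power_mult_distrib)
  qed
  \<comment> \<open>The translation is moved from S to f. Testing the equation for w with \<psi>
    thus amounts to testing the equation for the increment of w with S.\<close>
  have sum_parts: "(\<integral>x. \<psi> x * f x \<partial>torus) = (\<integral>x. S x * (f (x + (h, 0)) - f x) \<partial>torus)" if f: "L1p f" for f
  proof -
    have i: "integrable torus (\<lambda>x. S (x + (- h, 0)) * f x)" "integrable torus (\<lambda>x. S x * f x)"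
        "integrable torus (\<lambda>x. S x * f (x + (h, 0)))"
      by (intro L1pD(3) L1p_mult_Linf[OF LS f] L1p_mult_Linf[OF S f] L1p_mult_Linf[OF S L1p_shift[OF f]])+
    have s: "(\<integral>x. S x * f (x + (h, 0)) \<partial>torus) = (\<integral>x. S (x + (- h, 0)) * f x \<partial>torus)"
    proof (rule integral_cong_shift[where y = "(h, 0)"])
      show "(\<lambda>x. S (x + (- h, 0)) * f x) \<in> borel_measurable borel" "periodic (\<lambda>x. S (x + (- h, 0)) * f x)"
        using L1p_mult_Linf[OF LS f] by auto
      show "S x * f (x + (h, 0)) = S (x + (h, 0) + (- h, 0)) * f (x + (h, 0))" for x
        by (simp add: add.assoc zero_prod_def[symmetric])
    qed
    have "(\<integral>x. \<psi> x * f x \<partial>torus) = (\<integral>x. S (x + (- h, 0)) * f x \<partial>torus) - (\<integral>x. S x * f x \<partial>torus)"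
      using i by (simp add: \<psi>_def left_diff_distrib)
    also have "\<dots> = (\<integral>x. S x * (f (x + (h, 0)) - f x) \<partial>torus)"
      using i s by (simp add: right_diff_distrib)
    finally show ?thesis .
  qed
  have H: "(\<integral>x. \<psi> x * (w (x + (0, t)) - w x) \<partial>torus) \<le> 0" for t
  proof -
    have w1: "L1p (\<lambda>x. w (x + (0, t)) - w x)" by (rule L1p_diff[OF L1p_shift]) (use L2p_L1p[OF w] in auto)
    have P: "L2p (\<lambda>x. trunc1 N (D h x))" using dL2_L2p[OF dL2_trunc1[OF N dL2_D]] by auto
    note P1 = L2p_L1p[OF P]
    have "(\<integral>x. \<psi> x * (w (x + (0, t)) - w x) \<partial>torus) = (\<integral>x. S x * (D h (x + (0, t)) - D h x) \<partial>torus)"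
      unfolding sum_parts[OF w1] by (intro Bochner_Integration.integral_cong) (auto simp: D_def ac_simps)
    also have "\<dots> \<le> (\<integral>x. trunc1 N (D h (x + (0, t))) - trunc1 N (D h x) \<partial>torus)"
    proof (rule integral_mono)
      have "L1p (\<lambda>x. S x * (D h (x + (0, t)) - D h x))"
        by (rule L1p_mult_Linf[OF S L1p_diff[OF L1p_shift]]) (use L2p_L1p[OF D_L2p] in auto)
      then show "integrable torus (\<lambda>x. S x * (D h (x + (0, t)) - D h x))" by auto
      show "integrable torus (\<lambda>x. trunc1 N (D h (x + (0, t))) - trunc1 N (D h x))"
        using L1p_diff[OF L1p_shift[OF P1, of "(0, t)"] P1] by auto
      show "S x * (D h (x + (0, t)) - D h x) \<le> trunc1 N (D h (x + (0, t))) - trunc1 N (D h x)" for x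
        unfolding S_def by (rule trunc1_convex[OF N])
    qed
    also have "\<dots> = (\<integral>x. trunc1 N (D h (x + (0, t))) \<partial>torus) - (\<integral>x. trunc1 N (D h x) \<partial>torus)"
      using L1pD(3)[OF L1p_shift[OF P1, of "(0, t)"]] L1pD(3)[OF P1] by (rule Bochner_Integration.integral_diff)
    also have "(\<integral>x. trunc1 N (D h (x + (0, t))) \<partial>torus) = (\<integral>x. trunc1 N (D h x) \<partial>torus)"
      using P1 by (intro integral_torus_shift[where f = "\<lambda>x. trunc1 N (D h x)"]) auto
    finally show ?thesis by simp
  qed
  have "\<bar>(\<integral>x. \<psi> x * v x \<partial>torus) - 0\<bar> \<le> 4 * \<beta> * \<gamma>"
    by (rule weak_equation_limit[OF \<psi> _ lip H]) (use nonneg in auto)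
  then show ?thesis by (simp add: sum_parts[OF v_L1p] S_def)
qed

text \<open>
  Polarisation: with \<open>A = w(\<cdot> + h e\<^sub>1) + w\<close> the increment of \<open>w \<partial>\<^sub>1 w\<close> is \<open>(D \<partial>\<^sub>1 A + A \<partial>\<^sub>1 D) / 2\<close>, and
  \<open>S(D) \<partial>\<^sub>1 D\<close> can be integrated by parts.
\<close>

lemma flux_identity:
  assumes N: "0 < N"
  shows "(\<integral>x. trunc N (D h x) * (v (x + (h, 0)) - v x) \<partial>torus) = (\<integral>x. (trunc N (D h x))\<^sup>2 / 2 * b (x + (h, 0)) \<partial>torus)"
proof -
  define S where "S x = trunc N (D h x)" for x
  define A where "A x = w (x + (h, 0)) + w x" for x
  define A' where "A' x = b (x + (h, 0)) + b x" for x
  define D' where "D' x = b (x + (h, 0)) - b x" for x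
  have S: "Linf N S" unfolding S_def[abs_def] by (rule trunc_D_Linf[OF N])
  have Q: "Linf (N\<^sup>2 / 2) (\<lambda>x. (S x)\<^sup>2 / 2)" unfolding S_def by (rule trunc_D_sq_Linf[OF N])
  have dA: "dL2 A A'" unfolding A_def[abs_def] A'_def[abs_def] by (rule dL2_add[OF dL2_shift[OF dL2_w] dL2_w])
  have dD: "dL2 (D h) D'" unfolding D'_def[abs_def] by (rule dL2_D)
  have dP: "dL2 (\<lambda>x. trunc1 N (D h x)) (\<lambda>x. S x * D' x)" unfolding S_def by (rule dL2_trunc1[OF N dD])
  note m = dL2_L2p[OF dA] dL2_L2p[OF dD] dL2_L2p[OF dP]
  have SD: "L2p (\<lambda>x. S x * D h x)" by (rule L2p_mult_Linf[OF S m(3)])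
  have b': "L2p (\<lambda>x. b (x + (h, 0)))" by (rule L2p_shift[OF b])
  have i: "integrable torus (\<lambda>x. S x * D h x * A' x)" "integrable torus (\<lambda>x. A x * (S x * D' x))"
      "integrable torus (\<lambda>x. A' x * trunc1 N (D h x))" "integrable torus (\<lambda>x. (S x)\<^sup>2 / 2 * b (x + (h, 0)))"
      "integrable torus (\<lambda>x. (S x)\<^sup>2 / 2 * D' x)"
    by (intro L1pD(3) L2p_L1p_mult SD m b' L2p_mult_Linf[OF S] Linf_L2p[OF Q])+
  have "(\<integral>x. trunc N (D h x) * (v (x + (h, 0)) - v x) \<partial>torus) =
      (\<integral>x. (S x * D h x * A' x + A x * (S x * D' x)) / 2 \<partial>torus)"
    by (intro Bochner_Integration.integral_cong) (auto simp: S_def v_def A_def A'_def D'_def D_def algebra_simps)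
  also have "\<dots> = ((\<integral>x. S x * D h x * A' x \<partial>torus) + (\<integral>x. A x * (S x * D' x) \<partial>torus)) / 2"
    using i by simp
  also have "(\<integral>x. A x * (S x * D' x) \<partial>torus) = - (\<integral>x. A' x * trunc1 N (D h x) \<partial>torus)"
    by (rule dL2_parts[OF dA dP])
  also have "((\<integral>x. S x * D h x * A' x \<partial>torus) + - (\<integral>x. A' x * trunc1 N (D h x) \<partial>torus)) / 2 =
      (\<integral>x. (S x * D h x * A' x - A' x * trunc1 N (D h x)) / 2 \<partial>torus)"
    using i by simp
  also have "\<dots> = (\<integral>x. (S x)\<^sup>2 / 2 * b (x + (h, 0)) - (S x)\<^sup>2 / 2 * D' x / 2 \<partial>torus)"
  proof (intro Bochner_Integration.integral_cong refl)
    fix x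
    have "S x * D h x * A' x - A' x * trunc1 N (D h x) = (S x * D h x - trunc1 N (D h x)) * A' x"
      by (simp add: algebra_simps)
    also have "\<dots> = (S x)\<^sup>2 / 2 * A' x" unfolding S_def trunc_trunc1[OF N] ..
    also have "\<dots> / 2 = (S x)\<^sup>2 / 2 * b (x + (h, 0)) - (S x)\<^sup>2 / 2 * D' x / 2"
      unfolding A'_def D'_def by (simp add: field_simps)
    finally show "(S x * D h x * A' x - A' x * trunc1 N (D h x)) / 2 = (S x)\<^sup>2 / 2 * b (x + (h, 0)) - (S x)\<^sup>2 / 2 * D' x / 2" .
  qed
  also have "\<dots> = (\<integral>x. (S x)\<^sup>2 / 2 * b (x + (h, 0)) \<partial>torus) - (\<integral>x. (S x)\<^sup>2 / 2 * D' x \<partial>torus) / 2"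
    using i(4) integrable_divide[OF i(5), of 2] by simp
  also have "(\<integral>x. (S x)\<^sup>2 / 2 * D' x \<partial>torus) = 0"
    unfolding S_def by (rule dL2_mean_zero[OF dL2_trunc2[OF N dD]])
  finally show ?thesis by (simp add: S_def)
qed

lemma trunc2_D_L2p: "0 < N \<Longrightarrow> L2p (\<lambda>x. trunc2 N (D h x))"
  using dL2_L2p(1)[OF dL2_trunc2[OF _ dL2_D]] by blast

text \<open>Formally the h-derivative of \<open>D h\<close> is b(x + h e1). The limit is taken after
  integration: the first order term converges in L2, and the remainder is at most N \<beta>^2 |d|.
  So the level N and the norm of b alone occur only in a quantity that vanishes in the
  limit.\<close>

lemma DERIV_integral_trunc2:
  assumes N: "0 < N"
  shows "((\<lambda>h. \<integral>x. trunc2 N (D h x) \<partial>torus) has_real_derivative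
     (\<integral>x. (trunc N (D h x))\<^sup>2 / 2 * b (x + (h, 0)) \<partial>torus)) (at h)"
  unfolding DERIV_def
proof (rule LIM_zero_cancel, rule Lim_null_comparison)
  define Q where "Q x = (trunc N (D h x))\<^sup>2 / 2" for x
  define J where "J d = (\<integral>x. Q x * dquot w d (x + (h, 0)) \<partial>torus)" for d
  have Q: "Linf (N\<^sup>2 / 2) Q" unfolding Q_def[abs_def] by (rule trunc_D_sq_Linf[OF N])
  note T1 = L2p_L1p[OF trunc2_D_L2p[OF N]]
  have J: "(J \<longlongrightarrow> (\<integral>x. Q x * b (x + (h, 0)) \<partial>torus)) (at 0)"
    unfolding J_def[abs_def]
    using dL2_w by (intro L2lim_prod L2lim_const L2lim_shift Linf_L2p[OF Q]) (auto simp: dL2_def)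
  have step: "D (h + d) x = D h x + D d (x + (h, 0))" for d x by (simp add: D_def ac_simps)
  have key: "\<bar>((\<integral>x. trunc2 N (D (h + d) x) \<partial>torus) - (\<integral>x. trunc2 N (D h x) \<partial>torus)) / d - J d\<bar> \<le> N * \<beta>\<^sup>2 * \<bar>d\<bar>" if d: "d \<noteq> 0" for d
  proof -
    have Dd: "L2p (\<lambda>x. D d (x + (h, 0)))" by (rule L2p_shift[OF D_L2p])
    have QD: "L1p (\<lambda>x. Q x * D d (x + (h, 0)))" by (rule L1p_mult_Linf[OF Q L2p_L1p[OF Dd]])
    have i: "integrable torus (\<lambda>x. trunc2 N (D (h + d) x))" "integrable torus (\<lambda>x. trunc2 N (D h x))"
      "integrable torus (\<lambda>x. Q x * D d (x + (h, 0)))"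
      using T1 QD by auto
    have "J d = (\<integral>x. Q x * D d (x + (h, 0)) / d \<partial>torus)"
      unfolding J_def dquot_def D_def by (intro Bochner_Integration.integral_cong) auto
    then have "J d = (\<integral>x. Q x * D d (x + (h, 0)) \<partial>torus) / d" by simp
    then have "\<bar>((\<integral>x. trunc2 N (D (h + d) x) \<partial>torus) - (\<integral>x. trunc2 N (D h x) \<partial>torus)) / d - J d\<bar> =
      \<bar>\<integral>x. trunc2 N (D (h + d) x) - trunc2 N (D h x) - Q x * D d (x + (h, 0)) \<partial>torus\<bar> / \<bar>d\<bar>"
      using i by (simp add: diff_divide_distrib flip: abs_divide)
    also have "\<dots> \<le> (\<integral>x. N * (D d (x + (h, 0)))\<^sup>2 \<partial>torus) / \<bar>d\<bar>"
    proof (intro divide_right_mono order_trans[OF integral_abs_bound] integral_mono)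
      show "integrable torus (\<lambda>x. \<bar>trunc2 N (D (h + d) x) - trunc2 N (D h x) - Q x * D d (x + (h, 0))\<bar>)"
        using i by auto
      show "integrable torus (\<lambda>x. N * (D d (x + (h, 0)))\<^sup>2)" using Dd by auto
      fix x
      have "\<bar>trunc2 N (D h x + D d (x + (h, 0))) - trunc2 N (D h x) - (trunc N (D h x))\<^sup>2 / 2 * (D h x + D d (x + (h, 0)) - D h x)\<bar>
        \<le> min (2 * (N\<^sup>2 / 2)) (N * \<bar>D h x + D d (x + (h, 0)) - D h x\<bar>) * \<bar>D h x + D d (x + (h, 0)) - D h x\<bar>"
        by (rule C1_remainder[OF DERIV_trunc2[OF N] trunc_abs_le(2)[OF N] trunc_sq_Lipschitz[OF N]]) (use N in auto)
      also have "\<dots> \<le> N * \<bar>D d (x + (h, 0))\<bar> * \<bar>D d (x + (h, 0))\<bar>"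
        using N by (intro mult_mono) auto
      finally show "\<bar>trunc2 N (D (h + d) x) - trunc2 N (D h x) - Q x * D d (x + (h, 0))\<bar> \<le> N * (D d (x + (h, 0)))\<^sup>2"
        by (simp add: step Q_def power2_eq_square)
    qed simp
    also have "\<dots> = N * (\<integral>x. (D d x)\<^sup>2 \<partial>torus) / \<bar>d\<bar>" by (simp add: integral_square_shift[OF D_L2p])
    also have "\<dots> \<le> N * (\<beta>\<^sup>2 * d\<^sup>2) / \<bar>d\<bar>"
      using N by (intro divide_right_mono mult_left_mono D_Lipschitz) auto
    also have "\<dots> = N * \<beta>\<^sup>2 * \<bar>d\<bar>" using d by (simp add: field_simps power2_eq_square)
    finally show ?thesis .
  qed
  show "\<forall>\<^sub>F d in at 0. norm (((\<integral>x. trunc2 N (D (h + d) x) \<partial>torus) - (\<integral>x. trunc2 N (D h x) \<partial>torus)) / d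
      - (\<integral>x. (trunc N (D h x))\<^sup>2 / 2 * b (x + (h, 0)) \<partial>torus)) \<le>
      N * \<beta>\<^sup>2 * \<bar>d\<bar> + \<bar>J d - (\<integral>x. Q x * b (x + (h, 0)) \<partial>torus)\<bar>"
    unfolding eventually_at_filter
  proof (intro always_eventually allI impI)
    fix d :: real assume "d \<noteq> 0"
    from key[OF this] show "norm (((\<integral>x. trunc2 N (D (h + d) x) \<partial>torus) - (\<integral>x. trunc2 N (D h x) \<partial>torus)) / d
      - (\<integral>x. (trunc N (D h x))\<^sup>2 / 2 * b (x + (h, 0)) \<partial>torus)) \<le>
      N * \<beta>\<^sup>2 * \<bar>d\<bar> + \<bar>J d - (\<integral>x. Q x * b (x + (h, 0)) \<partial>torus)\<bar>"
      unfolding Q_def real_norm_def by linarith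
  qed
  have "((\<lambda>d. N * \<beta>\<^sup>2 * \<bar>d\<bar> + \<bar>J d - (\<integral>x. Q x * b (x + (h, 0)) \<partial>torus)\<bar>) \<longlongrightarrow>
      N * \<beta>\<^sup>2 * \<bar>0\<bar> + \<bar>(\<integral>x. Q x * b (x + (h, 0)) \<partial>torus) - (\<integral>x. Q x * b (x + (h, 0)) \<partial>torus)\<bar>) (at 0)"
    by (intro tendsto_intros J)
  then show "((\<lambda>d. N * \<beta>\<^sup>2 * \<bar>d\<bar> + \<bar>J d - (\<integral>x. Q x * b (x + (h, 0)) \<partial>torus)\<bar>) \<longlongrightarrow> 0) (at 0)" by simp
qed

text \<open>The integral vanishes at h = 0, and its h-derivative is the flux bounded in
  \<open>flux_bound_increment\<close>.\<close>

lemma integral_trunc2_le: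
  assumes N: "0 < N" shows "(\<integral>x. trunc2 N (D h x) \<partial>torus) \<le> 4 * \<beta> * \<gamma> * \<bar>h\<bar>"
proof -
  have bound: "\<bar>\<integral>x. (trunc N (D h x))\<^sup>2 / 2 * b (x + (h, 0)) \<partial>torus\<bar> \<le> 4 * \<beta> * \<gamma>" for h
    using flux_bound_increment[OF N, of h] flux_identity[OF N, of h] by simp
  have "D 0 x = 0" for x by (simp add: D_def zero_prod_def[symmetric])
  then have "(\<integral>x. trunc2 N (D 0 x) \<partial>torus) = 0" using N by (simp add: trunc2_def max_def)
  with C1_Lipschitz[OF DERIV_integral_trunc2[OF N] bound, of h 0] show ?thesis by simp
qed

lemma integral_trunc_cube_le:
  assumes N: "0 < N" shows "(\<integral>x. trunc N (D h x) ^ 3 \<partial>torus) \<le> 24 * \<beta> * \<gamma> * \<bar>h\<bar>"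
proof -
  have "(\<integral>x. trunc N (D h x) ^ 3 \<partial>torus) \<le> (\<integral>x. 6 * trunc2 N (D h x) \<partial>torus)"
  proof (rule integral_mono)
    show "integrable torus (\<lambda>x. trunc N (D h x) ^ 3)"
      by (rule integrable_torus_const_bound[of _ "N ^ 3"])
         (use trunc_bounds[OF N] in \<open>auto intro!: power_mono\<close>)
    show "integrable torus (\<lambda>x. 6 * trunc2 N (D h x))"
      using L2p_L1p[OF trunc2_D_L2p[OF N]] by auto
  qed (rule trunc2_ge[OF N])
  also have "\<dots> \<le> 24 * \<beta> * \<gamma> * \<bar>h\<bar>" using integral_trunc2_le[OF N, of h] by (simp add: ac_simps)
  finally show ?thesis .
qed

text \<open>The bound for the truncated cube does not depend on the level, so monotone convergence
  removes the truncation.\<close>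

lemma pos_part_cube_le: "(\<integral>\<^sup>+x. ennreal (max 0 (D h x) ^ 3) \<partial>torus) \<le> ennreal (24 * \<beta> * \<gamma> * \<bar>h\<bar>)"
proof -
  have "(\<lambda>n. \<integral>\<^sup>+x. ennreal (trunc (real (Suc n)) (D h x) ^ 3) \<partial>torus) \<longlonglongrightarrow> (\<integral>\<^sup>+x. ennreal (max 0 (D h x) ^ 3) \<partial>torus)"
  proof (rule nn_integral_LIMSEQ)
    show "incseq (\<lambda>n x. ennreal (trunc (real (Suc n)) (D h x) ^ 3))"
      by (auto simp: incseq_def le_fun_def trunc_def intro!: ennreal_leI power_mono)
    show "(\<lambda>n. ennreal (trunc (real (Suc n)) (D h x) ^ 3)) \<longlonglongrightarrow> ennreal (max 0 (D h x) ^ 3)" for x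
      by (intro tendsto_ennrealI tendsto_power trunc_tendsto)
  qed measurable
  then show ?thesis
  proof (rule LIMSEQ_le_const2, intro exI allI impI)
    fix n
    have N: "0 < real (Suc n)" by simp
    have "(\<integral>\<^sup>+x. ennreal (trunc (real (Suc n)) (D h x) ^ 3) \<partial>torus) = ennreal (\<integral>x. trunc (real (Suc n)) (D h x) ^ 3 \<partial>torus)"
    proof (rule nn_integral_eq_integral)
      show "integrable torus (\<lambda>x. trunc (real (Suc n)) (D h x) ^ 3)"
        by (rule integrable_torus_const_bound[of _ "real (Suc n) ^ 3"])
           (use trunc_bounds[OF N] in \<open>auto intro!: power_mono\<close>)
    qed (use trunc_bounds[OF N] in auto)
    also have "\<dots> \<le> ennreal (24 * \<beta> * \<gamma> * \<bar>h\<bar>)" by (intro ennreal_leI integral_trunc_cube_le N)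
    finally show "(\<integral>\<^sup>+x. ennreal (trunc (real (Suc n)) (D h x) ^ 3) \<partial>torus) \<le> ennreal (24 * \<beta> * \<gamma> * \<bar>h\<bar>)" .
  qed
qed

text \<open>The negative part of the increment with step h is a translate of the positive part with
  step -h; hence twice 24.\<close>

lemma increment_cube_le: "(\<integral>\<^sup>+x. ennreal (\<bar>w (x + (h, 0)) - w x\<bar> ^ 3) \<partial>torus) \<le> ennreal (48 * \<beta> * \<gamma> * \<bar>h\<bar>)"
proof -
  have neg: "- D h x = D (- h) (x + (h, 0))" for x
    by (simp add: D_def add.assoc zero_prod_def[symmetric])
  have "(\<integral>\<^sup>+x. ennreal (\<bar>D h x\<bar> ^ 3) \<partial>torus) =
     (\<integral>\<^sup>+x. ennreal (max 0 (D h x) ^ 3) + ennreal (max 0 (D (- h) (x + (h, 0))) ^ 3) \<partial>torus)"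
    unfolding neg[symmetric] by (intro nn_integral_cong) (auto simp: max_def abs_if ennreal_plus[symmetric] simp del: ennreal_plus)
  also have "\<dots> = (\<integral>\<^sup>+x. ennreal (max 0 (D h x) ^ 3) \<partial>torus) + (\<integral>\<^sup>+x. ennreal (max 0 (D (- h) (x + (h, 0))) ^ 3) \<partial>torus)"
    by (rule nn_integral_add) measurable
  also have "(\<integral>\<^sup>+x. ennreal (max 0 (D (- h) (x + (h, 0))) ^ 3) \<partial>torus) = (\<integral>\<^sup>+x. ennreal (max 0 (D (- h) x) ^ 3) \<partial>torus)"
    by (rule nn_integral_torus_shift[where f = "\<lambda>x. ennreal (max 0 (D (- h) x) ^ 3)"])
       (measurable, rule periodic_comp[OF D_periodic])
  also have "(\<integral>\<^sup>+x. ennreal (max 0 (D h x) ^ 3) \<partial>torus) + \<dots> \<le> ennreal (24 * \<beta> * \<gamma> * \<bar>h\<bar>) + ennreal (24 * \<beta> * \<gamma> * \<bar>h\<bar>)"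
    using pos_part_cube_le[of h] pos_part_cube_le[of "- h"] by (intro add_mono) auto
  also have "\<dots> = ennreal (48 * \<beta> * \<gamma> * \<bar>h\<bar>)"
    using nonneg by (subst ennreal_plus[symmetric]) auto
  finally show ?thesis by (simp add: D_def)
qed

end

subsection \<open>Bounds on lines parallel to the first axis\<close>

lemma AE_seg_segment: "AE z in seg v. z \<in> closed_segment 0 v"
proof -
  have "closed_segment 0 v \<in> sets borel" by (intro borel_closed closed_segment)
  moreover have "AE t in unit01. t *\<^sub>R v \<in> closed_segment 0 v"
    using AE_unit01 by eventually_elim (auto simp: closed_segment_def)
  ultimately show ?thesis unfolding seg_def by (subst AE_distr_iff) auto
qed

lemma tavg_seg_L1_segment:
  assumes f: "L1p f" and e: "0 \<le> e" and le: "\<And>s. 0 \<le> s \<Longrightarrow> s \<le> 1 \<Longrightarrow> modL1 f (s *\<^sub>R v) \<le> e"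
  shows "(\<integral>x. \<bar>tavg (seg v) f x - f x\<bar> \<partial>torus) \<le> e"
proof -
  have "ennreal (\<integral>x. \<bar>tavg (seg v) f x - f x\<bar> \<partial>torus) \<le> (\<integral>\<^sup>+y. ennreal (modL1 f y) \<partial>seg v)"
    by (rule tavg_minus_L1[OF bprob_seg f])
  also have "\<dots> \<le> ennreal e"
  proof (rule nn_integral_prob_le)
    show "prob_space (seg v)" using bprob_seg[of v] by (simp add: bprob_def)
    show "AE z in seg v. ennreal (modL1 f z) \<le> ennreal e"
      using AE_seg_segment[of v] by eventually_elim (auto simp: closed_segment_def intro!: ennreal_leI le)
  qed
  finally show ?thesis using e by simp
qed

section \<open>Means over a full period in x1 and a kernel in x2 alone\<close>

lemma segA_0: "segA 0 = 1"
  using prob_space.prob_space[OF prob_space_unit01] by (simp add: segA_def)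

text \<open>A unit segment along e1 is a full period, so averaging over it is the projection onto
  the frequencies with k1 = 0.\<close>

lemma segA_freq: "k \<in> freqs \<Longrightarrow> segA (fst k) = (if fst k = 0 then 1 else 0)"
proof -
  assume "k \<in> freqs"
  then obtain m :: int where m: "fst k = 2 * pi * of_int m" by (auto simp: freqs_def)
  have "\<i> * complex_of_real (fst k) * segA (fst k) = 0"
    unfolding segA_mult unfolding m by (simp add: cis_freq_1)
  then show ?thesis by (auto simp: segA_0)
qed

text \<open>The coefficient of frequency 0 in cos(pi s)^(2N), that is, the mean of this function
  over a period.\<close>

definition kcentre :: "nat \<Rightarrow> real"
  where "kcentre N = real (2*N choose N) / 4 ^ N"

definition kline :: "nat \<Rightarrow> (real \<times> real \<Rightarrow> real) \<Rightarrow> real \<Rightarrow> real"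
  where "kline N f r = (\<integral>x. cos (pi * (snd x - r)) ^ (2 * N) / kcentre N * f x \<partial>torus)"

lemma kcentre_pos: "0 < kcentre N"
  by (simp add: kcentre_def)

lemma cos_even_power_bounds: "0 \<le> cos (a :: real) ^ (2 * N)" "cos a ^ (2 * N) \<le> 1"
  unfolding power_mult by (rule zero_le_power, simp, rule power_le_one) (auto simp: abs_square_le_1)

lemma integrable_kline:
  assumes f: "L1p f" shows "integrable torus (\<lambda>x. cos (pi * (snd x - r)) ^ (2 * N) / kcentre N * f x)"
proof (rule integrable_torus_bound)
  have [measurable]: "f \<in> borel_measurable borel" using f by auto
  show "integrable torus (\<lambda>x. (1 / kcentre N) * \<bar>f x\<bar>)" using f by auto
  show "(\<lambda>x. cos (pi * (snd x - r)) ^ (2 * N) / kcentre N * f x) \<in> borel_measurable borel" by measurable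
  show "norm (cos (pi * (snd x - r)) ^ (2 * N) / kcentre N * f x) \<le> (1 / kcentre N) * \<bar>f x\<bar>" for x
    using cos_even_power_bounds[of "pi * (snd x - r)" N] kcentre_pos[of N]
    by (simp add: abs_mult divide_right_mono mult_left_le_one_le)
qed

lemma kline_cis:
  assumes f: "L1p f"
  shows "complex_of_real (kline N f r) = (\<Sum>j\<le>2*N. complex_of_real (real (2*N choose j) / 4 ^ N / kcentre N) *
      fc f (0, 2 * pi * (real j - real N)) * cis (2 * pi * (real j - real N) * r))"
proof -
  have "complex_of_real (kline N f r) = (\<integral>x. complex_of_real (cos (pi * (snd x - r)) ^ (2 * N) / kcentre N * f x) \<partial>torus)"
    unfolding kline_def by (rule integral_complex_of_real[symmetric])
  also have "\<dots> = (\<integral>x. (\<Sum>j\<le>2*N. complex_of_real (real (2*N choose j) / 4 ^ N / kcentre N) * cis (2 * pi * (real j - real N) * r) *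
      (complex_of_real (f x) * cis (- ((0, 2 * pi * (real j - real N)) \<bullet> x)))) \<partial>torus)"
  proof (intro Bochner_Integration.integral_cong refl)
    fix x :: "real \<times> real"
    have c: "cis (- (2 * pi * (real j - real N) * (snd x - r))) =
        cis (2 * pi * (real j - real N) * r) * cis (- ((0, 2 * pi * (real j - real N)) \<bullet> x))" for j
      by (simp add: cis_mult inner_prod_def algebra_simps)
    have "complex_of_real (cos (pi * (snd x - r)) ^ (2 * N) / kcentre N * f x) =
        complex_of_real (cos (pi * (snd x - r)) ^ (2 * N)) / complex_of_real (kcentre N) * complex_of_real (f x)"
      by simp
    also have "\<dots> = (\<Sum>j\<le>2*N. complex_of_real (real (2*N choose j) / 4 ^ N / kcentre N) * cis (2 * pi * (real j - real N) * r) *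
      (complex_of_real (f x) * cis (- ((0, 2 * pi * (real j - real N)) \<bullet> x))))"
      unfolding cos_power_cis c sum_divide_distrib sum_distrib_right by (intro sum.cong) auto
    finally show "complex_of_real (cos (pi * (snd x - r)) ^ (2 * N) / kcentre N * f x) = \<dots>" .
  qed
  also have "\<dots> = (\<Sum>j\<le>2*N. complex_of_real (real (2*N choose j) / 4 ^ N / kcentre N) *
      fc f (0, 2 * pi * (real j - real N)) * cis (2 * pi * (real j - real N) * r))"
    by (subst Bochner_Integration.integral_sum)
       (auto intro!: sum.cong integrable_mult_right integrable_fc f simp: fc_def)
  finally show ?thesis .
qed

text \<open>The mean over a period in x1 leaves only k1 = 0, that is, the first index N, and the
  kernel reduces to its factor in x2. The prefactor turns out to be 1 in \<open>Kmass_eq\<close>,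
  which is derived from the present identity for f = 1.\<close>

lemma tavg_ker_line:
  assumes f: "L1p f"
  shows "tavg (ker N) (tavg (seg (1, 0)) f) x = (kcentre N)\<^sup>2 / Kmass N * kline N f (snd x)"
proof -
  note A = tavg_L1p[OF bprob_seg f, of "(1, 0)"]
  have fcA: "fc (tavg (seg (1, 0)) f) (kfreq N i) = (if fst i = N then fc f (kfreq N i) else 0)" for i
    using fc_tavg_seg[OF f kfreq_freqs, of "(1, 0)" N i] segA_freq[OF kfreq_freqs, of N i]
    by (auto simp: inner_prod_def kfreq_def)
  have "complex_of_real (tavg (ker N) (tavg (seg (1, 0)) f) x) =
     (\<Sum>i\<le>2*N. \<Sum>j\<le>2*N. if i = N then complex_of_real (kcoef N (N, j)) * fc f (kfreq N (N, j)) * cis (kfreq N (N, j) \<bullet> x) else 0)"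
    unfolding tavg_ker_cis[OF A] kidx_def fcA sum.cartesian_product by (intro sum.cong) auto
  also have "\<dots> = (\<Sum>j\<le>2*N. \<Sum>i\<le>2*N. if i = N then complex_of_real (kcoef N (N, j)) * fc f (kfreq N (N, j)) * cis (kfreq N (N, j) \<bullet> x) else 0)"
    by (rule sum.swap)
  also have "\<dots> = (\<Sum>j\<le>2*N. complex_of_real (kcoef N (N, j)) * fc f (kfreq N (N, j)) * cis (kfreq N (N, j) \<bullet> x))"
    by (intro sum.cong refl, subst sum.delta) auto
  also have "\<dots> = complex_of_real ((kcentre N)\<^sup>2 / Kmass N) * complex_of_real (kline N f (snd x))"
  proof -
    have c: "kcoef N (N, j) = (kcentre N)\<^sup>2 / Kmass N * (real (2*N choose j) / 4 ^ N / kcentre N)" for j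
      using kcentre_pos[of N] unfolding kcoef_def fst_conv snd_conv kcentre_def[symmetric]
      by (simp add: power2_eq_square)
    have k: "kfreq N (N, j) = (0, 2 * pi * (real j - real N))" for j by (simp add: kfreq_def)
    have i: "(0, 2 * pi * (real j - real N)) \<bullet> x = 2 * pi * (real j - real N) * snd x" for j
      by (simp add: inner_prod_def)
    show ?thesis
      unfolding kline_cis[OF f] sum_distrib_left c k i of_real_mult
      by (intro sum.cong refl) (simp only: mult.assoc)
  qed
  finally show ?thesis by (simp only: of_real_eq_iff flip: of_real_mult)
qed

text \<open>A translation moves the difference quotient from f to the weight \<rho>, where it is
  bounded by C and converges pointwise. Dominated convergence is applied along sequences.\<close>

lemma line_quotient_tendsto:
  assumes f: "L1p f" and D: "\<And>s. (\<rho> has_real_derivative \<rho>' s) (at s)" and C: "\<And>s. \<bar>\<rho>' s\<bar> \<le> C"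
    and per: "\<And>s. \<rho> (s + 1) = \<rho> s"
  shows "((\<lambda>t. (\<integral>x. \<rho> (snd x) * (f (x + (0, t)) - f x) \<partial>torus) / t) \<longlongrightarrow> - (\<integral>x. \<rho>' (snd x) * f x \<partial>torus)) (at 0)"
proof -
  have [measurable]: "f \<in> borel_measurable borel" and pf: "periodic f" using f by auto
  have [measurable]: "\<rho> \<in> borel_measurable borel" by (rule borel_measurable_C1[OF D])
  have cont: "continuous_on UNIV \<rho>" using D by (intro continuous_at_imp_continuous_on ballI DERIV_isCont)
  obtain B where B: "\<forall>s\<in>{0..1}. \<bar>\<rho> s\<bar> \<le> B"
    using compact_imp_bounded[OF compact_continuous_image[OF continuous_on_subset[OF cont] compact_Icc[of 0 1]]]
    unfolding bounded_iff by auto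
  have B: "\<bar>\<rho> s\<bar> \<le> B" for s
    using periodic_shift_int[of \<rho> "frac s" "\<lfloor>s\<rfloor>", OF per] bspec[OF B, of "frac s"] frac_lt_1[of s] by (simp add: frac_def)
  have L: "Linf B (\<lambda>x. \<rho> (snd x + c))" for c
    unfolding Linf_def using B per[of "_ + c"] by (auto simp: periodic_def add.assoc add.commute add.left_commute)
  have L0: "Linf B (\<lambda>x. \<rho> (snd x))" using L[of 0] by simp
  have quot: "(\<integral>x. \<rho> (snd x) * (f (x + (0, t)) - f x) \<partial>torus) / t = - (\<integral>x. (\<rho> (snd x + (- t)) - \<rho> (snd x)) / (- t) * f x \<partial>torus)" for t
  proof -
    note i = L1pD(3)[OF L1p_mult_Linf[OF L0 L1p_shift[OF f, of "(0, t)"]]] L1pD(3)[OF L1p_mult_Linf[OF L0 f]]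
      L1pD(3)[OF L1p_mult_Linf[OF L[of "- t"] f]]
    have s: "(\<integral>x. \<rho> (snd x) * f (x + (0, t)) \<partial>torus) = (\<integral>x. \<rho> (snd x + (- t)) * f x \<partial>torus)"
      by (rule integral_cong_shift[where y = "(0, t)"]) (use L1p_mult_Linf[OF L[of "- t"] f] in auto)
    have "(\<integral>x. \<rho> (snd x) * (f (x + (0, t)) - f x) \<partial>torus) / t =
        ((\<integral>x. \<rho> (snd x + (- t)) * f x \<partial>torus) - (\<integral>x. \<rho> (snd x) * f x \<partial>torus)) / t"
      using i(1,2) by (simp add: right_diff_distrib s)
    also have "\<dots> = (\<integral>x. (\<rho> (snd x + (- t)) * f x - \<rho> (snd x) * f x) / t \<partial>torus)"
      unfolding Bochner_Integration.integral_diff[OF i(3,2), symmetric] by simp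
    also have "\<dots> = (\<integral>x. - ((\<rho> (snd x + (- t)) - \<rho> (snd x)) / (- t) * f x) \<partial>torus)"
      by (intro Bochner_Integration.integral_cong) (simp_all add: diff_divide_distrib left_diff_distrib)
    finally show ?thesis by simp
  qed
  show ?thesis
    unfolding quot
  proof (intro tendsto_minus)
    show "((\<lambda>t. \<integral>x. (\<rho> (snd x + (- t)) - \<rho> (snd x)) / (- t) * f x \<partial>torus) \<longlongrightarrow> (\<integral>x. \<rho>' (snd x) * f x \<partial>torus)) (at 0)"
      unfolding tendsto_at_iff_sequentially
    proof (intro allI impI)
      fix X :: "nat \<Rightarrow> real" assume X0: "\<forall>i. X i \<in> UNIV - {0}" and X: "X \<longlonglongrightarrow> 0"
      have Xm: "filterlim (\<lambda>n. - X n) (at 0) sequentially"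
        using X0 tendsto_minus[OF X] by (auto simp: filterlim_at)
      have lim: "(\<lambda>n. (\<rho> (s + (- X n)) - \<rho> s) / (- X n)) \<longlonglongrightarrow> \<rho>' s" for s
        using filterlim_compose[OF D[of s, unfolded DERIV_def] Xm] .
      have [measurable]: "\<rho>' \<in> borel_measurable borel"
        by (rule borel_measurable_LIMSEQ_metric[OF _ lim]) measurable
      show "((\<lambda>t. \<integral>x. (\<rho> (snd x + (- t)) - \<rho> (snd x)) / (- t) * f x \<partial>torus) \<circ> X) \<longlonglongrightarrow> (\<integral>x. \<rho>' (snd x) * f x \<partial>torus)"
        unfolding comp_def
      proof (rule integral_dominated_convergence[where w = "\<lambda>x. C * \<bar>f x\<bar>"])
        show "integrable torus (\<lambda>x. C * \<bar>f x\<bar>)" using f by auto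
        show "AE x in torus. (\<lambda>n. (\<rho> (snd x + (- X n)) - \<rho> (snd x)) / (- X n) * f x) \<longlonglongrightarrow> \<rho>' (snd x) * f x"
          by (intro AE_I2 tendsto_mult lim tendsto_const)
        show "AE x in torus. norm ((\<rho> (snd x + (- X n)) - \<rho> (snd x)) / (- X n) * f x) \<le> C * \<bar>f x\<bar>" for n
        proof (rule AE_I2)
          fix x :: "real \<times> real"
          have "\<bar>\<rho> (snd x + (- X n)) - \<rho> (snd x)\<bar> \<le> C * \<bar>X n\<bar>"
            using C1_Lipschitz[OF D C, of "snd x + (- X n)" "snd x"] by simp
          then have "\<bar>(\<rho> (snd x + (- X n)) - \<rho> (snd x)) / (- X n)\<bar> \<le> C"
            using X0 by (simp add: abs_divide pos_divide_le_eq)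
          then show "norm ((\<rho> (snd x + (- X n)) - \<rho> (snd x)) / (- X n) * f x) \<le> C * \<bar>f x\<bar>"
            unfolding real_norm_def abs_mult by (rule mult_right_mono) simp
        qed
      qed measurable
    qed
  qed
qed

text \<open>
  The primitive of \<open>1 - cos\<^bsup>2N\<^esup>(\<pi> s) / kcentre N\<close>; its summand for \<open>j = N\<close> vanishes because \<open>x / 0 = 0\<close>.
\<close>

definition kprim :: "nat \<Rightarrow> real \<Rightarrow> real"
  where "kprim N s = - (\<Sum>j\<le>2*N. real (2*N choose j) / 4 ^ N *
     (sin (2 * pi * (real j - real N) * s) / (2 * pi * (real j - real N)))) / kcentre N"

lemma cos_power_sum:
  "cos (pi * s) ^ (2 * N) = (\<Sum>j\<le>2*N. real (2*N choose j) / 4 ^ N * cos (2 * pi * (real j - real N) * s))"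
  using arg_cong[OF cos_power_cis[of s N], of Re] by (simp add: Re_sum)

lemma DERIV_kprim: "(kprim N has_real_derivative 1 - cos (pi * s) ^ (2 * N) / kcentre N) (at s)"
proof -
  have tm: "((\<lambda>s. sin (c * s) / c) has_real_derivative (if c = 0 then 0 else cos (c * s))) (at s)" for c :: real
    by (auto intro!: derivative_eq_intros)
  have "(kprim N has_real_derivative - (\<Sum>j\<le>2*N. real (2*N choose j) / 4 ^ N *
     (if 2 * pi * (real j - real N) = 0 then 0 else cos (2 * pi * (real j - real N) * s))) / kcentre N) (at s)"
    unfolding kprim_def[abs_def]
    by (intro DERIV_cdivide DERIV_minus DERIV_sum DERIV_cmult tm)
  also have "(\<Sum>j\<le>2*N. real (2*N choose j) / 4 ^ N *
     (if 2 * pi * (real j - real N) = 0 then 0 else cos (2 * pi * (real j - real N) * s))) =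
     (\<Sum>j\<le>2*N. real (2*N choose j) / 4 ^ N * cos (2 * pi * (real j - real N) * s) - (if j = N then kcentre N else 0))"
    by (intro sum.cong) (auto simp: kcentre_def)
  also have "\<dots> = cos (pi * s) ^ (2 * N) - kcentre N"
    unfolding sum_subtractf cos_power_sum by (subst sum.delta) auto
  finally show ?thesis using kcentre_pos[of N] by (simp add: diff_divide_distrib)
qed

lemma kprim_periodic: "kprim N (s + 1) = kprim N s"
proof -
  have "sin (2 * pi * (real j - real N) * (s + 1)) = sin (2 * pi * (real j - real N) * s)" for j
  proof -
    have "cis (2 * pi * (real j - real N) * (s + 1)) = cis (2 * pi * (real j - real N) * s) * cis (2 * pi * of_int (int j - int N))"
      by (simp add: cis_mult algebra_simps)
    also have "\<dots> = cis (2 * pi * (real j - real N) * s)" by (simp only: cis_freq_1 mult_1_right)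
    finally have "Im (cis (2 * pi * (real j - real N) * (s + 1))) = Im (cis (2 * pi * (real j - real N) * s))"
      by (rule arg_cong)
    then show ?thesis by simp
  qed
  then show ?thesis by (simp add: kprim_def)
qed

text \<open>The slope is at most 1, and the function vanishes at 0 and at 1. This bounds it above
  from the left end and below from the right end, independently of N although the kernel
  concentrates.\<close>

lemma kprim_bound: "\<bar>kprim N s\<bar> \<le> 1"
proof -
  have zero: "kprim N 0 = 0" by (simp add: kprim_def)
  have inc: "kprim N y - kprim N x \<le> y - x" if "x \<le> y" for x y
  proof -
    obtain z where "kprim N y - kprim N x = (1 - cos (pi * z) ^ (2 * N) / kcentre N) * (y - x)"
      using MVT_either_order[OF DERIV_kprim] by blast
    also have "\<dots> \<le> 1 * (y - x)"
      using that cos_even_power_bounds(1)[of "pi * z" N] kcentre_pos[of N] by (intro mult_right_mono) auto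
    finally show ?thesis by simp
  qed
  have f: "0 \<le> frac s" "frac s < 1" by (simp_all add: frac_lt_1)
  have "kprim N (frac s) \<le> frac s" using inc[of 0 "frac s"] f zero by simp
  moreover have "kprim N 1 = 0" using kprim_periodic[of N 0] zero by simp
  then have "- (1 - frac s) \<le> kprim N (frac s)" using inc[of "frac s" 1] f by simp
  moreover have "kprim N s = kprim N (frac s)"
    using periodic_shift_int[of "kprim N" "frac s" "\<lfloor>s\<rfloor>", OF kprim_periodic] by (simp add: frac_def)
  ultimately show ?thesis using f by linarith
qed

lemma kprim'_bound: "\<bar>1 - cos (pi * s) ^ (2 * N) / kcentre N\<bar> \<le> 1 + 1 / kcentre N"
proof -
  have "0 \<le> cos (pi * s) ^ (2 * N) / kcentre N" "cos (pi * s) ^ (2 * N) / kcentre N \<le> 1 / kcentre N"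
    using cos_even_power_bounds[of "pi * s" N] kcentre_pos[of N] by (auto intro: divide_right_mono)
  then show ?thesis by linarith
qed

lemma DERIV_kprim_shift: "((\<lambda>s. kprim N (s - r)) has_real_derivative 1 - cos (pi * (s - r)) ^ (2 * N) / kcentre N) (at s)"
  by (rule DERIV_chain2[OF DERIV_kprim, where g = "\<lambda>s. s - r" and Db = 1, simplified])
     (auto intro!: derivative_eq_intros)

lemma integral_kline_split:
  assumes f: "L1p f"
  shows "(\<integral>x. (1 - cos (pi * (snd x - r)) ^ (2 * N) / kcentre N) * f x \<partial>torus) = (\<integral>x. f x \<partial>torus) - kline N f r"
  unfolding kline_def Bochner_Integration.integral_diff[OF L1pD(3)[OF f] integrable_kline[OF f], symmetric]
  by (intro Bochner_Integration.integral_cong) (auto simp: left_diff_distrib)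

text \<open>
  Testing \<^term>\<open>kprim N\<close> with a constant function shows that the mean of its derivative is zero.
\<close>

lemma Kmass_eq: "Kmass N = (kcentre N)\<^sup>2"
proof -
  have one: "L1p (\<lambda>x. 1)" by (rule L2p_L1p[OF L2p_const])
  have p1: "measure M (UNIV :: (real \<times> real) set) = 1" if "bprob M" for M
    using that prob_space.prob_space[of M] bprob_space[OF that] by (simp add: bprob_def)
  have "((\<lambda>t. (\<integral>x. kprim N (snd x) * ((1::real) - 1) \<partial>torus) / t) \<longlongrightarrow>
      - (\<integral>x. (1 - cos (pi * snd x) ^ (2 * N) / kcentre N) * 1 \<partial>torus)) (at 0)"
    by (rule line_quotient_tendsto[OF one DERIV_kprim kprim'_bound kprim_periodic])
  then have "(\<integral>x. (1 - cos (pi * (snd x - 0)) ^ (2 * N) / kcentre N) * 1 \<partial>torus) = 0"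
    by (simp add: tendsto_const_iff)
  then have "kline N (\<lambda>x. 1) 0 = 1"
    unfolding integral_kline_split[OF one] using torus.prob_space by simp
  moreover have "tavg (ker N) (tavg (seg (1, 0)) (\<lambda>x. 1)) 0 = 1"
    using p1[OF bprob_ker] p1[OF bprob_seg] by (simp add: tavg_def bprob_space[OF bprob_ker] bprob_space[OF bprob_seg])
  ultimately show ?thesis using tavg_ker_line[OF one, of N 0] Kmass_pos[of N] by (simp add: field_simps)
qed

text \<open>The excess of A over M is at most the distance of A from its kernel average, which tends
  to 0 in L1.\<close>

lemma AE_le_of_tavg_ker_le:
  assumes A: "L1p A" and le: "\<And>N x. tavg (ker N) A x \<le> M"
  shows "AE x in torus. A x \<le> M"
proof -
  have [measurable]: "A \<in> borel_measurable borel" using A by auto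
  have iA: "integrable torus (\<lambda>x. max 0 (A x - M))"
    by (rule integrable_torus_bound[of "\<lambda>x. \<bar>A x\<bar> + \<bar>M\<bar>"]) (use A in auto)
  have "(\<integral>x. max 0 (A x - M) \<partial>torus) \<le> (\<integral>x. \<bar>tavg (ker N) A x - A x\<bar> \<partial>torus)" for N
  proof (rule integral_mono[OF iA])
    show "integrable torus (\<lambda>x. \<bar>tavg (ker N) A x - A x\<bar>)"
      using L1p_abs[OF L1p_diff[OF tavg_L1p[OF bprob_ker A] A]] by auto
    show "max 0 (A x - M) \<le> \<bar>tavg (ker N) A x - A x\<bar>" for x using le[of N x] by auto
  qed
  then have "(\<integral>x. max 0 (A x - M) \<partial>torus) \<le> 0"
    using LIMSEQ_le_const[OF tavg_ker_L1_tendsto[OF A]] by blast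
  moreover have "0 \<le> (\<integral>x. max 0 (A x - M) \<partial>torus)" by simp
  ultimately have "(\<integral>x. max 0 (A x - M) \<partial>torus) = 0" by linarith
  then have "AE x in torus. max 0 (A x - M) = 0"
    using integral_nonneg_eq_0_iff_AE[OF iA] by simp
  then show ?thesis by eventually_elim (auto simp: max_def split: if_splits)
qed

context burgers
begin

definition E :: real where "E = \<beta> * \<gamma>"

lemma E_nonneg: "0 \<le> E" using nonneg by (simp add: E_def)

text \<open>The cubic estimate is turned into an L1 estimate by t \<le> l + t^3 / l^2 for t \<ge> 0,
  with a height l to be chosen later.\<close>

lemma modL1_first_le:
  assumes l: "0 < l"
  shows "modL1 w (h, 0) \<le> l + 48 * E * \<bar>h\<bar> / l\<^sup>2"
proof -
  have pt: "t \<le> l + (1 / l\<^sup>2) * t ^ 3" if "0 \<le> t" for t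
  proof (cases "t \<le> l")
    case False
    then have "l\<^sup>2 * t \<le> t\<^sup>2 * t" using l by (intro mult_right_mono power_mono) auto
    then have "t \<le> (1 / l\<^sup>2) * t ^ 3" using l by (simp add: field_simps power2_eq_square power3_eq_cube)
    with l show ?thesis by linarith
  qed (use that l in \<open>auto intro: add_increasing2\<close>)
  have [measurable]: "w \<in> borel_measurable borel" using w by auto
  have "ennreal (modL1 w (h, 0)) = (\<integral>\<^sup>+x. ennreal \<bar>w (x + (h, 0)) - w x\<bar> \<partial>torus)"
    by (rule nn_integral_modL1[symmetric, OF L2p_L1p[OF w]])
  also have "\<dots> \<le> (\<integral>\<^sup>+x. ennreal l + ennreal (1 / l\<^sup>2) * ennreal (\<bar>w (x + (h, 0)) - w x\<bar> ^ 3) \<partial>torus)"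
    using pt l by (intro nn_integral_mono) (simp add: ennreal_mult[symmetric] ennreal_plus[symmetric] del: ennreal_plus)
  also have "\<dots> = ennreal l + ennreal (1 / l\<^sup>2) * (\<integral>\<^sup>+x. ennreal (\<bar>w (x + (h, 0)) - w x\<bar> ^ 3) \<partial>torus)"
    using torus.emeasure_space_1 by (subst nn_integral_add) (auto simp: nn_integral_cmult)
  also have "\<dots> \<le> ennreal l + ennreal (1 / l\<^sup>2) * ennreal (48 * E * \<bar>h\<bar>)"
    unfolding E_def mult.assoc[symmetric] by (intro add_left_mono mult_left_mono increment_cube_le) auto
  also have "\<dots> = ennreal (l + 48 * E * \<bar>h\<bar> / l\<^sup>2)"
    using l E_nonneg by (simp add: ennreal_mult[symmetric] ennreal_plus[symmetric] del: ennreal_plus)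
  finally show ?thesis using l E_nonneg by (subst (asm) ennreal_le_iff) auto
qed

lemma line_mean_zero: "AE x in torus. tavg (seg (1, 0)) w x = 0"
proof (rule fc_zero_imp_AE_zero[OF tavg_L1p[OF bprob_seg L2p_L1p[OF w]]])
  fix k assume k: "k \<in> freqs"
  show "fc (tavg (seg (1, 0)) w) k = 0"
    using fc_tavg_seg[OF L2p_L1p[OF w] k, of "(1, 0)"] segA_freq[OF k] fc_w_0[OF k]
    by (auto simp: inner_prod_def split: if_splits)
qed

lemma tavg_minus_first_le:
  assumes l: "0 < l" and h: "0 \<le> h"
  shows "(\<integral>x. \<bar>tavg (seg (h, 0)) w x - w x\<bar> \<partial>torus) \<le> l + 48 * E * h / l\<^sup>2"
proof (rule tavg_seg_L1_segment[OF L2p_L1p[OF w]])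
  show "0 \<le> l + 48 * E * h / l\<^sup>2" using l E_nonneg h by simp
  fix s :: real assume s: "0 \<le> s" "s \<le> 1"
  have "modL1 w (s * h, 0) \<le> l + 48 * E * \<bar>s * h\<bar> / l\<^sup>2" by (rule modL1_first_le[OF l])
  also have "\<dots> \<le> l + 48 * E * h / l\<^sup>2"
    using s h E_nonneg by (intro add_left_mono divide_right_mono mult_left_mono) (auto simp: abs_mult mult_left_le_one_le)
  finally show "modL1 w (s *\<^sub>R (h, 0)) \<le> l + 48 * E * h / l\<^sup>2" by simp
qed

text \<open>The mean over a full period vanishes, so |w| is itself the averaging defect for h = 1;
  the height is l = 1.\<close>

lemma L1_norm_le: "(\<integral>x. \<bar>w x\<bar> \<partial>torus) \<le> 1 + 48 * E"
proof -
  have "(\<integral>x. \<bar>w x\<bar> \<partial>torus) = (\<integral>x. \<bar>tavg (seg (1, 0)) w x - w x\<bar> \<partial>torus)"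
  proof (rule integral_cong_AE)
    show "AE x in torus. \<bar>w x\<bar> = \<bar>tavg (seg (1, 0)) w x - w x\<bar>"
      using line_mean_zero by eventually_elim simp
    show "(\<lambda>x. \<bar>tavg (seg (1, 0)) w x - w x\<bar>) \<in> borel_measurable torus"
      using L1pD(3)[OF L1p_abs[OF L1p_diff[OF tavg_L1p[OF bprob_seg L2p_L1p[OF w]] L2p_L1p[OF w]]]]
      by (rule borel_measurable_integrable)
    show "(\<lambda>x. \<bar>w x\<bar>) \<in> borel_measurable torus"
      using L1pD(3)[OF L1p_abs[OF L2p_L1p[OF w]]] by (rule borel_measurable_integrable)
  qed
  also have "\<dots> \<le> 1 + 48 * E" using tavg_minus_first_le[of 1 1] by simp
  finally show ?thesis .
qed

text \<open>By \<open>trunc_trunc1\<close> the integral equals that of \<rho> b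
  \<open>trunc1 N (w x)\<close>, because the half square times b is an x1-derivative and \<rho> does
  not depend on x1. Integration by parts shows that it also equals minus that integral.\<close>

lemma transport_zero:
  assumes \<rho>: "Linf B \<rho>" and inv: "\<And>x d. \<rho> (x + (d, 0)) = \<rho> x" and N: "0 < N"
  shows "(\<integral>x. \<rho> x * trunc N (w x) * v x \<partial>torus) = 0"
proof -
  have d\<rho>: "dL2 \<rho> (\<lambda>x. 0)"
  proof -
    have "dquot \<rho> = (\<lambda>d x. 0)" by (intro ext) (simp add: dquot_def inv)
    then show ?thesis using Linf_L2p[OF \<rho>] by (simp add: dL2_def L2p_const L2lim_const)
  qed
  have d\<rho>w: "dL2 (\<lambda>x. \<rho> x * w x) (\<lambda>x. \<rho> x * b x)"
  proof -
    have "dquot (\<lambda>x. \<rho> x * w x) = (\<lambda>d x. \<rho> x * dquot w d x)"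
      by (intro ext) (simp add: dquot_def inv right_diff_distrib)
    then show ?thesis using L2lim_mult_Linf[OF \<rho>, of "dquot w" b "at 0"] dL2_w L2p_mult_Linf[OF \<rho> w]
      by (simp add: dL2_def)
  qed
  note d1 = dL2_trunc1[OF N dL2_w] and d2 = dL2_trunc2[OF N dL2_w]
  have X: "(\<integral>x. \<rho> x * w x * (trunc N (w x) * b x) \<partial>torus) = - (\<integral>x. \<rho> x * b x * trunc1 N (w x) \<partial>torus)"
    by (rule dL2_parts[OF d\<rho>w d1])
  have Y: "(\<integral>x. \<rho> x * ((trunc N (w x))\<^sup>2 / 2 * b x) \<partial>torus) = 0"
    using dL2_parts[OF d\<rho> d2] by simp
  have i: "integrable torus (\<lambda>x. \<rho> x * b x * trunc1 N (w x))" "integrable torus (\<lambda>x. \<rho> x * ((trunc N (w x))\<^sup>2 / 2 * b x))"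
    by (intro L1pD(3) L2p_L1p_mult dL2_L2p[OF d\<rho>w] dL2_L2p[OF d1] dL2_L2p[OF d2] Linf_L2p[OF \<rho>])+
  have eq: "\<rho> x * trunc N (w x) * v x = \<rho> x * b x * trunc1 N (w x) + \<rho> x * ((trunc N (w x))\<^sup>2 / 2 * b x)" for x
  proof -
    have "\<rho> x * trunc N (w x) * v x = \<rho> x * b x * (trunc1 N (w x) + (trunc N (w x) * w x - trunc1 N (w x)))"
      by (simp add: v_def)
    then show ?thesis unfolding trunc_trunc1[OF N] by (simp add: distrib_left)
  qed
  have "(\<integral>x. \<rho> x * trunc N (w x) * v x \<partial>torus) = (\<integral>x. \<rho> x * b x * trunc1 N (w x) \<partial>torus)"
    unfolding eq using i Y by simp
  moreover have "(\<integral>x. \<rho> x * trunc N (w x) * v x \<partial>torus) = (\<integral>x. \<rho> x * w x * (trunc N (w x) * b x) \<partial>torus)"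
    by (intro Bochner_Integration.integral_cong) (auto simp: v_def)
  ultimately show ?thesis using X by linarith
qed

text \<open>The weight \<rho> depends on x2 alone and has the derivative 1 minus the kernel at r. As
  the transport term vanishes, the value at the line r exceeds the mean by no more than the
  contribution of g.\<close>

lemma line_test_le: "kline N (\<lambda>x. trunc1 1 (w x)) r \<le> (\<integral>x. trunc1 1 (w x) \<partial>torus) + 2 * E"
proof -
  have [measurable]: "w \<in> borel_measurable borel" and pw: "periodic w" using w by auto
  have [measurable]: "kprim N \<in> borel_measurable borel" by (rule borel_measurable_C1[OF DERIV_kprim])
  \<comment> \<open>The added 1 makes the weight nonnegative, as the convexity inequality requires;
    its values then lie in [0, 2].\<close>
  define \<rho> where "\<rho> x = kprim N (snd x - r) + 1" for x :: "real \<times> real"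
  have \<rho>01: "0 \<le> \<rho> x" "\<rho> x \<le> 2" for x using kprim_bound[of N "snd x - r"] by (auto simp: \<rho>_def)
  have per\<rho>: "kprim N (s + 1 - r) = kprim N (s - r)" for s
    using kprim_periodic[of N "s - r"] by (simp add: algebra_simps)
  have \<rho>: "Linf 2 \<rho>" unfolding Linf_def using \<rho>01 per\<rho>
    by (auto simp: \<rho>_def[abs_def] periodic_def abs_le_iff intro: order_trans[of _ 0])
  define f where "f x = trunc1 1 (w x)" for x
  have f2: "L2p f" unfolding f_def[abs_def] using dL2_L2p(1)[OF dL2_trunc1[OF _ dL2_w]] by simp
  note f = L2p_L1p[OF f2]
  have S: "Linf 1 (\<lambda>x. trunc 1 (w x))" by (rule Linf_comp[OF _ pw]) (auto simp: trunc_abs_le)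
  define \<psi> where "\<psi> x = \<rho> x * trunc 1 (w x)" for x
  have \<psi>: "Linf 2 \<psi>"
    unfolding Linf_def
  proof (intro conjI allI)
    show "\<psi> \<in> borel_measurable borel" "periodic \<psi>"
      using L1p_mult_Linf[OF \<rho> Linf_L1p[OF S]] unfolding \<psi>_def[abs_def] by auto
    fix x
    have "\<bar>\<psi> x\<bar> \<le> 2 * 1" unfolding \<psi>_def abs_mult by (intro mult_mono LinfD(3)[OF \<rho>] LinfD(3)[OF S]) auto
    then show "\<bar>\<psi> x\<bar> \<le> 2" by simp
  qed
  have lip: "(\<integral>x. (\<psi> (x + (d, 0)) - \<psi> x)\<^sup>2 \<partial>torus) \<le> (2 * \<beta>)\<^sup>2 * d\<^sup>2" for d
  proof -
    have "(\<integral>x. (\<psi> (x + (d, 0)) - \<psi> x)\<^sup>2 \<partial>torus) \<le> (\<integral>x. 4 * (D d x)\<^sup>2 \<partial>torus)"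
    proof (rule integral_mono)
      show "integrable torus (\<lambda>x. (\<psi> (x + (d, 0)) - \<psi> x)\<^sup>2)"
        using L2p_diff[OF L2p_shift[OF Linf_L2p[OF \<psi>], of "(d, 0)"] Linf_L2p[OF \<psi>]] by auto
      show "integrable torus (\<lambda>x. 4 * (D d x)\<^sup>2)" using D_L2p[of d] by auto
      fix x
      have "\<bar>\<psi> (x + (d, 0)) - \<psi> x\<bar> = \<rho> x * \<bar>trunc 1 (w (x + (d, 0))) - trunc 1 (w x)\<bar>"
        using \<rho>01(1)[of x] by (simp add: \<psi>_def \<rho>_def abs_mult flip: right_diff_distrib)
      also have "\<dots> \<le> 2 * \<bar>D d x\<bar>"
        using \<rho>01[of x] trunc_Lipschitz[of 1 "w (x + (d, 0))" "w x"] by (intro mult_mono) (auto simp: D_def)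
      finally show "(\<psi> (x + (d, 0)) - \<psi> x)\<^sup>2 \<le> 4 * (D d x)\<^sup>2"
        using power_mono[of "\<bar>\<psi> (x + (d, 0)) - \<psi> x\<bar>" "2 * \<bar>D d x\<bar>" 2] by (simp add: power_mult_distrib)
    qed
    also have "\<dots> \<le> 4 * (\<beta>\<^sup>2 * d\<^sup>2)" using D_Lipschitz[of d] by simp
    finally show ?thesis by (simp add: power_mult_distrib)
  qed
  have H: "(\<integral>x. \<psi> x * (w (x + (0, t)) - w x) \<partial>torus) \<le> (\<integral>x. \<rho> x * (f (x + (0, t)) - f x) \<partial>torus)" for t
  proof (rule integral_mono)
    have "L1p (\<lambda>x. \<psi> x * (w (x + (0, t)) - w x))"
      by (rule L1p_mult_Linf[OF \<psi> L1p_diff[OF L1p_shift]]) (use L2p_L1p[OF w] in auto)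
    then show "integrable torus (\<lambda>x. \<psi> x * (w (x + (0, t)) - w x))" by auto
    have "L1p (\<lambda>x. \<rho> x * (f (x + (0, t)) - f x))"
      by (rule L1p_mult_Linf[OF \<rho> L1p_diff[OF L1p_shift]]) (use f in auto)
    then show "integrable torus (\<lambda>x. \<rho> x * (f (x + (0, t)) - f x))" by auto
    show "\<psi> x * (w (x + (0, t)) - w x) \<le> \<rho> x * (f (x + (0, t)) - f x)" for x
      unfolding \<psi>_def f_def mult.assoc by (intro mult_left_mono trunc1_convex \<rho>01) auto
  qed
  have "((\<lambda>t. (\<integral>x. (kprim N (snd x - r) + 1) * (f (x + (0, t)) - f x) \<partial>torus) / t) \<longlongrightarrow>
      - (\<integral>x. (1 - cos (pi * (snd x - r)) ^ (2 * N) / kcentre N) * f x \<partial>torus)) (at 0)"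
  proof (rule line_quotient_tendsto[OF f, where \<rho> = "\<lambda>s. kprim N (s - r) + 1"])
    show "((\<lambda>s. kprim N (s - r) + 1) has_real_derivative 1 - cos (pi * (s - r)) ^ (2 * N) / kcentre N) (at s)" for s
      using DERIV_add[OF DERIV_kprim_shift DERIV_const] by simp
    show "\<bar>1 - cos (pi * (s - r)) ^ (2 * N) / kcentre N\<bar> \<le> 1 + 1 / kcentre N" for s by (rule kprim'_bound)
  qed (simp add: per\<rho>)
  then have lim: "((\<lambda>t. (\<integral>x. \<rho> x * (f (x + (0, t)) - f x) \<partial>torus) / t) \<longlongrightarrow> - ((\<integral>x. f x \<partial>torus) - kline N f r)) (at 0)"
    unfolding integral_kline_split[OF f] \<rho>_def .
  have "\<bar>(\<integral>x. \<psi> x * v x \<partial>torus) - - ((\<integral>x. f x \<partial>torus) - kline N f r)\<bar> \<le> 2 * \<beta> * \<gamma>"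
    by (rule weak_equation_limit[OF \<psi> _ lip H lim]) (use nonneg in auto)
  moreover have "(\<integral>x. \<psi> x * v x \<partial>torus) = 0"
    unfolding \<psi>_def by (rule transport_zero[OF \<rho>]) (auto simp: \<rho>_def)
  ultimately show ?thesis unfolding f_def[symmetric] E_def by linarith
qed

text \<open>Control of the positive part suffices, because w has mean zero on almost every
  line.\<close>

lemma line_mean_abs_le: "AE x in torus. tavg (seg (1, 0)) (\<lambda>x. \<bar>w x\<bar>) x \<le> 3 + 100 * E"
proof -
  have [measurable]: "w \<in> borel_measurable borel" using w by auto
  note w1 = L2p_L1p[OF w]
  define f where "f x = trunc1 1 (w x)" for x
  have f2: "L2p f" unfolding f_def[abs_def] using dL2_L2p(1)[OF dL2_trunc1[OF _ dL2_w]] by simp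
  note f = L2p_L1p[OF f2]
  define A where "A = tavg (seg (1, 0)) f"
  have "(\<integral>x. f x \<partial>torus) \<le> (\<integral>x. \<bar>w x\<bar> \<partial>torus)"
    by (rule integral_mono[OF L1pD(3)[OF f] L1pD(3)[OF L1p_abs[OF w1]]]) (simp add: f_def trunc1_bounds)
  then have "(\<integral>x. f x \<partial>torus) \<le> 1 + 48 * E" using L1_norm_le by linarith
  then have le: "kline N f r \<le> 1 + 50 * E" for N r using line_test_le[of N r] unfolding f_def by linarith
  have "AE x in torus. A x \<le> 1 + 50 * E"
  proof (rule AE_le_of_tavg_ker_le)
    show "L1p A" unfolding A_def by (rule tavg_L1p[OF bprob_seg f])
    show "tavg (ker N) A x \<le> 1 + 50 * E" for N x
      using tavg_ker_line[OF f, of N x] le[of N "snd x"] Kmass_pos[of N] by (simp add: A_def Kmass_eq)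
  qed
  with line_mean_zero AE_integrable_tavg[OF bprob_seg w1, of "(1, 0)"] AE_integrable_tavg[OF bprob_seg f, of "(1, 0)"]
  show ?thesis
  proof eventually_elim
    case (elim x)
    interpret nu: prob_space "seg (1, 0)" using bprob_seg[of "(1, 0)"] by (simp add: bprob_def)
    have i: "integrable (seg (1, 0)) (\<lambda>y. 2 * f (x + y) + 1 - w (x + y))" using elim by auto
    have "tavg (seg (1, 0)) (\<lambda>x. \<bar>w x\<bar>) x \<le> (\<integral>y. 2 * f (x + y) + 1 - w (x + y) \<partial>seg (1, 0))"
      unfolding tavg_def
    proof (rule integral_mono)
      show "integrable (seg (1, 0)) (\<lambda>y. \<bar>w (x + y)\<bar>)" using elim by auto
      \<comment> \<open>From |s| = 2 max 0 s - s and \<open>trunc1_ge\<close>. With the bound 1 + 50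
        E for the mean of f this gives 3 + 100 E.\<close>
      show "\<bar>w (x + y)\<bar> \<le> 2 * f (x + y) + 1 - w (x + y)" for y
        using trunc1_ge[of "w (x + y)"] by (auto simp: f_def max_def abs_if split: if_splits)
    qed (rule i)
    also have "\<dots> = 2 * A x + 1 - tavg (seg (1, 0)) w x"
      using elim nu.prob_space by (simp add: A_def tavg_def)
    finally show ?case using elim by simp
  qed
qed

end

subsection \<open>Higher integrability\<close>

lemma nn_integral_seg:
  assumes [measurable]: "f \<in> borel_measurable borel"
  shows "(\<integral>\<^sup>+z. f z \<partial>seg v) = (\<integral>\<^sup>+t\<in>{0..1}. f (t *\<^sub>R v) \<partial>lborel)"
proof -
  have [measurable]: "(\<lambda>t. t *\<^sub>R v) \<in> borel_measurable borel"
    by (intro borel_measurable_continuous_onI continuous_intros)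
  have "(\<integral>\<^sup>+z. f z \<partial>seg v) = (\<integral>\<^sup>+t. f (t *\<^sub>R v) \<partial>unit01)"
    unfolding seg_def by (rule nn_integral_distr) measurable
  also have "\<dots> = (\<integral>\<^sup>+t\<in>{0..1}. f (t *\<^sub>R v) \<partial>lborel)"
    unfolding unit01_def by (subst nn_integral_density) (auto simp: mult.commute)
  finally show ?thesis .
qed

text \<open>The shorter segment is part of the longer one, and the density of its uniform measure is
  larger by the factor 1 / h.\<close>

lemma nn_integral_seg_scale:
  assumes f [measurable]: "f \<in> borel_measurable borel" and h: "0 < h" "h \<le> 1"
  shows "(\<integral>\<^sup>+z. f z \<partial>seg (h *\<^sub>R v)) \<le> ennreal (1 / h) * (\<integral>\<^sup>+z. f z \<partial>seg v)"
proof -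
  have [measurable]: "(\<lambda>t. t *\<^sub>R v) \<in> borel_measurable borel"
    by (intro borel_measurable_continuous_onI continuous_intros)
  define G where "G s = f (s *\<^sub>R v) * indicator {0..h} s" for s :: real
  have [measurable]: "G \<in> borel_measurable borel" unfolding G_def[abs_def] by measurable
  have G: "(\<integral>\<^sup>+s. G s \<partial>lborel) = ennreal h * (\<integral>\<^sup>+t. G (h * t) \<partial>lborel)"
    using nn_integral_real_affine[of G h 0] h by simp
  have "(\<integral>\<^sup>+z. f z \<partial>seg (h *\<^sub>R v)) = (\<integral>\<^sup>+t. G (h * t) \<partial>lborel)"
    unfolding nn_integral_seg[OF f] G_def using h
    by (intro nn_integral_cong) (auto simp: indicator_def mult.commute mult_le_cancel_left1 zero_le_mult_iff)
  also have "\<dots> = ennreal (1 / h) * (ennreal h * (\<integral>\<^sup>+t. G (h * t) \<partial>lborel))"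
    using h by (simp add: mult.assoc[symmetric] ennreal_mult[symmetric])
  also have "\<dots> = ennreal (1 / h) * (\<integral>\<^sup>+s. G s \<partial>lborel)" unfolding G ..
  also have "\<dots> \<le> ennreal (1 / h) * (\<integral>\<^sup>+z. f z \<partial>seg v)"
    unfolding nn_integral_seg[OF f] G_def using h
    by (intro mult_left_mono nn_integral_mono) (auto simp: indicator_def)
  finally show ?thesis .
qed

text \<open>If m is the least exponent with t \<le> 2^m, the sum contains the term for j = m - 1,
  which alone dominates the power.\<close>

lemma dyadic_bound:
  assumes t: "0 \<le> t" and q: "0 \<le> q"
  shows "ennreal (t powr q) \<le> 1 + (\<Sum>j. ennreal (2 powr (q * (real j + 1))) * indicator {s. 2 ^ j < s} t)"
proof (cases "t \<le> 1")
  case True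
  then have "t powr q \<le> 1" using t q powr_mono2[of q t 1] by simp
  then have "ennreal (t powr q) \<le> 1" using ennreal_leI by fastforce
  then show ?thesis by (rule order_trans) simp
next
  case False
  obtain n where n: "t < 2 ^ n" using real_arch_pow[of 2 t] by auto
  define m where "m = (LEAST n. t \<le> 2 ^ n)"
  have m: "t \<le> 2 ^ m" unfolding m_def by (rule LeastI[of _ n]) (use n in auto)
  have "m \<noteq> 0" using m False by (cases m) auto
  then obtain j where j: "m = Suc j" by (cases m) auto
  have "\<not> t \<le> 2 ^ j" using not_less_Least[of j "\<lambda>n. t \<le> 2 ^ n"] j unfolding m_def by simp
  then have tj: "2 ^ j < t" by simp
  have "t powr q \<le> (2 powr (real j + 1)) powr q"
    using m t q by (intro powr_mono2) (auto simp: j powr_add powr_realpow)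
  then have "t powr q \<le> 2 powr (q * (real j + 1))" by (simp add: powr_powr mult.commute)
  define F where "F i = ennreal (2 powr (q * (real i + 1))) * indicator {s. 2 ^ i < s} t" for i
  have "ennreal (t powr q) \<le> F j"
    using tj \<open>t powr q \<le> 2 powr (q * (real j + 1))\<close> by (simp add: F_def ennreal_leI)
  also have "\<dots> = sum F {j}" by simp
  also have "\<dots> \<le> suminf F" by (rule sum_le_suminf) auto
  finally show ?thesis unfolding F_def by (rule order_trans) simp
qed

text \<open>Up to a constant the dyadic levels contribute 2^(7j/2) 2^(-4j), a geometric series with
  ratio 2^(-1/2); this is where 7/2 < 4 is used.\<close>

lemma nn_integral_powr_weak_type:
  assumes [measurable]: "f \<in> borel_measurable borel" and C: "0 \<le> C"
    and weak: "\<And>l. 0 < l \<Longrightarrow> measure torus {x. l < \<bar>f x\<bar>} \<le> C / l ^ 4"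
  shows "(\<integral>\<^sup>+x. ennreal (\<bar>f x\<bar> powr (7/2)) \<partial>torus) \<le> ennreal (1 + 2 powr (7/2) * C * (1 / (1 - 2 powr (-1/2))))"
proof -
  let ?r = "2 powr (-1/2) :: real"
  have r: "0 \<le> ?r" "?r < 1" using powr_less_mono[of "-1/2" 0 "2::real"] by auto
  have set_eq: "indicator {s. 2 ^ j < s} \<bar>f x\<bar> = (indicator {x. 2 ^ j < \<bar>f x\<bar>} x :: ennreal)" for j x
    by (simp add: indicator_def)
  have [measurable]: "{x. 2 ^ j < \<bar>f x\<bar>} \<in> sets borel" for j :: nat by measurable
  have "(\<integral>\<^sup>+x. ennreal (\<bar>f x\<bar> powr (7/2)) \<partial>torus) \<le>
     (\<integral>\<^sup>+x. 1 + (\<Sum>j. ennreal (2 powr (7/2 * (real j + 1))) * indicator {x. 2 ^ j < \<bar>f x\<bar>} x) \<partial>torus)"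
    unfolding set_eq[symmetric] by (intro nn_integral_mono dyadic_bound) auto
  also have "\<dots> = 1 + (\<Sum>j. ennreal (2 powr (7/2 * (real j + 1))) * emeasure torus {x. 2 ^ j < \<bar>f x\<bar>})"
    using torus.emeasure_space_1
    by (subst nn_integral_add, simp, simp, subst nn_integral_suminf) (auto simp: nn_integral_cmult)
  also have "\<dots> \<le> 1 + (\<Sum>j. ennreal (2 powr (7/2) * C * ?r ^ j))"
  proof (intro add_left_mono suminf_le)
    fix j :: nat
    have "2 powr (7/2 * (real j + 1)) * (C / (2 ^ j) ^ 4) = 2 powr (7/2) * C * ?r ^ j"
    proof -
      have "(2::real) ^ j = 2 powr real j" by (simp add: powr_realpow)
      then have "((2::real) ^ j) ^ 4 = 2 powr (4 * real j)" by (simp add: powr_power mult.commute)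
      moreover have "?r ^ j = 2 powr (- (real j / 2))" by (simp add: powr_power)
      moreover have "2 powr (7/2 * (real j + 1)) / 2 powr (4 * real j) = 2 powr (7/2) * 2 powr (- (real j / 2))"
        unfolding powr_diff[symmetric] powr_add[symmetric]
        by (intro arg_cong[where f = "\<lambda>e. 2 powr e"]) (simp add: field_simps)
      ultimately show ?thesis by (simp add: field_simps)
    qed
    moreover have "ennreal (2 powr (7/2 * (real j + 1))) * emeasure torus {x. 2 ^ j < \<bar>f x\<bar>} \<le>
        ennreal (2 powr (7/2 * (real j + 1))) * ennreal (C / (2 ^ j) ^ 4)"
      unfolding torus.emeasure_eq_measure by (intro mult_left_mono ennreal_leI weak) auto
    ultimately show "ennreal (2 powr (7/2 * (real j + 1))) * emeasure torus {x. 2 ^ j < \<bar>f x\<bar>} \<le>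
        ennreal (2 powr (7/2) * C * ?r ^ j)"
      using C by (simp add: ennreal_mult[symmetric])
  qed auto
  also have "(\<Sum>j. ennreal (2 powr (7/2) * C * ?r ^ j)) = ennreal (2 powr (7/2) * C * (1 / (1 - ?r)))"
    using r C by (intro suminf_ennreal_eq sums_mult geometric_sums) auto
  also have "1 + \<dots> = ennreal (1 + 2 powr (7/2) * C * (1 / (1 - ?r)))"
    using r C by (subst ennreal_plus) auto
  finally show ?thesis .
qed

text \<open>Put M = 3 + 100 E. The factor 768 = 48 * 2 * 8 comes from the defect 48 E h with h = 2 M
  / l, divided by (l / 2)^3. The term 16 M^4 = (2 M)^4 covers the levels l < 2 M.\<close>

definition weakC :: "real \<Rightarrow> real"
  where "weakC E = 768 * E * (3 + 100 * E) + 16 * (3 + 100 * E) ^ 4"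

definition boundL72 :: "real \<Rightarrow> real"
  where "boundL72 E = 1 + 2 powr (7/2) * weakC E * (1 / (1 - 2 powr (-1/2)))"

lemma boundL72_mono: "0 \<le> E \<Longrightarrow> E \<le> E' \<Longrightarrow> boundL72 E \<le> boundL72 E'"
proof -
  assume E: "0 \<le> E" "E \<le> E'"
  have "(2 powr (-1/2) :: real) < 1" using powr_less_mono[of "-1/2" 0 "2::real"] by auto
  then show ?thesis
    unfolding boundL72_def weakC_def using E
    by (intro add_left_mono add_mono mult_left_mono mult_right_mono mult_mono power_mono) auto
qed

lemma weakC_nonneg: "0 \<le> E \<Longrightarrow> 0 \<le> weakC E"
  by (simp add: weakC_def)

lemma boundL72_nonneg: "0 \<le> E \<Longrightarrow> 0 \<le> boundL72 E"
proof -
  assume E: "0 \<le> E"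
  have "(2 powr (-1/2) :: real) < 1" using powr_less_mono[of "-1/2" 0 "2::real"] by auto
  then show ?thesis
    unfolding boundL72_def using weakC_nonneg[OF E] by (intro add_nonneg_nonneg mult_nonneg_nonneg) auto
qed

context burgers
begin

lemma short_average_le:
  assumes h: "0 < h" "h \<le> 1"
  shows "AE x in torus. \<bar>tavg (seg (h, 0)) w x\<bar> \<le> (3 + 100 * E) / h"
  using line_mean_abs_le AE_integrable_tavg[OF bprob_seg L2p_L1p[OF w], of "(1, 0)"]
proof eventually_elim
  case (elim x)
  have [measurable]: "w \<in> borel_measurable borel" using w by auto
  have "ennreal \<bar>tavg (seg (h, 0)) w x\<bar> \<le> (\<integral>\<^sup>+y. ennreal \<bar>w (x + y)\<bar> \<partial>seg (h *\<^sub>R (1, 0)))"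
    unfolding tavg_def by (rule order_trans[OF ennreal_abs_integral_le]) simp
  also have "\<dots> \<le> ennreal (1 / h) * (\<integral>\<^sup>+y. ennreal \<bar>w (x + y)\<bar> \<partial>seg (1, 0))"
    by (rule nn_integral_seg_scale[OF _ h]) measurable
  also have "(\<integral>\<^sup>+y. ennreal \<bar>w (x + y)\<bar> \<partial>seg (1, 0)) = ennreal (tavg (seg (1, 0)) (\<lambda>x. \<bar>w x\<bar>) x)"
    unfolding tavg_def using elim by (intro nn_integral_eq_integral) auto
  also have "ennreal (1 / h) * \<dots> \<le> ennreal (1 / h) * ennreal (3 + 100 * E)"
    using elim by (intro mult_left_mono ennreal_leI) auto
  also have "\<dots> = ennreal ((3 + 100 * E) / h)"
    using h E_nonneg by (subst ennreal_mult[symmetric]) auto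
  finally show ?case using h E_nonneg by (subst (asm) ennreal_le_iff) auto
qed

lemma average_defect_cube_le:
  assumes h: "0 \<le> h"
  shows "(\<integral>\<^sup>+x. ennreal (\<bar>tavg (seg (h, 0)) w x - w x\<bar> ^ 3) \<partial>torus) \<le> ennreal (48 * E * h)"
proof -
  have "(\<integral>\<^sup>+x. ennreal (\<bar>tavg (seg (h, 0)) w x - w x\<bar> ^ 3) \<partial>torus) \<le>
      (\<integral>\<^sup>+y. (\<integral>\<^sup>+x. ennreal (\<bar>w (x + y) - w x\<bar> ^ 3) \<partial>torus) \<partial>seg (h, 0))"
    by (rule nn_integral_tavg_defect_le[OF bprob_seg L2p_L1p[OF w], where e = "\<lambda>t. \<bar>t\<bar> ^ 3"]) (auto intro: prob_nn_Jensen_cube)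
  also have "\<dots> \<le> ennreal (48 * E * h)"
  proof (rule nn_integral_prob_le)
    show "prob_space (seg (h, 0))" using bprob_seg[of "(h, 0)"] by (simp add: bprob_def)
    show "AE z in seg (h, 0). (\<integral>\<^sup>+x. ennreal (\<bar>w (x + z) - w x\<bar> ^ 3) \<partial>torus) \<le> ennreal (48 * E * h)"
      using AE_seg_segment[of "(h, 0)"]
    proof eventually_elim
      case (elim z)
      then obtain s where s: "0 \<le> s" "s \<le> 1" "z = (s * h, 0)" by (auto simp: closed_segment_def)
      have "(\<integral>\<^sup>+x. ennreal (\<bar>w (x + z) - w x\<bar> ^ 3) \<partial>torus) \<le> ennreal (48 * \<beta> * \<gamma> * \<bar>s * h\<bar>)"
        unfolding s(3) by (rule increment_cube_le)
      also have "\<dots> \<le> ennreal (48 * E * h)"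
        unfolding E_def mult.assoc[symmetric] using s h nonneg
        by (intro ennreal_leI) (auto simp: abs_mult mult.assoc intro!: mult_left_mono mult_left_le_one_le)
      finally show ?case .
    qed
  qed
  finally show ?thesis .
qed

lemma weak_type_bound:
  assumes l: "0 < l"
  shows "measure torus {x. l < \<bar>w x\<bar>} \<le> weakC E / l ^ 4"
proof -
  define M where "M = 3 + 100 * E"
  have M: "0 < M" using E_nonneg by (simp add: M_def)
  have [measurable]: "w \<in> borel_measurable borel" using w by auto
  have [measurable]: "tavg (seg v) w \<in> borel_measurable borel" for v by (rule tavg_measurable[OF bprob_seg]) measurable
  have [measurable]: "{x. l < \<bar>w x\<bar>} \<in> sets borel" by measurable
  have C: "weakC E = 768 * E * M + 16 * M ^ 4" by (simp add: weakC_def M_def)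
  show ?thesis
  proof (cases "2 * M \<le> l")
    \<comment> \<open>Here 2 M / l would exceed the period 1, and the trivial bound for a
      probability is enough.\<close>
    case False
    have "measure torus {x. l < \<bar>w x\<bar>} \<le> 1" by (rule torus.prob_le_1)
    also have "l ^ 4 \<le> (2 * M) ^ 4" using False l by (intro power_mono) auto
    then have "1 \<le> 16 * M ^ 4 / l ^ 4" using l by (simp add: power_mult_distrib)
    also have "\<dots> \<le> weakC E / l ^ 4" unfolding C using E_nonneg M l by (intro divide_right_mono) auto
    finally show ?thesis .
  next
    case True
    \<comment> \<open>Chosen so that averages over the segment are at most M / h = l / 2; where |w|
      > l, the averaging defect is then at least l / 2.\<close>
    define h where "h = 2 * M / l"
    have h: "0 < h" "h \<le> 1" using True M l by (auto simp: h_def)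
    have "ennreal ((l / 2) ^ 3) * emeasure torus {x. l < \<bar>w x\<bar>} = (\<integral>\<^sup>+x. ennreal ((l / 2) ^ 3) * indicator {x. l < \<bar>w x\<bar>} x \<partial>torus)"
      by (simp add: nn_integral_cmult)
    also have "\<dots> \<le> (\<integral>\<^sup>+x. ennreal (\<bar>tavg (seg (h, 0)) w x - w x\<bar> ^ 3) \<partial>torus)"
    proof (rule nn_integral_mono_AE)
      show "AE x in torus. ennreal ((l / 2) ^ 3) * indicator {x. l < \<bar>w x\<bar>} x \<le> ennreal (\<bar>tavg (seg (h, 0)) w x - w x\<bar> ^ 3)"
        using short_average_le[OF h]
      proof eventually_elim
        case (elim x)
        have "(3 + 100 * E) / h = l / 2" unfolding h_def M_def[symmetric] using M l by simp
        with elim have "l / 2 \<le> \<bar>tavg (seg (h, 0)) w x - w x\<bar>" if "l < \<bar>w x\<bar>" using that by linarith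
        then show ?case using l by (auto simp: indicator_def intro!: ennreal_leI power_mono)
      qed
    qed
    also have "\<dots> \<le> ennreal (48 * E * h)" using h by (intro average_defect_cube_le) auto
    finally have "ennreal ((l / 2) ^ 3 * measure torus {x. l < \<bar>w x\<bar>}) \<le> ennreal (48 * E * h)"
      using l by (simp add: torus.emeasure_eq_measure ennreal_mult[symmetric])
    then have "(l / 2) ^ 3 * measure torus {x. l < \<bar>w x\<bar>} \<le> 48 * E * h"
      using h E_nonneg by (subst (asm) ennreal_le_iff) auto
    then have "measure torus {x. l < \<bar>w x\<bar>} \<le> 48 * E * h / (l / 2) ^ 3"
      using l by (simp add: pos_le_divide_eq mult.commute)
    also have "\<dots> = 768 * E * M / l ^ 4"
      unfolding h_def using l by (simp add: field_simps eval_nat_numeral)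
    also have "\<dots> \<le> weakC E / l ^ 4" unfolding C using M l by (intro divide_right_mono) auto
    finally show ?thesis .
  qed
qed

lemma nn_integral_powr_le: "(\<integral>\<^sup>+x. ennreal (\<bar>w x\<bar> powr (7/2)) \<partial>torus) \<le> ennreal (boundL72 E)"
  unfolding boundL72_def
  by (rule nn_integral_powr_weak_type) (use w weakC_nonneg[OF E_nonneg] weak_type_bound in auto)

text \<open>This integral enters the flux term in the estimate for translations along e2.\<close>

lemma integral_square_le: "(\<integral>x. (w x)\<^sup>2 \<partial>torus) \<le> 1 + boundL72 E"
proof -
  have [measurable]: "w \<in> borel_measurable borel" using w by auto
  note B = boundL72_nonneg[OF E_nonneg]
  have pt: "(w x)\<^sup>2 \<le> 1 + \<bar>w x\<bar> powr (7/2)" for x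
  proof (cases "\<bar>w x\<bar> \<le> 1")
    case True
    then have "(w x)\<^sup>2 \<le> 1" by (simp add: abs_square_le_1)
    then show ?thesis by (simp add: add_increasing2)
  next
    case False
    then have "\<bar>w x\<bar> powr 2 \<le> \<bar>w x\<bar> powr (7/2)" by (intro powr_mono) auto
    then show ?thesis using False by (simp add: powr_numeral)
  qed
  have "ennreal (\<integral>x. (w x)\<^sup>2 \<partial>torus) = (\<integral>\<^sup>+x. ennreal ((w x)\<^sup>2) \<partial>torus)"
    using w by (intro nn_integral_eq_integral[symmetric]) auto
  also have "\<dots> \<le> (\<integral>\<^sup>+x. 1 + ennreal (\<bar>w x\<bar> powr (7/2)) \<partial>torus)"
    using pt by (intro nn_integral_mono) (simp add: ennreal_leI flip: ennreal_1 ennreal_plus del: ennreal_1)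
  also have "\<dots> = 1 + (\<integral>\<^sup>+x. ennreal (\<bar>w x\<bar> powr (7/2)) \<partial>torus)"
    using torus.emeasure_space_1 by (subst nn_integral_add) auto
  also have "\<dots> \<le> 1 + ennreal (boundL72 E)" by (intro add_left_mono nn_integral_powr_le)
  also have "\<dots> = ennreal (1 + boundL72 E)" using B by (subst ennreal_plus) auto
  finally show ?thesis using B by (subst (asm) ennreal_le_iff) auto
qed

end

subsection \<open>Equicontinuity in the second variable\<close>

lemma integral_unit01:
  fixes f :: "real \<Rightarrow> real"
  assumes [measurable]: "f \<in> borel_measurable borel"
  shows "(\<integral>t. f t \<partial>unit01) = (\<integral>t. indicator {0..1} t * f t \<partial>lborel)"
proof -
  have u: "unit01 = density lborel (\<lambda>t. ennreal (indicator {0..1} t))"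
    unfolding unit01_def by (intro density_cong) (auto simp: indicator_def)
  show ?thesis unfolding u by (subst integral_density) auto
qed

text \<open>The two indicators differ at most between 0 and -\<delta> and between 1 and 1 -
  \<delta>.\<close>

lemma interval_indicator_diff:
  fixes \<delta> :: real
  shows "(\<integral>t. \<bar>indicator {0..1} (t + \<delta>) - indicator {0..1} t\<bar> \<partial>lborel) \<le> 2 * \<bar>\<delta>\<bar>"
    and "integrable lborel (\<lambda>t. \<bar>indicator {0..1} (t + \<delta>) - indicator {0..1} t\<bar> :: real)"
proof -
  define G :: "real \<Rightarrow> real" where "G t = indicator {min 0 (-\<delta>)..max 0 (-\<delta>)} t + indicator {min 1 (1 - \<delta>)..max 1 (1 - \<delta>)} t" for t
  have i: "integrable lborel G" unfolding G_def[abs_def] by (intro Bochner_Integration.integrable_add) auto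
  have le: "\<bar>indicator {0..1} (t + \<delta>) - indicator {0..1} t\<bar> \<le> G t" for t
    by (auto simp: G_def indicator_def min_def max_def)
  show int: "integrable lborel (\<lambda>t. \<bar>indicator {0..1} (t + \<delta>) - indicator {0..1} t\<bar> :: real)"
    by (rule Bochner_Integration.integrable_bound[OF i]) (use order_trans[OF le abs_ge_self] in auto)
  have "(\<integral>t. \<bar>indicator {0..1} (t + \<delta>) - indicator {0..1} t\<bar> \<partial>lborel) \<le> (\<integral>t. G t \<partial>lborel)"
    by (rule integral_mono[OF int i le])
  also have "\<dots> = 2 * \<bar>\<delta>\<bar>"
    unfolding G_def by (subst Bochner_Integration.integral_add) (auto simp: min_def max_def)
  finally show "(\<integral>t. \<bar>indicator {0..1} (t + \<delta>) - indicator {0..1} t\<bar> \<partial>lborel) \<le> 2 * \<bar>\<delta>\<bar>" .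
qed

text \<open>Moving x by d shifts the parameter interval [0, 1] by d / h, so a merely bounded
  function acquires a Lipschitz average along e1.\<close>

lemma tavg_seg_Lipschitz:
  assumes u: "Linf 1 u" and h: "0 < h"
  shows "\<bar>tavg (seg (- h, 0)) u (x + (d, 0)) - tavg (seg (- h, 0)) u x\<bar> \<le> 2 / h * \<bar>d\<bar>"
proof -
  have [measurable]: "u \<in> borel_measurable borel" using u by auto
  have line: "(\<lambda>t. x + (c - t * h, 0)) \<in> borel_measurable borel" for c :: real
    by (intro borel_measurable_continuous_onI continuous_intros)
  define \<phi> where "\<phi> t = u (x + (- t * h, 0))" for t
  have [measurable]: "\<phi> \<in> borel_measurable borel"
    unfolding \<phi>_def[abs_def] using line[of 0] by (auto intro: measurable_compose)
  have \<phi>1: "\<bar>\<phi> t\<bar> \<le> 1" for t unfolding \<phi>_def by (rule LinfD(3)[OF u])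
  define \<delta> where "\<delta> = d / h"
  have avg: "tavg (seg (- h, 0)) u (x + (d, 0)) = (\<integral>t. indicator {0..1} t * \<phi> (t - \<delta>) \<partial>lborel)"
    "tavg (seg (- h, 0)) u x = (\<integral>t. indicator {0..1} t * \<phi> t \<partial>lborel)"
  proof -
    have 1: "tavg (seg (- h, 0)) u z = (\<integral>t. u (z + (- t * h, 0)) \<partial>unit01)" for z
      unfolding tavg_def seg_def by (subst integral_distr) auto
    have "(\<integral>t. u (x + (d, 0) + (- t * h, 0)) \<partial>unit01) = (\<integral>t. \<phi> (t - \<delta>) \<partial>unit01)"
      using h by (intro Bochner_Integration.integral_cong) (auto simp: \<phi>_def \<delta>_def algebra_simps add.assoc)
    then show "tavg (seg (- h, 0)) u (x + (d, 0)) = (\<integral>t. indicator {0..1} t * \<phi> (t - \<delta>) \<partial>lborel)"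
      unfolding 1 by (subst (asm) (2) integral_unit01) auto
    have "(\<integral>t. u (x + (- t * h, 0)) \<partial>unit01) = (\<integral>t. \<phi> t \<partial>unit01)" by (simp add: \<phi>_def)
    then show "tavg (seg (- h, 0)) u x = (\<integral>t. indicator {0..1} t * \<phi> t \<partial>lborel)"
      unfolding 1 by (subst (asm) (2) integral_unit01) auto
  qed
  have i: "integrable lborel (\<lambda>t. indicator {0..1} (t + c) * \<phi> t)" for c
  proof (rule Bochner_Integration.integrable_bound)
    show "integrable lborel (indicator {-c..1-c} :: real \<Rightarrow> real)" by auto
    show "AE t in lborel. norm (indicator {0..1} (t + c) * \<phi> t) \<le> norm (indicator {-c..1-c} t :: real)"
      using \<phi>1 by (auto simp: indicator_def)
  qed measurable
  have "(\<integral>t. indicator {0..1} t * \<phi> (t - \<delta>) \<partial>lborel) = (\<integral>t. indicator {0..1} (t + \<delta>) * \<phi> t \<partial>lborel)"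
    using lborel_integral_real_affine[of 1 "\<lambda>t. indicator {0..1} t * \<phi> (t - \<delta>)" \<delta>] by (simp add: add.commute)
  then have "tavg (seg (- h, 0)) u (x + (d, 0)) - tavg (seg (- h, 0)) u x =
      (\<integral>t. (indicator {0..1} (t + \<delta>) - indicator {0..1} t) * \<phi> t \<partial>lborel)"
    unfolding avg using i[of \<delta>] i[of 0] by (simp add: left_diff_distrib)
  also have "\<bar>\<dots>\<bar> \<le> (\<integral>t. \<bar>(indicator {0..1} (t + \<delta>) - indicator {0..1} t) * \<phi> t\<bar> \<partial>lborel)"
    by (rule integral_abs_bound)
  also have "\<dots> \<le> (\<integral>t. \<bar>indicator {0..1} (t + \<delta>) - indicator {0..1} t\<bar> \<partial>lborel)"
  proof (rule integral_mono[OF _ interval_indicator_diff(2)])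
    show "integrable lborel (\<lambda>t. \<bar>(indicator {0..1} (t + \<delta>) - indicator {0..1} t) * \<phi> t\<bar>)"
      using Bochner_Integration.integrable_diff[OF i[of \<delta>] i[of 0]] by (simp add: left_diff_distrib)
    show "\<bar>(indicator {0..1} (t + \<delta>) - indicator {0..1} t) * \<phi> t\<bar> \<le> \<bar>indicator {0..1} (t + \<delta>) - indicator {0..1} t\<bar>" for t
      using mult_left_mono[OF \<phi>1[of t], of "\<bar>indicator {0..1} (t + \<delta>) - indicator {0..1} t\<bar>"] by (simp add: abs_mult)
  qed
  also have "\<dots> \<le> 2 * \<bar>\<delta>\<bar>" by (rule interval_indicator_diff(1))
  also have "\<dots> = 2 / h * \<bar>d\<bar>" using h by (simp add: \<delta>_def abs_divide)
  finally show ?thesis .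
qed

lemma tavg_Lipschitz:
  assumes \<nu>: "bprob \<nu>" and u: "Linf B u" and K: "\<And>x d. \<bar>u (x + (d, 0)) - u x\<bar> \<le> K * \<bar>d\<bar>"
  shows "\<bar>tavg \<nu> u (x + (d, 0)) - tavg \<nu> u x\<bar> \<le> K * \<bar>d\<bar>"
proof -
  interpret prob_space \<nu> using \<nu> by (simp add: bprob_def)
  note [measurable_cong] = bprob_sets[OF \<nu>]
  have [measurable]: "u \<in> borel_measurable borel" using u by auto
  have i: "integrable \<nu> (\<lambda>y. u (z + y))" for z
    by (rule integrable_const_bound[where B = B]) (use LinfD(3)[OF u] in auto)
  have "tavg \<nu> u (x + (d, 0)) - tavg \<nu> u x = (\<integral>y. u (x + (d, 0) + y) - u (x + y) \<partial>\<nu>)"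
    unfolding tavg_def using i by simp
  also have "\<bar>\<dots>\<bar> \<le> (\<integral>y. \<bar>u (x + (d, 0) + y) - u (x + y)\<bar> \<partial>\<nu>)" by (rule integral_abs_bound)
  also have "\<dots> \<le> (\<integral>y. K * \<bar>d\<bar> \<partial>\<nu>)"
  proof (rule integral_mono)
    show "\<bar>u (x + (d, 0) + y) - u (x + y)\<bar> \<le> K * \<bar>d\<bar>" for y
      using K[of "x + y" d] by (simp add: ac_simps)
  qed (use i in auto)
  finally show ?thesis by (simp add: prob_space)
qed

lemma integral_tavg_Linf_mult:
  assumes \<nu>: "bprob \<nu>" and u: "Linf B u" and f: "L1p f"
  shows "(\<integral>x. tavg \<nu> u x * f x \<partial>torus) = (\<integral>y. (\<integral>x. u (x + y) * f x \<partial>torus) \<partial>\<nu>)"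
proof -
  interpret pair_sigma_finite torus \<nu> by (rule bprob_pair[OF \<nu>])
  interpret nu: prob_space \<nu> using \<nu> by (simp add: bprob_def)
  note [measurable_cong] = bprob_sets[OF \<nu>]
  have [measurable]: "u \<in> borel_measurable borel" "f \<in> borel_measurable borel" using u f by auto
  have pf: "integrable (torus \<Otimes>\<^sub>M \<nu>) (\<lambda>(x, y). B * \<bar>f x\<bar>)"
  proof (rule Fubini_integrable)
    show "integrable torus (\<lambda>x. \<integral>y. norm (case (x, y) of (x, y) \<Rightarrow> B * \<bar>f x\<bar>) \<partial>\<nu>)"
      using L1pD(3)[OF L1p_abs[OF f]] by (simp add: nu.prob_space abs_mult)
  qed auto
  have i: "integrable (torus \<Otimes>\<^sub>M \<nu>) (\<lambda>(x, y). u (x + y) * f x)"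
  proof (rule Bochner_Integration.integrable_bound[OF pf])
    show "AE z in torus \<Otimes>\<^sub>M \<nu>. norm (case z of (x, y) \<Rightarrow> u (x + y) * f x) \<le> norm (case z of (x, y) \<Rightarrow> B * \<bar>f x\<bar>)"
    proof (intro AE_I2)
      fix z :: "(real \<times> real) \<times> (real \<times> real)"
      obtain x y where z: "z = (x, y)" by (cases z)
      have "\<bar>u (x + y)\<bar> * \<bar>f x\<bar> \<le> B * \<bar>f x\<bar>" by (intro mult_right_mono LinfD(3)[OF u]) auto
      then show "norm (case z of (x, y) \<Rightarrow> u (x + y) * f x) \<le> norm (case z of (x, y) \<Rightarrow> B * \<bar>f x\<bar>)"
        using abs_ge_self[of "B * \<bar>f x\<bar>"] by (simp add: z abs_mult)
    qed
  qed measurable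
  have "(\<integral>x. tavg \<nu> u x * f x \<partial>torus) = (\<integral>x. (\<integral>y. u (x + y) * f x \<partial>\<nu>) \<partial>torus)"
    by (simp add: tavg_def)
  also have "\<dots> = (\<integral>y. (\<integral>x. u (x + y) * f x \<partial>torus) \<partial>\<nu>)"
    by (rule Fubini_integral[symmetric]) (rule i)
  finally show ?thesis .
qed

lemma integral_seg:
  fixes F :: "real \<times> real \<Rightarrow> real"
  assumes "F \<in> borel_measurable borel"
  shows "(\<integral>z. F z \<partial>seg y) = (\<integral>t. F (t *\<^sub>R y) \<partial>unit01)"
  unfolding seg_def using assms by (subst integral_distr) auto

text \<open>The adjoint of a translation is the opposite translation.\<close>

lemma integral_tavg_seg_adjoint:
  assumes u: "Linf B u" and f: "L1p f"
  shows "(\<integral>x. u x * tavg (seg y) f x \<partial>torus) = (\<integral>x. tavg (seg (- y)) u x * f x \<partial>torus)"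
proof -
  have [measurable]: "u \<in> borel_measurable borel" "f \<in> borel_measurable borel" using u f by auto
  have m1: "(\<lambda>z. \<integral>x. f (x + z) * u x \<partial>torus) \<in> borel_measurable borel"
    by (rule torus.borel_measurable_lebesgue_integral) measurable
  have m2: "(\<lambda>z. \<integral>x. u (x + z) * f x \<partial>torus) \<in> borel_measurable borel"
    by (rule torus.borel_measurable_lebesgue_integral) measurable
  have "(\<integral>x. u x * tavg (seg y) f x \<partial>torus) = (\<integral>x. of_real (tavg (seg y) f x) * u x \<partial>torus)"
    by (simp add: mult.commute)
  also have "\<dots> = (\<integral>z. (\<integral>x. of_real (f (x + z)) * u x \<partial>torus) \<partial>seg y)"
    by (rule integral_mult_tavg[OF bprob_seg f, of u B]) (use LinfD(3)[OF u] in auto)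
  also have "\<dots> = (\<integral>t. (\<integral>x. f (x + t *\<^sub>R y) * u x \<partial>torus) \<partial>unit01)"
    using integral_seg[OF m1] by simp
  also have "\<dots> = (\<integral>t. (\<integral>x. u (x + t *\<^sub>R (- y)) * f x \<partial>torus) \<partial>unit01)"
  proof (rule Bochner_Integration.integral_cong[OF refl])
    fix t
    show "(\<integral>x. f (x + t *\<^sub>R y) * u x \<partial>torus) = (\<integral>x. u (x + t *\<^sub>R (- y)) * f x \<partial>torus)"
      by (rule integral_cong_shift[where y = "t *\<^sub>R y"])
         (use L1p_mult_Linf[OF Linf_shift[OF u] f, of "t *\<^sub>R (- y)"] in auto)
  qed
  also have "\<dots> = (\<integral>x. tavg (seg (- y)) u x * f x \<partial>torus)"
    unfolding integral_tavg_Linf_mult[OF bprob_seg u f] using integral_seg[OF m2] by simp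
  finally show ?thesis .
qed

context burgers
begin

text \<open>The x1-derivative in v is moved to u in the form of a difference quotient, which the
  Lipschitz constant bounds. The norm of b does not appear.\<close>

lemma flux_bound_Lipschitz:
  assumes u: "Linf B u" and K: "\<And>x d. \<bar>u (x + (d, 0)) - u x\<bar> \<le> K * \<bar>d\<bar>"
  shows "\<bar>\<integral>x. u x * v x \<partial>torus\<bar> \<le> K / 2 * (\<integral>x. (w x)\<^sup>2 \<partial>torus)"
proof -
  have w2: "L1p (\<lambda>x. (w x)\<^sup>2)" by (rule L2p_L1p_square[OF w])
  have "\<bar>\<integral>x. u x * (((w (x + (d, 0)))\<^sup>2 - (w x)\<^sup>2) / d) \<partial>torus\<bar> \<le> K * (\<integral>x. (w x)\<^sup>2 \<partial>torus)" if d: "d \<noteq> 0" for d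
  proof -
    have us: "Linf B (\<lambda>x. u (x + (- d, 0)))" by (rule Linf_shift[OF u])
    note i1 = L1pD(3)[OF L1p_mult_Linf[OF u L1p_shift[OF w2, of "(d, 0)"]]]
      and i2 = L1pD(3)[OF L1p_mult_Linf[OF u w2]] and i3 = L1pD(3)[OF L1p_mult_Linf[OF us w2]]
    have s: "(\<integral>x. u x * (w (x + (d, 0)))\<^sup>2 \<partial>torus) = (\<integral>x. u (x + (- d, 0)) * (w x)\<^sup>2 \<partial>torus)"
      by (rule integral_cong_shift[where y = "(d, 0)"])
         (use L1p_mult_Linf[OF us w2] in \<open>auto simp: add.assoc zero_prod_def[symmetric]\<close>)
    have "(\<integral>x. u x * (((w (x + (d, 0)))\<^sup>2 - (w x)\<^sup>2) / d) \<partial>torus) =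
        (\<integral>x. (u x * (w (x + (d, 0)))\<^sup>2 - u x * (w x)\<^sup>2) / d \<partial>torus)"
      by (simp add: right_diff_distrib)
    also have "\<dots> = ((\<integral>x. u (x + (- d, 0)) * (w x)\<^sup>2 \<partial>torus) - (\<integral>x. u x * (w x)\<^sup>2 \<partial>torus)) / d"
      using Bochner_Integration.integral_diff[OF i1 i2] s by simp
    also have "\<dots> = (\<integral>x. (u (x + (- d, 0)) - u x) * (w x)\<^sup>2 \<partial>torus) / d"
      unfolding Bochner_Integration.integral_diff[OF i3 i2, symmetric] by (simp add: left_diff_distrib)
    finally have eq: "(\<integral>x. u x * (((w (x + (d, 0)))\<^sup>2 - (w x)\<^sup>2) / d) \<partial>torus) = (\<integral>x. (u (x + (- d, 0)) - u x) * (w x)\<^sup>2 \<partial>torus) / d" .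
    have "\<bar>\<integral>x. (u (x + (- d, 0)) - u x) * (w x)\<^sup>2 \<partial>torus\<bar> \<le> (\<integral>x. \<bar>(u (x + (- d, 0)) - u x) * (w x)\<^sup>2\<bar> \<partial>torus)"
      by (rule integral_abs_bound)
    also have "\<dots> \<le> (\<integral>x. K * \<bar>d\<bar> * (w x)\<^sup>2 \<partial>torus)"
    proof (rule integral_mono)
      show "integrable torus (\<lambda>x. \<bar>(u (x + (- d, 0)) - u x) * (w x)\<^sup>2\<bar>)"
        using Bochner_Integration.integrable_diff[OF i3 i2] by (simp add: left_diff_distrib)
      show "integrable torus (\<lambda>x. K * \<bar>d\<bar> * (w x)\<^sup>2)" using w2 by auto
      show "\<bar>(u (x + (- d, 0)) - u x) * (w x)\<^sup>2\<bar> \<le> K * \<bar>d\<bar> * (w x)\<^sup>2" for x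
        unfolding abs_mult using K[of x "- d"] by (intro mult_mono) auto
    qed
    finally have "\<bar>\<integral>x. (u (x + (- d, 0)) - u x) * (w x)\<^sup>2 \<partial>torus\<bar> \<le> K * (\<integral>x. (w x)\<^sup>2 \<partial>torus) * \<bar>d\<bar>"
      by (simp add: ac_simps)
    then show ?thesis unfolding eq using d by (simp add: abs_divide pos_divide_le_eq)
  qed
  then have ev: "\<forall>\<^sub>F d in at 0. \<bar>\<integral>x. u x * (((w (x + (d, 0)))\<^sup>2 - (w x)\<^sup>2) / d) \<partial>torus\<bar> \<le> K * (\<integral>x. (w x)\<^sup>2 \<partial>torus)"
    by (auto simp: eventually_at_filter)
  have "\<bar>2 * (\<integral>x. u x * v x \<partial>torus)\<bar> \<le> K * (\<integral>x. (w x)\<^sup>2 \<partial>torus)"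
    by (rule tendsto_upperbound[OF tendsto_rabs[OF square_quotient_tendsto[OF u]] ev]) simp
  then show ?thesis by (simp add: abs_mult)
qed

text \<open>The sign of f is too rough for the equation. Replacing f by its average over a segment
  costs the averaging defect of w twice, and by \<open>integral_tavg_seg_adjoint\<close> the average
  falls on the sign, which becomes Lipschitz with constant 2 / h. The length h is independent of
  t.\<close>

lemma modL1_second_le:
  assumes l: "0 < l" and h: "0 < h"
  shows "modL1 w (0, t) \<le> 2 * (l + 48 * E * h / l\<^sup>2) + \<bar>t\<bar> * ((\<integral>x. (w x)\<^sup>2 \<partial>torus) + 2 * \<gamma>) / h"
proof -
  note w1 = L2p_L1p[OF w]
  define f where "f x = w (x + (0, t)) - w x" for x
  have f: "L1p f" unfolding f_def[abs_def] by (rule L1p_diff[OF L1p_shift[OF w1] w1])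
  have [measurable]: "w \<in> borel_measurable borel" "f \<in> borel_measurable borel" using w f by auto
  define sg where "sg x = sgn (f x)" for x
  have sg: "Linf 1 sg" unfolding Linf_def sg_def using L1pD(2)[OF f] by (auto simp: sgn_real_def periodic_def)
  define A where "A = tavg (seg (h, 0))"
  define r where "r x = \<bar>A w x - w x\<bar>" for x
  have Aw: "L1p (A w)" and Af: "L1p (A f)" unfolding A_def using tavg_L1p[OF bprob_seg] w1 f by auto
  have r: "L1p r" unfolding r_def[abs_def] by (rule L1p_abs[OF L1p_diff[OF Aw w1]])
  have defect: "(\<integral>x. \<bar>A f x - f x\<bar> \<partial>torus) \<le> 2 * (l + 48 * E * h / l\<^sup>2)"
  proof -
    have "(\<integral>x. \<bar>A f x - f x\<bar> \<partial>torus) \<le> (\<integral>x. r (x + (0, t)) + r x \<partial>torus)"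
    proof (rule integral_mono_AE)
      show "integrable torus (\<lambda>x. \<bar>A f x - f x\<bar>)" using L1p_abs[OF L1p_diff[OF Af f]] by auto
      show "integrable torus (\<lambda>x. r (x + (0, t)) + r x)" using L1p_add[OF L1p_shift[OF r, of "(0, t)"] r] by auto
      have "AE x in torus. integrable (seg (h, 0)) (\<lambda>y. w (x + (0, t) + y))"
        using AE_integrable_tavg[OF bprob_seg L1p_shift[OF w1, of "(0, t)"], of "(h, 0)"] by (simp add: ac_simps)
      then show "AE x in torus. \<bar>A f x - f x\<bar> \<le> r (x + (0, t)) + r x"
        using AE_integrable_tavg[OF bprob_seg w1, of "(h, 0)"]
      proof eventually_elim
        case (elim x)
        have "A f x = (\<integral>y. w (x + (0, t) + y) - w (x + y) \<partial>seg (h, 0))"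
          unfolding A_def tavg_def f_def by (simp add: ac_simps)
        then have "A f x = A w (x + (0, t)) - A w x" using elim by (simp add: A_def tavg_def)
        then show ?case unfolding f_def r_def by linarith
      qed
    qed
    also have "\<dots> = (\<integral>x. r (x + (0, t)) \<partial>torus) + (\<integral>x. r x \<partial>torus)"
      using L1pD(3)[OF L1p_shift[OF r, of "(0, t)"]] L1pD(3)[OF r] by (rule Bochner_Integration.integral_add)
    also have "(\<integral>x. r (x + (0, t)) \<partial>torus) = (\<integral>x. r x \<partial>torus)" using r by (intro integral_torus_shift) auto
    also have "\<dots> + (\<integral>x. r x \<partial>torus) \<le> 2 * (l + 48 * E * h / l\<^sup>2)"
    proof -
      have "(\<integral>x. r x \<partial>torus) \<le> l + 48 * E * h / l\<^sup>2"
        unfolding r_def A_def using l h by (intro tavg_minus_first_le) auto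
      from add_mono[OF this this] show ?thesis unfolding mult_2 .
    qed
    finally show ?thesis .
  qed
  define u where "u = tavg (seg (- (h, 0))) sg"
  have u: "Linf 1 u" unfolding u_def by (rule Linf_tavg[OF bprob_seg sg])
  have uL: "\<bar>u (x + (d, 0)) - u x\<bar> \<le> 2 / h * \<bar>d\<bar>" for x d
    unfolding u_def using tavg_seg_Lipschitz[OF sg h] by simp
  have lip: "(\<integral>x. (u (x + (d, 0)) - u x)\<^sup>2 \<partial>torus) \<le> (2 / h)\<^sup>2 * d\<^sup>2" for d
  proof -
    have "(\<integral>x. (u (x + (d, 0)) - u x)\<^sup>2 \<partial>torus) \<le> (\<integral>x. (2 / h * \<bar>d\<bar>)\<^sup>2 \<partial>torus)"
    proof (rule integral_mono)
      show "integrable torus (\<lambda>x. (u (x + (d, 0)) - u x)\<^sup>2)"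
        using L2p_diff[OF L2p_shift[OF Linf_L2p[OF u], of "(d, 0)"] Linf_L2p[OF u]] by auto
      show "(u (x + (d, 0)) - u x)\<^sup>2 \<le> (2 / h * \<bar>d\<bar>)\<^sup>2" for x
        using power_mono[OF uL[of x d], of 2] by simp
    qed simp
    then show ?thesis using torus.prob_space by (simp add: power_mult_distrib power_divide)
  qed
  have avg_v: "\<bar>\<integral>x. u x * tavg (seg (0, t)) v x \<partial>torus\<bar> \<le> 1 / h * (\<integral>x. (w x)\<^sup>2 \<partial>torus)"
  proof -
    have "\<bar>\<integral>x. tavg (seg (- (0, t))) u x * v x \<partial>torus\<bar> \<le> 2 / h / 2 * (\<integral>x. (w x)\<^sup>2 \<partial>torus)"
      by (rule flux_bound_Lipschitz[OF Linf_tavg[OF bprob_seg u] tavg_Lipschitz[OF bprob_seg u uL]])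
    then show ?thesis unfolding integral_tavg_seg_adjoint[OF u v_L1p] by simp
  qed
  have "\<bar>(\<integral>x. u x * f x \<partial>torus) - t * (\<integral>x. u x * tavg (seg (0, t)) v x \<partial>torus)\<bar> \<le> \<bar>t\<bar> * (2 / h * \<gamma>)"
    unfolding f_def by (rule weak_equation[OF u _ lip]) (use h in auto)
  moreover have "\<bar>t * (\<integral>x. u x * tavg (seg (0, t)) v x \<partial>torus)\<bar> \<le> \<bar>t\<bar> * (1 / h * (\<integral>x. (w x)\<^sup>2 \<partial>torus))"
    unfolding abs_mult by (intro mult_left_mono avg_v) auto
  ultimately have "\<bar>\<integral>x. u x * f x \<partial>torus\<bar> \<le> \<bar>t\<bar> * (1 / h * (\<integral>x. (w x)\<^sup>2 \<partial>torus)) + \<bar>t\<bar> * (2 / h * \<gamma>)" by linarith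
  also have "\<dots> = \<bar>t\<bar> * ((\<integral>x. (w x)\<^sup>2 \<partial>torus) + 2 * \<gamma>) / h" using h by (simp add: field_simps)
  finally have main: "\<bar>\<integral>x. u x * f x \<partial>torus\<bar> \<le> \<bar>t\<bar> * ((\<integral>x. (w x)\<^sup>2 \<partial>torus) + 2 * \<gamma>) / h" .
  have "modL1 w (0, t) = (\<integral>x. sg x * f x \<partial>torus)"
    unfolding modL1_def by (intro Bochner_Integration.integral_cong) (auto simp: sg_def f_def abs_sgn mult.commute)
  moreover have "\<bar>(\<integral>x. sg x * A f x \<partial>torus) - (\<integral>x. sg x * f x \<partial>torus)\<bar> \<le> 1 * (\<integral>x. \<bar>A f x - f x\<bar> \<partial>torus)"
    by (rule integral_mult_Linf_diff_le[OF sg Af f])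
  moreover have "(\<integral>x. sg x * A f x \<partial>torus) = (\<integral>x. u x * f x \<partial>torus)"
    unfolding A_def u_def by (rule integral_tavg_seg_adjoint[OF sg f])
  ultimately show ?thesis using defect main by linarith
qed

text \<open>The length h makes 48 E h / l^2 at most l, with + 1 keeping the denominator positive for
  E0 = 0, and d makes the term with |t| / h at most l. The first variable then costs 2 l and the
  second 2 (l + l) + l.\<close>

lemma modL1_uniform:
  assumes E0: "E \<le> E0" and g0: "\<gamma> \<le> \<gamma>0" and l: "0 < l"
    and h: "h = l ^ 3 / (48 * E0 + 1)" and d: "d \<le> h" "d \<le> l * h / (1 + boundL72 E0 + 2 * \<gamma>0)"
    and y: "\<bar>fst y\<bar> \<le> d" "\<bar>snd y\<bar> \<le> d"
  shows "modL1 w y \<le> 8 * l"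
proof -
  note w1 = L2p_L1p[OF w]
  have E0n: "0 \<le> E0" using E0 E_nonneg by linarith
  have h0: "0 < h" unfolding h using l E0n by simp
  have Eh: "48 * E * s / l\<^sup>2 \<le> l" if "0 \<le> s" "s \<le> h" for s
  proof -
    have "48 * E * s \<le> (48 * E0 + 1) * h"
      using E0 E0n that E_nonneg h0 by (intro mult_mono) auto
    also have "\<dots> = l ^ 3" unfolding h using E0n by simp
    finally show ?thesis using l by (simp add: divide_le_eq power2_eq_square power3_eq_cube)
  qed
  define B where "B = 1 + boundL72 E0 + 2 * \<gamma>0"
  have "0 \<le> boundL72 E0" by (rule boundL72_nonneg[OF E0n])
  then have B0: "0 < B" unfolding B_def using g0 nonneg(2) by linarith
  have W: "(\<integral>x. (w x)\<^sup>2 \<partial>torus) + 2 * \<gamma> \<le> B"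
    using integral_square_le boundL72_mono[OF E_nonneg E0] g0 unfolding B_def by linarith
  have 1: "modL1 w (fst y, 0) \<le> 2 * l"
    using modL1_first_le[OF l, of "fst y"] Eh[of "\<bar>fst y\<bar>"] y d by simp
  have "\<bar>snd y\<bar> * ((\<integral>x. (w x)\<^sup>2 \<partial>torus) + 2 * \<gamma>) / h \<le> (l * h / B) * B / h"
    using W y d(2) h0 nonneg(2) B0 l unfolding B_def[symmetric] by (intro divide_right_mono mult_mono) auto
  also have "\<dots> = l" using B0 h0 by simp
  finally have "\<bar>snd y\<bar> * ((\<integral>x. (w x)\<^sup>2 \<partial>torus) + 2 * \<gamma>) / h \<le> l" .
  then have "modL1 w (0, snd y) \<le> 2 * (l + l) + l"
    by (intro order_trans[OF modL1_second_le[OF l h0, of "snd y"]] add_mono mult_left_mono Eh) (use h0 in auto)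
  then have 2: "modL1 w (0, snd y) \<le> 5 * l" by simp
  have i: "integrable torus (\<lambda>x. \<bar>w (x + y) - w (x + (0, snd y))\<bar>)" "integrable torus (\<lambda>x. \<bar>w (x + (0, snd y)) - w x\<bar>)"
    by (intro L1pD(3) L1p_abs L1p_diff L1p_shift w1)+
  have "modL1 w y \<le> (\<integral>x. \<bar>w (x + y) - w (x + (0, snd y))\<bar> + \<bar>w (x + (0, snd y)) - w x\<bar> \<partial>torus)"
    unfolding modL1_def
  proof (rule integral_mono)
    show "integrable torus (\<lambda>x. \<bar>w (x + y) - w x\<bar>)" by (intro L1pD(3) L1p_abs L1p_diff L1p_shift w1)
  qed (use i in auto)
  also have "\<dots> = (\<integral>x. \<bar>w (x + y) - w (x + (0, snd y))\<bar> \<partial>torus) + modL1 w (0, snd y)"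
    unfolding modL1_def by (rule Bochner_Integration.integral_add[OF i])
  also have "(\<integral>x. \<bar>w (x + y) - w (x + (0, snd y))\<bar> \<partial>torus) = modL1 w (fst y, 0)"
    unfolding modL1_def
  proof (rule integral_cong_shift[where y = "(0, snd y)"])
    have L: "L1p (\<lambda>x. \<bar>w (x + (fst y, 0)) - w x\<bar>)" by (intro L1p_abs L1p_diff L1p_shift w1)
    then show "(\<lambda>x. \<bar>w (x + (fst y, 0)) - w x\<bar>) \<in> borel_measurable borel" "periodic (\<lambda>x. \<bar>w (x + (fst y, 0)) - w x\<bar>)" by auto
    show "\<bar>w (x + y) - w (x + (0, snd y))\<bar> = \<bar>w (x + (0, snd y) + (fst y, 0)) - w (x + (0, snd y))\<bar>" for x
      by (simp add: add.assoc)
  qed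
  finally show ?thesis using 1 2 l by linarith
qed

end

subsection \<open>From the energy to the equation for Fourier coefficients\<close>

lemma abs_powr_2: "\<bar>x\<bar> powr 2 = x\<^sup>2" for x :: real
  by (cases "x = 0") (auto simp: powr_numeral)

lemma in_Lp_2_L2p:
  assumes "in_Lp 2 f" shows "L2p f"
proof -
  have f: "f \<in> borel_measurable borel" "periodic f" "set_integrable lborel cell (\<lambda>x. (f x)\<^sup>2)"
    using assms unfolding in_Lp_def abs_powr_2 by auto
  then have "(\<lambda>x. (f x)\<^sup>2) \<in> borel_measurable borel" by measurable
  from f integrable_torus[OF this] show ?thesis unfolding L2p_def by blast
qed

lemma has_vector_derivative_cis_scaled:
  "((\<lambda>t. c * cis (- (a * t + r))) has_vector_derivative c * (- \<i> * complex_of_real a) * cis (- (a * t + r))) (at t)"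
proof -
  have "((\<lambda>t. - (a * t + r)) has_derivative (\<lambda>s. - (a * s))) (at t)"
    by (auto intro!: derivative_eq_intros)
  from has_derivative_mult_right[OF has_derivative_cis[OF this], of c]
  show ?thesis unfolding has_vector_derivative_def
    by (rule has_derivative_eq_rhs) (auto simp: scaleR_conv_of_real algebra_simps)
qed

lemma exp_partial_derivs:
  fixes k :: "real \<times> real"
  shows "((\<lambda>t. c * cis (- (k \<bullet> (t, x2)))) has_vector_derivative c * (- \<i> * complex_of_real (fst k)) * cis (- (k \<bullet> (x1, x2)))) (at x1)"
    and "((\<lambda>t. c * cis (- (k \<bullet> (x1, t)))) has_vector_derivative c * (- \<i> * complex_of_real (snd k)) * cis (- (k \<bullet> (x1, x2)))) (at x2)"
  using has_vector_derivative_cis_scaled[of c "fst k" "snd k * x2" x1] has_vector_derivative_cis_scaled[of c "snd k" "fst k * x1" x2]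
  by (simp_all add: inner_prod_def add.commute)

lemma d1_exp: "d1 (\<lambda>x. c * cis (- (k \<bullet> x))) = (\<lambda>x. c * (- \<i> * complex_of_real (fst k)) * cis (- (k \<bullet> x)))"
  unfolding d1_def by (intro ext) (use vector_derivative_at[OF exp_partial_derivs(1)] in auto)

lemma d2_exp: "d2 (\<lambda>x. c * cis (- (k \<bullet> x))) = (\<lambda>x. c * (- \<i> * complex_of_real (snd k)) * cis (- (k \<bullet> x)))"
  unfolding d2_def by (intro ext) (use vector_derivative_at[OF exp_partial_derivs(2)] in auto)

text \<open>The constant c is arbitrary in the induction because each partial derivative changes
  it.\<close>

lemma Ck_exp: "Ck n (\<lambda>x. c * cis (- (k \<bullet> x)))"
proof (induction n arbitrary: c)
  case 0
  show ?case by (auto intro!: continuous_intros)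
next
  case (Suc n)
  have "continuous_on UNIV (\<lambda>x. c * cis (- (k \<bullet> x)))" by (intro continuous_intros)
  moreover have "(\<lambda>t. c * cis (- (k \<bullet> (t, x2)))) differentiable (at x1)" "(\<lambda>t. c * cis (- (k \<bullet> (x1, t)))) differentiable (at x2)" for x1 x2
    using differentiableI_vector exp_partial_derivs by blast+
  ultimately show ?case unfolding Ck.simps d1_exp d2_exp using Suc by blast
qed

lemma exp_test_function: "k \<in> freqs \<Longrightarrow> (\<lambda>x. cis (- (k \<bullet> x))) \<in> test_functions"
  using Ck_exp[of _ 1 k] periodic_cis(1)[of k] by (simp add: test_functions_def)

lemma distr_of_exp:
  assumes "f \<in> borel_measurable borel"
  shows "distr_of f (\<lambda>x. c * cis (- (k \<bullet> x))) = c * fc f k"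
proof -
  have [measurable]: "f \<in> borel_measurable borel" by fact
  have "distr_of f (\<lambda>x. c * cis (- (k \<bullet> x))) = (\<integral>x. complex_of_real (f x) * (c * cis (- (k \<bullet> x))) \<partial>torus)"
    unfolding distr_of_def by (rule integral_torus) measurable
  also have "\<dots> = (\<integral>x. c * (complex_of_real (f x) * cis (- (k \<bullet> x))) \<partial>torus)" by (simp add: ac_simps)
  finally show ?thesis by (simp add: fc_def)
qed

lemma D_exp:
  assumes f: "f \<in> borel_measurable borel"
  shows "D1 (distr_of f) (\<lambda>x. cis (- (k \<bullet> x))) = \<i> * complex_of_real (fst k) * fc f k"
    and "D2 (distr_of f) (\<lambda>x. cis (- (k \<bullet> x))) = \<i> * complex_of_real (snd k) * fc f k"
  using d1_exp[of 1 k] d2_exp[of 1 k] distr_of_exp[OF f, of "- \<i> * complex_of_real (fst k)" k]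
    distr_of_exp[OF f, of "- \<i> * complex_of_real (snd k)" k]
  by (simp_all add: D1_def D2_def)

text \<open>The defining identities are evaluated at exponentials. For k1 = 0 both sides of the last
  equation vanish, because w has vanishing mean in x1.\<close>

lemma burgers_of_energy:
  assumes w: "in_Lp 2 w" and mean: "vanishing_mean_x1 (distr_of w)"
    and b: "in_Lp 2 b" "distr_eq (D1 (distr_of w)) (distr_of b)"
    and g: "in_Lp 2 g" "is_abs_D1_inv (eta w) (distr_of g)"
  shows "burgers w b g"
proof
  show L: "L2p w" "L2p b" "L2p g" using w b g by (auto intro: in_Lp_2_L2p)
  have mw: "w \<in> borel_measurable borel" "b \<in> borel_measurable borel" "g \<in> borel_measurable borel" using L by auto
  then have mw2: "(\<lambda>x. 1 / 2 * (w x)\<^sup>2) \<in> borel_measurable borel" by measurable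
  fix k assume k: "k \<in> freqs"
  have "D1 (distr_of w) (\<lambda>x. cis (- (k \<bullet> x))) = distr_of b (\<lambda>x. cis (- (k \<bullet> x)))"
    using b(2) exp_test_function[OF k] by (simp add: distr_eq_def)
  then show "fc b k = \<i> * complex_of_real (fst k) * fc w k"
    using distr_of_exp[OF mw(2), of 1 k] D_exp(1)[OF mw(1)] by simp
  show zero: "fc w k = 0" if "fst k = 0"
    using mean k that fourier_distr_of[OF mw(1)] by (simp add: vanishing_mean_x1_def)
  have e: "fourier (eta w) k = \<i> * complex_of_real (snd k) * fc w k - \<i> * complex_of_real (fst k) / 2 * fc (\<lambda>x. (w x)\<^sup>2) k"
    unfolding fourier_def eta_def D_exp(2)[OF mw(1)] D_exp(1)[OF mw2] fc_cmult by simp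
  have "fc g k = (if fst k = 0 then 0 else fourier (eta w) k / complex_of_real \<bar>fst k\<bar>)"
    using g(2) k fourier_distr_of[OF mw(3)] by (simp add: is_abs_D1_inv_def)
  then show "\<i> * complex_of_real (snd k) * fc w k =
      complex_of_real \<bar>fst k\<bar> * fc g k + \<i> * complex_of_real (fst k) / 2 * fc (\<lambda>x. (w x)\<^sup>2) k"
    using zero by (cases "fst k = 0") (simp_all add: e)
qed

section \<open>Bounds shared by all members of the sequence\<close>

definition controlled :: "real \<Rightarrow> real \<Rightarrow> (real \<times> real \<Rightarrow> real) \<Rightarrow> bool"
  where "controlled E0 G0 w \<longleftrightarrow> (\<exists>b g. burgers w b g \<and> burgers.E b g \<le> E0 \<and> burgers.\<gamma> g \<le> G0)"

lemma nn_integral_cell_square: "L2p f \<Longrightarrow> (\<integral>\<^sup>+x\<in>cell. ennreal ((f x)\<^sup>2) \<partial>lborel) = ennreal (\<integral>x. (f x)\<^sup>2 \<partial>torus)"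
  using nn_integral_torus[of "\<lambda>x. ennreal ((f x)\<^sup>2)"] nn_integral_eq_integral[of torus "\<lambda>x. (f x)\<^sup>2"]
  by (auto simp: L2p_def)

lemma INF_ennreal_approx:
  fixes F :: "'a \<Rightarrow> ennreal"
  assumes "(INF a\<in>A. F a) = ennreal x" "0 \<le> x" "0 < \<delta>"
  obtains a where "a \<in> A" "F a \<le> ennreal (x + \<delta>)"
proof -
  have "(INF a\<in>A. F a) < ennreal (x + \<delta>)"
    unfolding assms(1) using assms(2,3) by (intro ennreal_lessI) auto
  then show ?thesis using that by (auto simp: INF_less_iff less_imp_le)
qed

text \<open>The infima are approximated by representatives with errors \<epsilon>/2 and
  1/(2\<epsilon>). Weighted by 1/\<epsilon> and \<epsilon>, each contributes 1/2, whence 2 c + 1. In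
  the product of the norms of b and g the weights cancel; the bound \<epsilon>0 enters only through
  the norm of g.\<close>

lemma controlled_of_energy:
  assumes adm: "w \<in> admissible" and eps: "0 < \<epsilon>" "\<epsilon> \<le> \<epsilon>0" and c: "0 \<le> c"
    and en: "energy_eps \<epsilon> w \<le> ennreal c"
  shows "controlled (2 * c + 1) (sqrt (\<epsilon>0 * (2 * c + 1))) w"
proof -
  have hw: "in_Lp 2 w" "vanishing_mean_x1 (distr_of w)" and fin: "energy w < \<infinity>" using adm by (auto simp: admissible_def)
  have "int_abs_D1_inv_eta_sq w \<noteq> \<infinity>" "int_D1_sq w \<noteq> \<infinity>" using fin by (auto simp: energy_def split: if_splits)
  then obtain xg xb where x: "int_abs_D1_inv_eta_sq w = ennreal xg" "0 \<le> xg" "int_D1_sq w = ennreal xb" "0 \<le> xb"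
    by (metis ennreal_cases infinity_ennreal_def)
  have "energy_eps \<epsilon> w = ennreal (1 / 2 * (1 / \<epsilon> * xg + \<epsilon> * xb))"
  proof -
    have "ennreal (1 / \<epsilon>) * ennreal xg = ennreal (1 / \<epsilon> * xg)" "ennreal \<epsilon> * ennreal xb = ennreal (\<epsilon> * xb)"
      using x eps by (intro ennreal_mult[symmetric], simp, simp)+
    moreover have "ennreal (1 / \<epsilon> * xg) + ennreal (\<epsilon> * xb) = ennreal (1 / \<epsilon> * xg + \<epsilon> * xb)"
      using x eps by (intro ennreal_plus[symmetric]) auto
    moreover have "ennreal (1 / 2) * ennreal (1 / \<epsilon> * xg + \<epsilon> * xb) = ennreal (1 / 2 * (1 / \<epsilon> * xg + \<epsilon> * xb))"
      using x eps by (intro ennreal_mult[symmetric]) auto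
    ultimately show ?thesis unfolding energy_eps_def x(1,3) by (simp only:)
  qed
  then have xle: "1 / \<epsilon> * xg + \<epsilon> * xb \<le> 2 * c" using en c by (simp add: ennreal_le_iff)
  have "0 < \<epsilon> / 2" using eps by simp
  from INF_ennreal_approx[OF x(1)[unfolded int_abs_D1_inv_eta_sq_def] x(2) this]
  obtain g where hg: "in_Lp 2 g" "is_abs_D1_inv (eta w) (distr_of g)"
      "(\<integral>\<^sup>+x\<in>cell. ennreal ((g x)\<^sup>2) \<partial>lborel) \<le> ennreal (xg + \<epsilon> / 2)" by blast
  have "0 < 1 / (2 * \<epsilon>)" using eps by simp
  from INF_ennreal_approx[OF x(3)[unfolded int_D1_sq_def] x(4) this]
  obtain b where hb: "in_Lp 2 b" "distr_eq (D1 (distr_of w)) (distr_of b)"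
      "(\<integral>\<^sup>+x\<in>cell. ennreal ((b x)\<^sup>2) \<partial>lborel) \<le> ennreal (xb + 1 / (2 * \<epsilon>))" by blast
  interpret burgers w b g by (rule burgers_of_energy[OF hw hb(1,2) hg(1,2)])
  define G where "G = (\<integral>x. (g x)\<^sup>2 \<partial>torus)"
  define B where "B = (\<integral>x. (b x)\<^sup>2 \<partial>torus)"
  have GB: "0 \<le> G" "0 \<le> B" by (simp_all add: G_def B_def)
  have G: "G \<le> xg + \<epsilon> / 2"
    using hg(3) x(2) eps unfolding nn_integral_cell_square[OF in_Lp_2_L2p[OF hg(1)]] G_def by (subst (asm) ennreal_le_iff) auto
  have B: "B \<le> xb + 1 / (2 * \<epsilon>)"
    using hb(3) x(4) eps unfolding nn_integral_cell_square[OF in_Lp_2_L2p[OF hb(1)]] B_def by (subst (asm) ennreal_le_iff) auto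
  have "1 / \<epsilon> * G \<le> 1 / \<epsilon> * (xg + \<epsilon> / 2)" "\<epsilon> * B \<le> \<epsilon> * (xb + 1 / (2 * \<epsilon>))"
    using G B eps by (auto intro!: mult_left_mono divide_right_mono)
  moreover have "1 / \<epsilon> * (xg + \<epsilon> / 2) + \<epsilon> * (xb + 1 / (2 * \<epsilon>)) = 1 / \<epsilon> * xg + \<epsilon> * xb + 1"
    using eps by (simp add: field_simps)
  ultimately have sum: "1 / \<epsilon> * G + \<epsilon> * B \<le> 2 * c + 1" using xle by linarith
  have e1: "0 \<le> 1 / \<epsilon> * G" "0 \<le> \<epsilon> * B" using GB eps by auto
  have "\<beta> * \<gamma> = sqrt (B * G)" by (simp add: \<beta>_def \<gamma>_def B_def G_def real_sqrt_mult)
  also have "\<dots> = sqrt ((1 / \<epsilon> * G) * (\<epsilon> * B))" using eps by (simp add: mult.commute)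
  also have "\<dots> \<le> sqrt ((2 * c + 1) * (2 * c + 1))"
    using sum e1 by (intro real_sqrt_le_mono mult_mono) auto
  also have "\<dots> = 2 * c + 1" using c by simp
  finally have Ele: "E \<le> 2 * c + 1" by (simp add: E_def)
  have "1 / \<epsilon> * G \<le> 2 * c + 1" using sum e1 by linarith
  then have "G \<le> \<epsilon> * (2 * c + 1)" using eps by (simp add: field_simps)
  also have "\<dots> \<le> \<epsilon>0 * (2 * c + 1)" using eps c by (intro mult_right_mono) auto
  finally have "\<gamma> \<le> sqrt (\<epsilon>0 * (2 * c + 1))" unfolding \<gamma>_def G_def by (rule real_sqrt_le_mono)
  with Ele show ?thesis unfolding controlled_def using burgers_axioms by blast
qed

lemma controlled_L2p: "controlled E0 G0 w \<Longrightarrow> L2p w"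
  by (auto simp: controlled_def burgers_def)

lemma controlled_bound_nonneg: "controlled E0 G0 w \<Longrightarrow> 0 \<le> E0"
  using burgers.E_nonneg by (force simp: controlled_def)

lemma controlled_L1: "controlled E0 G0 w \<Longrightarrow> (\<integral>x. \<bar>w x\<bar> \<partial>torus) \<le> 1 + 48 * E0"
  using burgers.L1_norm_le by (force simp: controlled_def)

lemma controlled_powr:
  assumes "controlled E0 G0 w"
  shows "(\<integral>\<^sup>+x. ennreal (\<bar>w x\<bar> powr (7/2)) \<partial>torus) \<le> ennreal (boundL72 E0)"
proof -
  obtain b g where bg: "burgers w b g" "burgers.E b g \<le> E0" using assms by (auto simp: controlled_def)
  have "boundL72 (burgers.E b g) \<le> boundL72 E0"
    by (rule boundL72_mono[OF burgers.E_nonneg[OF bg(1)] bg(2)])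
  then show ?thesis using burgers.nn_integral_powr_le[OF bg(1)] by (meson ennreal_leI order_trans)
qed

lemma controlled_equicontinuous:
  assumes l: "0 < l" and E0: "0 \<le> E0" and G0: "0 \<le> G0"
  obtains d where "0 < d" "d \<le> 1/4"
    "\<And>w y. controlled E0 G0 w \<Longrightarrow> \<bar>fst y\<bar> \<le> d \<Longrightarrow> \<bar>snd y\<bar> \<le> d \<Longrightarrow> modL1 w y \<le> 8 * l"
proof -
  define h where "h = l ^ 3 / (48 * E0 + 1)"
  define d where "d = min (1/4) (min h (l * h / (1 + boundL72 E0 + 2 * G0)))"
  have h: "0 < h" unfolding h_def using l E0 by simp
  have "0 < 1 + boundL72 E0 + 2 * G0" using boundL72_nonneg[OF E0] G0 by linarith
  then have "0 < d" unfolding d_def using h l by simp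
  moreover have "d \<le> 1/4" unfolding d_def by (rule min.cobounded1)
  moreover have "modL1 w y \<le> 8 * l" if ctl: "controlled E0 G0 w" and y: "\<bar>fst y\<bar> \<le> d" "\<bar>snd y\<bar> \<le> d" for w y
  proof -
    obtain b g where bg: "burgers w b g" "burgers.E b g \<le> E0" "burgers.\<gamma> g \<le> G0"
      using ctl by (auto simp: controlled_def)
    show ?thesis
      by (rule burgers.modL1_uniform[OF bg l h_def _ _ y]) (auto simp: d_def)
  qed
  ultimately show ?thesis by (rule that)
qed

subsection \<open>Compactness\<close>

lemma countable_freqs: "countable freqs"
proof -
  have eq: "freqs = (\<lambda>(m, n). (2 * pi * of_int m, 2 * pi * of_int n)) ` (UNIV :: (int \<times> int) set)"
    by (auto simp: freqs_def)
  show ?thesis by (subst eq) (intro countable_image countableI_type)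
qed

text \<open>Fatou's lemma, with the bound required only from the index n0 on.\<close>

lemma nn_integral_lim_le:
  fixes F :: "nat \<Rightarrow> 'a \<Rightarrow> ennreal"
  assumes [measurable]: "\<And>n. F n \<in> borel_measurable M"
    and lim: "AE x in M. (\<lambda>n. F n x) \<longlonglongrightarrow> f x" and le: "\<And>n. n \<ge> n0 \<Longrightarrow> (\<integral>\<^sup>+x. F n x \<partial>M) \<le> c"
  shows "(\<integral>\<^sup>+x. f x \<partial>M) \<le> c"
proof -
  have "(\<integral>\<^sup>+x. f x \<partial>M) = (\<integral>\<^sup>+x. liminf (\<lambda>n. F n x) \<partial>M)"
  proof (rule nn_integral_cong_AE)
    show "AE x in M. f x = liminf (\<lambda>n. F n x)"
      using lim by eventually_elim (simp add: lim_imp_Liminf[OF sequentially_bot])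
  qed
  also have "\<dots> \<le> liminf (\<lambda>n. \<integral>\<^sup>+x. F n x \<partial>M)" by (rule nn_integral_liminf) measurable
  also have "\<dots> \<le> liminf (\<lambda>n::nat. c)"
    by (rule Liminf_mono) (use le in \<open>auto simp: eventually_sequentially\<close>)
  also have "\<dots> = c" by (simp add: Liminf_const)
  finally show ?thesis .
qed

text \<open>By equicontinuity one kernel index N serves all members at once. The kernel averages
  involve only finitely many Fourier coefficients, so convergence of these makes the averages
  uniformly Cauchy.\<close>

lemma controlled_L1_Cauchy:
  assumes u: "\<And>n. controlled E0 G0 (u n)" and G0: "0 \<le> G0"
    and conv: "\<And>k. k \<in> freqs \<Longrightarrow> \<exists>c. (\<lambda>n. fc (u n) k) \<longlonglongrightarrow> c" and e: "0 < e"
  shows "\<exists>n0. \<forall>m\<ge>n0. \<forall>n\<ge>n0. (\<integral>x. \<bar>u m x - u n x\<bar> \<partial>torus) \<le> e"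
proof -
  note L1 = L2p_L1p[OF controlled_L2p[OF u]]
  note E0 = controlled_bound_nonneg[OF u]
  \<comment> \<open>Two approximation errors of 9 l and 2 l from the coefficients add up to 20
    l.\<close>
  define l where "l = e / 20"
  have l: "0 < l" using e by (simp add: l_def)
  obtain d where d: "0 < d" "d \<le> 1/4"
    and equi: "\<And>w y. controlled E0 G0 w \<Longrightarrow> \<bar>fst y\<bar> \<le> d \<Longrightarrow> \<bar>snd y\<bar> \<le> d \<Longrightarrow> modL1 w y \<le> 8 * l"
    using controlled_equicontinuous[OF l E0 G0] by blast
  define M where "M = 1 + 48 * E0"
  have "(\<lambda>N. 2 * M * ktail d N) \<longlonglongrightarrow> 2 * M * 0" by (intro tendsto_intros ktail_tendsto d)
  then have "\<forall>\<^sub>F N in sequentially. 2 * M * ktail d N < l" by (rule order_tendstoD) (use l in auto)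
  then obtain N where N: "2 * M * ktail d N < l" using eventually_happens'[OF sequentially_bot] by blast
  have approx: "(\<integral>x. \<bar>tavg (ker N) (u n) x - u n x\<bar> \<partial>torus) \<le> 9 * l" for n
  proof -
    have "(\<integral>x. \<bar>tavg (ker N) (u n) x - u n x\<bar> \<partial>torus) \<le> 8 * l + 2 * M * ktail d N"
      using l controlled_L1[OF u] by (intro tavg_ker_L1[OF L1 _ d] equi[OF u]) (auto simp: M_def)
    then show ?thesis using N by linarith
  qed
  obtain c where c: "\<And>k. k \<in> freqs \<Longrightarrow> (\<lambda>n. fc (u n) k) \<longlonglongrightarrow> c k" using conv by metis
  define S where "S n = (\<Sum>i\<in>kidx N. kcoef N i * norm (fc (u n) (kfreq N i) - c (kfreq N i)))" for n
  have "S \<longlonglongrightarrow> (\<Sum>i\<in>kidx N. kcoef N i * norm (c (kfreq N i) - c (kfreq N i)))"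
    unfolding S_def[abs_def] by (intro tendsto_intros c kfreq_freqs)
  then have "\<forall>\<^sub>F n in sequentially. S n < l" by (rule order_tendstoD) (use l in auto)
  then obtain n0 where n0: "\<And>n. n \<ge> n0 \<Longrightarrow> S n < l" by (auto simp: eventually_sequentially)
  have diff: "\<bar>tavg (ker N) (u m) x - tavg (ker N) (u n) x\<bar> \<le> S m + S n" for m n x
  proof -
    have "complex_of_real (tavg (ker N) (u m) x - tavg (ker N) (u n) x) =
       (\<Sum>i\<in>kidx N. complex_of_real (kcoef N i) * (fc (u m) (kfreq N i) - fc (u n) (kfreq N i)) * cis (kfreq N i \<bullet> x))"
      unfolding of_real_diff tavg_ker_cis[OF L1] sum_subtractf[symmetric] by (intro sum.cong) (auto simp: algebra_simps)
    then have "\<bar>tavg (ker N) (u m) x - tavg (ker N) (u n) x\<bar> =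
       norm (\<Sum>i\<in>kidx N. complex_of_real (kcoef N i) * (fc (u m) (kfreq N i) - fc (u n) (kfreq N i)) * cis (kfreq N i \<bullet> x))"
      by (metis norm_of_real)
    also have "\<dots> \<le> (\<Sum>i\<in>kidx N. norm (complex_of_real (kcoef N i) * (fc (u m) (kfreq N i) - fc (u n) (kfreq N i)) * cis (kfreq N i \<bullet> x)))"
      by (rule norm_sum)
    also have "\<dots> \<le> (\<Sum>i\<in>kidx N. kcoef N i * norm (fc (u m) (kfreq N i) - c (kfreq N i)) + kcoef N i * norm (fc (u n) (kfreq N i) - c (kfreq N i)))"
    proof (rule sum_mono)
      fix i
      have "norm (fc (u m) (kfreq N i) - fc (u n) (kfreq N i)) \<le> norm (fc (u m) (kfreq N i) - c (kfreq N i)) + norm (fc (u n) (kfreq N i) - c (kfreq N i))"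
        using norm_triangle_ineq4[of "fc (u m) (kfreq N i) - c (kfreq N i)" "fc (u n) (kfreq N i) - c (kfreq N i)"] by simp
      from mult_left_mono[OF this kcoef_nonneg[of N i]]
      show "norm (complex_of_real (kcoef N i) * (fc (u m) (kfreq N i) - fc (u n) (kfreq N i)) * cis (kfreq N i \<bullet> x)) \<le>
        kcoef N i * norm (fc (u m) (kfreq N i) - c (kfreq N i)) + kcoef N i * norm (fc (u n) (kfreq N i) - c (kfreq N i))"
        using kcoef_nonneg[of N i] by (simp add: norm_mult distrib_left)
    qed
    also have "\<dots> = S m + S n" by (simp add: S_def sum.distrib)
    finally show ?thesis .
  qed
  have "(\<integral>x. \<bar>u m x - u n x\<bar> \<partial>torus) \<le> e" if mn: "m \<ge> n0" "n \<ge> n0" for m n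
  proof -
    have i: "integrable torus (\<lambda>x. \<bar>tavg (ker N) (u n) x - u n x\<bar>)" for n
      using L1p_abs[OF L1p_diff[OF tavg_L1p[OF bprob_ker L1] L1]] by auto
    have "(\<integral>x. \<bar>u m x - u n x\<bar> \<partial>torus) \<le> (\<integral>x. \<bar>tavg (ker N) (u m) x - u m x\<bar> + \<bar>tavg (ker N) (u n) x - u n x\<bar> + 2 * l \<partial>torus)"
    proof (rule integral_mono)
      show "integrable torus (\<lambda>x. \<bar>u m x - u n x\<bar>)" using L1p_abs[OF L1p_diff[OF L1 L1]] by auto
      show "integrable torus (\<lambda>x. \<bar>tavg (ker N) (u m) x - u m x\<bar> + \<bar>tavg (ker N) (u n) x - u n x\<bar> + 2 * l)" using i by auto
      show "\<bar>u m x - u n x\<bar> \<le> \<bar>tavg (ker N) (u m) x - u m x\<bar> + \<bar>tavg (ker N) (u n) x - u n x\<bar> + 2 * l" for x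
        using diff[of m x n] n0[OF mn(1)] n0[OF mn(2)] by linarith
    qed
    also have "\<dots> = (\<integral>x. \<bar>tavg (ker N) (u m) x - u m x\<bar> \<partial>torus) + (\<integral>x. \<bar>tavg (ker N) (u n) x - u n x\<bar> \<partial>torus) + 2 * l"
      using i torus.prob_space by simp
    also have "\<dots> \<le> e" using approx[of m] approx[of n] by (simp add: l_def)
    finally show ?thesis .
  qed
  then show ?thesis by blast
qed

text \<open>The completeness of L1, arranged so that the limit is periodic at every point: v is the
  pointwise \<open>lim\<close>, whose value depends only on the sequence of values, also where that
  sequence diverges.\<close>

lemma L1_Cauchy_AE_subsequence:
  fixes u :: "nat \<Rightarrow> real \<times> real \<Rightarrow> real"
  assumes u: "\<And>n. L1p (u n)"
    and cauchy: "\<And>e. 0 < e \<Longrightarrow> \<exists>n0. \<forall>m\<ge>n0. \<forall>n\<ge>n0. (\<integral>x. \<bar>u m x - u n x\<bar> \<partial>torus) \<le> e"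
  obtains t v where "strict_mono (t :: nat \<Rightarrow> nat)" "v \<in> borel_measurable borel" "periodic v"
    "AE x in torus. (\<lambda>n. u (t n) x) \<longlonglongrightarrow> v x"
    "\<And>n. (\<integral>\<^sup>+x. ennreal \<bar>u (t n) x - v x\<bar> \<partial>torus) \<le> ennreal ((1/2) ^ n)"
proof -
  have [measurable]: "u n \<in> borel_measurable borel" for n using u by auto
  have "\<forall>k. \<exists>n0. \<forall>m\<ge>n0. \<forall>n\<ge>n0. (\<integral>x. \<bar>u m x - u n x\<bar> \<partial>torus) \<le> (1/2) ^ k" using cauchy by simp
  then obtain N where N: "\<And>k m n. m \<ge> N k \<Longrightarrow> n \<ge> N k \<Longrightarrow> (\<integral>x. \<bar>u m x - u n x\<bar> \<partial>torus) \<le> (1/2) ^ k" by metis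
  \<comment> \<open>The summand n makes t strictly increasing, and the sum makes it at least N k for
    every k \<le> n.\<close>
  define t where "t n = n + (\<Sum>i\<le>n. N i)" for n
  have t: "strict_mono t" unfolding strict_mono_Suc_iff by (simp add: t_def)
  have tN: "N k \<le> t n" if "k \<le> n" for k n
    using member_le_sum[of k "{..n}" N] that by (simp add: t_def)
  define z where "z n x = u (t n) x" for n x
  have [measurable]: "z n \<in> borel_measurable borel" for n unfolding z_def by measurable
  have zd: "(\<integral>\<^sup>+x. ennreal \<bar>z n x - z m x\<bar> \<partial>torus) \<le> ennreal ((1/2) ^ k)" if "k \<le> n" "k \<le> m" for n m k
  proof -
    have "(\<integral>\<^sup>+x. ennreal \<bar>z n x - z m x\<bar> \<partial>torus) = ennreal (\<integral>x. \<bar>z n x - z m x\<bar> \<partial>torus)"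
      unfolding z_def by (intro nn_integral_eq_integral L1pD(3) L1p_abs L1p_diff u) auto
    also have "\<dots> \<le> ennreal ((1/2) ^ k)" unfolding z_def by (intro ennreal_leI N tN that)
    finally show ?thesis .
  qed
  define v where "v x = lim (\<lambda>n. z n x)" for x
  have vm [measurable]: "v \<in> borel_measurable borel" unfolding v_def by measurable
  have vp: "periodic v"
  proof -
    have "periodic (z n)" for n unfolding z_def using u by auto
    then show ?thesis by (simp add: periodic_def v_def)
  qed
  have "(\<integral>\<^sup>+x. (\<Sum>n. ennreal \<bar>z (Suc n) x - z n x\<bar>) \<partial>torus) = (\<Sum>n. \<integral>\<^sup>+x. ennreal \<bar>z (Suc n) x - z n x\<bar> \<partial>torus)"
    by (rule nn_integral_suminf) measurable
  also have "\<dots> \<le> (\<Sum>n. ennreal ((1/2) ^ n))" by (intro suminf_le zd) auto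
  also have "\<dots> = ennreal (1 / (1 - 1/2))" by (intro suminf_ennreal_eq geometric_sums) auto
  also have "\<dots> < \<infinity>" by simp
  finally have "AE x in torus. (\<Sum>n. ennreal \<bar>z (Suc n) x - z n x\<bar>) \<noteq> \<infinity>"
    by (intro nn_integral_PInf_AE) auto
  then have lim: "AE x in torus. (\<lambda>n. z n x) \<longlonglongrightarrow> v x"
  proof eventually_elim
    case (elim x)
    then have "summable (\<lambda>n. \<bar>z (Suc n) x - z n x\<bar>)"
      by (intro summable_suminf_not_top) (auto simp: less_top)
    then have "summable (\<lambda>n. z (Suc n) x - z n x)" by (rule summable_rabs_cancel)
    then have "(\<lambda>n. \<Sum>i<n. z (Suc i) x - z i x) \<longlonglongrightarrow> (\<Sum>i. z (Suc i) x - z i x)" by (rule summable_LIMSEQ)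
    then have "(\<lambda>n. z n x - z 0 x) \<longlonglongrightarrow> (\<Sum>i. z (Suc i) x - z i x)" unfolding sum_lessThan_telescope[of "\<lambda>i. z i x"] .
    from tendsto_add[OF this tendsto_const[of "z 0 x"]]
    have "convergent (\<lambda>n. z n x)" by (auto simp: convergent_def)
    then show ?case unfolding v_def by (simp add: convergent_LIMSEQ_iff)
  qed
  have "(\<integral>\<^sup>+x. ennreal \<bar>z n x - v x\<bar> \<partial>torus) \<le> ennreal ((1/2) ^ n)" for n
  proof (rule nn_integral_lim_le[where F = "\<lambda>m x. ennreal \<bar>z n x - z m x\<bar>" and ?n0.0 = n])
    show "AE x in torus. (\<lambda>m. ennreal \<bar>z n x - z m x\<bar>) \<longlonglongrightarrow> ennreal \<bar>z n x - v x\<bar>"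
      using lim by eventually_elim (intro tendsto_ennrealI tendsto_rabs tendsto_diff tendsto_const)
  qed (use zd in auto)
  then show ?thesis using that[OF t vm vp] lim unfolding z_def by blast
qed

section \<open>Interpolation between L1 and L7/2\<close>

lemma integrable_powr_of_bound:
  assumes [measurable]: "f \<in> borel_measurable borel" and fin: "(\<integral>\<^sup>+x. ennreal (\<bar>f x\<bar> powr (7/2)) \<partial>torus) < \<infinity>"
    and p: "0 < p" "p \<le> 7/2"
  shows "integrable torus (\<lambda>x. \<bar>f x\<bar> powr p)"
proof -
  have i: "integrable torus (\<lambda>x. \<bar>f x\<bar> powr (7/2))"
    by (rule integrableI_bounded) (use fin in auto)
  have le: "t powr p \<le> 1 + t powr (7/2)" if "0 \<le> t" for t :: real
  proof (cases "t \<le> 1")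
    case True
    then have "t powr p \<le> 1" using powr_mono2[of p t 1] that p by simp
    then show ?thesis by (simp add: add_increasing2)
  next
    case False
    then have "t powr p \<le> t powr (7/2)" using p by (intro powr_mono) auto
    then show ?thesis by simp
  qed
  show ?thesis
    by (rule Bochner_Integration.integrable_bound[of _ "\<lambda>x. 1 + \<bar>f x\<bar> powr (7/2)"]) (use i le in auto)
qed

lemma in_Lp_of_bound:
  assumes f: "f \<in> borel_measurable borel" "periodic f" and fin: "(\<integral>\<^sup>+x. ennreal (\<bar>f x\<bar> powr (7/2)) \<partial>torus) < \<infinity>"
    and p: "0 < p" "p \<le> 7/2"
  shows "in_Lp p f"
proof -
  have [measurable]: "f \<in> borel_measurable borel" by fact
  have m: "(\<lambda>x. \<bar>f x\<bar> powr p) \<in> borel_measurable borel" by measurable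
  show ?thesis
    using f integrable_powr_of_bound[OF f(1) fin p] by (simp add: in_Lp_def integrable_torus[OF m])
qed

lemma Lp_norm_torus:
  assumes [measurable]: "f \<in> borel_measurable borel"
  shows "Lp_norm p f = (\<integral>x. \<bar>f x\<bar> powr p \<partial>torus) powr (1 / p)"
  unfolding Lp_norm_def by (subst integral_torus) auto

text \<open>For t \<le> R the power p - 1 of t is bounded by that of R; for t > R the nonpositive
  power p - q is.\<close>

lemma powr_interpolation:
  fixes t R p q :: real
  assumes t: "0 \<le> t" and R: "0 < R" and p: "1 \<le> p" "p \<le> q"
  shows "t powr p \<le> R powr (p - 1) * t + R powr (p - q) * t powr q"
proof (cases "t \<le> R")
  case True
  have "t powr p = t powr (p - 1) * t"
    using t p by (cases "t = 0") (auto simp: powr_diff)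
  also have "\<dots> \<le> R powr (p - 1) * t" using True t p by (intro mult_right_mono powr_mono2) auto
  finally show ?thesis by (simp add: add_increasing2)
next
  case False
  then have "t powr p = t powr (p - q) * t powr q" using R by (simp flip: powr_add)
  also have "\<dots> \<le> R powr (p - q) * t powr q" using False R p by (intro mult_right_mono powr_mono2') auto
  finally show ?thesis using t by (simp add: add_increasing)
qed

lemma powr_abs_diff_le: "\<bar>a - b\<bar> powr q \<le> 2 powr q * (\<bar>a\<bar> powr q + \<bar>b\<bar> powr q)" if "0 \<le> q" for a b q :: real
proof -
  have "\<bar>a - b\<bar> powr q \<le> (2 * max \<bar>a\<bar> \<bar>b\<bar>) powr q" using that by (intro powr_mono2) auto
  also have "\<dots> = 2 powr q * max \<bar>a\<bar> \<bar>b\<bar> powr q" by (simp add: powr_mult)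
  also have "\<dots> \<le> 2 powr q * (\<bar>a\<bar> powr q + \<bar>b\<bar> powr q)" by (intro mult_left_mono) (auto simp: max_def)
  finally show ?thesis .
qed

lemma Lp_convergence:
  fixes f :: "nat \<Rightarrow> real \<times> real \<Rightarrow> real"
  assumes f: "\<And>n. f n \<in> borel_measurable borel"
    and L1: "\<And>n. (\<integral>\<^sup>+x. ennreal \<bar>f n x\<bar> \<partial>torus) \<le> ennreal ((1/2) ^ n)"
    and B: "\<And>n. (\<integral>\<^sup>+x. ennreal (\<bar>f n x\<bar> powr (7/2)) \<partial>torus) \<le> ennreal B" "0 \<le> B"
    and p: "1 \<le> p" "p < 7/2"
  shows "(\<lambda>n. Lp_norm p (f n)) \<longlonglongrightarrow> 0"
proof -
  have [measurable]: "f n \<in> borel_measurable borel" for n by (rule f)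
  have ip: "integrable torus (\<lambda>x. \<bar>f n x\<bar> powr p)" for n
    by (rule integrable_powr_of_bound) (use B(1)[of n] p in \<open>auto intro: le_less_trans\<close>)
  have le: "(\<integral>x. \<bar>f n x\<bar> powr p \<partial>torus) \<le> R powr (p - 1) * (1/2) ^ n + R powr (p - 7/2) * B" if R: "0 < R" for n R
  proof -
    have "ennreal (\<integral>x. \<bar>f n x\<bar> powr p \<partial>torus) = (\<integral>\<^sup>+x. ennreal (\<bar>f n x\<bar> powr p) \<partial>torus)"
      by (rule nn_integral_eq_integral[symmetric, OF ip]) simp
    also have "\<dots> \<le> (\<integral>\<^sup>+x. ennreal (R powr (p - 1)) * ennreal \<bar>f n x\<bar> + ennreal (R powr (p - 7/2)) * ennreal (\<bar>f n x\<bar> powr (7/2)) \<partial>torus)"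
      using powr_interpolation[OF abs_ge_zero R p(1), of "7/2"] p
      by (intro nn_integral_mono) (auto simp: ennreal_leI ennreal_mult[symmetric] ennreal_plus[symmetric] simp del: ennreal_plus)
    also have "\<dots> = ennreal (R powr (p - 1)) * (\<integral>\<^sup>+x. ennreal \<bar>f n x\<bar> \<partial>torus) + ennreal (R powr (p - 7/2)) * (\<integral>\<^sup>+x. ennreal (\<bar>f n x\<bar> powr (7/2)) \<partial>torus)"
      by (subst nn_integral_add) (auto simp: nn_integral_cmult)
    also have "\<dots> \<le> ennreal (R powr (p - 1)) * ennreal ((1/2) ^ n) + ennreal (R powr (p - 7/2)) * ennreal B"
      by (intro add_mono mult_left_mono L1 B(1)) auto
    also have "\<dots> = ennreal (R powr (p - 1) * (1/2) ^ n + R powr (p - 7/2) * B)"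
      using B(2) by (simp add: ennreal_mult ennreal_plus)
    finally show ?thesis using B(2) by (subst (asm) ennreal_le_iff) auto
  qed
  have "(\<lambda>n. \<integral>x. \<bar>f n x\<bar> powr p \<partial>torus) \<longlonglongrightarrow> 0"
  proof (rule LIMSEQ_I)
    fix e :: real assume e: "0 < e"
    \<comment> \<open>Solves R^(p - 7/2) = e / (2 (B + 1)), which makes the L7/2 contribution at
      most e / 2 for all n.\<close>
    define R where "R = (e / (2 * (B + 1))) powr (1 / (p - 7/2))"
    have R: "0 < R" using e B(2) by (simp add: R_def)
    have "R powr (p - 7/2) = e / (2 * (B + 1))" using e B(2) p by (simp add: R_def powr_powr)
    then have "R powr (p - 7/2) * B = e / (2 * (B + 1)) * B" by simp
    also have "\<dots> \<le> e / 2" using e B(2) by (simp add: field_simps)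
    finally have small: "R powr (p - 7/2) * B \<le> e / 2" .
    have "(\<lambda>n. R powr (p - 1) * (1/2) ^ n) \<longlonglongrightarrow> R powr (p - 1) * 0"
      by (intro tendsto_mult tendsto_const LIMSEQ_power_zero) auto
    then have "\<forall>\<^sub>F n in sequentially. R powr (p - 1) * (1/2) ^ n < e / 2" by (rule order_tendstoD) (use e in auto)
    then obtain n0 where n0: "\<And>n. n \<ge> n0 \<Longrightarrow> R powr (p - 1) * (1/2) ^ n < e / 2" by (auto simp: eventually_sequentially)
    have "(\<integral>x. \<bar>f n x\<bar> powr p \<partial>torus) < e" if "n \<ge> n0" for n
      using le_less_trans[OF le[OF R, of n] add_less_le_mono[OF n0[OF that] small]] by simp
    then show "\<exists>n0. \<forall>n\<ge>n0. norm ((\<integral>x. \<bar>f n x\<bar> powr p \<partial>torus) - 0) < e"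
      by (intro exI[of _ n0]) auto
  qed
  then have "(\<lambda>n. (\<integral>x. \<bar>f n x\<bar> powr p \<partial>torus) powr (1 / p)) \<longlonglongrightarrow> 0"
    by (rule tendsto_zero_powrI[OF _ tendsto_const]) (use p in auto)
  then show ?thesis by (simp add: Lp_norm_torus)
qed

text \<open>A diagonal argument makes all Fourier coefficients converge,
  \<open>controlled_L1_Cauchy\<close> turns this into an L1 Cauchy sequence, and along a further
  subsequence that converges almost everywhere Fatou's lemma puts the limit into L7/2.\<close>

lemma controlled_precompact:
  assumes w: "\<And>n. controlled E0 G0 (w n)" and G0: "0 \<le> G0" and p: "1 \<le> p" "p < 7/2"
  shows "precompact_Lp p w"
  unfolding precompact_Lp_def
proof (intro conjI allI impI)
  note E0 = controlled_bound_nonneg[OF w]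
  note L2 = controlled_L2p[OF w]
  note L1 = L2p_L1p[OF L2]
  show "in_Lp p (w n)" for n
    by (rule in_Lp_of_bound) (use L2[of n] controlled_powr[OF w[of n]] p in \<open>auto intro: le_less_trans\<close>)
  fix r :: "nat \<Rightarrow> nat" assume "strict_mono r"
  have "norm (fc (w (r n)) k) \<le> 1 + 48 * E0" for n k
    by (rule order_trans[OF norm_fc_le[OF L1] controlled_L1[OF w]])
  then obtain s0 :: "nat \<Rightarrow> nat" where s0: "strict_mono s0"
    and conv: "\<And>k. k \<in> freqs \<Longrightarrow> \<exists>c. (\<lambda>n. fc (w (r (s0 n))) k) \<longlonglongrightarrow> c"
    using function_convergent_subsequence[OF countable_freqs, of "\<lambda>n k. fc (w (r n)) k" "1 + 48 * E0"] by blast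
  define u where "u n = w (r (s0 n))" for n
  have uc: "controlled E0 G0 (u n)" for n unfolding u_def by (rule w)
  have uL: "L1p (u n)" for n unfolding u_def by (rule L1)
  have cauchy: "\<exists>n0. \<forall>m\<ge>n0. \<forall>n\<ge>n0. (\<integral>x. \<bar>u m x - u n x\<bar> \<partial>torus) \<le> e" if "0 < e" for e
    by (rule controlled_L1_Cauchy[OF uc G0 _ that]) (use conv in \<open>auto simp: u_def\<close>)
  obtain t v where t: "strict_mono (t :: nat \<Rightarrow> nat)" and v: "v \<in> borel_measurable borel" "periodic v"
    and lim: "AE x in torus. (\<lambda>n. u (t n) x) \<longlonglongrightarrow> v x"
    and L1v: "\<And>n. (\<integral>\<^sup>+x. ennreal \<bar>u (t n) x - v x\<bar> \<partial>torus) \<le> ennreal ((1/2) ^ n)"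
    using L1_Cauchy_AE_subsequence[OF uL cauchy] by blast
  have [measurable]: "v \<in> borel_measurable borel" "u n \<in> borel_measurable borel" for n using v uL by auto
  define B where "B = boundL72 E0"
  have B0: "0 \<le> B" unfolding B_def by (rule boundL72_nonneg[OF E0])
  have uB: "(\<integral>\<^sup>+x. ennreal (\<bar>u n x\<bar> powr (7/2)) \<partial>torus) \<le> ennreal B" for n
    unfolding B_def by (rule controlled_powr[OF uc])
  have vB: "(\<integral>\<^sup>+x. ennreal (\<bar>v x\<bar> powr (7/2)) \<partial>torus) \<le> ennreal B"
  proof (rule nn_integral_lim_le[where F = "\<lambda>n x. ennreal (\<bar>u (t n) x\<bar> powr (7/2))"])
    show "AE x in torus. (\<lambda>n. ennreal (\<bar>u (t n) x\<bar> powr (7/2))) \<longlonglongrightarrow> ennreal (\<bar>v x\<bar> powr (7/2))"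
      using lim
    proof eventually_elim
      case (elim x)
      show ?case by (intro tendsto_ennrealI tendsto_powr' tendsto_rabs elim tendsto_const) auto
    qed
  qed (use uB in auto)
  have dB: "(\<integral>\<^sup>+x. ennreal (\<bar>u (t n) x - v x\<bar> powr (7/2)) \<partial>torus) \<le> ennreal (2 powr (7/2) * (B + B))" for n
  proof -
    have "(\<integral>\<^sup>+x. ennreal (\<bar>u (t n) x - v x\<bar> powr (7/2)) \<partial>torus) \<le>
      (\<integral>\<^sup>+x. ennreal (2 powr (7/2)) * (ennreal (\<bar>u (t n) x\<bar> powr (7/2)) + ennreal (\<bar>v x\<bar> powr (7/2))) \<partial>torus)"
      using powr_abs_diff_le[of "7/2"]
      by (intro nn_integral_mono) (auto simp: ennreal_leI ennreal_mult[symmetric] ennreal_plus[symmetric] simp del: ennreal_plus)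
    also have "\<dots> = ennreal (2 powr (7/2)) * ((\<integral>\<^sup>+x. ennreal (\<bar>u (t n) x\<bar> powr (7/2)) \<partial>torus) + (\<integral>\<^sup>+x. ennreal (\<bar>v x\<bar> powr (7/2)) \<partial>torus))"
      by (subst nn_integral_cmult) (auto simp: nn_integral_add)
    also have "\<dots> \<le> ennreal (2 powr (7/2)) * (ennreal B + ennreal B)"
      by (intro mult_left_mono add_mono uB vB) auto
    also have "\<dots> = ennreal (2 powr (7/2) * (B + B))" using B0 by (simp only: ennreal_mult ennreal_plus powr_ge_zero add_nonneg_nonneg)
    finally show ?thesis .
  qed
  have "(\<lambda>n. Lp_norm p (\<lambda>x. u (t n) x - v x)) \<longlonglongrightarrow> 0"
    by (rule Lp_convergence[where f = "\<lambda>n x. u (t n) x - v x", OF _ L1v dB]) (use B0 p in auto)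
  moreover have "in_Lp p v"
    by (rule in_Lp_of_bound[OF v]) (use vB p in \<open>auto intro: le_less_trans\<close>)
  moreover have "strict_mono (s0 \<circ> t)" using s0 t by (rule strict_mono_o)
  ultimately show "\<exists>(s :: nat \<Rightarrow> nat) v. strict_mono s \<and> in_Lp p v \<and> (\<lambda>n. Lp_norm p (\<lambda>x. w (r (s n)) x - v x)) \<longlonglongrightarrow> 0"
    unfolding u_def by (intro exI[of _ "s0 \<circ> t"] exI[of _ v]) simp
qed

theorem corollary2p10:
  fixes \<epsilon>0 :: real and C :: ennreal
    and \<epsilon> :: "nat \<Rightarrow> real" and w :: "nat \<Rightarrow> real \<times> real \<Rightarrow> real" and p :: real
  assumes "\<epsilon>0 > 0" and "C < \<infinity>"
    and "\<And>n. \<epsilon> n > 0" and "\<And>n. \<bar>\<epsilon> n\<bar> \<le> \<epsilon>0"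
    and "\<And>n. w n \<in> admissible"
    and "\<And>n. energy_eps (\<epsilon> n) (w n) \<le> C"
    and "1 \<le> p" and "p < 10 / 3"
  shows "precompact_Lp p w"
proof -
  obtain c where c: "C = ennreal c" "0 \<le> c" using assms(2) by (cases C) auto
  have "controlled (2 * c + 1) (sqrt (\<epsilon>0 * (2 * c + 1))) (w n)" for n
  proof (rule controlled_of_energy[OF assms(5) assms(3) _ c(2)])
    show "\<epsilon> n \<le> \<epsilon>0" using assms(4) by (rule abs_le_D1)
    show "energy_eps (\<epsilon> n) (w n) \<le> ennreal c" using assms(6)[of n] by (simp add: c(1))
  qed
  then show ?thesis
    by (rule controlled_precompact) (use assms(1,7,8) c(2) in auto)
qed


end
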